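(* Assume that $|u(q^\dagger)|\ge c_0$ in $\Omega$ for some constant $c_0>0$. Then for any $\epsilon\in(0,\tfrac12)$ there is a constant $C>0$ (independent of $q$) such that $$\|q-q^\dagger\|_{H^{-1-\epsilon}(\Omega)}\le C\,\|u(q)-u(q^\dagger)\|_{0,\Omega}^{1/2}\qquad\text{for all } q\in K.$$
   Context: $\Omega\subset\mathbb{R}^d$ ($d=2,3$) is an open bounded connected domain with $C^2$ boundary. Standing assumptions: $a\in W^{1,\infty}(\Omega)$ has a positive lower bound, $f\in L^2(\Omega)$, $g\in H^{3/2}(\partial\Omega)$. With constants $0<\underline q\le\bar q$, the admissible set is $K=\{q\in L^2(\Omega): \underline q\le q\le\bar q \text{ a.e. in }\Omega\}$. For $q\in K$, $u(q)\in H^2(\Omega)$ denotes the unique solution of $$-\nabla\cdot(a\nabla u)+q u=f\ \text{ in }\Omega,\qquad u=g\ \text{ on }\partial\Omega.$$ $q^\dagger\in K$ is the true radiativity. $\|\cdot\|_{s,\Omega}$ denotes the norm of the Sobolev space $H^s(\Omega)$ ($\|\cdot\|_{0,\Omega}$ being the $L^2(\Omega)$ norm). For $s>0$, $H^s_0(\Omega)$ is the completion of $C_c^\infty(\Omega)$ under $\|\cdot\|_{s,\Omega}$, and $H^{-s}(\Omega)$ is the dual space of $H_0^s(\Omega)$ with respect to the $L^2(\Omega)$ inner product. *)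

theory Defs
  imports "HOL-Analysis.Analysis"
begin

section \<open>Smooth functions and test functions\<close>

definition partial :: "'a::euclidean_space \<Rightarrow> ('a \<Rightarrow> real) \<Rightarrow> 'a \<Rightarrow> real" where
  "partial b \<phi> = (\<lambda>x. frechet_derivative \<phi> (at x) b)"

definition partials :: "'a::euclidean_space list \<Rightarrow> ('a \<Rightarrow> real) \<Rightarrow> 'a \<Rightarrow> real" where
  "partials bs \<phi> = foldr partial bs \<phi>"

definition grad :: "('a::euclidean_space \<Rightarrow> real) \<Rightarrow> 'a \<Rightarrow> 'a" where
  "grad \<phi> x = (\<Sum>b\<in>Basis. partial b \<phi> x *\<^sub>R b)"

primrec Ck :: "nat \<Rightarrow> ('a::euclidean_space \<Rightarrow> real) \<Rightarrow> bool" where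
  "Ck 0 \<phi> \<longleftrightarrow> continuous_on UNIV \<phi>"
| "Ck (Suc k) \<phi> \<longleftrightarrow> (\<forall>x. \<phi> differentiable (at x)) \<and> (\<forall>b\<in>Basis. Ck k (partial b \<phi>))"

definition smooth :: "('a::euclidean_space \<Rightarrow> real) \<Rightarrow> bool" where
  "smooth \<phi> \<longleftrightarrow> (\<forall>k. Ck k \<phi>)"

definition test_functions :: "'a::euclidean_space set \<Rightarrow> ('a \<Rightarrow> real) set" where
  "test_functions \<Omega> =
     {\<phi>. smooth \<phi> \<and> compact (closure {x. \<phi> x \<noteq> 0}) \<and> closure {x. \<phi> x \<noteq> 0} \<subseteq> \<Omega>}"


section \<open>Lebesgue spaces and weak derivatives\<close>

text \<open>Elements of function spaces are represented by functions on the whole type; only their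
  values on \<open>\<Omega>\<close>, up to null sets, matter.\<close>

definition L2 :: "'a::euclidean_space set \<Rightarrow> ('a \<Rightarrow> real) set" where
  "L2 \<Omega> = {u. u \<in> borel_measurable (lebesgue_on \<Omega>) \<and> integrable (lebesgue_on \<Omega>) (\<lambda>x. (u x)\<^sup>2)}"

definition L2_norm :: "'a::euclidean_space set \<Rightarrow> ('a \<Rightarrow> real) \<Rightarrow> real" where
  "L2_norm \<Omega> u = sqrt (\<integral>x. (u x)\<^sup>2 \<partial>lebesgue_on \<Omega>)"

definition Linfty :: "'a::euclidean_space set \<Rightarrow> ('a \<Rightarrow> real) set" where
  "Linfty \<Omega> =
     {u. u \<in> borel_measurable (lebesgue_on \<Omega>) \<and> (\<exists>M. AE x in lebesgue_on \<Omega>. \<bar>u x\<bar> \<le> M)}"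

definition locally_integrable :: "'a::euclidean_space set \<Rightarrow> ('a \<Rightarrow> real) \<Rightarrow> bool" where
  "locally_integrable \<Omega> u \<longleftrightarrow> (\<forall>A. compact A \<and> A \<subseteq> \<Omega> \<longrightarrow> integrable (lebesgue_on A) u)"

definition has_weak_deriv ::
    "'a::euclidean_space set \<Rightarrow> 'a list \<Rightarrow> ('a \<Rightarrow> real) \<Rightarrow> ('a \<Rightarrow> real) \<Rightarrow> bool" where
  "has_weak_deriv \<Omega> bs u v \<longleftrightarrow>
     locally_integrable \<Omega> u \<and> locally_integrable \<Omega> v \<and>
     (\<forall>\<phi>\<in>test_functions \<Omega>.
        (\<integral>x. u x * partials bs \<phi> x \<partial>lebesgue_on \<Omega>)
          = (-1) ^ length bs * (\<integral>x. v x * \<phi> x \<partial>lebesgue_on \<Omega>))"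

text \<open>The weak derivative is unique up to null sets; \<open>SOME\<close> picks a representative.\<close>

definition weak_deriv ::
    "'a::euclidean_space set \<Rightarrow> 'a list \<Rightarrow> ('a \<Rightarrow> real) \<Rightarrow> 'a \<Rightarrow> real" where
  "weak_deriv \<Omega> bs u = (SOME v. has_weak_deriv \<Omega> bs u v)"

definition weak_grad :: "'a::euclidean_space set \<Rightarrow> ('a \<Rightarrow> real) \<Rightarrow> 'a \<Rightarrow> 'a" where
  "weak_grad \<Omega> u x = (\<Sum>b\<in>Basis. weak_deriv \<Omega> [b] u x *\<^sub>R b)"

definition has_weak_div ::
    "'a::euclidean_space set \<Rightarrow> ('a \<Rightarrow> 'a) \<Rightarrow> ('a \<Rightarrow> real) \<Rightarrow> bool" where
  "has_weak_div \<Omega> F h \<longleftrightarrow>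
     (\<forall>b\<in>Basis. locally_integrable \<Omega> (\<lambda>x. F x \<bullet> b)) \<and> locally_integrable \<Omega> h \<and>
     (\<forall>\<phi>\<in>test_functions \<Omega>.
        (\<integral>x. F x \<bullet> grad \<phi> x \<partial>lebesgue_on \<Omega>) = - (\<integral>x. h x * \<phi> x \<partial>lebesgue_on \<Omega>))"


section \<open>Sobolev spaces\<close>

definition W1infty :: "'a::euclidean_space set \<Rightarrow> ('a \<Rightarrow> real) set" where
  "W1infty \<Omega> = {u \<in> Linfty \<Omega>. \<forall>b\<in>Basis. \<exists>v\<in>Linfty \<Omega>. has_weak_deriv \<Omega> [b] u v}"

definition gagliardo_sq :: "'a::euclidean_space set \<Rightarrow> real \<Rightarrow> ('a \<Rightarrow> real) \<Rightarrow> ennreal" where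
  "gagliardo_sq \<Omega> \<theta> u =
     (\<integral>\<^sup>+x. (\<integral>\<^sup>+y. ennreal ((u x - u y)\<^sup>2 / dist x y powr (real DIM('a) + 2 * \<theta>))
        \<partial>lebesgue_on \<Omega>) \<partial>lebesgue_on \<Omega>)"

definition words :: "nat \<Rightarrow> 'a::euclidean_space list set" where
  "words j = {bs. set bs \<subseteq> Basis \<and> length bs = j}"

text \<open>Sobolev--Slobodeckij norm of order \<open>s \<ge> 0\<close>. The sum over \<^term>\<open>words j\<close> is the squared
  \<open>L\<^sup>2\<close> norm of the Frobenius norm of the tensor of all weak derivatives of order \<open>j\<close>.\<close>

definition sobolev_norm_sq :: "'a::euclidean_space set \<Rightarrow> real \<Rightarrow> ('a \<Rightarrow> real) \<Rightarrow> ennreal" where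
  "sobolev_norm_sq \<Omega> s u =
     (\<Sum>j\<le>nat \<lfloor>s\<rfloor>. \<Sum>bs\<in>words j. \<integral>\<^sup>+x. ennreal ((weak_deriv \<Omega> bs u x)\<^sup>2) \<partial>lebesgue_on \<Omega>)
     + (if frac s = 0 then 0
        else (\<Sum>bs\<in>words (nat \<lfloor>s\<rfloor>). gagliardo_sq \<Omega> (frac s) (weak_deriv \<Omega> bs u)))"

definition sobolev_norm :: "'a::euclidean_space set \<Rightarrow> real \<Rightarrow> ('a \<Rightarrow> real) \<Rightarrow> real" where
  "sobolev_norm \<Omega> s u = sqrt (enn2real (sobolev_norm_sq \<Omega> s u))"

definition sobolev :: "'a::euclidean_space set \<Rightarrow> real \<Rightarrow> ('a \<Rightarrow> real) set" where
  "sobolev \<Omega> s =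
     {u \<in> L2 \<Omega>. (\<forall>j\<le>nat \<lfloor>s\<rfloor>. \<forall>bs\<in>words j. \<exists>v\<in>L2 \<Omega>. has_weak_deriv \<Omega> bs u v)
        \<and> sobolev_norm_sq \<Omega> s u < \<infinity>}"

text \<open>Since \<open>H\<^sup>s\<close> is complete, the completion of the test functions is their closure in it.\<close>

definition sobolev0 :: "'a::euclidean_space set \<Rightarrow> real \<Rightarrow> ('a \<Rightarrow> real) set" where
  "sobolev0 \<Omega> s =
     {u \<in> sobolev \<Omega> s. \<forall>e>0. \<exists>\<phi>\<in>test_functions \<Omega>. sobolev_norm \<Omega> s (\<lambda>x. u x - \<phi> x) < e}"

text \<open>Norm in the dual of \<^term>\<open>sobolev0 \<Omega> s\<close> of the functional that \<open>p \<in> L\<^sup>2\<close> induces through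
  the \<open>L\<^sup>2\<close> inner product.\<close>

definition neg_sobolev_norm :: "'a::euclidean_space set \<Rightarrow> real \<Rightarrow> ('a \<Rightarrow> real) \<Rightarrow> ennreal" where
  "neg_sobolev_norm \<Omega> s p =
     (SUP \<phi>\<in>{\<phi> \<in> sobolev0 \<Omega> s. sobolev_norm \<Omega> s \<phi> \<le> 1}.
        ennreal \<bar>\<integral>x. p x * \<phi> x \<partial>lebesgue_on \<Omega>\<bar>)"


section \<open>Boundaries, Sobolev spaces on boundaries and traces\<close>

text \<open>For boundary notions \<open>\<real>\<^sup>d\<close> is written as \<open>\<real>\<^sup>d\<^sup>-\<^sup>1 \<times> \<real>\<close>, with type \<^typ>\<open>'n \<times> real\<close>. Following
  Grisvard (Elliptic Problems in Nonsmooth Domains, Definition 1.2.1.1), a chart consists of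
  orthogonal coordinates (a rotation or reflection \<open>R\<close> and an origin \<open>c\<close>), a box
  \<open>box (-\<alpha>) \<alpha> \<times> {-h<..<h}\<close> in these coordinates, and a function \<open>\<gamma>\<close> below whose graph the
  domain lies inside this box.\<close>

definition boundary_chart ::
    "('n::euclidean_space \<times> real) set \<Rightarrow> ('n \<times> real \<Rightarrow> 'n \<times> real) \<Rightarrow> 'n \<times> real \<Rightarrow> 'n \<Rightarrow> real
      \<Rightarrow> ('n \<Rightarrow> real) \<Rightarrow> bool" where
  "boundary_chart \<Omega> R c \<alpha> h \<gamma> \<longleftrightarrow>
     orthogonal_transformation R \<and> (\<forall>i\<in>Basis. 0 < \<alpha> \<bullet> i) \<and> 0 < h \<and>
     Ck 2 \<gamma> \<and> (\<forall>y\<in>box (- \<alpha>) \<alpha>. \<bar>\<gamma> y\<bar> \<le> h / 2) \<and>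
     (\<forall>y\<in>box (- \<alpha>) \<alpha>. \<forall>t\<in>{-h<..<h}.
        (c + R (y, t) \<in> \<Omega> \<longleftrightarrow> t < \<gamma> y) \<and> (c + R (y, t) \<in> frontier \<Omega> \<longleftrightarrow> t = \<gamma> y))"

definition C2_boundary :: "('n::euclidean_space \<times> real) set \<Rightarrow> bool" where
  "C2_boundary \<Omega> \<longleftrightarrow>
     (\<forall>x\<in>frontier \<Omega>. \<exists>R c \<alpha> h \<gamma>. boundary_chart \<Omega> R c \<alpha> h \<gamma> \<and>
        x \<in> (\<lambda>z. c + R z) ` (box (- \<alpha>) \<alpha> \<times> {-h<..<h}))"

definition pullback ::
    "('n::euclidean_space \<times> real \<Rightarrow> 'n \<times> real) \<Rightarrow> 'n \<times> real \<Rightarrow> ('n \<Rightarrow> real)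
      \<Rightarrow> ('n \<times> real \<Rightarrow> real) \<Rightarrow> 'n \<Rightarrow> real" where
  "pullback R c \<gamma> g = (\<lambda>y. g (c + R (y, \<gamma> y)))"

text \<open>Grisvard, Definition 1.3.3.2; meaningful for \<open>0 \<le> s \<le> 2\<close> on \<open>C\<^sup>2\<close> boundaries.\<close>

definition boundary_sobolev ::
    "('n::euclidean_space \<times> real) set \<Rightarrow> real \<Rightarrow> ('n \<times> real \<Rightarrow> real) set" where
  "boundary_sobolev \<Omega> s =
     {g. \<forall>R c \<alpha> h \<gamma>. boundary_chart \<Omega> R c \<alpha> h \<gamma> \<longrightarrow>
           pullback R c \<gamma> g \<in> sobolev (box (- \<alpha>) \<alpha>) s}"

text \<open>The graph of the trace operator \<open>H\<^sup>1(\<Omega>) \<rightarrow> L\<^sup>2(\<partial>\<Omega>)\<close>, the continuous extension of the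
  restriction map on smooth functions. The surface element is bounded above and below in each
  chart, so convergence in \<open>L\<^sup>2(\<partial>\<Omega>)\<close> is \<open>L\<^sup>2\<close> convergence in all charts.\<close>

definition has_trace ::
    "('n::euclidean_space \<times> real) set \<Rightarrow> ('n \<times> real \<Rightarrow> real) \<Rightarrow> ('n \<times> real \<Rightarrow> real) \<Rightarrow> bool" where
  "has_trace \<Omega> u g \<longleftrightarrow>
     u \<in> sobolev \<Omega> 1 \<and>
     (\<exists>\<phi> :: nat \<Rightarrow> _. (\<forall>n. smooth (\<phi> n)) \<and>
        (\<lambda>n. sobolev_norm \<Omega> 1 (\<lambda>x. u x - \<phi> n x)) \<longlonglongrightarrow> 0 \<and>
        (\<forall>R c \<alpha> h \<gamma>. boundary_chart \<Omega> R c \<alpha> h \<gamma> \<longrightarrow>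
           pullback R c \<gamma> g \<in> L2 (box (- \<alpha>) \<alpha>) \<and>
           (\<lambda>n. L2_norm (box (- \<alpha>) \<alpha>) (\<lambda>y. pullback R c \<gamma> g y - pullback R c \<gamma> (\<phi> n) y))
             \<longlonglongrightarrow> 0))"


section \<open>The boundary value problem\<close>

definition admissible :: "'a::euclidean_space set \<Rightarrow> real \<Rightarrow> real \<Rightarrow> ('a \<Rightarrow> real) set" where
  "admissible \<Omega> q_lo q_hi = {q \<in> L2 \<Omega>. AE x in lebesgue_on \<Omega>. q_lo \<le> q x \<and> q x \<le> q_hi}"

text \<open>\<open>u \<in> H\<^sup>2(\<Omega>)\<close> solves \<open>-\<nabla>\<cdot>(a\<nabla>u) + q u = f\<close> in \<open>\<Omega>\<close>, \<open>u = g\<close> on \<open>\<partial>\<Omega>\<close>.\<close>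

definition solves ::
    "('n::euclidean_space \<times> real) set \<Rightarrow> ('n \<times> real \<Rightarrow> real) \<Rightarrow> ('n \<times> real \<Rightarrow> real)
      \<Rightarrow> ('n \<times> real \<Rightarrow> real) \<Rightarrow> ('n \<times> real \<Rightarrow> real) \<Rightarrow> ('n \<times> real \<Rightarrow> real) \<Rightarrow> bool" where
  "solves \<Omega> a f g q u \<longleftrightarrow>
     u \<in> sobolev \<Omega> 2 \<and>
     (\<exists>D. has_weak_div \<Omega> (\<lambda>x. a x *\<^sub>R weak_grad \<Omega> u x) D \<and>
        (AE x in lebesgue_on \<Omega>. - D x + q x * u x = f x)) \<and>
     has_trace \<Omega> u g"

end

theory Submission
  imports Defs
begin

text \<open>
  Write \<open>v = u(q\<^sup>\<dagger>)\<close>, \<open>w = u(q) - v\<close> and \<open>p = q - q\<^sup>\<dagger>\<close>, so that \<open>div (a \<nabla>w) = q w + p v\<close>. Since \<open>w\<close> has zero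
  trace, testing with \<open>w\<close> gives \<open>a0 \<parallel>\<nabla>w\<parallel>\<^sup>2 + q_lo \<parallel>w\<parallel>\<^sup>2 \<le> C \<parallel>w\<parallel>\<close>, that is, the \<open>H\<^sup>1\<close> norm of \<open>w\<close> is at most a
  constant times the square root of its \<open>L\<^sup>2\<close> norm. Testing with \<open>\<phi> / v\<close> bounds the pairing of \<open>p\<close> with a test
  function \<open>\<phi>\<close> by the \<open>H\<^sup>1\<close> norm of \<open>w\<close> times that of \<open>\<phi> / v\<close>. The only delicate term is \<open>\<phi> \<nabla>v / v\<^sup>2\<close>; it is
  controlled by testing the equation of \<open>v\<close> itself with \<open>\<phi>\<^sup>2 H(v)\<close>, where \<open>H\<close> is bounded and \<open>H'(s)\<close> is of order
  \<open>s\<^sup>-\<^sup>4\<close> for \<open>|s| \<ge> c0\<close>, together with the inequality \<open>\<integral> |f| \<phi>\<^sup>2 \<le> C \<parallel>\<nabla>\<phi>\<parallel>\<^sup>2\<close> for \<open>f \<in> L\<^sup>2\<close> in dimension at most three.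
  In this way neither elliptic regularity nor a Sobolev embedding up to the boundary is used, and the
  estimate even holds in the dual norm of \<open>H\<^sup>1\<^sub>0\<close>.
\<close>

section \<open>Calculus of smooth functions\<close>

text \<open>The obstacle is that the equations may be tested only with smooth functions of compact
  support, whereas the functions to be inserted, \<open>w\<close>, \<phi> / v and \<phi>^2 H(v), are
  not of this kind. Towards the boundary, a zero trace says only that smooth approximations of
  \<open>w\<close> become small on the graphs of the charts. Integrating inwards from the graph
  turns this into an L2 norm of \<open>w\<close> of order o(r) in a layer of width r, which beats
  the gradient of size 1/r of a cutoff. Inside, \<open>v\<close> is replaced by smooth
  approximations, which may vanish although |v| \<ge> c0; hence 1/s and s^-3 are replaced by
  functions that are smooth and bounded on the whole line, with a parameter \<delta>. The square
  root comes from the energy estimate: \<open>p\<close> is bounded but not small, so the right side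
  has one power of the norm of \<open>w\<close> against two on the left. The bound on the dimension
  is used in \<open>weighted_L2_nn\<close>, through s^6 \<le> s^(2d) for 0 < s \<le> 1.\<close>

lemma partial_eq:
  assumes "(f has_derivative f') (at x)"
  shows "partial b f x = f' b"
  using frechet_derivative_at[OF assms] by (simp add: partial_def)

lemma has_derivative_partial:
  fixes f :: "'a::euclidean_space \<Rightarrow> real"
  assumes "f differentiable (at x)"
  shows "(f has_derivative (\<lambda>h. grad f x \<bullet> h)) (at x)"
proof -
  have d: "(f has_derivative frechet_derivative f (at x)) (at x)"
    using assms by (simp add: frechet_derivative_works)
  then interpret bounded_linear "frechet_derivative f (at x)"
    by (rule has_derivative_bounded_linear)
  have "frechet_derivative f (at x) h = grad f x \<bullet> h" for h
  proof -
    have "frechet_derivative f (at x) h = frechet_derivative f (at x) (\<Sum>b\<in>Basis. (h \<bullet> b) *\<^sub>R b)"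
      by (simp add: euclidean_representation)
    also have "\<dots> = (\<Sum>b\<in>Basis. (h \<bullet> b) * frechet_derivative f (at x) b)"
      by (simp add: sum scaleR)
    also have "\<dots> = grad f x \<bullet> h"
      by (simp add: grad_def inner_sum_left partial_def inner_commute[of h] mult.commute)
    finally show ?thesis .
  qed
  then have "frechet_derivative f (at x) = (\<lambda>h. grad f x \<bullet> h)" by blast
  then show ?thesis using d by simp
qed

lemma grad_inner_Basis: "b \<in> Basis \<Longrightarrow> grad f x \<bullet> b = partial b f x"
  by (simp add: grad_def inner_sum_left inner_Basis if_distrib cong: if_cong)

lemma Ck_continuous: "Ck k \<phi> \<Longrightarrow> continuous_on UNIV \<phi>"
  by (cases k) (auto simp: continuous_on_eq_continuous_at differentiable_imp_continuous_within)

lemma Ck_Suc_imp: "Ck (Suc k) \<phi> \<Longrightarrow> Ck k \<phi>"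
proof (induction k arbitrary: \<phi>)
  case 0
  then show ?case
    by (auto simp: continuous_on_eq_continuous_at differentiable_imp_continuous_within)
next
  case (Suc k)
  from Suc.prems have "\<forall>x. \<phi> differentiable (at x)" "\<forall>b\<in>Basis. Ck (Suc k) (partial b \<phi>)"
    by simp_all
  with Suc.IH show ?case by (simp only: Ck.simps) blast
qed

lemma Ck_const: "Ck k (\<lambda>x. c)"
proof (induction k arbitrary: c)
  case (Suc k)
  have "partial b (\<lambda>x::'a. c) = (\<lambda>x. 0)" for b
    by (rule ext) (rule partial_eq[of _ "\<lambda>h. 0"], simp)
  then show ?case using Suc by simp
qed simp

lemma partial_add:
  assumes "f differentiable (at x)" "g differentiable (at x)"
  shows "partial b (\<lambda>x. f x + g x) x = partial b f x + partial b g x"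
proof -
  from assms have "(f has_derivative frechet_derivative f (at x)) (at x)"
    "(g has_derivative frechet_derivative g (at x)) (at x)"
    by (simp_all add: frechet_derivative_works)
  from has_derivative_add[OF this] show ?thesis by (subst partial_eq) (auto simp: partial_def)
qed

lemma partial_mult:
  fixes f g :: "'a::euclidean_space \<Rightarrow> real"
  assumes "f differentiable (at x)" "g differentiable (at x)"
  shows "partial b (\<lambda>x. f x * g x) x = f x * partial b g x + partial b f x * g x"
proof -
  from assms have "(f has_derivative frechet_derivative f (at x)) (at x)"
    "(g has_derivative frechet_derivative g (at x)) (at x)"
    by (simp_all add: frechet_derivative_works)
  from has_derivative_mult[OF this] show ?thesis by (subst partial_eq) (auto simp: partial_def)
qed

lemma Ck_add: "Ck k f \<Longrightarrow> Ck k g \<Longrightarrow> Ck k (\<lambda>x. f x + g x)"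
proof (induction k arbitrary: f g)
  case 0
  then show ?case by (auto intro: continuous_intros)
next
  case (Suc k)
  then have "partial b (\<lambda>x. f x + g x) = (\<lambda>x. partial b f x + partial b g x)" for b
    by (intro ext partial_add) auto
  with Suc show ?case by (auto intro: differentiable_add)
qed

lemma Ck_mult: "Ck k f \<Longrightarrow> Ck k g \<Longrightarrow> Ck k (\<lambda>x. f x * g x)"
proof (induction k arbitrary: f g)
  case 0
  then show ?case by (auto intro: continuous_intros)
next
  case (Suc k)
  then have eq: "partial b (\<lambda>x. f x * g x) = (\<lambda>x. f x * partial b g x + partial b f x * g x)" for b
    by (intro ext partial_mult) auto
  have "Ck k f" "Ck k g" using Suc.prems Ck_Suc_imp by blast+
  with Suc show ?case by (auto intro: differentiable_mult simp: eq Ck_add)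
qed

text \<open>The derivative of \<open>1 / g\<close> is a product of \<open>partial b g\<close> with
  two copies of \<open>1 / g\<close>, which are of class \<open>k\<close> by induction, so
  \<open>Ck_mult\<close> closes the step.\<close>

lemma Ck_inverse:
  assumes "\<And>x. g x \<noteq> 0"
  shows "Ck k g \<Longrightarrow> Ck k (\<lambda>x. inverse (g x))"
proof (induction k)
  case 0
  then show ?case using assms by (auto intro: continuous_intros)
next
  case (Suc k)
  have eq: "partial b (\<lambda>x. inverse (g x)) = (\<lambda>x. (-1) * (inverse (g x) * (partial b g x * inverse (g x))))" for b
  proof (rule ext)
    fix x
    have "(g has_derivative frechet_derivative g (at x)) (at x)"
      using Suc.prems by (simp add: frechet_derivative_works)
    from Deriv.has_derivative_inverse[OF assms this, simplified mult.assoc]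
    show "partial b (\<lambda>x. inverse (g x)) x = (-1) * (inverse (g x) * (partial b g x * inverse (g x)))"
      by (subst partial_eq) (auto simp: partial_def mult.assoc)
  qed
  have "Ck k (\<lambda>x. inverse (g x))" using Suc Ck_Suc_imp by blast
  moreover have "Ck k (partial b g)" if "b \<in> Basis" for b using Suc that by simp
  ultimately have "Ck k (partial b (\<lambda>x. inverse (g x)))" if "b \<in> Basis" for b
    using that by (simp only: eq) (intro Ck_mult Ck_const; blast)
  moreover have "(\<lambda>x. inverse (g x)) differentiable (at x)" for x
    using Suc.prems assms by (intro differentiable_inverse) auto
  ultimately show ?case by simp
qed

lemma Ck_affine:
  fixes \<phi> :: "'a::euclidean_space \<Rightarrow> real"
  shows "Ck k \<phi> \<Longrightarrow> Ck k (\<lambda>x. \<phi> (r *\<^sub>R x + c))"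
proof (induction k arbitrary: \<phi>)
  case 0
  then have "continuous_on UNIV \<phi>" by simp
  then have "continuous_on UNIV (\<lambda>x. \<phi> (r *\<^sub>R x + c))"
    by (rule continuous_on_compose2) (auto intro!: continuous_intros)
  then show ?case by simp
next
  case (Suc k)
  have d: "((\<lambda>x. \<phi> (r *\<^sub>R x + c)) has_derivative (\<lambda>h. frechet_derivative \<phi> (at (r *\<^sub>R x + c)) (r *\<^sub>R h))) (at x)" for x
  proof -
    have "(\<phi> has_derivative frechet_derivative \<phi> (at (r *\<^sub>R x + c))) (at (r *\<^sub>R x + c))"
      using Suc.prems by (simp add: frechet_derivative_works)
    from has_derivative_compose[where f = "\<lambda>x. r *\<^sub>R x + c" and f' = "\<lambda>h. r *\<^sub>R h", OF _ this] show ?thesis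
      by (simp add: has_derivative_add_const has_derivative_scaleR_right has_derivative_ident)
  qed
  have lin: "linear (frechet_derivative \<phi> (at y))" for y
    using Suc.prems by (intro linear_frechet_derivative) simp
  have eq: "partial b (\<lambda>x. \<phi> (r *\<^sub>R x + c)) = (\<lambda>x. r * partial b \<phi> (r *\<^sub>R x + c))" for b
    by (rule ext, subst partial_eq[OF d]) (simp add: partial_def linear_cmul[OF lin])
  have "Ck k (\<lambda>x. r * partial b \<phi> (r *\<^sub>R x + c))" if "b \<in> Basis" for b
    using Suc that by (intro Ck_mult Ck_const) auto
  with d show ?case by (auto simp: eq differentiable_def)
qed

lemma partial_affine:
  fixes \<phi> :: "'a::euclidean_space \<Rightarrow> real"
  assumes "\<And>x. \<phi> differentiable (at x)"
  shows "partial b (\<lambda>x. \<phi> (r *\<^sub>R x + c)) x = r * partial b \<phi> (r *\<^sub>R x + c)"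
proof -
  have "(\<phi> has_derivative frechet_derivative \<phi> (at (r *\<^sub>R x + c))) (at (r *\<^sub>R x + c))"
    using assms by (simp add: frechet_derivative_works)
  from has_derivative_compose[where f = "\<lambda>x. r *\<^sub>R x + c" and f' = "\<lambda>h. r *\<^sub>R h", OF _ this]
  have d: "((\<lambda>x. \<phi> (r *\<^sub>R x + c)) has_derivative (\<lambda>h. frechet_derivative \<phi> (at (r *\<^sub>R x + c)) (r *\<^sub>R h))) (at x)"
    by (simp add: has_derivative_add_const has_derivative_scaleR_right has_derivative_ident)
  have lin: "linear (frechet_derivative \<phi> (at y))" for y
    using assms by (intro linear_frechet_derivative) simp
  show ?thesis by (subst partial_eq[OF d]) (simp add: partial_def linear_cmul[OF lin])
qed

text \<open>Each factor of a product bump on a box depends on one coordinate only, so its smoothness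
  is that of a function of one variable composed with an affine functional; every differentiation
  merely adds the factor \<open>v \<bullet> b\<close>.\<close>

lemma Ck_ridge:
  fixes g :: "real \<Rightarrow> real" and v :: "'a::euclidean_space"
  shows "Ck k g \<Longrightarrow> Ck k (\<lambda>x. g (v \<bullet> x + s))"
proof (induction k arbitrary: g)
  case 0
  then have "continuous_on UNIV g" by simp
  then have "continuous_on UNIV (\<lambda>x. g (v \<bullet> x + s))"
    by (rule continuous_on_compose2) (auto intro!: continuous_intros)
  then show ?case by simp
next
  case (Suc k)
  have d: "((\<lambda>x. g (v \<bullet> x + s)) has_derivative (\<lambda>h. frechet_derivative g (at (v \<bullet> x + s)) (v \<bullet> h))) (at x)" for x
  proof -
    have "(g has_derivative frechet_derivative g (at (v \<bullet> x + s))) (at (v \<bullet> x + s))"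
      using Suc.prems by (simp add: frechet_derivative_works)
    from has_derivative_compose[where f = "\<lambda>x. v \<bullet> x + s" and f' = "\<lambda>h. v \<bullet> h", OF _ this] show ?thesis
      by (simp add: has_derivative_add_const has_derivative_inner_right has_derivative_ident)
  qed
  have lin: "linear (frechet_derivative g (at y))" for y
    using Suc.prems by (intro linear_frechet_derivative) simp
  have eq: "partial b (\<lambda>x. g (v \<bullet> x + s)) = (\<lambda>x. (v \<bullet> b) * partial 1 g (v \<bullet> x + s))" for b
    using linear_cmul[OF lin, of _ "_ \<bullet> _" 1]
    by (intro ext, subst partial_eq[OF d]) (simp add: partial_def)
  have "Ck k (\<lambda>x. (v \<bullet> b) * partial 1 g (v \<bullet> x + s))" for b
    using Suc by (intro Ck_mult Ck_const) auto
  with d show ?case by (auto simp: eq differentiable_def)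
qed

lemma Ck_prod:
  assumes "finite A" "\<And>i. i \<in> A \<Longrightarrow> Ck k (f i)"
  shows "Ck k (\<lambda>x. \<Prod>i\<in>A. f i x)"
  using assms by (induction A rule: finite_induct) (auto intro: Ck_mult Ck_const)

lemma smooth_Ck: "smooth \<phi> \<Longrightarrow> Ck k \<phi>" by (simp add: smooth_def)

lemma smooth_differentiable: "smooth \<phi> \<Longrightarrow> \<phi> differentiable (at x)"
  using smooth_Ck[of \<phi> 1] by simp

lemma smooth_continuous: "smooth \<phi> \<Longrightarrow> continuous_on S \<phi>"
  using smooth_Ck[of \<phi> 0] by (auto intro: continuous_on_subset)

lemma smooth_partial: "smooth \<phi> \<Longrightarrow> b \<in> Basis \<Longrightarrow> smooth (partial b \<phi>)"
  unfolding smooth_def by (metis Ck.simps(2))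

lemma smooth_const: "smooth (\<lambda>x. c)"
  and smooth_add: "smooth f \<Longrightarrow> smooth g \<Longrightarrow> smooth (\<lambda>x. f x + g x)"
  and smooth_mult: "smooth f \<Longrightarrow> smooth g \<Longrightarrow> smooth (\<lambda>x. f x * g x)"
  and smooth_inverse: "(\<And>x. g x \<noteq> 0) \<Longrightarrow> smooth g \<Longrightarrow> smooth (\<lambda>x. inverse (g x))"
  by (auto simp: smooth_def Ck_const Ck_add Ck_mult Ck_inverse)

lemma smooth_diff: "smooth f \<Longrightarrow> smooth g \<Longrightarrow> smooth (\<lambda>x. f x - g x)"
  using smooth_add[OF _ smooth_mult[OF smooth_const[of "-1"]], of f g] by simp

lemma smooth_divide: "(\<And>x. g x \<noteq> 0) \<Longrightarrow> smooth f \<Longrightarrow> smooth g \<Longrightarrow> smooth (\<lambda>x. f x / g x)"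
  by (simp add: divide_inverse smooth_mult smooth_inverse)

lemma smooth_power: "smooth f \<Longrightarrow> smooth (\<lambda>x. f x ^ n)"
  by (induction n) (auto intro: smooth_mult smooth_const)

lemma grad_mult:
  fixes f g :: "'a::euclidean_space \<Rightarrow> real"
  assumes "f differentiable (at x)" "g differentiable (at x)"
  shows "grad (\<lambda>x. f x * g x) x = f x *\<^sub>R grad g x + g x *\<^sub>R grad f x"
  by (simp add: grad_def partial_mult[OF assms] scaleR_add_left sum.distrib scaleR_sum_right mult.commute)

lemma grad_const: "grad (\<lambda>x. c) x = 0"
  by (simp add: grad_def partial_def)

lemma grad_diff:
  fixes f g :: "'a::euclidean_space \<Rightarrow> real"
  assumes "f differentiable (at x)" "g differentiable (at x)"
  shows "grad (\<lambda>x. f x - g x) x = grad f x - grad g x"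
proof -
  from assms have "(f has_derivative frechet_derivative f (at x)) (at x)"
    "(g has_derivative frechet_derivative g (at x)) (at x)"
    by (simp_all add: frechet_derivative_works)
  from has_derivative_diff[OF this] have "partial b (\<lambda>x. f x - g x) x = partial b f x - partial b g x" for b
    by (subst partial_eq) (auto simp: partial_def)
  then show ?thesis by (simp add: grad_def scaleR_diff_left sum_subtractf)
qed

lemma grad_compose:
  fixes f :: "'a::euclidean_space \<Rightarrow> real"
  assumes "f differentiable (at x)" "(H has_real_derivative H') (at (f x))"
  shows "grad (\<lambda>x. H (f x)) x = H' *\<^sub>R grad f x"
proof -
  have "((\<lambda>x. H (f x)) has_derivative (\<lambda>h. (grad f x \<bullet> h) * H')) (at x)"
    using has_derivative_compose[OF has_derivative_partial[OF assms(1)]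
        assms(2)[unfolded has_field_derivative_def]]
    by (simp add: mult.commute)
  then have "partial b (\<lambda>x. H (f x)) x = (grad f x \<bullet> b) * H'" for b
    by (simp add: partial_eq)
  then show ?thesis
    by (simp add: grad_def scaleR_sum_right mult.commute grad_inner_Basis[unfolded grad_def] cong: sum.cong)
qed

lemma smooth_continuous_grad:
  assumes "smooth \<phi>"
  shows "continuous_on S (grad \<phi>)"
  unfolding grad_def[abs_def]
  by (intro continuous_intros smooth_continuous smooth_partial assms)

section \<open>Bump functions\<close>

text \<open>For \<open>m = 0\<close> this is the classical function that is flat at 0. The powers of
  \<open>1 / t\<close> are carried along because differentiation maps the family into its own linear
  combinations, which makes smoothness a plain induction.\<close>

definition exp_flat :: "nat \<Rightarrow> real \<Rightarrow> real" where
  "exp_flat m t = (if 0 < t then exp (- (1 / t)) / t ^ m else 0)"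

lemma exp_flat_tendsto_0: "(exp_flat m \<longlongrightarrow> 0) (at 0)"
proof -
  have "((\<lambda>x::real. x ^ m / exp x) \<longlongrightarrow> 0) at_top" by (rule tendsto_power_div_exp_0)
  then have "((\<lambda>t::real. inverse t ^ m / exp (inverse t)) \<longlongrightarrow> 0) (at_right 0)"
    by (rule filterlim_compose[OF _ filterlim_inverse_at_top_right])
  then have "(exp_flat m \<longlongrightarrow> 0) (at_right 0)"
    by (rule Lim_transform_eventually)
      (auto simp: eventually_at_filter exp_flat_def exp_minus field_simps)
  moreover have "(exp_flat m \<longlongrightarrow> 0) (at_left 0)"
    by (rule Lim_transform_eventually[OF tendsto_const])
      (auto simp: eventually_at_filter exp_flat_def)
  ultimately show ?thesis by (simp add: filterlim_at_split)
qed

lemma exp_flat_deriv: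
  "(exp_flat m has_real_derivative (exp_flat (m + 2) t - m * exp_flat (m + 1) t)) (at t)"
proof (cases t "0::real" rule: linorder_cases)
  case less
  have "((\<lambda>t. 0) has_real_derivative 0) (at t)" by simp
  then have "(exp_flat m has_real_derivative 0) (at t)"
    by (rule has_field_derivative_transform_within_open[where S = "{..<0}"])
      (use less in \<open>auto simp: exp_flat_def\<close>)
  with less show ?thesis by (simp add: exp_flat_def)
next
  case equal
  \<comment> \<open>The difference quotient at 0 is the next member \<open>exp_flat (Suc m)\<close>,
    on both sides of 0, so differentiability there is again the limit at 0.\<close>
  have "((\<lambda>h. (exp_flat m (0 + h) - exp_flat m 0) / h) \<longlongrightarrow> 0) (at 0)"
    by (rule Lim_transform_eventually[OF exp_flat_tendsto_0[of "Suc m"]])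
      (auto simp: exp_flat_def eventually_at_filter field_simps)
  then show ?thesis using equal by (simp add: DERIV_def exp_flat_def)
next
  case greater
  have "((\<lambda>t. exp (- (1 / t)) / t ^ m) has_real_derivative (exp_flat (m + 2) t - m * exp_flat (m + 1) t)) (at t)"
    using greater
    apply (auto intro!: derivative_eq_intros)
    apply (cases m)
     apply (auto simp: exp_flat_def field_simps power2_eq_square)
    done
  then show ?thesis
    by (rule has_field_derivative_transform_within_open[where S = "{0<..}"])
      (use greater in \<open>auto simp: exp_flat_def\<close>)
qed

lemma smooth_exp_flat: "smooth (exp_flat m)"
proof -
  have "Ck k (exp_flat m)" for k
  proof (induction k arbitrary: m)
    case 0
    then show ?case
      using DERIV_isCont[OF exp_flat_deriv] by (simp add: continuous_on_eq_continuous_at)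
  next
    case (Suc k)
    have "partial 1 (exp_flat m) = (\<lambda>t. exp_flat (m + 2) t + (- real m) * exp_flat (m + 1) t)"
      by (rule ext, subst partial_eq[OF exp_flat_deriv[unfolded has_field_derivative_def]]) simp
    moreover have "exp_flat m differentiable (at t)" for t
      using exp_flat_deriv real_differentiable_def by blast
    moreover have "Ck k (\<lambda>t. exp_flat (m + 2) t + (- real m) * exp_flat (m + 1) t)"
      by (intro Ck_add Ck_mult Ck_const Suc)
    ultimately show ?case by simp
  qed
  then show ?thesis by (simp add: smooth_def)
qed

definition bump :: "real \<Rightarrow> 'a::euclidean_space \<Rightarrow> 'a \<Rightarrow> 'a \<Rightarrow> real" where
  "bump n l u x = (\<Prod>b\<in>Basis. exp_flat 0 (n * (x \<bullet> b - l \<bullet> b)) * exp_flat 0 (n * (u \<bullet> b - x \<bullet> b)))"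

lemma smooth_bump: "smooth (bump n l u)"
proof -
  have *: "Ck k (\<lambda>x. exp_flat 0 ((n *\<^sub>R b) \<bullet> x + (- n * (l \<bullet> b))) * exp_flat 0 ((- n *\<^sub>R b) \<bullet> x + n * (u \<bullet> b)))"
    for k and b :: 'a
    by (intro Ck_mult Ck_ridge smooth_Ck smooth_exp_flat)
  have "Ck k (\<lambda>x. exp_flat 0 (n * (x \<bullet> b - l \<bullet> b)) * exp_flat 0 (n * (u \<bullet> b - x \<bullet> b)))"
    for k and b :: 'a
    using *[of k b] by (simp add: right_diff_distrib inner_commute[of b] add.commute)
  then show ?thesis unfolding smooth_def bump_def[abs_def] by (intro allI Ck_prod) auto
qed

lemma exp_flat_0_bounds: "0 \<le> exp_flat 0 t" "exp_flat 0 t \<le> 1" "exp_flat 0 t > 0 \<longleftrightarrow> t > 0"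
  by (auto simp: exp_flat_def)

lemma bump_bounds: "0 \<le> bump n l u x" "bump n l u x \<le> 1"
  unfolding bump_def by (auto intro!: prod_nonneg prod_le_1 mult_le_one simp: exp_flat_0_bounds)

lemma bump_nonzero: "0 < n \<Longrightarrow> bump n l u x \<noteq> 0 \<longleftrightarrow> x \<in> box l u"
  by (auto simp: bump_def mem_box exp_flat_def zero_less_mult_iff)

text \<open>For \<open>s > 0\<close> the factors exp(-1 / (n s)) tend to 1, and outside the open box
  one factor is 0 for every \<open>n\<close>. Hence the convergence holds at every point, and
  together with values in [0, 1] it lets bumps stand in for indicators of boxes.\<close>

lemma bump_tendsto: "(\<lambda>n. bump (real (Suc n)) l u x) \<longlonglongrightarrow> indicator (box l u) x"
proof (cases "x \<in> box l u")
  case True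
  have *: "(\<lambda>n. exp_flat 0 (real (Suc n) * s)) \<longlonglongrightarrow> 1" if "s > 0" for s
  proof -
    have "(\<lambda>n. exp (- (inverse (real (Suc n)) * inverse s))) \<longlonglongrightarrow> exp (- (0 * inverse s))"
      by (intro tendsto_intros LIMSEQ_inverse_real_of_nat)
    moreover have "exp_flat 0 (real (Suc n) * s) = exp (- (inverse (real (Suc n)) * inverse s))" for n
      using that by (simp add: exp_flat_def divide_inverse zero_less_mult_iff del: of_nat_Suc)
    ultimately show ?thesis by simp
  qed
  have "(\<lambda>n. bump (real (Suc n)) l u x) \<longlonglongrightarrow> (\<Prod>b\<in>(Basis::'a set). 1 * 1)"
    unfolding bump_def using True
    by (intro tendsto_prod tendsto_mult * ) (auto simp: mem_box)
  then show ?thesis using True by simp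
next
  case False
  then have "bump (real (Suc n)) l u x = 0" for n using bump_nonzero[of "real (Suc n)" l u x] by auto
  then show ?thesis using False by simp
qed

lemma bump_test_function:
  assumes "0 < n" "cbox l u \<subseteq> \<Omega>"
  shows "bump n l u \<in> test_functions \<Omega>"
proof -
  have "closure {x. bump n l u x \<noteq> 0} \<subseteq> cbox l u"
    using bump_nonzero[OF assms(1), of l u] box_subset_cbox[of l u] by (intro closure_minimal) auto
  moreover from this have "compact (closure {x. bump n l u x \<noteq> 0})"
    using compact_cbox bounded_subset[OF bounded_cbox] compact_eq_bounded_closed by blast
  ultimately show ?thesis using assms by (auto simp: test_functions_def smooth_bump)
qed

section \<open>Weak derivatives\<close>

text \<open>Open boxes form an intersection-stable generator of the Borel sets. Hence the finite
  measures given by the positive and the negative part of \<open>g\<close> coincide as soon as they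
  agree on boxes, and then so do their densities.\<close>

lemma AE_zero_if_box_integrals_zero:
  fixes g :: "'a::euclidean_space \<Rightarrow> real"
  assumes g: "integrable lebesgue g"
    and zero: "\<And>l u. (\<integral>x. g x * indicator (box l u) x \<partial>lebesgue) = 0"
  shows "AE x in lebesgue. g x = 0"
proof -
  obtain g' where g'[measurable]: "g' \<in> borel_measurable lborel" and eq: "AE x in lborel. g x = g' x"
    using completion_ex_borel_measurable_real[OF borel_measurable_integrable[OF g]] by blast
  have eqL: "AE x in lebesgue. g x = g' x" using eq AE_completion by blast
  have g'm: "g' \<in> borel_measurable lebesgue" by (simp add: measurable_completion)
  have "integrable lebesgue g'"
    using g g'm eqL by (subst integrable_cong_AE[of _ _ g]) (auto elim: AE_mp)
  then have int: "integrable lborel g'" by (simp add: integrable_completion)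
  have int_box: "integrable lborel (\<lambda>x. g' x * indicator (box l u) x)" for l u
    by (rule Bochner_Integration.integrable_bound[OF int]) (auto simp: indicator_def)
  have zero': "(\<integral>x. g' x * indicator (box l u) x \<partial>lborel) = 0" for l u
  proof -
    have "(\<integral>x. g' x * indicator (box l u) x \<partial>lborel) = (\<integral>x. g' x * indicator (box l u) x \<partial>lebesgue)"
      by (simp add: integral_completion)
    also have "\<dots> = (\<integral>x. g x * indicator (box l u) x \<partial>lebesgue)"
    proof (rule integral_cong_AE)
      show "AE x in lebesgue. g' x * indicat_real (box l u) x = g x * indicat_real (box l u) x"
        using eqL by eventually_elim simp
    qed (use g g'm in \<open>auto intro!: borel_measurable_times borel_measurable_indicator\<close>)
    finally show ?thesis using zero by simp
  qed
  \<comment> \<open>\<open>ennreal\<close> maps negative numbers to 0, so these are the measures of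
    the positive and of the negative part.\<close>
  define P where "P = density lborel (\<lambda>x. ennreal (g' x))"
  define N where "N = density lborel (\<lambda>x. ennreal (- g' x))"
  have fin: "(\<integral>\<^sup>+x. ennreal (g' x) \<partial>lborel) \<noteq> \<infinity>" "(\<integral>\<^sup>+x. ennreal (- g' x) \<partial>lborel) \<noteq> \<infinity>"
    using int by (auto simp: real_integrable_def)
  have "P = N"
  proof (rule measure_eqI_generator_eq)
    let ?E = "range (\<lambda>(a, b). box a b::'a set)"
    show "Int_stable ?E"
      by (auto simp: Int_stable_def box_Int_box)
    show "?E \<subseteq> Pow UNIV" "sets P = sigma_sets UNIV ?E" "sets N = sigma_sets UNIV ?E"
      by (simp_all add: borel_eq_box P_def N_def)
    let ?A = "\<lambda>n::nat. box (- (real n *\<^sub>R One)) (real n *\<^sub>R One) :: 'a set"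
    show "range ?A \<subseteq> ?E" "(\<Union>i. ?A i) = UNIV"
      unfolding UN_box_eq_UNIV by auto
    have le: "emeasure P X \<le> (\<integral>\<^sup>+x. ennreal (g' x) \<partial>lborel)" if "X \<in> sets borel" for X
      using that unfolding P_def
      by (subst emeasure_density) (auto intro!: nn_integral_mono simp: indicator_def)
    show "emeasure P (?A i) \<noteq> \<infinity>" for i
      using le[of "?A i"] fin(1) by (metis borel_open neq_top_trans open_box infinity_ennreal_def)
    fix X assume "X \<in> ?E"
    then obtain l u where X: "X = box l u" by auto
    have *: "(\<integral>\<^sup>+x. ennreal (s * g' x) * indicator X x \<partial>lborel) = (\<integral>\<^sup>+x. ennreal (s * (g' x * indicator X x)) \<partial>lborel)" for s
      by (rule nn_integral_cong) (auto simp: indicator_def)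
    have fin': "(\<integral>\<^sup>+x. ennreal (g' x * indicator X x) \<partial>lborel) \<noteq> \<infinity>"
         "(\<integral>\<^sup>+x. ennreal (- (g' x * indicator X x)) \<partial>lborel) \<noteq> \<infinity>"
      using int_box[of l u] by (auto simp: real_integrable_def X)
    have "enn2real (\<integral>\<^sup>+x. ennreal (g' x * indicator X x) \<partial>lborel) = enn2real (\<integral>\<^sup>+x. ennreal (- (g' x * indicator X x)) \<partial>lborel)"
      using zero'[of l u] real_lebesgue_integral_def[OF int_box[of l u]] by (simp add: X)
    then have "(\<integral>\<^sup>+x. ennreal (g' x * indicator X x) \<partial>lborel) = (\<integral>\<^sup>+x. ennreal (- (g' x * indicator X x)) \<partial>lborel)"
      using fin' by (metis ennreal_enn2real_if infinity_ennreal_def)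
    then show "emeasure P X = emeasure N X"
      using *[of 1] *[of "-1"] unfolding P_def N_def
      by (subst (1 2) emeasure_density) (auto simp: X)
  qed
  then have "AE x in lborel. ennreal (g' x) = ennreal (- g' x)"
    unfolding P_def N_def using fin by (subst (asm) finite_density_unique) auto
  then have "AE x in lborel. g' x = 0"
    by eventually_elim (metis ennreal_eq_0_iff ennreal_inj linorder_le_cases neg_equal_0_iff_equal neg_le_0_iff_le order_antisym_conv)
  then have "AE x in lebesgue. g' x = 0" by (rule AE_completion)
  with eqL show ?thesis by eventually_elim simp
qed

lemma AE_lebesgue_on_iff: "S \<in> sets lebesgue \<Longrightarrow> (AE x in lebesgue_on S. P x) \<longleftrightarrow> (AE x in lebesgue. x \<in> S \<longrightarrow> P x)"
  by (simp add: AE_restrict_space_iff)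

lemma open_sets_lebesgue: "open S \<Longrightarrow> S \<in> sets lebesgue"
  by simp

lemma lebesgue_on_integral_eq:
  fixes f :: "'a::euclidean_space \<Rightarrow> real"
  assumes "S \<in> sets lebesgue"
  shows "(\<integral>x. f x \<partial>lebesgue_on S) = (\<integral>x. f x * indicator S x \<partial>lebesgue)"
  using assms by (subst integral_restrict_space) (auto simp: mult.commute)

lemma lebesgue_on_integrable_iff:
  fixes f :: "'a::euclidean_space \<Rightarrow> real"
  assumes "S \<in> sets lebesgue"
  shows "integrable (lebesgue_on S) f \<longleftrightarrow> integrable lebesgue (\<lambda>x. f x * indicator S x)"
  using assms by (subst integrable_restrict_space) (auto simp: mult.commute)

text \<open>Bumps on a box whose closure lies in \<Omega> are admissible and converge to its
  indicator, so dominated convergence yields vanishing integrals over all such boxes. Countably many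
  closed boxes exhaust \<Omega>, which keeps the exceptional set null.\<close>

lemma fundamental_lemma:
  fixes v :: "'a::euclidean_space \<Rightarrow> real"
  assumes \<Omega>: "open \<Omega>" and v: "locally_integrable \<Omega> v"
    and zero: "\<And>\<phi>. \<phi> \<in> test_functions \<Omega> \<Longrightarrow> (\<integral>x. v x * \<phi> x \<partial>lebesgue_on \<Omega>) = 0"
  shows "AE x in lebesgue_on \<Omega>. v x = 0"
proof -
  have \<Omega>m: "\<Omega> \<in> sets lebesgue" using \<Omega> by (rule open_sets_lebesgue)
  have box0: "(\<integral>x. v x * indicator (box l u) x \<partial>lebesgue) = 0" if lu: "cbox l u \<subseteq> \<Omega>" for l u
  proof -
    have "integrable (lebesgue_on (cbox l u)) v"
      using v lu by (auto simp: locally_integrable_def)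
    then have int: "integrable lebesgue (\<lambda>x. v x * indicator (cbox l u) x)"
      by (simp add: lebesgue_on_integrable_iff)
    have m: "(\<lambda>x. v x * bump (real (Suc n)) l u x) \<in> borel_measurable lebesgue" for n
    proof -
      have "(\<lambda>x. (v x * indicator (cbox l u) x) * bump (real (Suc n)) l u x) \<in> borel_measurable lebesgue"
      proof (rule borel_measurable_times)
        show "(\<lambda>x. v x * indicator (cbox l u) x) \<in> borel_measurable lebesgue"
          using int by (rule borel_measurable_integrable)
        have "bump (real (Suc n)) l u \<in> borel_measurable borel"
          by (intro borel_measurable_continuous_onI smooth_continuous smooth_bump)
        then show "bump (real (Suc n)) l u \<in> borel_measurable lebesgue"
          by (simp add: measurable_completion)
      qed
      moreover have "(v x * indicator (cbox l u) x) * bump (real (Suc n)) l u x = v x * bump (real (Suc n)) l u x" for x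
        using bump_nonzero[of "real (Suc n)" l u x] box_subset_cbox[of l u] by (auto simp: indicator_def)
      ultimately show ?thesis by (simp only:)
    qed
    have "(\<lambda>n. \<integral>x. v x * bump (real (Suc n)) l u x \<partial>lebesgue) \<longlonglongrightarrow> (\<integral>x. v x * indicator (box l u) x \<partial>lebesgue)"
    proof (rule integral_dominated_convergence)
      show "(\<lambda>x. v x * indicator (box l u) x) \<in> borel_measurable lebesgue"
      proof -
        have "(\<lambda>x. (v x * indicator (cbox l u) x) * indicator (box l u) x) \<in> borel_measurable lebesgue"
          by (intro borel_measurable_times[OF borel_measurable_integrable[OF int]] borel_measurable_indicator) auto
        moreover have "(v x * indicator (cbox l u) x) * indicator (box l u) x = v x * indicator (box l u) x" for x
          using box_subset_cbox[of l u] by (auto simp: indicator_def)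
        ultimately show ?thesis by (simp only:)
      qed
      show "integrable lebesgue (\<lambda>x. \<bar>v x * indicator (cbox l u) x\<bar>)" using int by simp
      show "AE x in lebesgue. (\<lambda>n. v x * bump (real (Suc n)) l u x) \<longlonglongrightarrow> v x * indicat_real (box l u) x"
        by (intro always_eventually allI tendsto_mult tendsto_const bump_tendsto)
      show "AE x in lebesgue. norm (v x * bump (real (Suc n)) l u x) \<le> \<bar>v x * indicat_real (cbox l u) x\<bar>" for n
      proof (intro always_eventually allI)
        fix x
        show "norm (v x * bump (real (Suc n)) l u x) \<le> \<bar>v x * indicat_real (cbox l u) x\<bar>"
          using bump_nonzero[of "real (Suc n)" l u x] box_subset_cbox[of l u]
            bump_bounds[of "real (Suc n)" l u x]
          by (cases "x \<in> cbox l u") (auto simp: abs_mult mult_left_le)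
      qed
    qed (fact m)
    moreover have "(\<integral>x. v x * bump (real (Suc n)) l u x \<partial>lebesgue) = 0" for n
    proof -
      have "bump (real (Suc n)) l u \<in> test_functions \<Omega>" using lu by (intro bump_test_function) auto
      then have "(\<integral>x. v x * bump (real (Suc n)) l u x * indicator \<Omega> x \<partial>lebesgue) = 0"
        using zero \<Omega>m by (simp add: lebesgue_on_integral_eq)
      moreover have "v x * bump (real (Suc n)) l u x * indicator \<Omega> x = v x * bump (real (Suc n)) l u x" for x
        using bump_nonzero[of "real (Suc n)" l u x] box_subset_cbox[of l u] lu by (auto simp: indicator_def)
      ultimately show ?thesis by (simp only:)
    qed
    ultimately show ?thesis by (simp add: LIMSEQ_const_iff)
  qed
  have AE_cbox: "AE x in lebesgue. x \<in> cbox l u \<longrightarrow> v x = 0" if lu: "cbox l u \<subseteq> \<Omega>" for l u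
  proof -
    have "integrable (lebesgue_on (cbox l u)) v"
      using v lu by (auto simp: locally_integrable_def)
    then have int: "integrable lebesgue (\<lambda>x. v x * indicator (cbox l u) x)"
      by (simp add: lebesgue_on_integrable_iff)
    have "integrable lebesgue (\<lambda>x. (v x * indicator (cbox l u) x) * indicator (box l u) x)"
      by (intro Bochner_Integration.integrable_bound[OF int] borel_measurable_times
            borel_measurable_indicator borel_measurable_integrable[OF int])
        (auto simp: indicator_def)
    moreover have "(v x * indicator (cbox l u) x) * indicator (box l u) x = v x * indicator (box l u) x" for x
      using box_subset_cbox[of l u] by (auto simp: indicator_def)
    ultimately have int': "integrable lebesgue (\<lambda>x. v x * indicator (box l u) x)" by simp
    have "AE x in lebesgue. v x * indicator (box l u) x = 0"
    proof (rule AE_zero_if_box_integrals_zero[OF int'])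
      fix a b
      \<comment> \<open>An arbitrary \<open>box a b\<close> may leave \<Omega>; only its
        intersection with \<open>box l u\<close> matters, and that is again a box, with these
        corners.\<close>
      define a' where "a' = (\<Sum>i\<in>Basis. max (a \<bullet> i) (l \<bullet> i) *\<^sub>R i)"
      define b' where "b' = (\<Sum>i\<in>Basis. min (b \<bullet> i) (u \<bullet> i) *\<^sub>R i)"
      have eq: "box a b \<inter> box l u = box a' b'" by (simp add: box_Int_box a'_def b'_def)
      have sub: "box a' b' \<subseteq> box l u" using eq by blast
      have "(\<integral>x. v x * indicator (box l u) x * indicator (box a b) x \<partial>lebesgue) = (\<integral>x. v x * indicator (box a' b') x \<partial>lebesgue)"
        by (rule Bochner_Integration.integral_cong) (auto simp: eq[symmetric] indicator_def)
      also have "\<dots> = 0"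
      proof (cases "box a' b' = {}")
        case False
        then have "cbox a' b' \<subseteq> cbox l u"
          using sub by (metis box_subset_cbox closure_box closure_mono closure_cbox order_trans)
        then show ?thesis using box0 lu by blast
      qed simp
      finally show "(\<integral>x. v x * indicator (box l u) x * indicator (box a b) x \<partial>lebesgue) = 0" .
    qed
    moreover have "AE x in lebesgue. x \<notin> cbox l u - box l u"
      using null_sets_cbox_Diff_box[of l u] by (intro AE_not_in) (rule null_sets_completionI)
    ultimately show ?thesis by eventually_elim (auto simp: indicator_def split: if_splits)
  qed
  obtain D where D: "countable D" "\<And>X. X \<in> D \<Longrightarrow> \<exists>a b. X = cbox a b" "\<Union>D = \<Omega>"
    using open_countable_Union_open_cbox[OF \<Omega>] by metis
  have "AE x in lebesgue. \<forall>X\<in>D. x \<in> X \<longrightarrow> v x = 0"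
    unfolding AE_ball_countable[OF D(1)]
  proof
    fix X assume "X \<in> D"
    then show "AE x in lebesgue. x \<in> X \<longrightarrow> v x = 0"
      using AE_cbox D by (metis Union_upper)
  qed
  then show ?thesis
    using \<Omega>m D(3) by (subst AE_lebesgue_on_iff) (auto elim!: AE_mp)
qed

section \<open>Test functions: supports, bounds and uniform Taylor expansion\<close>

lemma test_smooth: "\<phi> \<in> test_functions \<Omega> \<Longrightarrow> smooth \<phi>"
  by (simp add: test_functions_def)

lemma test_UNIV: "\<phi> \<in> test_functions \<Omega> \<Longrightarrow> \<phi> \<in> test_functions UNIV"
  by (simp add: test_functions_def)

lemma test_zero: "\<phi> \<in> test_functions \<Omega> \<Longrightarrow> x \<notin> \<Omega> \<Longrightarrow> \<phi> x = 0"
  using closure_subset[of "{x. \<phi> x \<noteq> 0}"] by (auto simp: test_functions_def)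

lemma grad_zero_outside:
  fixes \<phi> :: "'a::euclidean_space \<Rightarrow> real"
  assumes "x \<notin> closure {x. \<phi> x \<noteq> 0}"
  shows "partial b \<phi> x = 0" "grad \<phi> x = 0"
proof -
  have "((\<lambda>x. 0) has_derivative (\<lambda>h. 0)) (at x)" by simp
  then have "(\<phi> has_derivative (\<lambda>h. 0)) (at x)"
    by (rule has_derivative_transform_within_open[where s = "- closure {x. \<phi> x \<noteq> 0}"])
      (use assms closure_subset[of "{x. \<phi> x \<noteq> 0}"] in auto)
  then show "partial b \<phi> x = 0" for b by (rule partial_eq)
  then show "grad \<phi> x = 0" by (simp add: grad_def)
qed

lemma test_partial:
  assumes "\<phi> \<in> test_functions \<Omega>" "b \<in> Basis"
  shows "partial b \<phi> \<in> test_functions \<Omega>"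
proof -
  have "closure {x. partial b \<phi> x \<noteq> 0} \<subseteq> closure {x. \<phi> x \<noteq> 0}"
    using grad_zero_outside(1) by (intro closure_minimal) auto
  moreover from this have "compact (closure {x. partial b \<phi> x \<noteq> 0})"
    using assms(1) unfolding test_functions_def
    by (metis (no_types, lifting) closed_closure compact_Int_closed inf.absorb_iff2 mem_Collect_eq)
  ultimately show ?thesis using assms by (auto simp: test_functions_def smooth_partial)
qed

lemma test_mult_smooth:
  assumes "\<phi> \<in> test_functions \<Omega>" "smooth \<psi>"
  shows "(\<lambda>x. \<phi> x * \<psi> x) \<in> test_functions \<Omega>"
proof -
  have "closure {x. \<phi> x * \<psi> x \<noteq> 0} \<subseteq> closure {x. \<phi> x \<noteq> 0}"
    by (intro closure_mono) auto
  moreover from this have "compact (closure {x. \<phi> x * \<psi> x \<noteq> 0})"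
    using assms(1) unfolding test_functions_def
    by (metis (no_types, lifting) closed_closure compact_Int_closed inf.absorb_iff2 mem_Collect_eq)
  ultimately show ?thesis using assms by (auto simp: test_functions_def smooth_mult)
qed

lemma test_support_ball:
  fixes \<phi> :: "'a::euclidean_space \<Rightarrow> real"
  assumes "\<phi> \<in> test_functions \<Omega>"
  obtains R where "R > 0" "\<And>x. R \<le> norm x \<Longrightarrow> x \<notin> closure {x. \<phi> x \<noteq> 0}"
    "\<And>x. R \<le> norm x \<Longrightarrow> \<phi> x = 0" "\<And>x. R \<le> norm x \<Longrightarrow> grad \<phi> x = 0"
proof -
  have "bounded (closure {x. \<phi> x \<noteq> 0})"
    using assms by (auto simp: test_functions_def compact_imp_bounded)
  then obtain R where R: "R > 0" "closure {x. \<phi> x \<noteq> 0} \<subseteq> ball 0 R"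
    using bounded_subset_ballD by blast
  then have *: "x \<notin> closure {x. \<phi> x \<noteq> 0}" if "R \<le> norm x" for x using that by auto
  show ?thesis
    using R(1) * grad_zero_outside(2)[OF *] closure_subset[of "{x. \<phi> x \<noteq> 0}"] by (intro that) blast+
qed

lemma bounded_if_zero_outside:
  fixes f :: "'a::euclidean_space \<Rightarrow> 'b::real_normed_vector"
  assumes "continuous_on UNIV f" "\<And>x. R \<le> norm x \<Longrightarrow> f x = 0"
  obtains B where "B > 0" "\<And>x. norm (f x) \<le> B"
proof -
  have "bounded (f ` cball 0 R)"
    by (intro compact_imp_bounded compact_continuous_image continuous_on_subset[OF assms(1)]) auto
  then obtain B where B: "B > 0" "\<And>x. x \<in> cball 0 R \<Longrightarrow> norm (f x) \<le> B"
    unfolding bounded_pos by auto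
  show ?thesis
  proof (rule that[OF B(1)])
    fix x show "norm (f x) \<le> B" using B assms(2)[of x] by (cases "R \<le> norm x") auto
  qed
qed

lemma line_deriv:
  fixes \<phi> :: "'a::euclidean_space \<Rightarrow> real"
  assumes "smooth \<phi>"
  shows "((\<lambda>t. \<phi> (x + t *\<^sub>R h)) has_real_derivative grad \<phi> (x + t *\<^sub>R h) \<bullet> h) (at t)"
proof -
  have "((\<lambda>t. x + t *\<^sub>R h) has_derivative (\<lambda>s. s *\<^sub>R h)) (at t)"
    by (auto intro!: derivative_eq_intros)
  from has_derivative_compose[OF this has_derivative_partial[OF smooth_differentiable[OF assms]]]
  have "((\<lambda>t. \<phi> (x + t *\<^sub>R h)) has_derivative (\<lambda>s. s * (grad \<phi> (x + t *\<^sub>R h) \<bullet> h))) (at t)"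
    by simp
  moreover have "(\<lambda>s. s * G) = (*) G" for G :: real by (auto simp: mult.commute)
  ultimately show ?thesis by (simp only: has_field_derivative_def)
qed

lemma line_mvt:
  fixes \<phi> :: "'a::euclidean_space \<Rightarrow> real"
  assumes "smooth \<phi>"
  obtains \<xi> where "0 < \<xi>" "\<xi> < 1" "\<phi> (x + h) - \<phi> x = grad \<phi> (x + \<xi> *\<^sub>R h) \<bullet> h"
proof -
  have "\<exists>z>0. z < 1 \<and> \<phi> (x + 1 *\<^sub>R h) - \<phi> (x + 0 *\<^sub>R h) = (1 - 0) * (grad \<phi> (x + z *\<^sub>R h) \<bullet> h)"
    by (rule MVT2) (auto intro: line_deriv assms)
  then show ?thesis using that by auto
qed

text \<open>The remainder must be small uniformly in \<open>x\<close> so that it can be integrated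
  when a convolution is differentiated. By the mean value theorem this reduces to uniform continuity
  of the gradient.\<close>

lemma uniform_taylor:
  fixes \<phi> :: "'a::euclidean_space \<Rightarrow> real"
  assumes \<phi>: "\<phi> \<in> test_functions UNIV" and "e > 0"
  obtains d where "d > 0"
    "\<And>x h. norm h < d \<Longrightarrow> \<bar>\<phi> (x + h) - \<phi> x - grad \<phi> x \<bullet> h\<bar> \<le> e * norm h"
proof -
  obtain R where R: "R > 0" "\<And>x. R \<le> norm x \<Longrightarrow> grad \<phi> x = 0"
    using test_support_ball[OF \<phi>] by metis
  \<comment> \<open>The margin 1 over the support radius \<open>R\<close> matches increments of norm
    less than 1: if one of two such points leaves the larger ball, both lie where the gradient is
    0.\<close>
  have "uniformly_continuous_on (cball 0 (R + 1)) (grad \<phi>)"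
    by (intro compact_uniformly_continuous smooth_continuous_grad test_smooth[OF \<phi>] compact_cball)
  then obtain d where d: "d > 0"
    "\<And>x x'. x \<in> cball 0 (R + 1) \<Longrightarrow> x' \<in> cball 0 (R + 1) \<Longrightarrow> dist x' x < d \<Longrightarrow> dist (grad \<phi> x') (grad \<phi> x) < e"
    unfolding uniformly_continuous_on_def using \<open>e > 0\<close> by metis
  have near: "norm (grad \<phi> x' - grad \<phi> x) \<le> e" if "norm (x' - x) < min d 1" for x x'
  proof (cases "x \<in> cball 0 (R + 1) \<and> x' \<in> cball 0 (R + 1)")
    case True
    then show ?thesis using d(2)[of x x'] that by (simp add: dist_norm)
  next
    case False
    have "norm x \<le> norm x' + norm (x' - x)" "norm x' \<le> norm x + norm (x' - x)"
      by (metis norm_minus_commute norm_triangle_sub add.commute)+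
    with False that have "R \<le> norm x" "R \<le> norm x'" by auto
    then show ?thesis using R \<open>e > 0\<close> by simp
  qed
  show ?thesis
  proof (rule that[of "min d 1"])
    fix x h :: 'a assume h: "norm h < min d 1"
    obtain \<xi> where \<xi>: "0 < \<xi>" "\<xi> < 1" "\<phi> (x + h) - \<phi> x = grad \<phi> (x + \<xi> *\<^sub>R h) \<bullet> h"
      using line_mvt[OF test_smooth[OF \<phi>]] by blast
    have "norm (\<xi> *\<^sub>R h) \<le> norm h" using \<xi> by (simp add: mult_left_le_one_le)
    then have "norm (grad \<phi> (x + \<xi> *\<^sub>R h) - grad \<phi> x) \<le> e" using h by (intro near) simp
    then have "\<bar>(grad \<phi> (x + \<xi> *\<^sub>R h) - grad \<phi> x) \<bullet> h\<bar> \<le> e * norm h"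
      by (meson Cauchy_Schwarz_ineq2 mult_right_mono norm_ge_zero order_trans)
    then show "\<bar>\<phi> (x + h) - \<phi> x - grad \<phi> x \<bullet> h\<bar> \<le> e * norm h"
      using \<xi>(3) by (simp add: inner_diff_left)
  qed (use d in auto)
qed

section \<open>Convolution of a test function with a bounded function\<close>

definition conv :: "('a::euclidean_space \<Rightarrow> real) \<Rightarrow> ('a \<Rightarrow> real) \<Rightarrow> 'a \<Rightarrow> real" where
  "conv k \<phi> x = (\<integral>y. \<phi> (x - y) * k y \<partial>lborel)"

lemma conv_integrable:
  fixes \<phi> :: "'a::euclidean_space \<Rightarrow> real"
  assumes "continuous_on UNIV \<phi>" "\<And>x. R \<le> norm x \<Longrightarrow> \<phi> x = 0"
    and k: "k \<in> borel_measurable borel" "\<And>y. \<bar>k y\<bar> \<le> 1"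
  shows "integrable lborel (\<lambda>y. \<phi> (x - y) * k y)"
proof -
  obtain B where B: "B > 0" "\<And>x. norm (\<phi> x) \<le> B" using bounded_if_zero_outside[OF assms(1,2)] by blast
  have [measurable]: "\<phi> \<in> borel_measurable borel" using assms(1) by (rule borel_measurable_continuous_onI)
  note k(1)[measurable]
  show ?thesis
  proof (rule Bochner_Integration.integrable_bound)
    show "integrable lborel (\<lambda>y. B * indicator (cball x R) y)"
      using emeasure_lborel_cball_finite[of x R] by (intro integrable_mult_right integrable_real_indicator) auto
    show "AE y in lborel. norm (\<phi> (x - y) * k y) \<le> norm (B * indicat_real (cball x R) y)"
    proof (intro always_eventually allI)
      fix y
      have "\<bar>\<phi> (x - y)\<bar> * \<bar>k y\<bar> \<le> B * 1" using B(2)[of "x - y"] k(2)[of y] B(1) by (intro mult_mono) auto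
      then show "norm (\<phi> (x - y) * k y) \<le> norm (B * indicat_real (cball x R) y)"
        using assms(2)[of "x - y"] B(1) by (auto simp: indicator_def abs_mult dist_norm)
    qed
  qed measurable
qed

text \<open>Differentiation under the integral sign: the smooth factor carries the variable
  \<open>x\<close>, so boundedness and measurability of \<open>k\<close> suffice. Two choices of
  \<open>k\<close> matter later: the constant 1, which yields vanishing integrals of derivatives,
  and the indicator of a closed set, which yields cutoff functions.\<close>

lemma conv_has_derivative:
  fixes \<phi> :: "'a::euclidean_space \<Rightarrow> real"
  assumes \<phi>: "\<phi> \<in> test_functions UNIV"
    and k: "k \<in> borel_measurable borel" "\<And>y. \<bar>k y\<bar> \<le> 1"
  shows "(conv k \<phi> has_derivative (\<lambda>h. \<Sum>b\<in>Basis. (h \<bullet> b) * conv k (partial b \<phi>) x)) (at x)"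
  unfolding has_derivative_within_alt
proof (intro conjI allI impI)
  show "bounded_linear (\<lambda>h. \<Sum>b\<in>Basis. (h \<bullet> b) * conv k (partial b \<phi>) x)"
    by (intro bounded_linear_sum bounded_linear_mult_const bounded_linear_inner_left)
  fix e :: real assume "e > 0"
  obtain R where R: "R > 0" "\<And>x. R \<le> norm x \<Longrightarrow> \<phi> x = 0" "\<And>x. R \<le> norm x \<Longrightarrow> grad \<phi> x = 0"
    using test_support_ball[OF \<phi>] by metis
  \<comment> \<open>For \<open>norm h < 1\<close> all remainders vanish outside this ball, so a
    pointwise error of \<open>e / (V + 1) * norm h\<close> integrates to at most
    \<open>e * norm h\<close>.\<close>
  define V where "V = measure lborel (cball x (R + 1))"
  have V: "0 \<le> V" by (simp add: V_def)
  obtain d where d: "d > 0"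
    "\<And>x h. norm h < d \<Longrightarrow> \<bar>\<phi> (x + h) - \<phi> x - grad \<phi> x \<bullet> h\<bar> \<le> e / (V + 1) * norm h"
    using uniform_taylor[OF \<phi>, of "e / (V + 1)"] \<open>e > 0\<close> V by auto
  have cont: "continuous_on UNIV \<phi>" using test_smooth[OF \<phi>] by (rule smooth_continuous)
  have int1: "integrable lborel (\<lambda>y. \<phi> (z - y) * k y)" for z
    using cont R(2) k by (rule conv_integrable)
  have int2: "integrable lborel (\<lambda>y. partial b \<phi> (z - y) * k y)" if "b \<in> Basis" for b z
  proof (rule conv_integrable[OF _ _ k])
    show "continuous_on UNIV (partial b \<phi>)"
      using test_smooth[OF \<phi>] that by (intro smooth_continuous smooth_partial)
    show "partial b \<phi> w = 0" if "R \<le> norm w" for w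
      using R(3)[OF that] grad_inner_Basis[OF \<open>b \<in> Basis\<close>, of \<phi> w] by simp
  qed
  show "\<exists>d>0. \<forall>y\<in>UNIV. norm (y - x) < d \<longrightarrow>
     norm (conv k \<phi> y - conv k \<phi> x - (\<Sum>b\<in>Basis. ((y - x) \<bullet> b) * conv k (partial b \<phi>) x)) \<le> e * norm (y - x)"
  proof (intro exI[of _ "min d 1"] conjI ballI impI)
    fix z assume "norm (z - x) < min d 1"
    define h where "h = z - x"
    have h: "norm h < d" "norm h < 1" using \<open>norm (z - x) < min d 1\<close> by (auto simp: h_def)
    define D where "D y = (\<phi> (z - y) - \<phi> (x - y) - grad \<phi> (x - y) \<bullet> h) * k y" for y
    have Dsum: "D y = \<phi> (z - y) * k y - \<phi> (x - y) * k y - (\<Sum>b\<in>Basis. (h \<bullet> b) * (partial b \<phi> (x - y) * k y))" for y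
    proof -
      have "grad \<phi> (x - y) \<bullet> h = (\<Sum>b\<in>Basis. (h \<bullet> b) * partial b \<phi> (x - y))"
        by (simp add: grad_def inner_sum_left inner_commute[of h] mult.commute)
      then show ?thesis
        by (simp only: D_def left_diff_distrib sum_distrib_right mult.assoc)
    qed
    have intD: "integrable lborel D"
      unfolding Dsum by (intro Bochner_Integration.integrable_diff int1 Bochner_Integration.integrable_sum integrable_mult_right int2)
    have "conv k \<phi> z - conv k \<phi> x - (\<Sum>b\<in>Basis. (h \<bullet> b) * conv k (partial b \<phi>) x) = (\<integral>y. D y \<partial>lborel)"
      unfolding Dsum conv_def using int1 int2
      by (simp add: Bochner_Integration.integral_diff Bochner_Integration.integral_sum)
    also have "norm \<dots> \<le> (\<integral>y. e / (V + 1) * norm h * indicator (cball x (R + 1)) y \<partial>lborel)"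
    proof (rule Bochner_Integration.integral_norm_bound_integral[OF intD])
      show "integrable lborel (\<lambda>y. e / (V + 1) * norm h * indicat_real (cball x (R + 1)) y)"
        using emeasure_lborel_cball_finite[of x "R + 1"] by (intro integrable_mult_right integrable_real_indicator) auto
      fix y
      show "norm (D y) \<le> e / (V + 1) * norm h * indicat_real (cball x (R + 1)) y"
      proof (cases "y \<in> cball x (R + 1)")
        case True
        have "\<bar>\<phi> (x - y + h) - \<phi> (x - y) - grad \<phi> (x - y) \<bullet> h\<bar> * \<bar>k y\<bar> \<le> (e / (V + 1) * norm h) * 1"
          using d(2)[OF h(1)] k(2) \<open>e > 0\<close> V by (intro mult_mono) auto
        moreover have "x - y + h = z - y" by (simp add: h_def)
        ultimately have "\<bar>\<phi> (z - y) - \<phi> (x - y) - grad \<phi> (x - y) \<bullet> h\<bar> * \<bar>k y\<bar> \<le> (e / (V + 1) * norm h) * 1"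
          by (simp only:)
        then show ?thesis using True by (simp add: D_def abs_mult)
      next
        case False
        then have n: "R + 1 \<le> norm (x - y)" by (simp add: dist_norm)
        have "norm (x - y) \<le> norm (z - y) + norm h"
          unfolding h_def by (metis norm_triangle_ineq4 diff_diff_eq2 add_diff_cancel_left' diff_add_cancel)
        with n h have "R \<le> norm (z - y)" by simp
        with n have "D y = 0" using R by (simp add: D_def)
        then show ?thesis using \<open>e > 0\<close> V by simp
      qed
    qed
    also have "\<dots> = e / (V + 1) * norm h * V" by (simp add: V_def)
    also have "\<dots> = e * norm h * (V / (V + 1))" by simp
    also have "\<dots> \<le> e * norm h * 1"
      using V \<open>e > 0\<close> by (intro mult_left_mono) auto
    finally show "norm (conv k \<phi> z - conv k \<phi> x - (\<Sum>b\<in>Basis. ((z - x) \<bullet> b) * conv k (partial b \<phi>) x)) \<le> e * norm (z - x)"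
      by (simp add: h_def)
  qed (use d in auto)
qed

lemma partial_conv:
  fixes \<phi> :: "'a::euclidean_space \<Rightarrow> real"
  assumes "\<phi> \<in> test_functions UNIV" "k \<in> borel_measurable borel" "\<And>y. \<bar>k y\<bar> \<le> 1" "b \<in> Basis"
  shows "partial b (conv k \<phi>) = conv k (partial b \<phi>)"
  by (rule ext, subst partial_eq[OF conv_has_derivative[OF assms(1-3)]])
    (simp add: inner_Basis assms(4) if_distrib[of "\<lambda>x. x * _"] cong: if_cong)

lemma smooth_conv:
  fixes \<phi> :: "'a::euclidean_space \<Rightarrow> real"
  assumes "\<phi> \<in> test_functions UNIV" "k \<in> borel_measurable borel" "\<And>y. \<bar>k y\<bar> \<le> 1"
  shows "smooth (conv k \<phi>)"
proof -
  have "Ck n (conv k \<phi>)" for n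
    using assms(1)
  proof (induction n arbitrary: \<phi>)
    case 0
    then show ?case
      using has_derivative_continuous[OF conv_has_derivative[OF _ assms(2,3)]]
      by (simp add: continuous_on_eq_continuous_at)
  next
    case (Suc n)
    moreover have "conv k \<phi> differentiable (at x)" for x
      using conv_has_derivative[OF Suc.prems assms(2,3)] unfolding differentiable_def by blast
    ultimately show ?case
      using assms(2,3) by (simp add: partial_conv test_partial)
  qed
  then show ?thesis by (simp add: smooth_def)
qed

lemma integral_lborel_reflect:
  fixes g :: "'a::euclidean_space \<Rightarrow> real"
  assumes "g \<in> borel_measurable borel"
  shows "(\<integral>y. g (x - y) \<partial>lborel) = (\<integral>y. g y \<partial>lborel)"
proof -
  have "lborel = density (distr lborel borel (\<lambda>y. x + (-1) *\<^sub>R y)) (\<lambda>_. ennreal (\<bar>-1\<bar> ^ DIM('a)))"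
    using lborel_affine[of "-1" x] by simp
  then have "lborel = distr lborel borel (\<lambda>y. x - y)" by (simp add: density_1)
  then have "(\<integral>y. g y \<partial>lborel) = (\<integral>y. g y \<partial>distr lborel borel (\<lambda>y. x - y))" by (rule arg_cong)
  also have "\<dots> = (\<integral>y. g (x - y) \<partial>lborel)" using assms by (subst integral_distr) auto
  finally show ?thesis ..
qed

text \<open>Convolution with the constant 1 gives a constant function, whose derivative is 0; but
  that derivative is also the convolution of \<open>partial b g\<close> with 1, that is, the
  integral in question.\<close>

lemma integral_partial_zero:
  fixes g :: "'a::euclidean_space \<Rightarrow> real"
  assumes g: "g \<in> test_functions UNIV" and b: "b \<in> Basis"
  shows "(\<integral>x. partial b g x \<partial>lborel) = 0"
proof -
  have m: "g \<in> borel_measurable borel" "partial b g \<in> borel_measurable borel"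
    using test_smooth[OF g] b by (auto intro!: borel_measurable_continuous_onI smooth_continuous smooth_partial)
  have "conv (\<lambda>_. 1) g = (\<lambda>x. \<integral>y. g y \<partial>lborel)"
    by (simp add: conv_def[abs_def] integral_lborel_reflect m)
  then have "partial b (conv (\<lambda>_. 1) g) 0 = 0" by (simp add: partial_def)
  moreover have "partial b (conv (\<lambda>_. 1) g) = conv (\<lambda>_. 1) (partial b g)"
    using g b by (intro partial_conv) auto
  ultimately show ?thesis using integral_lborel_reflect[OF m(2), of 0] by (simp add: conv_def)
qed

lemma lebesgue_on_integral_lborel:
  fixes f :: "'a::euclidean_space \<Rightarrow> real"
  assumes "f \<in> borel_measurable borel" "S \<in> sets lebesgue" "\<And>x. x \<notin> S \<Longrightarrow> f x = 0"
  shows "(\<integral>x. f x \<partial>lebesgue_on S) = (\<integral>x. f x \<partial>lborel)"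
proof -
  have "f x * indicator S x = f x" for x using assms(3)[of x] by (auto simp: indicator_def)
  then have "(\<integral>x. f x * indicator S x \<partial>lebesgue) = (\<integral>x. f x \<partial>lborel)"
    unfolding \<open>\<And>x. f x * indicator S x = f x\<close> using assms(1) by (intro integral_completion) simp
  then show ?thesis using assms(2) by (simp only: lebesgue_on_integral_eq)
qed

section \<open>Weak derivatives of smooth functions and uniqueness\<close>

lemma locally_integrable_continuous:
  fixes f :: "'a::euclidean_space \<Rightarrow> real"
  assumes "continuous_on UNIV f"
  shows "locally_integrable \<Omega> f"
  unfolding locally_integrable_def
proof (intro allI impI)
  fix A assume "compact A \<and> A \<subseteq> \<Omega>"
  then have "integrable lborel (\<lambda>x. indicator A x *\<^sub>R f x)"
    by (intro borel_integrable_compact continuous_on_subset[OF assms]) auto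
  then have "integrable lebesgue (\<lambda>x. f x * indicator A x)"
    by (simp add: integrable_completion mult.commute)
  moreover have "A \<in> sets lebesgue"
    using \<open>compact A \<and> A \<subseteq> \<Omega>\<close> by (simp add: compact_imp_closed)
  ultimately show "integrable (lebesgue_on A) f" by (simp add: lebesgue_on_integrable_iff)
qed

text \<open>Integration by parts is \<open>integral_partial_zero\<close> for the product of \<phi>
  and \<open>f\<close>, whose support is compact because that of \<phi> is. Since \<phi> vanishes
  outside \<Omega>, the integrals over \<Omega> are integrals over the whole space.\<close>

lemma has_weak_deriv_smooth:
  fixes f :: "'a::euclidean_space \<Rightarrow> real"
  assumes \<Omega>: "open \<Omega>" and f: "smooth f" and b: "b \<in> Basis"
  shows "has_weak_deriv \<Omega> [b] f (partial b f)"
  unfolding has_weak_deriv_def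
proof (intro conjI ballI)
  show "locally_integrable \<Omega> f" "locally_integrable \<Omega> (partial b f)"
    using f b by (auto intro!: locally_integrable_continuous smooth_continuous smooth_partial)
  fix \<phi> assume \<phi>: "\<phi> \<in> test_functions \<Omega>"
  have s: "smooth \<phi>" "smooth (partial b \<phi>)" "smooth (partial b f)"
    using \<phi> f b by (auto intro: test_smooth smooth_partial)
  have z: "\<phi> x = 0" "partial b \<phi> x = 0" if "x \<notin> \<Omega>" for x
    using test_zero \<phi> test_partial[OF \<phi> b] that by blast+
  have \<Omega>m: "\<Omega> \<in> sets lebesgue" using \<Omega> by simp
  have m: "(\<lambda>x. f x * partial b \<phi> x) \<in> borel_measurable borel" "(\<lambda>x. partial b f x * \<phi> x) \<in> borel_measurable borel"
    using s f by (intro borel_measurable_continuous_onI continuous_on_mult; blast intro: smooth_continuous)+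
  have p: "(\<lambda>x. \<phi> x * f x) \<in> test_functions UNIV"
    by (intro test_mult_smooth test_UNIV[OF \<phi>] f)
  obtain R where R: "R > 0" "\<And>x. R \<le> norm x \<Longrightarrow> \<phi> x = 0" "\<And>x. R \<le> norm x \<Longrightarrow> grad \<phi> x = 0"
    using test_support_ball[OF \<phi>] by metis
  have i: "integrable lborel (\<lambda>x. f x * partial b \<phi> x)" "integrable lborel (\<lambda>x. partial b f x * \<phi> x)"
  proof -
    have c: "integrable lborel g" if "continuous_on UNIV g" "\<And>x. R \<le> norm x \<Longrightarrow> g x = 0" for g :: "'a \<Rightarrow> real"
    proof -
      have "integrable lborel (\<lambda>y. (\<lambda>z. g (- z)) (0 - y) * 1)"
        by (rule conv_integrable[of _ R])
          (auto intro!: continuous_on_compose2[OF that(1), of _ uminus] continuous_intros that(2))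
      then show ?thesis by simp
    qed
    have "partial b \<phi> x = 0" if "R \<le> norm x" for x using R(3)[OF that] grad_inner_Basis[OF b, of \<phi> x] by simp
    then show "integrable lborel (\<lambda>x. f x * partial b \<phi> x)" "integrable lborel (\<lambda>x. partial b f x * \<phi> x)"
      using R(2) s f by (intro c continuous_on_mult; simp add: smooth_continuous)+
  qed
  have "0 = (\<integral>x. partial b (\<lambda>x. \<phi> x * f x) x \<partial>lborel)" using integral_partial_zero[OF p b] by simp
  also have "\<dots> = (\<integral>x. f x * partial b \<phi> x + partial b f x * \<phi> x \<partial>lborel)"
    using partial_mult[of \<phi> _ f b] smooth_differentiable[OF s(1)] smooth_differentiable[OF f]
    by (simp add: mult.commute add.commute)
  also have "\<dots> = (\<integral>x. f x * partial b \<phi> x \<partial>lborel) + (\<integral>x. partial b f x * \<phi> x \<partial>lborel)"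
    using i by (rule Bochner_Integration.integral_add)
  finally have "(\<integral>x. f x * partial b \<phi> x \<partial>lborel) = - (\<integral>x. partial b f x * \<phi> x \<partial>lborel)" by simp
  then show "(\<integral>x. f x * partials [b] \<phi> x \<partial>lebesgue_on \<Omega>)
      = (- 1) ^ length [b] * (\<integral>x. partial b f x * \<phi> x \<partial>lebesgue_on \<Omega>)"
    using z \<Omega>m m by (simp add: partials_def lebesgue_on_integral_lborel)
qed

text \<open>Local integrability controls \<open>v\<close> on the compact support of \<phi>, where
  \<phi> is bounded; elsewhere the product is 0.\<close>

lemma locally_integrable_test:
  fixes v :: "'a::euclidean_space \<Rightarrow> real"
  assumes \<Omega>: "open \<Omega>" and v: "locally_integrable \<Omega> v" and \<phi>: "\<phi> \<in> test_functions \<Omega>"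
  shows "integrable (lebesgue_on \<Omega>) (\<lambda>x. v x * \<phi> x)"
proof -
  let ?K = "closure {x. \<phi> x \<noteq> 0}"
  have K: "compact ?K" "?K \<subseteq> \<Omega>" using \<phi> by (auto simp: test_functions_def)
  have Km: "?K \<in> sets lebesgue" by simp
  have c: "continuous_on UNIV \<phi>" using test_smooth[OF \<phi>] by (rule smooth_continuous)
  have "integrable (lebesgue_on ?K) v" using v K by (simp add: locally_integrable_def)
  then have i: "integrable lebesgue (\<lambda>x. v x * indicator ?K x)" using Km by (simp add: lebesgue_on_integrable_iff)
  obtain R where "\<And>x. R \<le> norm x \<Longrightarrow> \<phi> x = 0" using test_support_ball[OF \<phi>] by metis
  then obtain B where B: "\<And>x. norm (\<phi> x) \<le> B" using bounded_if_zero_outside[OF c] by metis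
  have "integrable lebesgue (\<lambda>x. (v x * indicator ?K x) * \<phi> x)"
  proof (rule Bochner_Integration.integrable_bound[OF integrable_mult_right[OF i, of B]])
    have "\<phi> \<in> borel_measurable lebesgue" using borel_measurable_continuous_onI[OF c] by (simp add: measurable_completion)
    then show "(\<lambda>x. (v x * indicator ?K x) * \<phi> x) \<in> borel_measurable lebesgue"
      using borel_measurable_integrable[OF i] by (rule borel_measurable_times[rotated])
    show "AE x in lebesgue. norm (v x * indicat_real ?K x * \<phi> x) \<le> norm (B * (v x * indicat_real ?K x))"
    proof (intro always_eventually allI)
      fix x
      have "\<bar>v x * indicat_real ?K x\<bar> * \<bar>\<phi> x\<bar> \<le> \<bar>v x * indicat_real ?K x\<bar> * \<bar>B\<bar>"
        using B[of x] by (intro mult_left_mono) auto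
      then show "norm (v x * indicat_real ?K x * \<phi> x) \<le> norm (B * (v x * indicat_real ?K x))"
        by (simp add: abs_mult mult_ac)
    qed
  qed
  moreover have "(v x * indicator ?K x) * \<phi> x = v x * \<phi> x * indicator \<Omega> x" for x
    using K(2) closure_subset[of "{x. \<phi> x \<noteq> 0}"] by (auto simp: indicator_def)
  ultimately have "integrable lebesgue (\<lambda>x. v x * \<phi> x * indicator \<Omega> x)" by (simp only:)
  then show ?thesis using \<Omega> by (simp add: lebesgue_on_integrable_iff)
qed

lemma locally_integrable_diff:
  "locally_integrable \<Omega> u \<Longrightarrow> locally_integrable \<Omega> v \<Longrightarrow> locally_integrable \<Omega> (\<lambda>x. u x - v x)"
  unfolding locally_integrable_def by auto

lemma weak_deriv_unique:
  fixes u :: "'a::euclidean_space \<Rightarrow> real"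
  assumes \<Omega>: "open \<Omega>" and v: "has_weak_deriv \<Omega> bs u v" "has_weak_deriv \<Omega> bs u v'"
  shows "AE x in lebesgue_on \<Omega>. v x = v' x"
proof -
  have l: "locally_integrable \<Omega> v" "locally_integrable \<Omega> v'" using v by (auto simp: has_weak_deriv_def)
  have "AE x in lebesgue_on \<Omega>. v x - v' x = 0"
  proof (rule fundamental_lemma[OF \<Omega>])
    show "locally_integrable \<Omega> (\<lambda>x. v x - v' x)" using l by (rule locally_integrable_diff)
    fix \<phi> assume \<phi>: "\<phi> \<in> test_functions \<Omega>"
    have "(\<integral>x. v x * \<phi> x \<partial>lebesgue_on \<Omega>) = (\<integral>x. v' x * \<phi> x \<partial>lebesgue_on \<Omega>)"
      using v \<phi> by (auto simp: has_weak_deriv_def)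
    then show "(\<integral>x. (v x - v' x) * \<phi> x \<partial>lebesgue_on \<Omega>) = 0"
      using locally_integrable_test[OF \<Omega> l(1) \<phi>] locally_integrable_test[OF \<Omega> l(2) \<phi>]
      by (simp add: left_diff_distrib)
  qed
  then show ?thesis by eventually_elim simp
qed

lemma weak_deriv_works:
  "has_weak_deriv \<Omega> bs u v \<Longrightarrow> has_weak_deriv \<Omega> bs u (weak_deriv \<Omega> bs u)"
  unfolding weak_deriv_def by (rule someI[where P = "has_weak_deriv \<Omega> bs u"])

lemma weak_deriv_AE:
  assumes "open \<Omega>" "has_weak_deriv \<Omega> bs u v"
  shows "AE x in lebesgue_on \<Omega>. weak_deriv \<Omega> bs u x = v x"
  using weak_deriv_unique[OF assms(1) weak_deriv_works[OF assms(2)] assms(2)] .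

lemma test_partials:
  "\<phi> \<in> test_functions \<Omega> \<Longrightarrow> set bs \<subseteq> Basis \<Longrightarrow> partials bs \<phi> \<in> test_functions \<Omega>"
  by (induction bs) (auto simp: partials_def test_partial)

lemma has_weak_deriv_diff:
  fixes u :: "'a::euclidean_space \<Rightarrow> real"
  assumes \<Omega>: "open \<Omega>" and bs: "set bs \<subseteq> Basis"
    and u: "has_weak_deriv \<Omega> bs u v" and u': "has_weak_deriv \<Omega> bs u' v'"
  shows "has_weak_deriv \<Omega> bs (\<lambda>x. u x - u' x) (\<lambda>x. v x - v' x)"
  unfolding has_weak_deriv_def
proof (intro conjI ballI)
  have l: "locally_integrable \<Omega> u" "locally_integrable \<Omega> v" "locally_integrable \<Omega> u'" "locally_integrable \<Omega> v'"
    using u u' by (auto simp: has_weak_deriv_def)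
  then show "locally_integrable \<Omega> (\<lambda>x. u x - u' x)" "locally_integrable \<Omega> (\<lambda>x. v x - v' x)"
    by (auto intro: locally_integrable_diff)
  fix \<phi> assume \<phi>: "\<phi> \<in> test_functions \<Omega>"
  note i = locally_integrable_test[OF \<Omega> _ \<phi>] locally_integrable_test[OF \<Omega> _ test_partials[OF \<phi> bs]]
  show "(\<integral>x. (u x - u' x) * partials bs \<phi> x \<partial>lebesgue_on \<Omega>) = (- 1) ^ length bs * (\<integral>x. (v x - v' x) * \<phi> x \<partial>lebesgue_on \<Omega>)"
    using u u' \<phi> i l by (simp add: left_diff_distrib has_weak_deriv_def right_diff_distrib)
qed

lemma has_weak_deriv_Nil: "locally_integrable \<Omega> u \<Longrightarrow> has_weak_deriv \<Omega> [] u u"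
  by (simp add: has_weak_deriv_def partials_def)

section \<open>Square-integrable functions\<close>

text \<open>Vector values and an arbitrary measure are allowed, so that gradients, chart domains and
  boundary layers fall under the same inequalities; for real functions on a domain it is membership
  in \<open>L2\<close>.\<close>

definition sqint :: "'b measure \<Rightarrow> ('b \<Rightarrow> 'c::euclidean_space) \<Rightarrow> bool" where
  "sqint M f \<longleftrightarrow> f \<in> borel_measurable M \<and> integrable M (\<lambda>x. (norm (f x))\<^sup>2)"

definition nrm :: "'b measure \<Rightarrow> ('b \<Rightarrow> 'c::euclidean_space) \<Rightarrow> real" where
  "nrm M f = sqrt (\<integral>x. (norm (f x))\<^sup>2 \<partial>M)"

lemma L2_iff_sqint: "u \<in> L2 \<Omega> \<longleftrightarrow> sqint (lebesgue_on \<Omega>) u"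
  by (simp add: L2_def sqint_def)

lemma L2_norm_eq_nrm: "L2_norm \<Omega> u = nrm (lebesgue_on \<Omega>) u"
  by (simp add: L2_norm_def nrm_def)

lemma sqint_measurable [measurable_dest]: "sqint M f \<Longrightarrow> f \<in> borel_measurable M"
  by (simp add: sqint_def)

lemma nrm_nonneg: "0 \<le> nrm M f"
  by (simp add: nrm_def)

lemma nrm_power2: "(nrm M f)\<^sup>2 = (\<integral>x. (norm (f x))\<^sup>2 \<partial>M)"
  by (simp add: nrm_def)

lemma sqint_dominated:
  assumes "sqint M g" "f \<in> borel_measurable M" "AE x in M. norm (f x) \<le> C * norm (g x)"
  shows "sqint M f"
  unfolding sqint_def
proof
  show "integrable M (\<lambda>x. (norm (f x))\<^sup>2)"
  proof (rule Bochner_Integration.integrable_bound)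
    show "integrable M (\<lambda>x. C\<^sup>2 * (norm (g x))\<^sup>2)" using assms(1) by (simp add: sqint_def)
    show "(\<lambda>x. (norm (f x))\<^sup>2) \<in> borel_measurable M"
      using assms(2) by measurable
    show "AE x in M. norm ((norm (f x))\<^sup>2) \<le> norm (C\<^sup>2 * (norm (g x))\<^sup>2)"
      using assms(3)
    proof eventually_elim
      case (elim x)
      then have "(norm (f x))\<^sup>2 \<le> (C * norm (g x))\<^sup>2" by (intro power_mono) auto
      then show ?case by (simp add: power_mult_distrib)
    qed
  qed
qed fact

lemma nrm_dominated:
  assumes "sqint M g" "f \<in> borel_measurable M" "AE x in M. norm (f x) \<le> C * norm (g x)" "0 \<le> C"
  shows "nrm M f \<le> C * nrm M g"
proof -
  have "(\<integral>x. (norm (f x))\<^sup>2 \<partial>M) \<le> (\<integral>x. C\<^sup>2 * (norm (g x))\<^sup>2 \<partial>M)"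
  proof (rule integral_mono_AE')
    show "AE x in M. (norm (f x))\<^sup>2 \<le> C\<^sup>2 * (norm (g x))\<^sup>2"
      using assms(3)
    proof eventually_elim
      case (elim x)
      then have "(norm (f x))\<^sup>2 \<le> (C * norm (g x))\<^sup>2" by (intro power_mono) auto
      then show ?case by (simp add: power_mult_distrib)
    qed
  qed (use assms(1) in \<open>auto simp: sqint_def\<close>)
  then have "nrm M f \<le> sqrt (C\<^sup>2 * (\<integral>x. (norm (g x))\<^sup>2 \<partial>M))"
    unfolding nrm_def by (intro real_sqrt_le_mono) simp
  then show ?thesis using assms(4) by (simp add: nrm_def real_sqrt_mult)
qed

lemma sqint_prod_integrable:
  assumes "sqint M f" "sqint M g"
  shows "integrable M (\<lambda>x. norm (f x) * norm (g x))"
proof (rule Bochner_Integration.integrable_bound)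
  show "integrable M (\<lambda>x. (norm (f x))\<^sup>2 + (norm (g x))\<^sup>2)"
    using assms by (auto simp: sqint_def)
  note assms[THEN sqint_measurable, measurable]
  show "(\<lambda>x. norm (f x) * norm (g x)) \<in> borel_measurable M"
    by measurable
  have "a * b \<le> a\<^sup>2 + b\<^sup>2" for a b :: real
    using sum_squares_bound[of a b] zero_le_power2[of a] zero_le_power2[of b] by linarith
  then show "AE x in M. norm (norm (f x) * norm (g x)) \<le> norm ((norm (f x))\<^sup>2 + (norm (g x))\<^sup>2)"
    by (simp add: abs_mult)
qed

lemma sqint_inner_integrable:
  assumes "sqint M f" "sqint M g"
  shows "integrable M (\<lambda>x. f x \<bullet> g x)"
proof (rule Bochner_Integration.integrable_bound[OF sqint_prod_integrable[OF assms]])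
  show "(\<lambda>x. f x \<bullet> g x) \<in> borel_measurable M"
    using assms unfolding sqint_def by (intro borel_measurable_inner) auto
qed (simp add: Cauchy_Schwarz_ineq2)

lemma sqint_mult_integrable:
  fixes f g :: "'b \<Rightarrow> real"
  shows "sqint M f \<Longrightarrow> sqint M g \<Longrightarrow> integrable M (\<lambda>x. f x * g x)"
  using sqint_inner_integrable[of M f g] by simp

lemma nrm_Cauchy_Schwarz:
  assumes f: "sqint M f" and g: "sqint M g"
  shows "(\<integral>x. norm (f x) * norm (g x) \<partial>M) \<le> nrm M f * nrm M g"
proof -
  define A B I where "A = (\<integral>x. (norm (f x))\<^sup>2 \<partial>M)" and "B = (\<integral>x. (norm (g x))\<^sup>2 \<partial>M)"
    and "I = (\<integral>x. norm (f x) * norm (g x) \<partial>M)"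
  have ints: "integrable M (\<lambda>x. (norm (f x))\<^sup>2)" "integrable M (\<lambda>x. (norm (g x))\<^sup>2)"
    "integrable M (\<lambda>x. norm (f x) * norm (g x))"
    using f g sqint_prod_integrable by (auto simp: sqint_def)
  have nn: "0 \<le> A" "0 \<le> B" "0 \<le> I" by (auto simp: A_def B_def I_def)
  have quad: "0 \<le> s\<^sup>2 * A - 2 * s * I + B" for s
  proof -
    have "0 \<le> (\<integral>x. (s * norm (f x) - norm (g x))\<^sup>2 \<partial>M)" by simp
    also have "\<dots> = (\<integral>x. s\<^sup>2 * (norm (f x))\<^sup>2 - 2 * s * (norm (f x) * norm (g x)) + (norm (g x))\<^sup>2 \<partial>M)"
      by (intro Bochner_Integration.integral_cong) (auto simp: power2_eq_square algebra_simps)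
    also have "\<dots> = s\<^sup>2 * A - 2 * s * I + B"
      using ints by (simp add: A_def B_def I_def)
    finally show ?thesis .
  qed
  have "I\<^sup>2 \<le> A * B"
  proof (cases "A = 0")
    case True
    have "2 * s * I \<le> B" for s using quad[of s] True by simp
    \<comment> \<open>For \<open>I > 0\<close> this value of \<open>s\<close> would give
      \<open>B + 1 \<le> B\<close>.\<close>
    from this[of "(B + 1) / (2 * I)"] have "I = 0" using nn by (cases "I = 0") auto
    then show ?thesis using nn by simp
  next
    case False
    then have "A > 0" using nn by simp
    have "0 \<le> (I / A)\<^sup>2 * A - 2 * (I / A) * I + B" by (rule quad)
    also have "\<dots> = B - I\<^sup>2 / A" using \<open>A > 0\<close> by (simp add: field_simps power2_eq_square)
    finally show ?thesis using \<open>A > 0\<close> by (simp add: field_simps)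
  qed
  then have "I \<le> sqrt (A * B)" using nn by (simp add: real_le_rsqrt)
  then show ?thesis by (simp add: A_def B_def I_def nrm_def real_sqrt_mult)
qed

lemma nrm_Cauchy_Schwarz_inner:
  assumes f: "sqint M f" and g: "sqint M g"
  shows "\<bar>\<integral>x. f x \<bullet> g x \<partial>M\<bar> \<le> nrm M f * nrm M g"
proof -
  have "\<bar>\<integral>x. f x \<bullet> g x \<partial>M\<bar> \<le> (\<integral>x. \<bar>f x \<bullet> g x\<bar> \<partial>M)" by (rule integral_abs_bound)
  also have "\<dots> \<le> (\<integral>x. norm (f x) * norm (g x) \<partial>M)"
    by (intro integral_mono integrable_abs sqint_inner_integrable f g sqint_prod_integrable Cauchy_Schwarz_ineq2)
  finally show ?thesis using nrm_Cauchy_Schwarz[OF f g] by simp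
qed

lemma nrm_Cauchy_Schwarz_mult:
  fixes f g :: "'b \<Rightarrow> real"
  shows "sqint M f \<Longrightarrow> sqint M g \<Longrightarrow> \<bar>\<integral>x. f x * g x \<partial>M\<bar> \<le> nrm M f * nrm M g"
  using nrm_Cauchy_Schwarz_inner[of M f g] by simp

lemma norm_add_power2_le:
  fixes a b :: "'b::real_normed_vector"
  shows "(norm (a + b))\<^sup>2 \<le> 2 * (norm a)\<^sup>2 + 2 * (norm b)\<^sup>2"
proof -
  have "(norm (a + b))\<^sup>2 \<le> (norm a + norm b)\<^sup>2" by (intro power_mono norm_triangle_ineq) auto
  also have "\<dots> \<le> 2 * (norm a)\<^sup>2 + 2 * (norm b)\<^sup>2"
    using sum_squares_bound[of "norm a" "norm b"] by (simp add: power2_sum)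
  finally show ?thesis .
qed

lemma sqint_add:
  assumes "sqint M f" "sqint M g"
  shows "sqint M (\<lambda>x. f x + g x)"
  unfolding sqint_def
proof
  note assms[THEN sqint_measurable, measurable]
  show m: "(\<lambda>x. f x + g x) \<in> borel_measurable M" by measurable
  show "integrable M (\<lambda>x. (norm (f x + g x))\<^sup>2)"
  proof (rule Bochner_Integration.integrable_bound)
    show "integrable M (\<lambda>x. 2 * (norm (f x))\<^sup>2 + 2 * (norm (g x))\<^sup>2)"
      using assms by (simp add: sqint_def)
    show "AE x in M. norm ((norm (f x + g x))\<^sup>2) \<le> norm (2 * (norm (f x))\<^sup>2 + 2 * (norm (g x))\<^sup>2)"
      by (simp add: norm_add_power2_le)
  qed measurable
qed

lemma sqint_cmult:
  assumes "sqint M f"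
  shows "sqint M (\<lambda>x. c *\<^sub>R f x)"
  by (rule sqint_dominated[OF assms, where C = "\<bar>c\<bar>"]) (use sqint_measurable[OF assms] in auto)

lemma sqint_uminus: "sqint M f \<Longrightarrow> sqint M (\<lambda>x. - f x)"
  using sqint_cmult[of M f "-1"] by simp

lemma sqint_diff: "sqint M f \<Longrightarrow> sqint M g \<Longrightarrow> sqint M (\<lambda>x. f x - g x)"
  using sqint_add[OF _ sqint_uminus, of M f g] by simp

lemma sqint_bounded_scaleR:
  assumes "sqint M f" "h \<in> borel_measurable M" "AE x in M. \<bar>h x\<bar> \<le> B"
  shows "sqint M (\<lambda>x. h x *\<^sub>R f x)"
proof (rule sqint_dominated[OF assms(1), where C = B])
  show "AE x in M. norm (h x *\<^sub>R f x) \<le> B * norm (f x)"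
    using assms(3) by eventually_elim (auto intro: mult_right_mono)
qed (use assms in \<open>auto simp: sqint_def\<close>)

lemma sqint_bounded_mult:
  fixes f h :: "'b \<Rightarrow> real"
  assumes "sqint M f" "h \<in> borel_measurable M" "AE x in M. \<bar>h x\<bar> \<le> B"
  shows "sqint M (\<lambda>x. h x * f x)"
  using sqint_bounded_scaleR[OF assms] by simp

lemma sqint_bounded:
  assumes "finite_measure M" "f \<in> borel_measurable M" "AE x in M. norm (f x) \<le> B"
  shows "sqint M f"
proof -
  interpret finite_measure M by fact
  have "sqint M (\<lambda>x. 1 :: real)" by (simp add: sqint_def)
  then show ?thesis by (rule sqint_dominated[where C = B]) (use assms in auto)
qed

lemma nrm_triangle:
  assumes f: "sqint M f" and g: "sqint M g"
  shows "nrm M (\<lambda>x. f x + g x) \<le> nrm M f + nrm M g"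
proof (rule power2_le_imp_le)
  have ints: "integrable M (\<lambda>x. (norm (f x))\<^sup>2)" "integrable M (\<lambda>x. (norm (g x))\<^sup>2)"
    "integrable M (\<lambda>x. norm (f x) * norm (g x))"
    using f g sqint_prod_integrable by (auto simp: sqint_def)
  have "(nrm M (\<lambda>x. f x + g x))\<^sup>2 \<le> (\<integral>x. (norm (f x))\<^sup>2 + (norm (g x))\<^sup>2 + 2 * (norm (f x) * norm (g x)) \<partial>M)"
    unfolding nrm_power2
  proof (rule integral_mono)
    show "integrable M (\<lambda>x. (norm (f x + g x))\<^sup>2)" using sqint_add[OF f g] by (simp add: sqint_def)
    fix x
    have "(norm (f x + g x))\<^sup>2 \<le> (norm (f x) + norm (g x))\<^sup>2" by (intro power_mono norm_triangle_ineq) auto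
    then show "(norm (f x + g x))\<^sup>2 \<le> (norm (f x))\<^sup>2 + (norm (g x))\<^sup>2 + 2 * (norm (f x) * norm (g x))"
      by (simp add: power2_sum)
  qed (use ints in auto)
  also have "\<dots> = (nrm M f)\<^sup>2 + (nrm M g)\<^sup>2 + 2 * (\<integral>x. norm (f x) * norm (g x) \<partial>M)"
    using ints by (simp add: nrm_power2)
  also have "\<dots> \<le> (nrm M f + nrm M g)\<^sup>2"
    using nrm_Cauchy_Schwarz[OF f g] by (simp add: power2_sum)
  finally show "(nrm M (\<lambda>x. f x + g x))\<^sup>2 \<le> (nrm M f + nrm M g)\<^sup>2" .
qed (simp add: nrm_nonneg)

lemma nrm_uminus: "nrm M (\<lambda>x. - f x) = nrm M f" by (simp add: nrm_def)

lemma nrm_triangle_diff: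
  assumes f: "sqint M f" and g: "sqint M g"
  shows "nrm M (\<lambda>x. f x - g x) \<le> nrm M f + nrm M g"
  using nrm_triangle[OF f sqint_uminus[OF g]] unfolding nrm_uminus by (simp only: diff_conv_add_uminus)

section \<open>Weighted integrals of test functions\<close>

text \<open>Fundamental theorem of calculus, then Cauchy-Schwarz of \<open>h'\<close> against the
  indicator of the interval. Extended nonnegative integrals on the right allow the bound to be
  integrated over further variables by Tonelli's theorem alone.\<close>

lemma C1_segment:
  fixes h h' :: "real \<Rightarrow> real"
  assumes "a \<le> b" and deriv: "\<And>t. a \<le> t \<Longrightarrow> t \<le> b \<Longrightarrow> (h has_real_derivative h' t) (at t)"
    and cont: "continuous_on {a..b} h'"
  shows "ennreal ((h b - h a)\<^sup>2) \<le> ennreal (b - a) * (\<integral>\<^sup>+t. ennreal ((h' t)\<^sup>2) * indicator {a..b} t \<partial>lborel)"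
proof -
  define k where "k t = indicator {a..b} t *\<^sub>R h' t" for t
  have FTC: "(\<integral>t. k t \<partial>lborel) = h b - h a"
    unfolding k_def
  proof (rule integral_FTC_atLeastAtMost[OF \<open>a \<le> b\<close> _ cont])
    fix t assume "a \<le> t" "t \<le> b"
    then show "(h has_vector_derivative h' t) (at t within {a..b})"
      using deriv by (simp add: has_real_derivative_iff_has_vector_derivative has_vector_derivative_at_within)
  qed
  have k2: "(norm (k t))\<^sup>2 = indicator {a..b} t *\<^sub>R (h' t)\<^sup>2" for t
    by (simp add: k_def indicator_def)
  have ind2: "(norm (indicat_real {a..b} t))\<^sup>2 = indicat_real {a..b} t" for t
    by (simp add: indicator_def)
  have i1: "integrable lborel k"
    unfolding k_def[abs_def] using cont by (intro borel_integrable_compact) auto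
  have i2: "integrable lborel (\<lambda>t. (norm (k t))\<^sup>2)"
    unfolding k2 using cont by (intro borel_integrable_compact continuous_intros) auto
  have sk: "sqint lborel k" using i1 i2 by (simp add: sqint_def)
  have s1: "sqint lborel (indicat_real {a..b})"
    unfolding sqint_def ind2 by (auto intro!: integrable_real_indicator simp: emeasure_lborel_Icc_eq)
  have "(h b - h a)\<^sup>2 = (\<integral>t. indicator {a..b} t * k t \<partial>lborel)\<^sup>2"
  proof -
    have "indicator {a..b} t * k t = k t" for t by (simp add: k_def indicator_def)
    then show ?thesis using FTC by (simp only:)
  qed
  also have "\<dots> \<le> (nrm lborel (indicat_real {a..b}) * nrm lborel k)\<^sup>2"
    using nrm_Cauchy_Schwarz_mult[OF s1 sk] by (metis abs_le_square_iff abs_of_nonneg abs_ge_zero order_trans)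
  also have "\<dots> = (b - a) * (\<integral>t. (norm (k t))\<^sup>2 \<partial>lborel)"
    using \<open>a \<le> b\<close> by (simp add: power_mult_distrib nrm_power2[of lborel k] nrm_power2[of lborel "indicat_real {a..b}", unfolded ind2])
  finally have "ennreal ((h b - h a)\<^sup>2) \<le> ennreal ((b - a) * (\<integral>t. (norm (k t))\<^sup>2 \<partial>lborel))"
    by (rule ennreal_leI)
  also have "\<dots> = ennreal (b - a) * (\<integral>\<^sup>+t. ennreal ((norm (k t))\<^sup>2) \<partial>lborel)"
    using i2 \<open>a \<le> b\<close> by (subst nn_integral_eq_integral) (auto simp: ennreal_mult)
  also have "(\<integral>\<^sup>+t. ennreal ((norm (k t))\<^sup>2) \<partial>lborel) = (\<integral>\<^sup>+t. ennreal ((h' t)\<^sup>2) * indicator {a..b} t \<partial>lborel)"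
    unfolding k2 by (intro nn_integral_cong) (auto simp: indicator_def)
  finally show ?thesis .
qed

lemma nn_integral_translate:
  fixes g :: "'a::euclidean_space \<Rightarrow> ennreal"
  assumes "g \<in> borel_measurable borel"
  shows "(\<integral>\<^sup>+x. g (x + c) \<partial>lborel) = (\<integral>\<^sup>+x. g x \<partial>lborel)"
proof -
  have "(\<integral>\<^sup>+x. g x \<partial>lborel) = (\<integral>\<^sup>+x. g x \<partial>distr lborel borel ((+) c))"
    by (simp add: lborel_distr_plus)
  also have "\<dots> = (\<integral>\<^sup>+x. g (x + c) \<partial>lborel)"
    using assms by (subst nn_integral_distr) (auto simp: add.commute)
  finally show ?thesis ..
qed

lemma nn_integral_scale:
  fixes g :: "'a::euclidean_space \<Rightarrow> ennreal"
  assumes [measurable]: "g \<in> borel_measurable borel" and "c \<noteq> 0"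
  shows "(\<integral>\<^sup>+x. g x \<partial>lborel) = (\<integral>\<^sup>+x. ennreal (\<bar>c\<bar> ^ DIM('a)) * g (t + c *\<^sub>R x) \<partial>lborel)"
proof -
  have "(\<integral>\<^sup>+x. g x \<partial>lborel) = (\<integral>\<^sup>+x. g x \<partial>density (distr lborel borel (\<lambda>x. t + c *\<^sub>R x)) (\<lambda>_. ennreal (\<bar>c\<bar> ^ DIM('a))))"
    using lborel_affine[OF \<open>c \<noteq> 0\<close>, of t] by simp
  also have "\<dots> = (\<integral>\<^sup>+x. ennreal (\<bar>c\<bar> ^ DIM('a)) * g (t + c *\<^sub>R x) \<partial>lborel)"
    by (subst nn_integral_density, simp_all) (subst nn_integral_distr, simp_all)
  finally show ?thesis .
qed

text \<open>Integrate along \<open>s \<mapsto> x + s\<^sup>4 z\<close> to a point where \<open>\<phi>\<close> vanishes. The quartic parametrisation supplies the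
  factor \<open>s\<^sup>6\<close>, which in dimension \<open>d \<le> 3\<close> absorbs the factor \<open>s\<^sup>-\<^sup>2\<^sup>d\<close> that appears when this bound is averaged
  over \<open>z\<close> against an \<open>L\<^sup>2\<close> function.\<close>

lemma test_far_bound:
  fixes \<phi> :: "'a::euclidean_space \<Rightarrow> real"
  assumes \<phi>: "smooth \<phi>" and zero: "\<phi> (x + z) = 0" and z: "norm z \<le> L"
  shows "ennreal ((\<phi> x)\<^sup>2) \<le> ennreal (16 * L\<^sup>2) * (\<integral>\<^sup>+s. ennreal (s ^ 6 * (norm (grad \<phi> (x + s ^ 4 *\<^sub>R z)))\<^sup>2) * indicator {0..1} s \<partial>lborel)"
proof -
  let ?h = "\<lambda>s::real. \<phi> (x + s ^ 4 *\<^sub>R z)" and ?h' = "\<lambda>s::real. (grad \<phi> (x + s ^ 4 *\<^sub>R z) \<bullet> z) * (4 * s ^ 3)"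
  have [measurable]: "grad \<phi> \<in> borel_measurable borel"
    using \<phi> by (intro borel_measurable_continuous_onI smooth_continuous_grad)
  have "ennreal ((\<phi> x)\<^sup>2) = ennreal ((?h 1 - ?h 0)\<^sup>2)" using zero by simp
  also have "\<dots> \<le> ennreal (1 - 0) * (\<integral>\<^sup>+s. ennreal ((?h' s)\<^sup>2) * indicator {0..1} s \<partial>lborel)"
  proof (rule C1_segment)
    fix s :: real
    have "((\<lambda>s. s ^ 4) has_real_derivative 4 * s ^ 3) (at s)"
      by (auto intro!: derivative_eq_intros)
    from DERIV_chain2[OF line_deriv[OF \<phi>] this]
    show "(?h has_real_derivative ?h' s) (at s)" by simp
  next
    show "continuous_on {0..1} ?h'"
      by (intro continuous_intros continuous_on_compose2[OF smooth_continuous_grad[OF \<phi>, of UNIV]]) auto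
  qed simp
  also have "\<dots> \<le> (\<integral>\<^sup>+s. ennreal (16 * L\<^sup>2) * (ennreal (s ^ 6 * (norm (grad \<phi> (x + s ^ 4 *\<^sub>R z)))\<^sup>2) * indicator {0..1} s) \<partial>lborel)"
  proof -
    have "(?h' s)\<^sup>2 \<le> (16 * L\<^sup>2) * (s ^ 6 * (norm (grad \<phi> (x + s ^ 4 *\<^sub>R z)))\<^sup>2)" for s
    proof -
      have "(grad \<phi> (x + s ^ 4 *\<^sub>R z) \<bullet> z)\<^sup>2 \<le> (norm (grad \<phi> (x + s ^ 4 *\<^sub>R z)) * L)\<^sup>2"
        by (meson Cauchy_Schwarz_ineq2 abs_le_square_iff abs_ge_self mult_left_mono norm_ge_zero order_trans z)
      then have "(grad \<phi> (x + s ^ 4 *\<^sub>R z) \<bullet> z)\<^sup>2 * (4 * s ^ 3)\<^sup>2 \<le> (norm (grad \<phi> (x + s ^ 4 *\<^sub>R z)) * L)\<^sup>2 * (4 * s ^ 3)\<^sup>2"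
        by (intro mult_right_mono) auto
      then show ?thesis by (simp add: power_mult_distrib mult_ac flip: power_mult)
    qed
    then show ?thesis
      by (auto intro!: nn_integral_mono simp: indicator_def simp flip: ennreal_mult' intro: ennreal_leI)
  qed
  also have "\<dots> = ennreal (16 * L\<^sup>2) * (\<integral>\<^sup>+s. ennreal (s ^ 6 * (norm (grad \<phi> (x + s ^ 4 *\<^sub>R z)))\<^sup>2) * indicator {0..1} s \<partial>lborel)"
    by (rule nn_integral_cmult) measurable
  finally show ?thesis .
qed

text \<open>Average \<open>test_far_bound\<close> over all displacements \<open>z\<close> in
  \<open>A\<close>, multiply by the weight and substitute \<open>y = x + s ^ 4 *\<^sub>R z\<close>:
  the gradient is then evaluated at \<open>y\<close> and the weight at
  \<open>y - s ^ 4 *\<^sub>R z\<close>. The \<open>z\<close>-integral of the weight is bounded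
  independently of \<open>s\<close> and \<open>y\<close>, which leaves the integral of the squared
  gradient. Any bound linear in that integral will do, so the weight may be estimated crudely by 1
  plus its square.\<close>

lemma weighted_L2_nn:
  fixes \<phi> g :: "'a::euclidean_space \<Rightarrow> real"
  assumes dim: "DIM('a) \<le> 3" and \<phi>: "smooth \<phi>" and [measurable]: "g \<in> borel_measurable borel" "A \<in> sets borel"
    and g0: "\<And>x. 0 \<le> g x"
    and far: "\<And>x z. z \<in> A \<Longrightarrow> \<phi> x = 0 \<or> \<phi> (x + z) = 0"
    and A: "\<And>z. z \<in> A \<Longrightarrow> norm z \<le> L"
  shows "emeasure lborel A * (\<integral>\<^sup>+x. ennreal (g x * (\<phi> x)\<^sup>2) \<partial>lborel)
    \<le> ennreal (16 * L\<^sup>2) * ((emeasure lborel A + (\<integral>\<^sup>+x. ennreal ((g x)\<^sup>2) \<partial>lborel)) * (\<integral>\<^sup>+x. ennreal ((norm (grad \<phi> x))\<^sup>2) \<partial>lborel))"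
proof -
  have [measurable]: "grad \<phi> \<in> borel_measurable borel" "\<phi> \<in> borel_measurable borel"
    using \<phi> by (auto intro!: borel_measurable_continuous_onI smooth_continuous_grad smooth_continuous)
  define G where "G x = (norm (grad \<phi> x))\<^sup>2" for x
  have [measurable]: "G \<in> borel_measurable borel" unfolding G_def by measurable
  have G0: "0 \<le> G x" for x by (simp add: G_def)
  define K where "K = ennreal (16 * L\<^sup>2)"
  define N where "N = (\<integral>\<^sup>+x. ennreal ((g x)\<^sup>2) \<partial>lborel)"
  define P where "P s z x = indicator A z * indicator {0..1} s * ennreal (s ^ 6 * g x * G (x + s ^ 4 *\<^sub>R z))" for s :: real and z x :: 'a
  have [measurable]: "(\<lambda>(s, z, x). P s z x) \<in> borel_measurable (borel \<Otimes>\<^sub>M borel \<Otimes>\<^sub>M borel)"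
    unfolding P_def by measurable
  have pt: "indicator A z * ennreal (g x * (\<phi> x)\<^sup>2) \<le> K * (\<integral>\<^sup>+s. P s z x \<partial>lborel)" for x z
  proof (cases "z \<in> A \<and> \<phi> x \<noteq> 0")
    case True
    then have "\<phi> (x + z) = 0" "norm z \<le> L" using far A by auto
    then have "ennreal (g x) * ennreal ((\<phi> x)\<^sup>2) \<le> ennreal (g x) * (K * (\<integral>\<^sup>+s. ennreal (s ^ 6 * G (x + s ^ 4 *\<^sub>R z)) * indicator {0..1} s \<partial>lborel))"
      unfolding K_def G_def by (intro mult_left_mono test_far_bound \<phi>) auto
    also have "\<dots> = K * (\<integral>\<^sup>+s. ennreal (g x) * (ennreal (s ^ 6 * G (x + s ^ 4 *\<^sub>R z)) * indicator {0..1} s) \<partial>lborel)"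
      by (subst nn_integral_cmult) (measurable, simp add: mult_ac)
    also have "(\<integral>\<^sup>+s. ennreal (g x) * (ennreal (s ^ 6 * G (x + s ^ 4 *\<^sub>R z)) * indicator {0..1} s) \<partial>lborel) = (\<integral>\<^sup>+s. P s z x \<partial>lborel)"
      using True g0 G0
      by (intro nn_integral_cong) (auto simp: P_def indicator_def mult_ac simp flip: ennreal_mult)
    finally show ?thesis using True g0 by (simp add: ennreal_mult)
  qed auto
  have inner: "(\<integral>\<^sup>+z. indicator A z * indicator {0..1} s * ennreal (s ^ 6 * g (y - s ^ 4 *\<^sub>R z) * G y) \<partial>lborel)
     \<le> indicator {0..1} s * (ennreal (G y) * (emeasure lborel A + N))" for s :: real and y
  proof (cases "0 < s \<and> s \<le> 1")
    case True
    \<comment> \<open>As \<open>s \<le> 1\<close> and the dimension \<open>d\<close> is at most 3,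
      \<open>s ^ 6 \<le> s ^ (2 * d)\<close>. Squaring that factor gives \<open>s ^ (4 * d)\<close>,
      exactly the Jacobian of the scaling of \<open>z\<close> by \<open>s ^ 4\<close>, so that the
      integral of the squared weight comes out free of \<open>s\<close>.\<close>
    have pw: "s ^ 6 * a \<le> 1 + \<bar>- (s ^ 4)\<bar> ^ DIM('a) * a\<^sup>2" if "0 \<le> a" for a
    proof -
      have "s ^ 6 * a \<le> s ^ (2 * DIM('a)) * a"
        using True dim that by (intro mult_right_mono power_decreasing) auto
      also have "\<dots> \<le> 1 + (s ^ (2 * DIM('a)) * a)\<^sup>2"
      proof -
        have "b \<le> 1 + b\<^sup>2" for b :: real
          using zero_le_power2[of "b - 1/2"] by (simp add: power2_diff power_divide)
        then show ?thesis .
      qed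
      also have "(s ^ (2 * DIM('a)) * a)\<^sup>2 = \<bar>- (s ^ 4)\<bar> ^ DIM('a) * a\<^sup>2"
        using True by (simp add: power_mult_distrib flip: power_mult)
      finally show ?thesis .
    qed
    have "(\<integral>\<^sup>+z. indicator A z * indicator {0..1} s * ennreal (s ^ 6 * g (y - s ^ 4 *\<^sub>R z) * G y) \<partial>lborel)
      \<le> (\<integral>\<^sup>+z. ennreal (G y) * (indicator A z + ennreal (\<bar>- (s ^ 4)\<bar> ^ DIM('a)) * ennreal ((g (y + (- (s ^ 4)) *\<^sub>R z))\<^sup>2)) \<partial>lborel)"
    proof (rule nn_integral_mono)
      fix z
      have "indicator A z * ennreal (s ^ 6 * g (y - s ^ 4 *\<^sub>R z))
         \<le> indicator A z + ennreal (\<bar>- (s ^ 4)\<bar> ^ DIM('a)) * ennreal ((g (y + (- (s ^ 4)) *\<^sub>R z))\<^sup>2)"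
      proof (cases "z \<in> A")
        case True
        have "ennreal (s ^ 6 * g (y - s ^ 4 *\<^sub>R z)) \<le> ennreal (1 + \<bar>- (s ^ 4)\<bar> ^ DIM('a) * (g (y - s ^ 4 *\<^sub>R z))\<^sup>2)"
          by (intro ennreal_leI pw g0)
        then show ?thesis using True by (simp add: ennreal_plus ennreal_mult)
      qed simp
      then have "ennreal (G y) * (indicator A z * ennreal (s ^ 6 * g (y - s ^ 4 *\<^sub>R z)))
         \<le> ennreal (G y) * (indicator A z + ennreal (\<bar>- (s ^ 4)\<bar> ^ DIM('a)) * ennreal ((g (y + (- (s ^ 4)) *\<^sub>R z))\<^sup>2))"
        by (rule mult_left_mono) simp
      moreover have "ennreal (s ^ 6 * g (y - s ^ 4 *\<^sub>R z) * G y) = ennreal (G y) * ennreal (s ^ 6 * g (y - s ^ 4 *\<^sub>R z))"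
        using True g0 G0 by (subst ennreal_mult[symmetric]) (auto simp: mult_ac)
      ultimately show "indicator A z * indicator {0..1} s * ennreal (s ^ 6 * g (y - s ^ 4 *\<^sub>R z) * G y)
         \<le> ennreal (G y) * (indicator A z + ennreal (\<bar>- (s ^ 4)\<bar> ^ DIM('a)) * ennreal ((g (y + (- (s ^ 4)) *\<^sub>R z))\<^sup>2))"
        using True by (simp add: mult_ac)
    qed
    also have "\<dots> = ennreal (G y) * (emeasure lborel A + (\<integral>\<^sup>+z. ennreal (\<bar>- (s ^ 4)\<bar> ^ DIM('a)) * ennreal ((g (y + (- (s ^ 4)) *\<^sub>R z))\<^sup>2) \<partial>lborel))"
    proof -
      define q where "q z = ennreal (\<bar>- (s ^ 4)\<bar> ^ DIM('a)) * ennreal ((g (y + (- (s ^ 4)) *\<^sub>R z))\<^sup>2)" for z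
      have [measurable]: "q \<in> borel_measurable borel" unfolding q_def by measurable
      have "(\<integral>\<^sup>+z. ennreal (G y) * (indicator A z + q z) \<partial>lborel) = ennreal (G y) * (\<integral>\<^sup>+z. indicator A z + q z \<partial>lborel)"
        by (rule nn_integral_cmult) measurable
      also have "(\<integral>\<^sup>+z. indicator A z + q z \<partial>lborel) = (\<integral>\<^sup>+z. indicator A z \<partial>lborel) + (\<integral>\<^sup>+z. q z \<partial>lborel)"
        by (rule nn_integral_add) measurable
      finally show ?thesis by (simp add: q_def)
    qed
    also have "(\<integral>\<^sup>+z. ennreal (\<bar>- (s ^ 4)\<bar> ^ DIM('a)) * ennreal ((g (y + (- (s ^ 4)) *\<^sub>R z))\<^sup>2) \<partial>lborel) = N"
      unfolding N_def using True by (intro nn_integral_scale[symmetric]) auto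
    finally show ?thesis using True by simp
  next
    case False
    then have "s = 0 \<or> s \<notin> {0..1}" by auto
    then show ?thesis by auto
  qed
  have "emeasure lborel A * (\<integral>\<^sup>+x. ennreal (g x * (\<phi> x)\<^sup>2) \<partial>lborel) = (\<integral>\<^sup>+x. (\<integral>\<^sup>+z. indicator A z * ennreal (g x * (\<phi> x)\<^sup>2) \<partial>lborel) \<partial>lborel)"
    by (subst nn_integral_cmult[symmetric], measurable) (simp add: nn_integral_multc)
  also have "\<dots> \<le> (\<integral>\<^sup>+x. (\<integral>\<^sup>+z. K * (\<integral>\<^sup>+s. P s z x \<partial>lborel) \<partial>lborel) \<partial>lborel)"
    by (rule nn_integral_mono, rule nn_integral_mono, rule pt)
  also have "\<dots> = K * (\<integral>\<^sup>+x. (\<integral>\<^sup>+z. (\<integral>\<^sup>+s. P s z x \<partial>lborel) \<partial>lborel) \<partial>lborel)"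
  proof -
    have "(\<lambda>z. \<integral>\<^sup>+s. P s z x \<partial>lborel) \<in> borel_measurable lborel" for x
      unfolding P_def by measurable
    moreover have "(\<lambda>x. \<integral>\<^sup>+z. \<integral>\<^sup>+s. P s z x \<partial>lborel \<partial>lborel) \<in> borel_measurable lborel"
      unfolding P_def by measurable
    ultimately show ?thesis by (simp add: nn_integral_cmult)
  qed
  \<comment> \<open>Tonelli repeatedly: \<open>x\<close> has to become the innermost variable for
    the translation, and afterwards \<open>z\<close> for the bound \<open>inner\<close>.\<close>
  also have "(\<integral>\<^sup>+x. (\<integral>\<^sup>+z. (\<integral>\<^sup>+s. P s z x \<partial>lborel) \<partial>lborel) \<partial>lborel) = (\<integral>\<^sup>+x. (\<integral>\<^sup>+s. (\<integral>\<^sup>+z. P s z x \<partial>lborel) \<partial>lborel) \<partial>lborel)"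
    unfolding P_def by (rule nn_integral_cong, rule lborel_pair.Fubini') measurable
  also have "\<dots> = (\<integral>\<^sup>+s. (\<integral>\<^sup>+x. (\<integral>\<^sup>+z. P s z x \<partial>lborel) \<partial>lborel) \<partial>lborel)"
    unfolding P_def by (rule lborel_pair.Fubini') measurable
  also have "\<dots> = (\<integral>\<^sup>+s. (\<integral>\<^sup>+z. (\<integral>\<^sup>+x. P s z x \<partial>lborel) \<partial>lborel) \<partial>lborel)"
    unfolding P_def by (rule nn_integral_cong, rule lborel_pair.Fubini') measurable
  also have "\<dots> = (\<integral>\<^sup>+s. (\<integral>\<^sup>+z. (\<integral>\<^sup>+y. indicator A z * indicator {0..1} s * ennreal (s ^ 6 * g (y - s ^ 4 *\<^sub>R z) * G y) \<partial>lborel) \<partial>lborel) \<partial>lborel)"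
  proof (rule nn_integral_cong, rule nn_integral_cong)
    fix s :: real and z :: 'a
    have "(\<integral>\<^sup>+x. P s z x \<partial>lborel) = (\<integral>\<^sup>+x. (\<lambda>y. indicator A z * indicator {0..1} s * ennreal (s ^ 6 * g (y - s ^ 4 *\<^sub>R z) * G y)) (x + s ^ 4 *\<^sub>R z) \<partial>lborel)"
      by (simp add: P_def)
    also have "\<dots> = (\<integral>\<^sup>+y. indicator A z * indicator {0..1} s * ennreal (s ^ 6 * g (y - s ^ 4 *\<^sub>R z) * G y) \<partial>lborel)"
      by (rule nn_integral_translate) measurable
    finally show "(\<integral>\<^sup>+x. P s z x \<partial>lborel) = (\<integral>\<^sup>+y. indicator A z * indicator {0..1} s * ennreal (s ^ 6 * g (y - s ^ 4 *\<^sub>R z) * G y) \<partial>lborel)" .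
  qed
  also have "\<dots> = (\<integral>\<^sup>+s. (\<integral>\<^sup>+y. (\<integral>\<^sup>+z. indicator A z * indicator {0..1} s * ennreal (s ^ 6 * g (y - s ^ 4 *\<^sub>R z) * G y) \<partial>lborel) \<partial>lborel) \<partial>lborel)"
    by (rule nn_integral_cong, rule lborel_pair.Fubini') measurable
  also have "\<dots> \<le> (\<integral>\<^sup>+s. (\<integral>\<^sup>+y. indicator {0..1::real} s * (ennreal (G y) * (emeasure lborel A + N)) \<partial>lborel) \<partial>lborel)"
  proof (rule nn_integral_mono, rule nn_integral_mono)
    fix s :: real and y :: 'a
    show "(\<integral>\<^sup>+z. indicator A z * indicator {0..1} s * ennreal (s ^ 6 * g (y - s ^ 4 *\<^sub>R z) * G y) \<partial>lborel)
     \<le> indicator {0..1} s * (ennreal (G y) * (emeasure lborel A + N))"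
      by (rule inner)
  qed
  also have "\<dots> = (\<integral>\<^sup>+s. indicator {0..1::real} s * ((emeasure lborel A + N) * (\<integral>\<^sup>+y. ennreal (G y) \<partial>lborel)) \<partial>lborel)"
    by (intro nn_integral_cong) (simp add: nn_integral_cmult nn_integral_multc mult_ac)
  also have "\<dots> = (emeasure lborel A + N) * (\<integral>\<^sup>+y. ennreal (G y) \<partial>lborel)"
    by (subst nn_integral_multc) auto
  finally show ?thesis by (simp add: K_def N_def G_def mult_left_mono)
qed

text \<open>An \<open>L2\<close> function acts here as a potential: the constant depends on
  \<open>f\<close> and \<Omega> but not on \<phi>, and integrability of the product is part of the
  conclusion. The weight inserted in \<open>weighted_L2_nn\<close> is a Borel representative of |f|,
  extended by 0.\<close>

lemma test_weighted_bound:
  fixes f :: "'a::euclidean_space \<Rightarrow> real"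
  assumes dim: "DIM('a) \<le> 3" and \<Omega>: "open \<Omega>" "bounded \<Omega>" and f: "sqint (lebesgue_on \<Omega>) f"
  obtains C where "0 \<le> C" "\<And>\<phi>. \<phi> \<in> test_functions \<Omega> \<Longrightarrow> integrable (lebesgue_on \<Omega>) (\<lambda>x. \<bar>f x\<bar> * (\<phi> x)\<^sup>2)"
    "\<And>\<phi>. \<phi> \<in> test_functions \<Omega> \<Longrightarrow> (\<integral>x. \<bar>f x\<bar> * (\<phi> x)\<^sup>2 \<partial>lebesgue_on \<Omega>) \<le> C * (nrm (lebesgue_on \<Omega>) (grad \<phi>))\<^sup>2"
proof -
  have \<Omega>m: "\<Omega> \<in> sets lebesgue" using \<Omega> by simp
  have "(\<lambda>x. indicator \<Omega> x *\<^sub>R f x) \<in> borel_measurable lebesgue"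
    using sqint_measurable[OF f] \<Omega>m by (subst (asm) borel_measurable_restrict_space_iff) auto
  then obtain F where F[measurable]: "F \<in> borel_measurable lborel" and FAE: "AE x in lborel. indicator \<Omega> x *\<^sub>R f x = F x"
    using completion_ex_borel_measurable_real by blast
  define g where "g x = \<bar>F x\<bar>" for x
  have gm[measurable]: "g \<in> borel_measurable borel" using F unfolding g_def by simp
  have gm': "g \<in> borel_measurable lebesgue" using gm by (simp add: measurable_completion)
  have gAE: "AE x in lebesgue. \<bar>f x\<bar> * indicator \<Omega> x = g x"
    using AE_completion[OF FAE] by eventually_elim (auto simp: g_def indicator_def split: if_splits)
  have "integrable lebesgue (\<lambda>x. (norm (f x))\<^sup>2 * indicator \<Omega> x)"
    using f \<Omega>m by (simp add: sqint_def lebesgue_on_integrable_iff)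
  moreover have "AE x in lebesgue. (norm (f x))\<^sup>2 * indicator \<Omega> x = (g x)\<^sup>2"
    using gAE by eventually_elim (auto simp: indicator_def split: if_splits, metis power2_abs)
  moreover have "(\<lambda>x. (g x)\<^sup>2) \<in> borel_measurable lebesgue" using gm' by simp
  ultimately have "integrable lebesgue (\<lambda>x. (g x)\<^sup>2)"
    by (subst integrable_cong_AE[of _ _ "\<lambda>x. (norm (f x))\<^sup>2 * indicator \<Omega> x"]) (auto elim: AE_mp)
  then have g2: "integrable lborel (\<lambda>x. (g x)\<^sup>2)" by (simp add: integrable_completion)
  obtain R where R: "R > 0" "\<Omega> \<subseteq> ball 0 R" using bounded_subset_ballD[OF \<Omega>(2)] by blast
  obtain b :: 'a where b: "b \<in> Basis" using nonempty_Basis by blast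
  \<comment> \<open>\<Omega> lies in the ball of radius \<open>R\<close> about the origin, so
    displacements of length at least \<open>2 * R\<close> lead out of it. The ball of radius
    \<open>R\<close> about a point of norm \<open>3 * R\<close> consists of such displacements and
    has positive volume.\<close>
  define A where "A = ball ((3 * R) *\<^sub>R b) R"
  have Anorm: "2 * R \<le> norm z" "norm z \<le> 4 * R" if "z \<in> A" for z
  proof -
    have "norm ((3 * R) *\<^sub>R b) = 3 * R" using b R by simp
    moreover have "norm (z - (3 * R) *\<^sub>R b) < R" using that by (simp add: A_def dist_norm norm_minus_commute)
    ultimately show "2 * R \<le> norm z" "norm z \<le> 4 * R"
      using norm_triangle_ineq2[of "(3 * R) *\<^sub>R b" z] norm_triangle_ineq2[of z "(3 * R) *\<^sub>R b"]
      by (simp_all add: norm_minus_commute)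
  qed
  define v where "v = measure lborel A"
  have vA: "emeasure lborel A = ennreal v"
    unfolding v_def A_def using emeasure_lborel_ball_finite[of "(3 * R) *\<^sub>R b" R]
    by (intro emeasure_eq_ennreal_measure) simp
  have v: "v > 0"
    unfolding v_def A_def using R(1) by (intro content_ball_pos)
  define N where "N = (\<integral>x. (g x)\<^sup>2 \<partial>lborel)"
  have N: "0 \<le> N" by (simp add: N_def)
  define C where "C = 16 * (4 * R)\<^sup>2 * (v + N) / v"
  have main: "integrable (lebesgue_on \<Omega>) (\<lambda>x. \<bar>f x\<bar> * (\<phi> x)\<^sup>2) \<and>
      (\<integral>x. \<bar>f x\<bar> * (\<phi> x)\<^sup>2 \<partial>lebesgue_on \<Omega>) \<le> C * (nrm (lebesgue_on \<Omega>) (grad \<phi>))\<^sup>2"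
    if \<phi>: "\<phi> \<in> test_functions \<Omega>" for \<phi>
  proof -
    have s: "smooth \<phi>" using \<phi> by (rule test_smooth)
    have cg: "continuous_on UNIV (grad \<phi>)" using s by (rule smooth_continuous_grad)
    have m1[measurable]: "\<phi> \<in> borel_measurable borel" using s by (intro borel_measurable_continuous_onI smooth_continuous)
    have m2[measurable]: "grad \<phi> \<in> borel_measurable borel" using cg by (rule borel_measurable_continuous_onI)
    have z: "\<phi> x = 0" "grad \<phi> x = 0" if "x \<notin> \<Omega>" for x
      using that test_zero[OF \<phi>] grad_zero_outside(2)[of x \<phi>] \<phi> by (auto simp: test_functions_def)
    have gradint: "integrable lborel (\<lambda>x. (norm (grad \<phi> x))\<^sup>2)"
    proof -
      let ?K = "closure {x. \<phi> x \<noteq> 0}"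
      have "integrable lborel (\<lambda>x. indicator ?K x *\<^sub>R (norm (grad \<phi> x))\<^sup>2)"
        using \<phi> by (intro borel_integrable_compact continuous_intros continuous_on_subset[OF cg]) (auto simp: test_functions_def)
      moreover have "indicator ?K x *\<^sub>R (norm (grad \<phi> x))\<^sup>2 = (norm (grad \<phi> x))\<^sup>2" for x
        using grad_zero_outside(2)[of x \<phi>] by (auto simp: indicator_def)
      ultimately show ?thesis by (simp only:)
    qed
    have nrm_eq: "(nrm (lebesgue_on \<Omega>) (grad \<phi>))\<^sup>2 = (\<integral>x. (norm (grad \<phi> x))\<^sup>2 \<partial>lborel)"
      unfolding nrm_power2 using z \<Omega>m by (intro lebesgue_on_integral_lborel) auto
    have "ennreal v * (\<integral>\<^sup>+x. ennreal (g x * (\<phi> x)\<^sup>2) \<partial>lborel)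
      \<le> ennreal (16 * (4 * R)\<^sup>2) * ((ennreal v + (\<integral>\<^sup>+x. ennreal ((g x)\<^sup>2) \<partial>lborel)) * (\<integral>\<^sup>+x. ennreal ((norm (grad \<phi> x))\<^sup>2) \<partial>lborel))"
      unfolding vA[symmetric]
    proof (rule weighted_L2_nn[OF dim s gm])
      show "A \<in> sets borel" by (simp add: A_def)
      show "norm z \<le> 4 * R" if "z \<in> A" for z using Anorm that by blast
      show "\<phi> x = 0 \<or> \<phi> (x + z) = 0" if "z \<in> A" for x z
      proof (cases "x \<in> \<Omega>")
        case True
        then have "norm x < R" using R by auto
        then have "R \<le> norm (x + z)"
          using norm_triangle_ineq2[of z "- x"] Anorm(1)[OF that] by (simp add: add.commute)
        then have "x + z \<notin> \<Omega>" using R by auto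
        then show ?thesis using z by blast
      qed (use z in blast)
    qed (simp add: g_def)
    also have "\<dots> = ennreal (16 * (4 * R)\<^sup>2 * ((v + N) * (nrm (lebesgue_on \<Omega>) (grad \<phi>))\<^sup>2))"
      using gradint g2 v N
      by (simp add: nn_integral_eq_integral N_def[symmetric] nrm_eq ennreal_mult ennreal_plus)
    finally have le: "ennreal v * (\<integral>\<^sup>+x. ennreal (g x * (\<phi> x)\<^sup>2) \<partial>lborel) \<le> ennreal (16 * (4 * R)\<^sup>2 * ((v + N) * (nrm (lebesgue_on \<Omega>) (grad \<phi>))\<^sup>2))" .
    have fin: "(\<integral>\<^sup>+x. ennreal (g x * (\<phi> x)\<^sup>2) \<partial>lborel) < \<infinity>"
      using le_less_trans[OF le ennreal_less_top] v by (auto simp: ennreal_mult_less_top)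
    have gi: "integrable lborel (\<lambda>x. g x * (\<phi> x)\<^sup>2)"
      using fin by (intro integrableI_nonneg) (auto simp: g_def)
    then have "integrable lebesgue (\<lambda>x. g x * (\<phi> x)\<^sup>2)" by (simp add: integrable_completion)
    moreover have eqAE: "AE x in lebesgue. g x * (\<phi> x)\<^sup>2 = \<bar>f x\<bar> * (\<phi> x)\<^sup>2 * indicator \<Omega> x"
      using gAE by eventually_elim (auto simp: indicator_def split: if_splits)
    moreover have fm: "(\<lambda>x. \<bar>f x\<bar> * (\<phi> x)\<^sup>2 * indicator \<Omega> x) \<in> borel_measurable lebesgue"
      by (rule borel_measurable_AE[OF _ eqAE]) (use gm' m1 in \<open>auto simp: measurable_completion intro!: borel_measurable_times borel_measurable_power\<close>)
    moreover have gm2: "(\<lambda>x. g x * (\<phi> x)\<^sup>2) \<in> borel_measurable lebesgue"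
      using gm' m1 by (auto simp: measurable_completion intro!: borel_measurable_times borel_measurable_power)
    ultimately have int: "integrable lebesgue (\<lambda>x. \<bar>f x\<bar> * (\<phi> x)\<^sup>2 * indicator \<Omega> x)"
      using integrable_cong_AE by blast
    have "(\<integral>x. \<bar>f x\<bar> * (\<phi> x)\<^sup>2 \<partial>lebesgue_on \<Omega>) = (\<integral>x. g x * (\<phi> x)\<^sup>2 \<partial>lebesgue)"
      unfolding lebesgue_on_integral_eq[OF \<Omega>m] using eqAE fm gm2 by (intro integral_cong_AE) (auto elim: AE_mp)
    also have "\<dots> = (\<integral>x. g x * (\<phi> x)\<^sup>2 \<partial>lborel)" by (intro integral_completion) measurable
    finally have I: "(\<integral>x. \<bar>f x\<bar> * (\<phi> x)\<^sup>2 \<partial>lebesgue_on \<Omega>) = (\<integral>x. g x * (\<phi> x)\<^sup>2 \<partial>lborel)" .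
    have "v * (\<integral>x. g x * (\<phi> x)\<^sup>2 \<partial>lborel) \<le> 16 * (4 * R)\<^sup>2 * ((v + N) * (nrm (lebesgue_on \<Omega>) (grad \<phi>))\<^sup>2)"
    proof -
      have nn: "0 \<le> (\<integral>x. g x * (\<phi> x)\<^sup>2 \<partial>lborel)" by (simp add: g_def)
      have "ennreal v * (\<integral>\<^sup>+x. ennreal (g x * (\<phi> x)\<^sup>2) \<partial>lborel) = ennreal (v * (\<integral>x. g x * (\<phi> x)\<^sup>2 \<partial>lborel))"
        using v nn by (subst nn_integral_eq_integral[OF gi]) (auto simp: ennreal_mult g_def)
      with le have "ennreal (v * (\<integral>x. g x * (\<phi> x)\<^sup>2 \<partial>lborel)) \<le> ennreal (16 * (4 * R)\<^sup>2 * ((v + N) * (nrm (lebesgue_on \<Omega>) (grad \<phi>))\<^sup>2))"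
        by (simp only:)
      then show ?thesis using v N by (subst (asm) ennreal_le_iff) auto
    qed
    then have "(\<integral>x. g x * (\<phi> x)\<^sup>2 \<partial>lborel) \<le> C * (nrm (lebesgue_on \<Omega>) (grad \<phi>))\<^sup>2"
      using v by (simp add: C_def field_simps)
    then show ?thesis using int \<Omega>m I by (simp add: lebesgue_on_integrable_iff)
  qed
  show ?thesis
    using v N main by (intro that[of C]) (auto simp: C_def)
qed

section \<open>First-order Sobolev functions\<close>

text \<open>Lebesgue measure is complete, so a change on a null set preserves measurability. Weak
  derivatives call for this because they are arbitrary representatives.\<close>

lemma borel_measurable_lebesgue_on_AE:
  fixes f g :: "'a::euclidean_space \<Rightarrow> 'b::euclidean_space"
  assumes S: "S \<in> sets lebesgue" and f: "f \<in> borel_measurable (lebesgue_on S)"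
    and ae: "AE x in lebesgue_on S. f x = g x"
  shows "g \<in> borel_measurable (lebesgue_on S)"
proof -
  have "(\<lambda>x. indicator S x *\<^sub>R f x) \<in> borel_measurable lebesgue"
    using f S by (subst (asm) borel_measurable_restrict_space_iff) auto
  moreover have "AE x in lebesgue. indicator S x *\<^sub>R f x = indicator S x *\<^sub>R g x"
    using ae unfolding AE_lebesgue_on_iff[OF S] by eventually_elim (auto simp: indicator_def)
  ultimately have "(\<lambda>x. indicator S x *\<^sub>R g x) \<in> borel_measurable lebesgue"
    by (rule borel_measurable_AE)
  then show ?thesis using S by (subst borel_measurable_restrict_space_iff) auto
qed

lemma sqint_AE:
  fixes f g :: "'a::euclidean_space \<Rightarrow> 'b::euclidean_space"
  assumes S: "S \<in> sets lebesgue" and f: "sqint (lebesgue_on S) f"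
    and ae: "AE x in lebesgue_on S. f x = g x"
  shows "sqint (lebesgue_on S) g"
  using f borel_measurable_lebesgue_on_AE[OF S sqint_measurable[OF f] ae]
  by (rule sqint_dominated[where C = 1]) (use ae in eventually_elim, simp)

lemma nrm_AE:
  fixes f g :: "'b \<Rightarrow> 'c::euclidean_space"
  assumes "f \<in> borel_measurable M" "g \<in> borel_measurable M" "AE x in M. f x = g x"
  shows "nrm M f = nrm M g"
proof -
  note assms(1,2)[measurable]
  have "(\<integral>x. (norm (f x))\<^sup>2 \<partial>M) = (\<integral>x. (norm (g x))\<^sup>2 \<partial>M)"
    by (rule integral_cong_AE) (measurable, use assms(3) in eventually_elim, simp)
  then show ?thesis by (simp add: nrm_def)
qed

lemma finite_measure_bounded:
  assumes "open \<Omega>" "bounded \<Omega>"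
  shows "finite_measure (lebesgue_on (\<Omega> :: 'a::euclidean_space set))"
proof (rule finite_measure_lebesgue_on)
  show "\<Omega> \<in> lmeasurable" using assms by (simp add: bounded_set_imp_lmeasurable lmeasurable_open)
qed

lemma sqint_integrable:
  assumes "finite_measure M" "sqint M f"
  shows "integrable M f"
proof (rule Bochner_Integration.integrable_bound)
  interpret finite_measure M by fact
  show "integrable M (\<lambda>x. 1 + (norm (f x))\<^sup>2)" using assms(2) by (simp add: sqint_def)
  have "a \<le> 1 + a\<^sup>2" for a :: real
    using zero_le_power2[of "a - 1/2"] by (simp add: power2_diff power_divide)
  then show "AE x in M. norm (f x) \<le> norm (1 + (norm (f x))\<^sup>2)" by simp
qed (rule sqint_measurable[OF assms(2)])

lemma integrable_lebesgue_on_subset: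
  fixes f :: "'a::euclidean_space \<Rightarrow> real"
  assumes "integrable (lebesgue_on S) f" "S \<in> sets lebesgue" "A \<in> sets lebesgue" "A \<subseteq> S"
  shows "integrable (lebesgue_on A) f"
proof -
  have i: "integrable lebesgue (\<lambda>x. f x * indicator S x)"
    using assms(1,2) by (simp add: lebesgue_on_integrable_iff)
  have "integrable lebesgue (\<lambda>x. indicator A x * (f x * indicator S x))"
    using i assms(3) by (rule integrable_mult_indicator[where f = "\<lambda>x. f x * indicator S x", unfolded real_scaleR_def, rotated])
  moreover have "indicator A x * (f x * indicator S x) = f x * indicator A x" for x
    using assms(4) by (auto simp: indicator_def)
  ultimately show ?thesis using assms(3) by (simp add: lebesgue_on_integrable_iff)
qed

lemma sqint_locally_integrable:
  fixes f :: "'a::euclidean_space \<Rightarrow> real"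
  assumes "open \<Omega>" "bounded \<Omega>" "sqint (lebesgue_on \<Omega>) f"
  shows "locally_integrable \<Omega> f"
  unfolding locally_integrable_def
proof (intro allI impI)
  fix A assume A: "compact A \<and> A \<subseteq> \<Omega>"
  have "integrable (lebesgue_on \<Omega>) f"
    using sqint_integrable[OF finite_measure_bounded] assms by blast
  then show "integrable (lebesgue_on A) f"
    by (rule integrable_lebesgue_on_subset) (use assms A in \<open>auto simp: compact_imp_closed\<close>)
qed

lemma continuous_measurable_lebesgue_on:
  fixes f :: "'a::euclidean_space \<Rightarrow> 'b::euclidean_space"
  assumes "continuous_on UNIV f"
  shows "f \<in> borel_measurable (lebesgue_on \<Omega>)"
proof -
  have "f \<in> borel_measurable borel" using assms by (rule borel_measurable_continuous_onI)
  then have "f \<in> borel_measurable lebesgue" by (simp add: measurable_completion)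
  then show ?thesis by (rule measurable_restrict_space1)
qed

lemma bounded_on_bounded:
  fixes f :: "'a::euclidean_space \<Rightarrow> 'b::real_normed_vector"
  assumes "bounded \<Omega>" "continuous_on UNIV f"
  obtains B where "B > 0" "\<And>x. x \<in> \<Omega> \<Longrightarrow> norm (f x) \<le> B"
proof -
  have "bounded (f ` closure \<Omega>)"
    using assms by (intro compact_imp_bounded compact_continuous_image continuous_on_subset[OF assms(2)]) auto
  then show ?thesis using that closure_subset[of \<Omega>] unfolding bounded_pos by blast
qed

lemma continuous_sqint:
  fixes f :: "'a::euclidean_space \<Rightarrow> 'b::euclidean_space"
  assumes "open \<Omega>" "bounded \<Omega>" "continuous_on UNIV f"
  shows "sqint (lebesgue_on \<Omega>) f"
proof -
  obtain B where B: "\<And>x. x \<in> \<Omega> \<Longrightarrow> norm (f x) \<le> B"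
    using bounded_on_bounded[OF assms(2,3)] by blast
  show ?thesis
    by (rule sqint_bounded[OF finite_measure_bounded[OF assms(1,2)] continuous_measurable_lebesgue_on[OF assms(3)], of B])
      (rule AE_I2, simp add: B)
qed

lemma nn_integral_sqint:
  fixes f :: "'b \<Rightarrow> real"
  assumes "sqint M f"
  shows "(\<integral>\<^sup>+x. ennreal ((f x)\<^sup>2) \<partial>M) = ennreal ((nrm M f)\<^sup>2)"
  using assms unfolding sqint_def nrm_power2 by (simp add: nn_integral_eq_integral)

lemma words_0: "words 0 = {[]}" by (auto simp: words_def)

lemma words_1: "words 1 = (\<lambda>b. [b]) ` Basis"
  by (auto simp: words_def length_Suc_conv image_iff)

lemma sum_words_1: "(\<Sum>bs\<in>words 1. F bs) = (\<Sum>b\<in>Basis. F [b])"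
  unfolding words_1 by (subst sum.reindex) (auto simp: inj_on_def)

lemma sqint_weak_deriv:
  fixes v :: "'a::euclidean_space \<Rightarrow> real"
  assumes "open \<Omega>" "has_weak_deriv \<Omega> bs u v" "sqint (lebesgue_on \<Omega>) v"
  shows "sqint (lebesgue_on \<Omega>) (weak_deriv \<Omega> bs u)" "nrm (lebesgue_on \<Omega>) (weak_deriv \<Omega> bs u) = nrm (lebesgue_on \<Omega>) v"
proof -
  have ae: "AE x in lebesgue_on \<Omega>. v x = weak_deriv \<Omega> bs u x"
    using weak_deriv_AE[OF assms(1,2)] by eventually_elim simp
  show s: "sqint (lebesgue_on \<Omega>) (weak_deriv \<Omega> bs u)"
    using assms by (intro sqint_AE[OF _ assms(3) ae]) simp
  show "nrm (lebesgue_on \<Omega>) (weak_deriv \<Omega> bs u) = nrm (lebesgue_on \<Omega>) v"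
    using ae sqint_measurable[OF s] sqint_measurable[OF assms(3)] by (intro nrm_AE) (auto elim: AE_mp)
qed

lemma sobolev_norm_sq_H1_part:
  fixes v :: "'a::euclidean_space \<Rightarrow> real"
  assumes \<Omega>: "open \<Omega>" "bounded \<Omega>" and v: "sqint (lebesgue_on \<Omega>) v"
    and w: "\<And>b. b \<in> Basis \<Longrightarrow> has_weak_deriv \<Omega> [b] v (w b)" "\<And>b. b \<in> Basis \<Longrightarrow> sqint (lebesgue_on \<Omega>) (w b)"
  shows "(\<Sum>j\<le>1. \<Sum>bs\<in>words j. \<integral>\<^sup>+x. ennreal ((weak_deriv \<Omega> bs v x)\<^sup>2) \<partial>lebesgue_on \<Omega>)
    = ennreal ((nrm (lebesgue_on \<Omega>) v)\<^sup>2 + (\<Sum>b\<in>Basis. (nrm (lebesgue_on \<Omega>) (w b))\<^sup>2))"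
proof -
  \<comment> \<open>Even the term of order 0 in the norm is a representative picked by
    \<open>weak_deriv\<close>, so it is identified with \<open>v\<close> through uniqueness.\<close>
  have "has_weak_deriv \<Omega> [] v v"
    using sqint_locally_integrable[OF \<Omega> v] by (rule has_weak_deriv_Nil)
  note 0 = sqint_weak_deriv[OF \<Omega>(1) this v]
  have "{..1::nat} = {0, 1}" by auto
  then have "(\<Sum>j\<le>1. \<Sum>bs\<in>words j. \<integral>\<^sup>+x. ennreal ((weak_deriv \<Omega> bs v x)\<^sup>2) \<partial>lebesgue_on \<Omega>)
     = (\<integral>\<^sup>+x. ennreal ((weak_deriv \<Omega> [] v x)\<^sup>2) \<partial>lebesgue_on \<Omega>)
      + (\<Sum>b\<in>Basis. \<integral>\<^sup>+x. ennreal ((weak_deriv \<Omega> [b] v x)\<^sup>2) \<partial>lebesgue_on \<Omega>)"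
    by (simp add: words_0 sum_words_1[unfolded One_nat_def])
  also have "(\<integral>\<^sup>+x. ennreal ((weak_deriv \<Omega> [] v x)\<^sup>2) \<partial>lebesgue_on \<Omega>) = ennreal ((nrm (lebesgue_on \<Omega>) v)\<^sup>2)"
    using nn_integral_sqint[OF 0(1)] 0(2) by simp
  also have "(\<Sum>b\<in>Basis. \<integral>\<^sup>+x. ennreal ((weak_deriv \<Omega> [b] v x)\<^sup>2) \<partial>lebesgue_on \<Omega>)
     = (\<Sum>b\<in>Basis. ennreal ((nrm (lebesgue_on \<Omega>) (w b))\<^sup>2))"
  proof (rule sum.cong)
    fix b :: 'a assume b: "b \<in> Basis"
    show "(\<integral>\<^sup>+x. ennreal ((weak_deriv \<Omega> [b] v x)\<^sup>2) \<partial>lebesgue_on \<Omega>) = ennreal ((nrm (lebesgue_on \<Omega>) (w b))\<^sup>2)"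
      using nn_integral_sqint[OF sqint_weak_deriv(1)[OF \<Omega>(1) w[OF b]]]
      by (simp add: sqint_weak_deriv(2)[OF \<Omega>(1) w[OF b]])
  qed simp
  also have "ennreal ((nrm (lebesgue_on \<Omega>) v)\<^sup>2) + (\<Sum>b\<in>Basis. ennreal ((nrm (lebesgue_on \<Omega>) (w b))\<^sup>2))
     = ennreal ((nrm (lebesgue_on \<Omega>) v)\<^sup>2 + (\<Sum>b\<in>Basis. (nrm (lebesgue_on \<Omega>) (w b))\<^sup>2))"
    by (subst sum_ennreal) (auto simp: ennreal_plus sum_nonneg)
  finally show ?thesis .
qed

lemma sobolev_norm_1:
  fixes v :: "'a::euclidean_space \<Rightarrow> real"
  assumes \<Omega>: "open \<Omega>" "bounded \<Omega>" and v: "sqint (lebesgue_on \<Omega>) v"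
    and w: "\<And>b. b \<in> Basis \<Longrightarrow> has_weak_deriv \<Omega> [b] v (w b)" "\<And>b. b \<in> Basis \<Longrightarrow> sqint (lebesgue_on \<Omega>) (w b)"
  shows "sobolev_norm \<Omega> 1 v = sqrt ((nrm (lebesgue_on \<Omega>) v)\<^sup>2 + (\<Sum>b\<in>Basis. (nrm (lebesgue_on \<Omega>) (w b))\<^sup>2))"
proof -
  have "nat \<lfloor>1::real\<rfloor> = 1" by simp
  then have "sobolev_norm_sq \<Omega> 1 v = ennreal ((nrm (lebesgue_on \<Omega>) v)\<^sup>2 + (\<Sum>b\<in>Basis. (nrm (lebesgue_on \<Omega>) (w b))\<^sup>2))"
    using sobolev_norm_sq_H1_part[OF assms] by (simp only: sobolev_norm_sq_def) simp
  then show ?thesis by (simp add: sobolev_norm_def sum_nonneg del: ennreal_plus)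
qed

lemma nrm_components:
  fixes F :: "'b \<Rightarrow> 'a::euclidean_space"
  assumes "\<And>b. b \<in> Basis \<Longrightarrow> sqint M (\<lambda>x. F x \<bullet> b)"
  shows "sqint M F" "(nrm M F)\<^sup>2 = (\<Sum>b\<in>Basis. (nrm M (\<lambda>x. F x \<bullet> b))\<^sup>2)"
proof -
  have eq: "(norm (F x))\<^sup>2 = (\<Sum>b\<in>Basis. (norm (F x \<bullet> b))\<^sup>2)" for x
    by (subst power2_norm_eq_inner, subst euclidean_inner) (simp add: power2_eq_square)
  have i: "integrable M (\<lambda>x. (norm (F x \<bullet> b))\<^sup>2)" if "b \<in> Basis" for b
    using assms[OF that] by (simp add: sqint_def)
  have "F \<in> borel_measurable M"
    using assms by (intro borel_measurable_euclidean_space[THEN iffD2]) (auto dest: sqint_measurable)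
  then show "sqint M F" unfolding sqint_def eq using i by (auto intro!: Bochner_Integration.integrable_sum)
  show "(nrm M F)\<^sup>2 = (\<Sum>b\<in>Basis. (nrm M (\<lambda>x. F x \<bullet> b))\<^sup>2)"
    unfolding nrm_power2 eq using i by (rule Bochner_Integration.integral_sum)
qed

lemma weak_grad_inner: "b \<in> Basis \<Longrightarrow> weak_grad \<Omega> u x \<bullet> b = weak_deriv \<Omega> [b] u x"
  by (simp add: weak_grad_def inner_sum_left inner_Basis if_distrib cong: if_cong)

lemma sobolev1_weak_grad:
  fixes u :: "'a::euclidean_space \<Rightarrow> real"
  assumes \<Omega>: "open \<Omega>" "bounded \<Omega>" and u: "u \<in> sobolev \<Omega> 1"
  shows "sqint (lebesgue_on \<Omega>) u" "sqint (lebesgue_on \<Omega>) (weak_grad \<Omega> u)"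
    "b \<in> Basis \<Longrightarrow> has_weak_deriv \<Omega> [b] u (\<lambda>x. weak_grad \<Omega> u x \<bullet> b)"
proof -
  show "sqint (lebesgue_on \<Omega>) u" using u by (simp add: sobolev_def L2_iff_sqint)
  have w: "\<exists>v. sqint (lebesgue_on \<Omega>) v \<and> has_weak_deriv \<Omega> [b] u v" if "b \<in> Basis" for b
  proof -
    have "[b] \<in> words 1" using that by (simp only: words_1) blast
    moreover have "1 \<le> nat \<lfloor>1::real\<rfloor>" by simp
    moreover have "\<forall>j\<le>nat \<lfloor>1::real\<rfloor>. \<forall>bs\<in>words j. \<exists>v\<in>L2 \<Omega>. has_weak_deriv \<Omega> bs u v"
      using u[unfolded sobolev_def mem_Collect_eq] by (elim conjE)
    ultimately have "\<exists>v\<in>L2 \<Omega>. has_weak_deriv \<Omega> [b] u v" by meson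
    then show ?thesis by (auto simp: L2_iff_sqint)
  qed
  have eq: "(\<lambda>x. weak_grad \<Omega> u x \<bullet> b) = weak_deriv \<Omega> [b] u" if "b \<in> Basis" for b
    using that by (simp add: weak_grad_inner)
  show "has_weak_deriv \<Omega> [b] u (\<lambda>x. weak_grad \<Omega> u x \<bullet> b)" if "b \<in> Basis" for b
    using w[OF that] weak_deriv_works unfolding eq[OF that] by blast
  show "sqint (lebesgue_on \<Omega>) (weak_grad \<Omega> u)"
  proof (rule nrm_components(1))
    fix b :: 'a assume "b \<in> Basis"
    then show "sqint (lebesgue_on \<Omega>) (\<lambda>x. weak_grad \<Omega> u x \<bullet> b)"
      using w sqint_weak_deriv(1)[OF \<Omega>(1)] unfolding eq[OF \<open>b \<in> Basis\<close>] by blast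
  qed
qed

lemma sobolev_norm_1_diff_smooth:
  fixes u :: "'a::euclidean_space \<Rightarrow> real"
  assumes \<Omega>: "open \<Omega>" "bounded \<Omega>" and u: "u \<in> sobolev \<Omega> 1" and \<phi>: "smooth \<phi>"
  shows "sobolev_norm \<Omega> 1 (\<lambda>x. u x - \<phi> x)
    = sqrt ((nrm (lebesgue_on \<Omega>) (\<lambda>x. u x - \<phi> x))\<^sup>2 + (nrm (lebesgue_on \<Omega>) (\<lambda>x. weak_grad \<Omega> u x - grad \<phi> x))\<^sup>2)"
proof -
  note g = sobolev1_weak_grad[OF \<Omega> u]
  have s\<phi>: "sqint (lebesgue_on \<Omega>) \<phi>" "\<And>b. b \<in> Basis \<Longrightarrow> sqint (lebesgue_on \<Omega>) (partial b \<phi>)"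
    using \<phi> by (auto intro!: continuous_sqint \<Omega> smooth_continuous smooth_partial)
  have comp: "(weak_grad \<Omega> u x - grad \<phi> x) \<bullet> b = weak_grad \<Omega> u x \<bullet> b - partial b \<phi> x" if "b \<in> Basis" for b x
    using that by (simp add: inner_diff_left grad_inner_Basis)
  have sw: "sqint (lebesgue_on \<Omega>) (\<lambda>x. weak_grad \<Omega> u x \<bullet> b)" if "b \<in> Basis" for b
    using g(2) by (rule sqint_dominated[where C = 1])
      (use sqint_measurable[OF g(2)] that in \<open>auto simp: Basis_le_norm\<close>)
  have d: "sqint (lebesgue_on \<Omega>) (\<lambda>x. (weak_grad \<Omega> u x - grad \<phi> x) \<bullet> b)" if "b \<in> Basis" for b
    using sqint_diff[OF sw s\<phi>(2)] that by (simp add: comp)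
  have "sobolev_norm \<Omega> 1 (\<lambda>x. u x - \<phi> x)
    = sqrt ((nrm (lebesgue_on \<Omega>) (\<lambda>x. u x - \<phi> x))\<^sup>2 + (\<Sum>b\<in>Basis. (nrm (lebesgue_on \<Omega>) (\<lambda>x. (weak_grad \<Omega> u x - grad \<phi> x) \<bullet> b))\<^sup>2))"
  proof (rule sobolev_norm_1[OF \<Omega>])
    show "sqint (lebesgue_on \<Omega>) (\<lambda>x. u x - \<phi> x)" using g(1) s\<phi>(1) by (rule sqint_diff)
    fix b :: 'a assume b: "b \<in> Basis"
    show "has_weak_deriv \<Omega> [b] (\<lambda>x. u x - \<phi> x) (\<lambda>x. (weak_grad \<Omega> u x - grad \<phi> x) \<bullet> b)"
      unfolding comp[OF b] using b
      by (intro has_weak_deriv_diff \<Omega> g(3) has_weak_deriv_smooth \<phi>) auto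
    show "sqint (lebesgue_on \<Omega>) (\<lambda>x. (weak_grad \<Omega> u x - grad \<phi> x) \<bullet> b)" using b by (rule d)
  qed
  then show ?thesis using nrm_components(2)[OF d] by simp
qed

lemma H1_approx:
  fixes u :: "'a::euclidean_space \<Rightarrow> real"
  assumes \<Omega>: "open \<Omega>" "bounded \<Omega>" and u: "u \<in> sobolev \<Omega> 1" and \<phi>: "\<And>n. smooth (\<phi> n)"
    and lim: "(\<lambda>n. sobolev_norm \<Omega> 1 (\<lambda>x. u x - \<phi> n x)) \<longlonglongrightarrow> 0"
  shows "(\<lambda>n. nrm (lebesgue_on \<Omega>) (\<lambda>x. u x - \<phi> n x)) \<longlonglongrightarrow> 0"
    and "(\<lambda>n. nrm (lebesgue_on \<Omega>) (\<lambda>x. weak_grad \<Omega> u x - grad (\<phi> n) x)) \<longlonglongrightarrow> 0"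
proof -
  note eq = sobolev_norm_1_diff_smooth[OF \<Omega> u \<phi>]
  show "(\<lambda>n. nrm (lebesgue_on \<Omega>) (\<lambda>x. u x - \<phi> n x)) \<longlonglongrightarrow> 0"
    by (rule tendsto_sandwich[OF _ _ tendsto_const lim]) (auto simp: eq nrm_nonneg real_le_rsqrt)
  show "(\<lambda>n. nrm (lebesgue_on \<Omega>) (\<lambda>x. weak_grad \<Omega> u x - grad (\<phi> n) x)) \<longlonglongrightarrow> 0"
    by (rule tendsto_sandwich[OF _ _ tendsto_const lim]) (auto simp: eq nrm_nonneg real_le_rsqrt)
qed

section \<open>Limits in L2 and testing with nonlinear functions of a Sobolev function\<close>

lemma nrm_tendsto_AE_subseq:
  fixes f :: "nat \<Rightarrow> 'b \<Rightarrow> real"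
  assumes "\<And>n. sqint M (f n)" "sqint M g" "(\<lambda>n. nrm M (\<lambda>x. g x - f n x)) \<longlonglongrightarrow> 0"
  obtains r :: "nat \<Rightarrow> nat" where "strict_mono r" "AE x in M. (\<lambda>n. f (r n) x) \<longlonglongrightarrow> g x"
proof -
  have i: "integrable M (\<lambda>x. (g x - f n x)\<^sup>2)" for n
    using sqint_diff[OF assms(2) assms(1)[of n]] by (simp add: sqint_def)
  have "(\<lambda>n. (nrm M (\<lambda>x. g x - f n x))\<^sup>2) \<longlonglongrightarrow> 0\<^sup>2" using assms(3) by (rule tendsto_power)
  then have "(\<lambda>n. \<integral>x. norm ((g x - f n x)\<^sup>2) \<partial>M) \<longlonglongrightarrow> 0" by (simp add: nrm_power2)
  from tendsto_L1_AE_subseq[OF i this]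
  obtain r where r: "strict_mono r" "AE x in M. (\<lambda>n. (g x - f (r n) x)\<^sup>2) \<longlonglongrightarrow> 0" by auto
  have "AE x in M. (\<lambda>n. f (r n) x) \<longlonglongrightarrow> g x"
    using r(2)
  proof eventually_elim
    case (elim x)
    then have "(\<lambda>n. sqrt ((g x - f (r n) x)\<^sup>2)) \<longlonglongrightarrow> sqrt 0" by (rule tendsto_real_sqrt)
    then have "(\<lambda>n. g x - f (r n) x) \<longlonglongrightarrow> 0" by (simp add: tendsto_rabs_zero_iff)
    from tendsto_diff[OF tendsto_const this, of "g x"] show ?case by simp
  qed
  with r(1) show ?thesis using that by blast
qed

lemma nrm_tendsto_inner:
  assumes "\<And>n. sqint M (f n)" "sqint M g" "sqint M h" "(\<lambda>n. nrm M (\<lambda>x. g x - f n x)) \<longlonglongrightarrow> 0"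
  shows "(\<lambda>n. \<integral>x. h x \<bullet> f n x \<partial>M) \<longlonglongrightarrow> (\<integral>x. h x \<bullet> g x \<partial>M)"
proof -
  have "\<bar>(\<integral>x. h x \<bullet> f n x \<partial>M) - (\<integral>x. h x \<bullet> g x \<partial>M)\<bar> \<le> nrm M h * nrm M (\<lambda>x. g x - f n x)" for n
  proof -
    have "(\<integral>x. h x \<bullet> g x \<partial>M) - (\<integral>x. h x \<bullet> f n x \<partial>M) = (\<integral>x. h x \<bullet> (g x - f n x) \<partial>M)"
      using assms by (simp add: inner_diff_right sqint_inner_integrable)
    then show ?thesis
      using nrm_Cauchy_Schwarz_inner[OF assms(3) sqint_diff[OF assms(2) assms(1)[of n]]] by (simp add: abs_minus_commute)
  qed
  then have "\<forall>\<^sub>F n in sequentially. norm ((\<integral>x. h x \<bullet> f n x \<partial>M) - (\<integral>x. h x \<bullet> g x \<partial>M)) \<le> nrm M h * nrm M (\<lambda>x. g x - f n x)"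
    by (intro always_eventually allI) (simp only: real_norm_def)
  moreover have "(\<lambda>n. nrm M h * nrm M (\<lambda>x. g x - f n x)) \<longlonglongrightarrow> 0"
    using tendsto_mult_right_zero[OF assms(4)] by simp
  ultimately have "(\<lambda>n. (\<integral>x. h x \<bullet> f n x \<partial>M) - (\<integral>x. h x \<bullet> g x \<partial>M)) \<longlonglongrightarrow> 0"
    by (rule Lim_null_comparison)
  then show ?thesis by (rule LIM_zero_cancel)
qed

lemma nrm_tendsto_mult:
  fixes f :: "nat \<Rightarrow> 'b \<Rightarrow> real"
  assumes "\<And>n. sqint M (f n)" "sqint M g" "sqint M h" "(\<lambda>n. nrm M (\<lambda>x. g x - f n x)) \<longlonglongrightarrow> 0"
  shows "(\<lambda>n. \<integral>x. h x * f n x \<partial>M) \<longlonglongrightarrow> (\<integral>x. h x * g x \<partial>M)"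
  using nrm_tendsto_inner[OF assms] by simp

lemma has_weak_div_grad:
  "has_weak_div \<Omega> F D \<Longrightarrow> \<phi> \<in> test_functions \<Omega> \<Longrightarrow>
    (\<integral>x. F x \<bullet> grad \<phi> x \<partial>lebesgue_on \<Omega>) = - (\<integral>x. D x * \<phi> x \<partial>lebesgue_on \<Omega>)"
  by (simp add: has_weak_div_def)

text \<open>The approximations \<open>\<psi> n\<close> of \<open>u\<close>, smooth on the whole space, come for free with a trace of \<open>u\<close>;
  this is why no mollification of \<open>u\<close> is needed.\<close>

lemma weak_div_test_compose:
  fixes u D :: "'a::euclidean_space \<Rightarrow> real" and F :: "'a \<Rightarrow> 'a"
  assumes \<Omega>: "open \<Omega>" "bounded \<Omega>"
    and div: "has_weak_div \<Omega> F D" "sqint (lebesgue_on \<Omega>) F" "sqint (lebesgue_on \<Omega>) D"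
    and u: "sqint (lebesgue_on \<Omega>) u" and G: "sqint (lebesgue_on \<Omega>) G"
    and \<psi>: "\<And>n. smooth (\<psi> n)" "(\<lambda>n. nrm (lebesgue_on \<Omega>) (\<lambda>x. u x - \<psi> n x)) \<longlonglongrightarrow> 0"
      "(\<lambda>n. nrm (lebesgue_on \<Omega>) (\<lambda>x. G x - grad (\<psi> n) x)) \<longlonglongrightarrow> 0"
    and H: "\<And>f :: 'a \<Rightarrow> real. smooth f \<Longrightarrow> smooth (\<lambda>x. H (f x))" "\<And>s. (H has_real_derivative H' s) (at s)"
      "continuous_on UNIV H'" "\<And>s. \<bar>H s\<bar> \<le> B" "\<And>s. \<bar>H' s\<bar> \<le> B"
    and \<phi>: "\<phi> \<in> test_functions \<Omega>"
  shows "(\<integral>x. F x \<bullet> (H (u x) *\<^sub>R grad \<phi> x + (\<phi> x * H' (u x)) *\<^sub>R G x) \<partial>lebesgue_on \<Omega>) = - (\<integral>x. D x * (\<phi> x * H (u x)) \<partial>lebesgue_on \<Omega>)"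
proof -
  let ?M = "lebesgue_on \<Omega>"
  have s\<psi>: "sqint ?M (\<psi> n)" "sqint ?M (grad (\<psi> n))" for n
    using \<psi>(1) by (auto intro!: continuous_sqint \<Omega> smooth_continuous smooth_continuous_grad)
  \<comment> \<open>The approximations enter through the nonlinear \<open>H\<close> and
    \<open>H'\<close>, so pointwise convergence is required; convergence in L2 provides it along a
    subsequence.\<close>
  obtain r :: "nat \<Rightarrow> nat" where r: "strict_mono r" "AE x in ?M. (\<lambda>n. \<psi> (r n) x) \<longlonglongrightarrow> u x"
    using nrm_tendsto_AE_subseq[OF s\<psi>(1) u \<psi>(2)] by blast
  define \<xi> where "\<xi> n = \<psi> (r n)" for n
  have \<xi>: "smooth (\<xi> n)" "sqint ?M (\<xi> n)" "sqint ?M (grad (\<xi> n))" for n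
    using \<psi>(1) s\<psi> by (auto simp: \<xi>_def)
  have \<xi>u: "AE x in ?M. (\<lambda>n. \<xi> n x) \<longlonglongrightarrow> u x" using r(2) by (simp add: \<xi>_def)
  have \<xi>G: "(\<lambda>n. nrm ?M (\<lambda>x. G x - grad (\<xi> n) x)) \<longlonglongrightarrow> 0"
    using LIMSEQ_subseq_LIMSEQ[OF \<psi>(3) r(1)] by (simp add: \<xi>_def o_def)
  have sm\<phi>: "smooth \<phi>" using \<phi> by (rule test_smooth)
  have s\<phi>: "sqint ?M \<phi>" "sqint ?M (grad \<phi>)"
    using sm\<phi> by (auto intro!: continuous_sqint \<Omega> smooth_continuous smooth_continuous_grad)
  obtain R where "\<And>x. R \<le> norm x \<Longrightarrow> \<phi> x = 0" using test_support_ball[OF \<phi>] by metis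
  then obtain B\<phi> where B\<phi>: "B\<phi> > 0" "\<And>x. norm (\<phi> x) \<le> B\<phi>"
    using bounded_if_zero_outside[OF smooth_continuous[OF sm\<phi>]] by metis
  have B0: "0 \<le> B" using H(4)[of 0] by simp
  have cH: "continuous_on UNIV H" using H(2) DERIV_isCont by (auto simp: continuous_on_eq_continuous_at)
  have Hm: "H \<in> borel_measurable borel" "H' \<in> borel_measurable borel"
    using cH H(3) by (auto intro: borel_measurable_continuous_onI)
  note [measurable] = Hm sqint_measurable[OF u] sqint_measurable[OF \<xi>(2)] sqint_measurable[OF \<xi>(3)] sqint_measurable[OF s\<phi>(1)]
    sqint_measurable[OF s\<phi>(2)] sqint_measurable[OF G] sqint_measurable[OF div(2)] sqint_measurable[OF div(3)]
  \<comment> \<open>The gradient of \<open>\<xi> n\<close> is written as \<open>G\<close> minus an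
    error. Then the main terms are fixed integrable functions times bounded factors that converge
    a.e., ready for dominated convergence, and the error is paired with functions bounded in
    L2.\<close>
  have id: "(\<integral>x. H (\<xi> n x) * (F x \<bullet> grad \<phi> x) \<partial>?M) + (\<integral>x. \<phi> x * H' (\<xi> n x) * (F x \<bullet> G x) \<partial>?M)
      - (\<integral>x. (\<phi> x * H' (\<xi> n x)) *\<^sub>R F x \<bullet> (G x - grad (\<xi> n) x) \<partial>?M)
      = - (\<integral>x. H (\<xi> n x) * (D x * \<phi> x) \<partial>?M)" for n
  proof -
    have t: "(\<lambda>x. \<phi> x * H (\<xi> n x)) \<in> test_functions \<Omega>"
      using \<phi> \<xi>(1) H(1) by (intro test_mult_smooth) auto
    have g: "grad (\<lambda>x. \<phi> x * H (\<xi> n x)) x = \<phi> x *\<^sub>R H' (\<xi> n x) *\<^sub>R grad (\<xi> n) x + H (\<xi> n x) *\<^sub>R grad \<phi> x" for x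
      using smooth_differentiable[OF sm\<phi>] smooth_differentiable[OF H(1)[OF \<xi>(1)]]
        grad_compose[OF smooth_differentiable[OF \<xi>(1)] H(2)]
      by (simp add: grad_mult)
    have i1: "integrable ?M (\<lambda>x. H (\<xi> n x) * (F x \<bullet> grad \<phi> x))"
      using H(4) B0
      by (intro Bochner_Integration.integrable_bound[OF integrable_mult_right[OF sqint_inner_integrable[OF div(2) s\<phi>(2)], of B]])
        (measurable, auto simp: abs_mult mult_right_mono)
    have B2: "\<bar>\<phi> x * H' s\<bar> \<le> B\<phi> * B" for x s
      using B\<phi> H(5) B0 by (simp add: abs_mult mult_mono)
    have sF: "sqint ?M (\<lambda>x. (\<phi> x * H' (\<xi> n x)) *\<^sub>R F x)"
      by (rule sqint_bounded_scaleR[OF div(2), where B = "B\<phi> * B"]) (measurable, simp add: B2)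
    have i2: "integrable ?M (\<lambda>x. (\<phi> x * H' (\<xi> n x)) *\<^sub>R F x \<bullet> G x)" "integrable ?M (\<lambda>x. (\<phi> x * H' (\<xi> n x)) *\<^sub>R F x \<bullet> grad (\<xi> n) x)"
      using sqint_inner_integrable[OF sF] G \<xi>(3) by auto
    have "(\<integral>x. H (\<xi> n x) * (F x \<bullet> grad \<phi> x) \<partial>?M) + (\<integral>x. \<phi> x * H' (\<xi> n x) * (F x \<bullet> G x) \<partial>?M)
      - (\<integral>x. (\<phi> x * H' (\<xi> n x)) *\<^sub>R F x \<bullet> (G x - grad (\<xi> n) x) \<partial>?M)
      = (\<integral>x. H (\<xi> n x) * (F x \<bullet> grad \<phi> x) \<partial>?M) + (\<integral>x. (\<phi> x * H' (\<xi> n x)) *\<^sub>R F x \<bullet> grad (\<xi> n) x \<partial>?M)"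
      using i2 by (simp add: inner_diff_right right_diff_distrib mult.assoc)
    also have "\<dots> = (\<integral>x. F x \<bullet> grad (\<lambda>x. \<phi> x * H (\<xi> n x)) x \<partial>?M)"
      unfolding g using i1 i2(2) by (subst Bochner_Integration.integral_add[symmetric]) (auto simp: inner_add_right mult_ac add_ac)
    also have "\<dots> = - (\<integral>x. H (\<xi> n x) * (D x * \<phi> x) \<partial>?M)"
      using has_weak_div_grad[OF div(1) t] by (simp add: mult_ac)
    finally show ?thesis .
  qed
  have conv: "AE x in ?M. (\<lambda>n. H (\<xi> n x)) \<longlonglongrightarrow> H (u x)" "AE x in ?M. (\<lambda>n. H' (\<xi> n x)) \<longlonglongrightarrow> H' (u x)"
    using \<xi>u by (eventually_elim, auto intro: continuous_on_tendsto_compose[OF cH] continuous_on_tendsto_compose[OF H(3)])+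
  have dom: "(\<lambda>n. \<integral>x. k n x * f x \<partial>?M) \<longlonglongrightarrow> (\<integral>x. kk x * f x \<partial>?M)"
    if "integrable ?M f" "\<And>n. k n \<in> borel_measurable ?M" "kk \<in> borel_measurable ?M"
      "AE x in ?M. (\<lambda>n. k n x) \<longlonglongrightarrow> kk x" "\<And>n x. \<bar>k n x\<bar> \<le> C" for k :: "nat \<Rightarrow> 'a \<Rightarrow> real" and kk f C
  proof (rule integral_dominated_convergence)
    note that(2,3)[measurable] borel_measurable_integrable[OF that(1), measurable]
    show "(\<lambda>x. kk x * f x) \<in> borel_measurable ?M" "\<And>n. (\<lambda>x. k n x * f x) \<in> borel_measurable ?M" by measurable
    show "integrable ?M (\<lambda>x. C * \<bar>f x\<bar>)" using that(1) by simp
    show "AE x in ?M. (\<lambda>n. k n x * f x) \<longlonglongrightarrow> kk x * f x"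
      using that(4) by eventually_elim (intro tendsto_intros)
    show "AE x in ?M. norm (k n x * f x) \<le> C * \<bar>f x\<bar>" for n
      using that(5) by (auto simp: abs_mult mult_right_mono)
  qed
  have meas: "(\<lambda>x. H (\<xi> n x)) \<in> borel_measurable ?M" "(\<lambda>x. H (u x)) \<in> borel_measurable ?M"
    "(\<lambda>x. \<phi> x * H' (\<xi> n x)) \<in> borel_measurable ?M" "(\<lambda>x. \<phi> x * H' (u x)) \<in> borel_measurable ?M" for n
    by measurable
  have L1: "(\<lambda>n. \<integral>x. H (\<xi> n x) * (F x \<bullet> grad \<phi> x) \<partial>?M) \<longlonglongrightarrow> (\<integral>x. H (u x) * (F x \<bullet> grad \<phi> x) \<partial>?M)"
    by (rule dom[where C = B, OF sqint_inner_integrable[OF div(2) s\<phi>(2)] meas(1,2) conv(1) H(4)])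
  have L4: "(\<lambda>n. \<integral>x. H (\<xi> n x) * (D x * \<phi> x) \<partial>?M) \<longlonglongrightarrow> (\<integral>x. H (u x) * (D x * \<phi> x) \<partial>?M)"
    by (rule dom[where C = B, OF sqint_mult_integrable[OF div(3) s\<phi>(1)] meas(1,2) conv(1) H(4)])
  have B2: "\<bar>\<phi> x * H' s\<bar> \<le> B\<phi> * B" for x s
    using B\<phi> H(5) B0 by (simp add: abs_mult mult_mono)
  have L2: "(\<lambda>n. \<integral>x. \<phi> x * H' (\<xi> n x) * (F x \<bullet> G x) \<partial>?M) \<longlonglongrightarrow> (\<integral>x. \<phi> x * H' (u x) * (F x \<bullet> G x) \<partial>?M)"
  proof (rule dom[where C = "B\<phi> * B"])
    show "integrable ?M (\<lambda>x. F x \<bullet> G x)" using div(2) G by (rule sqint_inner_integrable)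
    show "AE x in ?M. (\<lambda>n. \<phi> x * H' (\<xi> n x)) \<longlonglongrightarrow> \<phi> x * H' (u x)"
      using conv(2) by eventually_elim (intro tendsto_intros)
  qed (rule meas B2)+
  have L3: "(\<lambda>n. \<integral>x. (\<phi> x * H' (\<xi> n x)) *\<^sub>R F x \<bullet> (G x - grad (\<xi> n) x) \<partial>?M) \<longlonglongrightarrow> 0"
  proof (rule Lim_null_comparison)
    show "(\<lambda>n. (B\<phi> * B * nrm ?M F) * nrm ?M (\<lambda>x. G x - grad (\<xi> n) x)) \<longlonglongrightarrow> 0"
      using tendsto_mult_right_zero[OF \<xi>G] by simp
    show "\<forall>\<^sub>F n in sequentially. norm (\<integral>x. (\<phi> x * H' (\<xi> n x)) *\<^sub>R F x \<bullet> (G x - grad (\<xi> n) x) \<partial>?M)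
      \<le> (B\<phi> * B * nrm ?M F) * nrm ?M (\<lambda>x. G x - grad (\<xi> n) x)"
    proof (intro always_eventually allI)
      fix n
      have sF: "sqint ?M (\<lambda>x. (\<phi> x * H' (\<xi> n x)) *\<^sub>R F x)"
        by (rule sqint_bounded_scaleR[OF div(2), where B = "B\<phi> * B"]) (measurable, simp add: B2)
      have "norm (\<integral>x. (\<phi> x * H' (\<xi> n x)) *\<^sub>R F x \<bullet> (G x - grad (\<xi> n) x) \<partial>?M)
        \<le> nrm ?M (\<lambda>x. (\<phi> x * H' (\<xi> n x)) *\<^sub>R F x) * nrm ?M (\<lambda>x. G x - grad (\<xi> n) x)"
        unfolding real_norm_def by (intro nrm_Cauchy_Schwarz_inner sF sqint_diff G \<xi>(3))
      also have "nrm ?M (\<lambda>x. (\<phi> x * H' (\<xi> n x)) *\<^sub>R F x) \<le> (B\<phi> * B) * nrm ?M F"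
        by (rule nrm_dominated[OF div(2)])
          (use sqint_measurable[OF sF] B2 B\<phi>(1) B0 in \<open>auto intro!: mult_right_mono simp del: abs_mult\<close>)
      finally show "norm (\<integral>x. (\<phi> x * H' (\<xi> n x)) *\<^sub>R F x \<bullet> (G x - grad (\<xi> n) x) \<partial>?M)
        \<le> (B\<phi> * B * nrm ?M F) * nrm ?M (\<lambda>x. G x - grad (\<xi> n) x)"
        by (simp add: mult_right_mono nrm_nonneg)
    qed
  qed
  have "(\<integral>x. H (u x) * (F x \<bullet> grad \<phi> x) \<partial>?M) + (\<integral>x. \<phi> x * H' (u x) * (F x \<bullet> G x) \<partial>?M) - 0 = - (\<integral>x. H (u x) * (D x * \<phi> x) \<partial>?M)"
    using tendsto_diff[OF tendsto_add[OF L1 L2] L3] tendsto_minus[OF L4] unfolding id by (rule LIMSEQ_unique)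
  moreover have "integrable ?M (\<lambda>x. H (u x) * (F x \<bullet> grad \<phi> x))"
    using H(4) B0
    by (intro Bochner_Integration.integrable_bound[OF integrable_mult_right[OF sqint_inner_integrable[OF div(2) s\<phi>(2)], of B]])
      (measurable, auto simp: abs_mult mult_right_mono)
  moreover have "integrable ?M (\<lambda>x. \<phi> x * H' (u x) * (F x \<bullet> G x))"
  proof (rule Bochner_Integration.integrable_bound[OF integrable_mult_right[OF sqint_inner_integrable[OF div(2) G], of "B\<phi> * B"]])
    show "AE x in ?M. norm (\<phi> x * H' (u x) * (F x \<bullet> G x)) \<le> norm (B\<phi> * B * (F x \<bullet> G x))"
      using B2 B\<phi>(1) B0 by (intro AE_I2) (simp add: abs_mult[of "_ * _" "_ \<bullet> _"] mult_right_mono del: abs_mult)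
  qed measurable
  ultimately show ?thesis by (simp add: inner_add_right mult_ac)
qed

section \<open>Boundary layers\<close>

text \<open>Translation invariance determines Lebesgue measure up to a factor, and the factor is read
  off from the unit ball.\<close>

lemma distr_lborel_orthogonal:
  fixes R :: "'a::euclidean_space \<Rightarrow> 'a"
  assumes R: "orthogonal_transformation R"
  shows "distr lborel borel R = lborel"
proof (rule measure_eqI)
  have lin: "linear R" using R by (rule orthogonal_transformation_linear)
  have bl: "bounded_linear R" using lin by (simp add: linear_conv_bounded_linear)
  have [measurable]: "R \<in> borel_measurable borel"
    using bl by (intro borel_measurable_continuous_onI linear_continuous_on)
  define S where "S = inv R"
  have RS: "R (S y) = y" for y
    using orthogonal_transformation_bij[OF R] by (simp add: S_def bij_is_surj surj_f_inv_f)
  fix A assume "A \<in> sets (distr lborel borel R)"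
  then have [measurable]: "A \<in> sets borel" by simp
  have RA[measurable]: "R -` A \<in> sets borel"
    by (rule measurable_sets_borel[of R borel]) measurable
  define B where "B = ball (0::'a) 1"
  have [measurable]: "B \<in> sets borel" by (simp add: B_def)
  have B: "emeasure lborel B \<noteq> 0" "emeasure lborel B \<noteq> \<infinity>"
    using content_ball_pos[of 1 "0::'a"] emeasure_lborel_ball_finite[of "0::'a" 1]
    by (auto simp: B_def measure_def)
  have RB: "R -` B = B" using orthogonal_transformation_norm[OF R] by (auto simp: B_def)
  have trans: "(\<integral>\<^sup>+x. g (x + w) \<partial>lborel) = (\<integral>\<^sup>+x. g x \<partial>lborel)" if "g \<in> borel_measurable borel" for g and w :: 'a
    using that by (rule nn_integral_translate)
  \<comment> \<open>The double integral over the pairs with \<open>R x\<close> in \<open>A\<close>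
    and \<open>y + R x\<close> in \<open>B\<close> is evaluated in both orders. Shifting
    \<open>x\<close> by the preimage \<open>S y\<close> of \<open>y\<close> moves \<open>y\<close>
    from the second condition to the first. As the unit ball is invariant under \<open>R\<close>,
    the volumes of \<open>A\<close> and of its preimage end up multiplied by the same finite
    positive number.\<close>
  have "emeasure lborel (R -` A) * emeasure lborel B = (\<integral>\<^sup>+x. indicator (R -` A) x * emeasure lborel B \<partial>lborel)"
    by (subst nn_integral_multc) auto
  also have "\<dots> = (\<integral>\<^sup>+x. (\<integral>\<^sup>+y. indicator A (R x) * indicator B (y + R x) \<partial>lborel) \<partial>lborel)"
  proof (rule nn_integral_cong)
    fix x
    have "(\<integral>\<^sup>+y. indicator A (R x) * indicator B (y + R x) \<partial>lborel) = indicator A (R x) * (\<integral>\<^sup>+y. indicator B (y + R x) \<partial>lborel)"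
      by (rule nn_integral_cmult) measurable
    also have "(\<integral>\<^sup>+y. indicator B (y + R x) \<partial>lborel) = (\<integral>\<^sup>+y. indicator B y \<partial>lborel)"
      by (rule trans) measurable
    finally show "indicator (R -` A) x * emeasure lborel B = (\<integral>\<^sup>+y. indicator A (R x) * indicator B (y + R x) \<partial>lborel)"
      by (simp add: indicator_vimage)
  qed
  also have "\<dots> = (\<integral>\<^sup>+y. (\<integral>\<^sup>+x. indicator A (R x) * indicator B (y + R x) \<partial>lborel) \<partial>lborel)"
    by (rule lborel_pair.Fubini') measurable
  also have "\<dots> = (\<integral>\<^sup>+y. (\<integral>\<^sup>+x. indicator A (R x - y) * indicator B (R x) \<partial>lborel) \<partial>lborel)"
  proof (rule nn_integral_cong)
    fix y
    have "(\<integral>\<^sup>+x. indicator A (R x - y) * indicator B (R x) \<partial>lborel) = (\<integral>\<^sup>+x. indicator A (R (x + S y) - y) * indicator B (R (x + S y)) \<partial>lborel)"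
      by (rule trans[symmetric]) measurable
    then show "(\<integral>\<^sup>+x. indicator A (R x) * indicator B (y + R x) \<partial>lborel) = (\<integral>\<^sup>+x. indicator A (R x - y) * indicator B (R x) \<partial>lborel)"
      by (simp add: linear_add[OF lin] RS add.commute)
  qed
  also have "\<dots> = (\<integral>\<^sup>+x. (\<integral>\<^sup>+y. indicator A (R x - y) * indicator B (R x) \<partial>lborel) \<partial>lborel)"
    by (rule lborel_pair.Fubini') measurable
  also have "\<dots> = (\<integral>\<^sup>+x. emeasure lborel A * indicator (R -` B) x \<partial>lborel)"
  proof (rule nn_integral_cong)
    fix x
    have "(\<integral>\<^sup>+y. indicator A (R x - y) * indicator B (R x) \<partial>lborel) = (\<integral>\<^sup>+y. indicator A (R x - y) \<partial>lborel) * indicator B (R x)"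
      by (rule nn_integral_multc) measurable
    also have "(\<integral>\<^sup>+y. indicator A (R x - y) \<partial>lborel) = emeasure lborel A"
      using nn_integral_scale[of "indicator A" "-1" "R x"] by simp
    finally show "(\<integral>\<^sup>+y. indicator A (R x - y) * indicator B (R x) \<partial>lborel) = emeasure lborel A * indicator (R -` B) x"
      by (simp add: indicator_vimage)
  qed
  also have "\<dots> = emeasure lborel A * emeasure lborel B"
    unfolding RB by (subst nn_integral_cmult) auto
  finally have "emeasure lborel (R -` A) = emeasure lborel A"
    using B by (metis ennreal_divide_times ennreal_times_divide mult_divide_eq_ennreal infinity_ennreal_def)
  then show "emeasure (distr lborel borel R) A = emeasure lborel A"
    by (subst emeasure_distr) auto
qed simp

section \<open>Layers under the graph of a boundary chart\<close>

lemma nn_integral_chart: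
  fixes R :: "'n::euclidean_space \<times> real \<Rightarrow> 'n \<times> real"
  assumes R: "orthogonal_transformation R" and [measurable]: "g \<in> borel_measurable borel"
  shows "(\<integral>\<^sup>+z. g z \<partial>lborel) = (\<integral>\<^sup>+y. (\<integral>\<^sup>+t. g (c + R (y, t)) \<partial>lborel) \<partial>lborel)"
proof -
  have [measurable]: "R \<in> borel_measurable borel"
    using R by (intro borel_measurable_continuous_onI linear_continuous_on)
      (simp add: orthogonal_transformation_linear flip: linear_conv_bounded_linear)
  have "(\<integral>\<^sup>+z. g z \<partial>lborel) = (\<integral>\<^sup>+z. g (z + c) \<partial>lborel)"
    by (rule nn_integral_translate[symmetric]) measurable
  also have "\<dots> = (\<integral>\<^sup>+z. g (z + c) \<partial>distr lborel borel R)"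
    by (simp add: distr_lborel_orthogonal[OF R])
  also have "\<dots> = (\<integral>\<^sup>+z. g (c + R z) \<partial>lborel)"
    by (subst nn_integral_distr) (auto simp: add.commute)
  also have "\<dots> = (\<integral>\<^sup>+z. g (c + R z) \<partial>(lborel \<Otimes>\<^sub>M lborel))"
    by (simp add: lborel_prod)
  also have "\<dots> = (\<integral>\<^sup>+y. (\<integral>\<^sup>+t. g (c + R (y, t)) \<partial>lborel) \<partial>lborel)"
    by (subst lborel.nn_integral_fst[symmetric]) (auto simp: lborel_prod)
  finally show ?thesis .
qed

text \<open>Each value is compared with the one at the end point \<open>T\<close>, which will lie on
  the boundary. The square of the latter enters with weight \<open>s\<close> and that of the
  derivative with weight \<open>s ^ 2\<close>; this second power is what offsets the squared
  gradient of a cutoff across a layer of width \<open>s\<close>.\<close>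

lemma segment_layer_bound:
  fixes h h' :: "real \<Rightarrow> real"
  assumes "0 < s" and deriv: "\<And>t. (h has_real_derivative h' t) (at t)" and cont: "continuous_on UNIV h'"
  shows "(\<integral>\<^sup>+t. ennreal ((h t)\<^sup>2) * indicator {T - s<..<T} t \<partial>lborel)
    \<le> ennreal (2 * s) * ennreal ((h T)\<^sup>2) + ennreal (2 * s\<^sup>2) * (\<integral>\<^sup>+t. ennreal ((h' t)\<^sup>2) * indicator {T - s<..<T} t \<partial>lborel)"
proof -
  define J where "J = (\<integral>\<^sup>+t. ennreal ((h' t)\<^sup>2) * indicator {T - s<..<T} t \<partial>lborel)"
  have pt: "ennreal ((h t)\<^sup>2) \<le> ennreal 2 * ennreal ((h T)\<^sup>2) + ennreal (2 * s) * J" if t: "t \<in> {T - s<..<T}" for t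
  proof -
    have "ennreal ((h T - h t)\<^sup>2) \<le> ennreal (T - t) * (\<integral>\<^sup>+\<tau>. ennreal ((h' \<tau>)\<^sup>2) * indicator {t..T} \<tau> \<partial>lborel)"
      using t by (intro C1_segment deriv continuous_on_subset[OF cont]) auto
    also have "\<dots> \<le> ennreal s * J"
      unfolding J_def
    proof (rule mult_mono)
      show "ennreal (T - t) \<le> ennreal s" using t by (intro ennreal_leI) auto
      show "(\<integral>\<^sup>+\<tau>. ennreal ((h' \<tau>)\<^sup>2) * indicator {t..T} \<tau> \<partial>lborel) \<le> (\<integral>\<^sup>+t. ennreal ((h' t)\<^sup>2) * indicator {T - s<..<T} t \<partial>lborel)"
      proof (rule nn_integral_mono_AE)
        \<comment> \<open>The end point \<open>T\<close> belongs to the closed interval but not to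
          the open layer, so the comparison holds a.e. only.\<close>
        show "AE \<tau> in lborel. ennreal ((h' \<tau>)\<^sup>2) * indicator {t..T} \<tau> \<le> ennreal ((h' \<tau>)\<^sup>2) * indicator {T - s<..<T} \<tau>"
          using AE_lborel_singleton[of T] by eventually_elim (use t in \<open>auto simp: indicator_def\<close>)
      qed
    qed auto
    finally have *: "ennreal ((h T - h t)\<^sup>2) \<le> ennreal s * J" .
    have "(h t)\<^sup>2 \<le> 2 * (h T)\<^sup>2 + 2 * (h T - h t)\<^sup>2"
      using norm_add_power2_le[of "h T" "h t - h T"] by (simp add: power2_commute)
    then have "ennreal ((h t)\<^sup>2) \<le> ennreal (2 * (h T)\<^sup>2 + 2 * (h T - h t)\<^sup>2)" by (rule ennreal_leI)
    also have "\<dots> = ennreal 2 * ennreal ((h T)\<^sup>2) + ennreal 2 * ennreal ((h T - h t)\<^sup>2)"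
      by (simp only: ennreal_mult' [symmetric] ennreal_plus[symmetric] zero_le_power2 mult_nonneg_nonneg zero_le_numeral ennreal_mult[symmetric])
    also have "\<dots> \<le> ennreal 2 * ennreal ((h T)\<^sup>2) + ennreal 2 * (ennreal s * J)"
      using * by (intro add_left_mono mult_left_mono) auto
    also have "ennreal 2 * (ennreal s * J) = ennreal (2 * s) * J"
      using \<open>0 < s\<close> by (subst ennreal_mult) (auto simp: mult.assoc)
    finally show ?thesis .
  qed
  have "(\<integral>\<^sup>+t. ennreal ((h t)\<^sup>2) * indicator {T - s<..<T} t \<partial>lborel)
     \<le> (\<integral>\<^sup>+t. (ennreal 2 * ennreal ((h T)\<^sup>2) + ennreal (2 * s) * J) * indicator {T - s<..<T} t \<partial>lborel)"
    using pt by (intro nn_integral_mono) (auto simp: indicator_def)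
  also have "\<dots> = (ennreal 2 * ennreal ((h T)\<^sup>2) + ennreal (2 * s) * J) * ennreal s"
    using \<open>0 < s\<close> by (subst nn_integral_cmult_indicator) auto
  also have "\<dots> = ennreal (2 * s) * ennreal ((h T)\<^sup>2) + ennreal (2 * s\<^sup>2) * J"
  proof -
    have 1: "ennreal (2 * s) = ennreal 2 * ennreal s"
      by (rule ennreal_mult) (use \<open>0 < s\<close> in auto)
    have 2: "ennreal ((2 * s) * s) = ennreal (2 * s) * ennreal s"
      by (rule ennreal_mult) (use \<open>0 < s\<close> in auto)
    have 3: "2 * s\<^sup>2 = (2 * s) * s" by (simp add: power2_eq_square)
    show ?thesis unfolding 3 2 unfolding 1 by (simp only: distrib_left distrib_right mult_ac)
  qed
  finally show ?thesis unfolding J_def .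
qed

text \<open>The depth \<open>s\<close> is measured along the last chart coordinate instead of as a
  distance, so that the layer is a union of segments of length \<open>s\<close> ending on the graph
  and Fubini applies in the chart.\<close>

definition chart_layer ::
  "('n::euclidean_space \<times> real \<Rightarrow> 'n \<times> real) \<Rightarrow> 'n \<times> real \<Rightarrow> 'n \<Rightarrow> ('n \<Rightarrow> real) \<Rightarrow> real \<Rightarrow> ('n \<times> real) set" where
  "chart_layer R c \<alpha> \<gamma> s = (\<lambda>z. c + R z) ` {(y, t). y \<in> box (- \<alpha>) \<alpha> \<and> \<gamma> y - s < t \<and> t < \<gamma> y}"

lemma open_chart_image:
  fixes R :: "'a::euclidean_space \<Rightarrow> 'a"
  assumes R: "orthogonal_transformation R" and "open S"
  shows "open ((\<lambda>z. c + R z) ` S)"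
proof -
  have "open (R ` S)"
    using assms orthogonal_transformation_linear[OF R] orthogonal_transformation_bij[OF R]
    by (simp add: open_bijective_linear_image_eq)
  then have "open ((+) c ` (R ` S))" by (rule open_translation)
  then show ?thesis by (simp add: image_image)
qed

lemma open_chart_layer:
  assumes "orthogonal_transformation R" "continuous_on UNIV \<gamma>"
  shows "open (chart_layer R c \<alpha> \<gamma> s)"
  unfolding chart_layer_def
proof (rule open_chart_image[OF assms(1)])
  have c: "continuous_on UNIV (\<lambda>z::'a \<times> real. \<gamma> (fst z))"
    by (rule continuous_on_compose2[OF assms(2)]) (auto intro: continuous_intros)
  have "{(y, t). y \<in> box (- \<alpha>) \<alpha> \<and> \<gamma> y - s < t \<and> t < \<gamma> y}
     = (box (- \<alpha>) \<alpha> \<times> UNIV) \<inter> {z. \<gamma> (fst z) - s < snd z} \<inter> {z. snd z < \<gamma> (fst z)}" by auto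
  moreover have "open {z::'a \<times> real. \<gamma> (fst z) - s < snd z}" "open {z::'a \<times> real. snd z < \<gamma> (fst z)}"
    by (intro open_Collect_less continuous_intros c)+
  ultimately show "open {(y, t). y \<in> box (- \<alpha>) \<alpha> \<and> \<gamma> y - s < t \<and> t < \<gamma> y}"
    by (auto intro!: open_Int open_Times open_box)
qed

lemma mem_chart_layer:
  assumes "orthogonal_transformation R"
  shows "c + R (y, t) \<in> chart_layer R c \<alpha> \<gamma> s \<longleftrightarrow> y \<in> box (- \<alpha>) \<alpha> \<and> \<gamma> y - s < t \<and> t < \<gamma> y"
proof -
  have "inj (\<lambda>z. c + R z)"
    using orthogonal_transformation_inj[OF assms] by (auto simp: inj_def)
  from inj_image_mem_iff[OF this, of "(y, t)"] show ?thesis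
    unfolding chart_layer_def by simp
qed

text \<open>\<open>segment_layer_bound\<close> on every vertical segment, integrated over the base.
  The derivative along a segment is controlled by the full gradient because \<open>R (0, 1)\<close>
  is a unit vector.\<close>

lemma chart_layer_nn_bound:
  fixes R :: "'n::euclidean_space \<times> real \<Rightarrow> 'n \<times> real"
  assumes R: "orthogonal_transformation R" and \<gamma>: "continuous_on UNIV \<gamma>" and \<psi>: "smooth \<psi>" and s: "0 < s"
  shows "(\<integral>\<^sup>+z. ennreal ((\<psi> z)\<^sup>2) * indicator (chart_layer R c \<alpha> \<gamma> s) z \<partial>lborel)
    \<le> ennreal (2 * s) * (\<integral>\<^sup>+y. ennreal ((\<psi> (c + R (y, \<gamma> y)))\<^sup>2) * indicator (box (- \<alpha>) \<alpha>) y \<partial>lborel)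
      + ennreal (2 * s\<^sup>2) * (\<integral>\<^sup>+z. ennreal ((norm (grad \<psi> z))\<^sup>2) * indicator (chart_layer R c \<alpha> \<gamma> s) z \<partial>lborel)"
proof -
  let ?L = "chart_layer R c \<alpha> \<gamma> s" and ?B = "box (- \<alpha>) \<alpha>"
  have Rlin: "linear R" using R by (rule orthogonal_transformation_linear)
  have Rc: "continuous_on UNIV R" using Rlin by (simp add: linear_continuous_on linear_conv_bounded_linear)
  have cP: "continuous_on UNIV (\<lambda>y. \<psi> (c + R (y, \<gamma> y)))"
    by (intro continuous_on_compose2[OF smooth_continuous[OF \<psi>, of UNIV]] continuous_intros continuous_on_compose2[OF Rc] \<gamma>) auto
  have [measurable]: "R \<in> borel_measurable borel" "\<gamma> \<in> borel_measurable borel" "\<psi> \<in> borel_measurable borel" "grad \<psi> \<in> borel_measurable borel"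
    using Rc \<gamma> \<psi> by (auto intro!: borel_measurable_continuous_onI smooth_continuous smooth_continuous_grad)
  have [measurable]: "?L \<in> sets borel" using open_chart_layer[OF R \<gamma>] by (rule borel_open)
  have [measurable]: "(\<lambda>y. \<psi> (c + R (y, \<gamma> y))) \<in> borel_measurable borel" using cP by (rule borel_measurable_continuous_onI)
  have e: "c + R (y, t) = c + R (y, 0) + t *\<^sub>R R (0, 1)" for y t
  proof -
    have "(y, t) = (y, 0) + t *\<^sub>R (0, 1)" by simp
    then have "R (y, t) = R (y, 0) + t *\<^sub>R R (0, 1)"
      by (metis linear_add[OF Rlin] linear_cmul[OF Rlin])
    then show ?thesis by simp
  qed
  have n1: "norm (R (0, 1)) = 1" using orthogonal_transformation_norm[OF R] by (simp add: norm_Pair)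
  have line: "(\<integral>\<^sup>+t. ennreal ((\<psi> (c + R (y, t)))\<^sup>2) * indicator ?L (c + R (y, t)) \<partial>lborel)
     \<le> ennreal (2 * s) * (ennreal ((\<psi> (c + R (y, \<gamma> y)))\<^sup>2) * indicator ?B y)
       + ennreal (2 * s\<^sup>2) * (\<integral>\<^sup>+t. ennreal ((norm (grad \<psi> (c + R (y, t))))\<^sup>2) * indicator ?L (c + R (y, t)) \<partial>lborel)" for y
  proof (cases "y \<in> ?B")
    case False
    then have "indicator ?L (c + R (y, t)) = (0 :: ennreal)" for t by (simp add: mem_chart_layer[OF R])
    then show ?thesis by simp
  next
    case True
    then have ind: "indicator ?L (c + R (y, t)) = (indicator {\<gamma> y - s<..<\<gamma> y} t :: ennreal)" for t
      by (simp add: mem_chart_layer[OF R] indicator_def)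
    define p where "p = c + R (y, 0)"
    have e': "c + R (y, t) = p + t *\<^sub>R R (0, 1)" for t unfolding p_def by (rule e)
    let ?h = "\<lambda>t. \<psi> (c + R (y, t))" and ?h' = "\<lambda>t. grad \<psi> (c + R (y, t)) \<bullet> R (0, 1)"
    have "(\<integral>\<^sup>+t. ennreal ((?h t)\<^sup>2) * indicator {\<gamma> y - s<..<\<gamma> y} t \<partial>lborel)
      \<le> ennreal (2 * s) * ennreal ((?h (\<gamma> y))\<^sup>2) + ennreal (2 * s\<^sup>2) * (\<integral>\<^sup>+t. ennreal ((?h' t)\<^sup>2) * indicator {\<gamma> y - s<..<\<gamma> y} t \<partial>lborel)"
    proof (rule segment_layer_bound[OF s])
      show "(?h has_real_derivative ?h' t) (at t)" for t
        unfolding e' by (rule line_deriv[OF \<psi>])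
      show "continuous_on UNIV ?h'"
        unfolding e' by (intro continuous_intros continuous_on_compose2[OF smooth_continuous_grad[OF \<psi>, of UNIV]]) auto
    qed
    also have "(\<integral>\<^sup>+t. ennreal ((?h' t)\<^sup>2) * indicator {\<gamma> y - s<..<\<gamma> y} t \<partial>lborel)
      \<le> (\<integral>\<^sup>+t. ennreal ((norm (grad \<psi> (c + R (y, t))))\<^sup>2) * indicator {\<gamma> y - s<..<\<gamma> y} t \<partial>lborel)"
    proof (intro nn_integral_mono mult_right_mono ennreal_leI)
      fix t
      have "\<bar>?h' t\<bar> \<le> norm (grad \<psi> (c + R (y, t)))"
        using Cauchy_Schwarz_ineq2[of "grad \<psi> (c + R (y, t))" "R (0, 1)"] n1 by simp
      then show "(?h' t)\<^sup>2 \<le> (norm (grad \<psi> (c + R (y, t))))\<^sup>2" by (metis abs_le_square_iff abs_norm_cancel)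
    qed simp
    finally show ?thesis using True by (simp add: ind add_left_mono mult_left_mono)
  qed
  have "(\<integral>\<^sup>+z. ennreal ((\<psi> z)\<^sup>2) * indicator ?L z \<partial>lborel)
     = (\<integral>\<^sup>+y. (\<integral>\<^sup>+t. ennreal ((\<psi> (c + R (y, t)))\<^sup>2) * indicator ?L (c + R (y, t)) \<partial>lborel) \<partial>lborel)"
    by (rule nn_integral_chart[OF R]) measurable
  also have "\<dots> \<le> (\<integral>\<^sup>+y. ennreal (2 * s) * (ennreal ((\<psi> (c + R (y, \<gamma> y)))\<^sup>2) * indicator ?B y)
       + ennreal (2 * s\<^sup>2) * (\<integral>\<^sup>+t. ennreal ((norm (grad \<psi> (c + R (y, t))))\<^sup>2) * indicator ?L (c + R (y, t)) \<partial>lborel) \<partial>lborel)"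
    by (rule nn_integral_mono) (rule line)
  also have "\<dots> = (\<integral>\<^sup>+y. ennreal (2 * s) * (ennreal ((\<psi> (c + R (y, \<gamma> y)))\<^sup>2) * indicator ?B y) \<partial>lborel)
       + (\<integral>\<^sup>+y. ennreal (2 * s\<^sup>2) * (\<integral>\<^sup>+t. ennreal ((norm (grad \<psi> (c + R (y, t))))\<^sup>2) * indicator ?L (c + R (y, t)) \<partial>lborel) \<partial>lborel)"
    by (rule nn_integral_add) measurable
  also have "(\<integral>\<^sup>+y. ennreal (2 * s) * (ennreal ((\<psi> (c + R (y, \<gamma> y)))\<^sup>2) * indicator ?B y) \<partial>lborel)
     = ennreal (2 * s) * (\<integral>\<^sup>+y. ennreal ((\<psi> (c + R (y, \<gamma> y)))\<^sup>2) * indicator ?B y \<partial>lborel)"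
    by (rule nn_integral_cmult) measurable
  also have "(\<integral>\<^sup>+y. ennreal (2 * s\<^sup>2) * (\<integral>\<^sup>+t. ennreal ((norm (grad \<psi> (c + R (y, t))))\<^sup>2) * indicator ?L (c + R (y, t)) \<partial>lborel) \<partial>lborel)
     = ennreal (2 * s\<^sup>2) * (\<integral>\<^sup>+y. (\<integral>\<^sup>+t. ennreal ((norm (grad \<psi> (c + R (y, t))))\<^sup>2) * indicator ?L (c + R (y, t)) \<partial>lborel) \<partial>lborel)"
    by (rule nn_integral_cmult) measurable
  also have "(\<integral>\<^sup>+y. (\<integral>\<^sup>+t. ennreal ((norm (grad \<psi> (c + R (y, t))))\<^sup>2) * indicator ?L (c + R (y, t)) \<partial>lborel) \<partial>lborel)
     = (\<integral>\<^sup>+z. ennreal ((norm (grad \<psi> z))\<^sup>2) * indicator ?L z \<partial>lborel)"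
    by (rule nn_integral_chart[OF R, symmetric]) measurable
  finally show ?thesis .
qed

lemma nrm_lebesgue_on_nn:
  fixes k :: "'a::euclidean_space \<Rightarrow> 'b::euclidean_space"
  assumes k: "sqint (lebesgue_on S) k" and S: "S \<in> sets borel" and km: "k \<in> borel_measurable borel"
  shows "(\<integral>\<^sup>+x. ennreal ((norm (k x))\<^sup>2) * indicator S x \<partial>lborel) = ennreal ((nrm (lebesgue_on S) k)\<^sup>2)"
proof -
  note [measurable] = S km
  have "ennreal ((nrm (lebesgue_on S) k)\<^sup>2) = (\<integral>\<^sup>+x. ennreal ((norm (k x))\<^sup>2) \<partial>lebesgue_on S)"
    using k by (simp add: nrm_power2 sqint_def nn_integral_eq_integral)
  also have "\<dots> = (\<integral>\<^sup>+x. ennreal ((norm (k x))\<^sup>2) * indicator S x \<partial>lebesgue)"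
    using S by (subst nn_integral_restrict_space) auto
  also have "\<dots> = (\<integral>\<^sup>+x. ennreal ((norm (k x))\<^sup>2) * indicator S x \<partial>lborel)"
    by (rule nn_integral_completion)
  finally show ?thesis ..
qed

lemma sqint_subset:
  fixes k :: "'a::euclidean_space \<Rightarrow> 'b::euclidean_space"
  assumes k: "sqint (lebesgue_on S) k" and "S \<in> sets lebesgue" "A \<in> sets lebesgue" "A \<subseteq> S"
  shows "sqint (lebesgue_on A) k" "nrm (lebesgue_on A) k \<le> nrm (lebesgue_on S) k"
proof -
  have i: "integrable (lebesgue_on S) (\<lambda>x. (norm (k x))\<^sup>2)" using k by (simp add: sqint_def)
  have "k \<in> borel_measurable (lebesgue_on A)"
    using sqint_measurable[OF k] assms(4) by (rule measurable_restrict_mono)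
  then show "sqint (lebesgue_on A) k"
    using integrable_lebesgue_on_subset[OF i assms(2-4)] by (simp add: sqint_def)
  have "(\<integral>x. (norm (k x))\<^sup>2 \<partial>lebesgue_on A) \<le> (\<integral>x. (norm (k x))\<^sup>2 \<partial>lebesgue_on S)"
    unfolding lebesgue_on_integral_eq[OF assms(2)] lebesgue_on_integral_eq[OF assms(3)]
    using i assms by (intro integral_mono') (auto simp: lebesgue_on_integrable_iff indicator_def)
  then show "nrm (lebesgue_on A) k \<le> nrm (lebesgue_on S) k" by (simp add: nrm_def)
qed

lemma chart_layer_subset:
  assumes ch: "boundary_chart \<Omega> R c \<alpha> h \<gamma>" and s: "0 < s" "s \<le> h / 2" and \<Omega>: "open \<Omega>"
  shows "chart_layer R c \<alpha> \<gamma> s \<subseteq> {x \<in> \<Omega>. infdist x (- \<Omega>) < s}"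
proof
  fix z assume "z \<in> chart_layer R c \<alpha> \<gamma> s"
  then obtain y t where z: "z = c + R (y, t)" and y: "y \<in> box (- \<alpha>) \<alpha>" and t: "\<gamma> y - s < t" "t < \<gamma> y"
    by (auto simp: chart_layer_def)
  have R: "orthogonal_transformation R" and "0 < h" and \<gamma>: "\<bar>\<gamma> y\<bar> \<le> h / 2"
    using ch y by (auto simp: boundary_chart_def)
  have iff: "c + R (y, t) \<in> \<Omega> \<longleftrightarrow> t < \<gamma> y" "c + R (y, t) \<in> frontier \<Omega> \<longleftrightarrow> t = \<gamma> y" if "t \<in> {-h<..<h}" for t
    using ch y that unfolding boundary_chart_def by blast+
  \<comment> \<open>The graph has height at most \<open>h / 2\<close> in absolute value and the
    layer is at most \<open>h / 2\<close> deep, so the segment stays in the range where the chart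
    describes \<Omega>.\<close>
  have "t \<in> {-h<..<h}" "\<gamma> y \<in> {-h<..<h}" using t s \<gamma> \<open>0 < h\<close> by auto
  then have "z \<in> \<Omega>" and p: "c + R (y, \<gamma> y) \<in> frontier \<Omega>" using iff t z by auto
  have "c + R (y, \<gamma> y) \<in> - \<Omega>" using p \<Omega> by (auto simp: frontier_def interior_open)
  then have "infdist z (- \<Omega>) \<le> dist z (c + R (y, \<gamma> y))" by (rule infdist_le)
  also have "\<dots> = norm (R (y, t) - R (y, \<gamma> y))" by (simp add: z dist_norm)
  also have "\<dots> = norm (R ((y, t) - (y, \<gamma> y)))"
    by (simp only: linear_diff[OF orthogonal_transformation_linear[OF R]])
  also have "\<dots> = \<bar>t - \<gamma> y\<bar>"
    using orthogonal_transformation_norm[OF R] by (simp add: norm_Pair)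
  also have "\<dots> < s" using t by auto
  finally show "z \<in> {x \<in> \<Omega>. infdist x (- \<Omega>) < s}" using \<open>z \<in> \<Omega>\<close> by simp
qed

lemma boundary_chartD:
  assumes "boundary_chart \<Omega> R c \<alpha> h \<gamma>"
  shows "orthogonal_transformation R" "continuous_on UNIV \<gamma>" "0 < h" "Ck 2 \<gamma>"
  using assms Ck_continuous by (auto simp: boundary_chart_def)

lemma pullback_continuous:
  assumes "orthogonal_transformation R" "continuous_on UNIV \<gamma>" "smooth \<psi>"
  shows "continuous_on UNIV (pullback R c \<gamma> \<psi>)"
proof -
  have Rc: "continuous_on UNIV R"
    using orthogonal_transformation_linear[OF assms(1)] by (simp add: linear_continuous_on linear_conv_bounded_linear)
  show ?thesis
    unfolding pullback_def
    by (intro continuous_on_compose2[OF smooth_continuous[OF assms(3), of UNIV]] continuous_intros continuous_on_compose2[OF Rc] assms(2)) auto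
qed

text \<open>A Poincare inequality across the layer for a function with zero trace. It is obtained as
  a limit from the smooth approximations, whose values on the graph tend to 0 and take the boundary
  term with them.\<close>

lemma chart_layer_L2_bound:
  fixes \<psi> :: "nat \<Rightarrow> 'n::euclidean_space \<times> real \<Rightarrow> real"
  assumes \<Omega>: "open \<Omega>" "bounded \<Omega>" and ch: "boundary_chart \<Omega> R c \<alpha> h \<gamma>" and s: "0 < s" "s \<le> h / 2"
    and w: "sqint (lebesgue_on \<Omega>) w" and W: "sqint (lebesgue_on \<Omega>) W"
    and \<psi>: "\<And>n. smooth (\<psi> n)" "(\<lambda>n. nrm (lebesgue_on \<Omega>) (\<lambda>x. w x - \<psi> n x)) \<longlonglongrightarrow> 0"
      "(\<lambda>n. nrm (lebesgue_on \<Omega>) (\<lambda>x. W x - grad (\<psi> n) x)) \<longlonglongrightarrow> 0"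
      "(\<lambda>n. nrm (lebesgue_on (box (- \<alpha>) \<alpha>)) (pullback R c \<gamma> (\<psi> n))) \<longlonglongrightarrow> 0"
  shows "nrm (lebesgue_on (chart_layer R c \<alpha> \<gamma> s)) w \<le> 2 * s * nrm (lebesgue_on (chart_layer R c \<alpha> \<gamma> s)) W"
proof -
  let ?L = "chart_layer R c \<alpha> \<gamma> s" and ?B = "box (- \<alpha>) \<alpha>"
  note chD = boundary_chartD[OF ch]
  have oL: "open ?L" using chD by (intro open_chart_layer)
  have L\<Omega>: "?L \<subseteq> \<Omega>" using chart_layer_subset[OF ch s \<Omega>(1)] by auto
  have Lm: "?L \<in> sets lebesgue" "\<Omega> \<in> sets lebesgue" "?L \<in> sets borel" using oL \<Omega> by auto
  have bL: "bounded ?L" using L\<Omega> \<Omega>(2) bounded_subset by blast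
  note sub = sqint_subset[OF _ Lm(2,1) L\<Omega>]
  have bound: "nrm (lebesgue_on ?L) (\<psi> n) \<le> sqrt (2 * s) * nrm (lebesgue_on ?B) (pullback R c \<gamma> (\<psi> n)) + sqrt 2 * s * nrm (lebesgue_on ?L) (grad (\<psi> n))" for n
  proof -
    have pc: "continuous_on UNIV (pullback R c \<gamma> (\<psi> n))"
      by (rule pullback_continuous[OF chD(1,2) \<psi>(1)])
    have sq: "sqint (lebesgue_on ?L) (\<psi> n)" "sqint (lebesgue_on ?L) (grad (\<psi> n))" "sqint (lebesgue_on ?B) (pullback R c \<gamma> (\<psi> n))"
      by (intro continuous_sqint oL bL open_box bounded_box smooth_continuous smooth_continuous_grad pc \<psi>(1))+
    have m: "\<psi> n \<in> borel_measurable borel" "grad (\<psi> n) \<in> borel_measurable borel" "pullback R c \<gamma> (\<psi> n) \<in> borel_measurable borel"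
      by (intro borel_measurable_continuous_onI smooth_continuous smooth_continuous_grad pc \<psi>(1))+
    define A where "A = nrm (lebesgue_on ?B) (pullback R c \<gamma> (\<psi> n))"
    define G where "G = nrm (lebesgue_on ?L) (grad (\<psi> n))"
    have nn: "0 \<le> A" "0 \<le> G" by (auto simp: A_def G_def nrm_nonneg)
    have "ennreal ((nrm (lebesgue_on ?L) (\<psi> n))\<^sup>2) \<le> ennreal (2 * s) * ennreal (A\<^sup>2) + ennreal (2 * s\<^sup>2) * ennreal (G\<^sup>2)"
      using chart_layer_nn_bound[OF chD(1,2) \<psi>(1) s(1), of n c \<alpha>]
        nrm_lebesgue_on_nn[OF sq(1) Lm(3) m(1)] nrm_lebesgue_on_nn[OF sq(2) Lm(3) m(2)]
        nrm_lebesgue_on_nn[OF sq(3) _ m(3)]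
      by (simp add: pullback_def A_def G_def)
    also have "\<dots> = ennreal (2 * s * A\<^sup>2 + 2 * s\<^sup>2 * G\<^sup>2)"
      using s by (simp add: ennreal_mult ennreal_plus)
    finally have "(nrm (lebesgue_on ?L) (\<psi> n))\<^sup>2 \<le> 2 * s * A\<^sup>2 + 2 * s\<^sup>2 * G\<^sup>2"
      using s by (subst (asm) ennreal_le_iff) auto
    also have "\<dots> \<le> (sqrt (2 * s) * A + sqrt 2 * s * G)\<^sup>2"
      using nn s by (simp add: power2_sum power_mult_distrib real_sqrt_mult)
    finally have "nrm (lebesgue_on ?L) (\<psi> n) \<le> sqrt (2 * s) * A + sqrt 2 * s * G"
      by (rule power2_le_imp_le) (use nn s in auto)
    then show ?thesis unfolding A_def G_def .
  qed
  have le: "nrm (lebesgue_on ?L) w \<le> nrm (lebesgue_on \<Omega>) (\<lambda>x. w x - \<psi> n x) + (sqrt (2 * s) * nrm (lebesgue_on ?B) (pullback R c \<gamma> (\<psi> n))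
      + sqrt 2 * s * (nrm (lebesgue_on ?L) W + nrm (lebesgue_on \<Omega>) (\<lambda>x. W x - grad (\<psi> n) x)))" for n
  proof -
    have sq: "sqint (lebesgue_on \<Omega>) (\<psi> n)" "sqint (lebesgue_on \<Omega>) (grad (\<psi> n))"
      using \<psi>(1) by (auto intro!: continuous_sqint \<Omega> smooth_continuous smooth_continuous_grad)
    have "nrm (lebesgue_on ?L) w \<le> nrm (lebesgue_on ?L) (\<lambda>x. w x - \<psi> n x) + nrm (lebesgue_on ?L) (\<psi> n)"
      using nrm_triangle[OF sub(1)[OF sqint_diff[OF w sq(1)]] sub(1)[OF sq(1)]] by simp
    moreover have "nrm (lebesgue_on ?L) (\<lambda>x. w x - \<psi> n x) \<le> nrm (lebesgue_on \<Omega>) (\<lambda>x. w x - \<psi> n x)"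
      by (rule sub(2)[OF sqint_diff[OF w sq(1)]])
    moreover have "nrm (lebesgue_on ?L) (grad (\<psi> n)) \<le> nrm (lebesgue_on ?L) W + nrm (lebesgue_on \<Omega>) (\<lambda>x. W x - grad (\<psi> n) x)"
      using nrm_triangle_diff[OF sub(1)[OF W] sub(1)[OF sqint_diff[OF W sq(2)]]]
        sub(2)[OF sqint_diff[OF W sq(2)]] by simp
    then have "sqrt 2 * s * nrm (lebesgue_on ?L) (grad (\<psi> n)) \<le> sqrt 2 * s * (nrm (lebesgue_on ?L) W + nrm (lebesgue_on \<Omega>) (\<lambda>x. W x - grad (\<psi> n) x))"
      using s by (intro mult_left_mono) auto
    ultimately show ?thesis using bound[of n] by linarith
  qed
  have "(\<lambda>n. nrm (lebesgue_on \<Omega>) (\<lambda>x. w x - \<psi> n x) + (sqrt (2 * s) * nrm (lebesgue_on ?B) (pullback R c \<gamma> (\<psi> n))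
      + sqrt 2 * s * (nrm (lebesgue_on ?L) W + nrm (lebesgue_on \<Omega>) (\<lambda>x. W x - grad (\<psi> n) x))))
      \<longlonglongrightarrow> 0 + (sqrt (2 * s) * 0 + sqrt 2 * s * (nrm (lebesgue_on ?L) W + 0))"
    by (intro tendsto_intros \<psi>(2,3,4))
  from LIMSEQ_le_const[OF this] le
  have "nrm (lebesgue_on ?L) w \<le> sqrt 2 * s * nrm (lebesgue_on ?L) W" by auto
  also have "\<dots> \<le> 2 * s * nrm (lebesgue_on ?L) W"
    using s sqrt2_less_2 by (intro mult_right_mono) (auto simp: nrm_nonneg)
  finally show ?thesis .
qed

section \<open>Cutoff functions\<close>

lemma integral_lborel_scale:
  fixes g :: "'a::euclidean_space \<Rightarrow> real"
  assumes g: "g \<in> borel_measurable borel" and r: "0 < r"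
  shows "(\<integral>x. g ((1 / r) *\<^sub>R x) \<partial>lborel) = r ^ DIM('a) * (\<integral>x. g x \<partial>lborel)"
proof -
  note g[measurable]
  let ?D = "distr lborel borel (\<lambda>x::'a. 0 + r *\<^sub>R x)"
  have "lborel = density ?D (\<lambda>_. ennreal (r ^ DIM('a)))"
    using lborel_affine[of r "0::'a"] r by simp
  then have "(\<integral>x. g ((1 / r) *\<^sub>R x) \<partial>lborel) = (\<integral>x. g ((1 / r) *\<^sub>R x) \<partial>density ?D (\<lambda>_. ennreal (r ^ DIM('a))))"
    by (rule arg_cong)
  also have "\<dots> = (\<integral>x. r ^ DIM('a) *\<^sub>R g ((1 / r) *\<^sub>R x) \<partial>?D)"
    using r by (intro integral_density) auto
  also have "\<dots> = (\<integral>x. r ^ DIM('a) *\<^sub>R g ((1 / r) *\<^sub>R (0 + r *\<^sub>R x)) \<partial>lborel)"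
    by (rule integral_distr) measurable
  finally show ?thesis using r by simp
qed

lemma integrable_zero_outside:
  fixes g :: "'a::euclidean_space \<Rightarrow> real"
  assumes "continuous_on UNIV g" "\<And>x. R \<le> norm x \<Longrightarrow> g x = 0"
  shows "integrable lborel g"
proof -
  have "integrable lborel (\<lambda>y. (\<lambda>z. g (- z)) (0 - y) * 1)"
    by (rule conv_integrable[of _ R])
      (auto intro!: continuous_on_compose2[OF assms(1), of _ uminus] continuous_intros assms(2))
  then show ?thesis by simp
qed

text \<open>Mollify the indicator of the points at distance at least \<open>2 * r\<close> from the
  complement with a kernel of radius \<open>r\<close>: the support stays at distance at least
  \<open>r\<close>, and the value is 1 from distance \<open>3 * r\<close> on. The kernels for
  different \<open>r\<close> are rescalings of one bump \<rho>, which makes \<open>C\<close>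
  independent of \<open>r\<close>.\<close>

lemma cutoff_functions:
  fixes \<Omega> :: "'a::euclidean_space set"
  assumes \<Omega>: "open \<Omega>" "bounded \<Omega>"
  obtains C where "0 \<le> C" "\<And>r. 0 < r \<Longrightarrow> \<exists>\<eta>\<in>test_functions \<Omega>. (\<forall>x. 0 \<le> \<eta> x \<and> \<eta> x \<le> 1) \<and>
      (\<forall>x. 3 * r \<le> infdist x (- \<Omega>) \<longrightarrow> \<eta> x = 1 \<and> grad \<eta> x = 0) \<and> (\<forall>x. norm (grad \<eta> x) \<le> C / r)"
proof -
  have ne: "- \<Omega> \<noteq> {}" using \<Omega>(2) not_bounded_UNIV by (metis Compl_UNIV_eq double_complement)
  obtain l u where lu: "(0::'a) \<in> box l u" "box l u \<subseteq> ball 0 1"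
    using rational_boxes[of 1 "0::'a"] by auto
  define \<rho> where "\<rho> = bump 1 l u"
  have \<rho>: "\<rho> \<in> test_functions UNIV" unfolding \<rho>_def by (rule bump_test_function) auto
  have \<rho>0: "0 \<le> \<rho> x" for x by (simp add: \<rho>_def bump_bounds)
  have \<rho>supp: "norm x < 1" if "\<rho> x \<noteq> 0" for x
    using that lu(2) bump_nonzero[of 1 l u x] by (auto simp: \<rho>_def)
  have c\<rho>: "continuous_on UNIV \<rho>" "\<And>b. b \<in> Basis \<Longrightarrow> continuous_on UNIV (partial b \<rho>)"
    using test_smooth[OF \<rho>] by (auto intro: smooth_continuous smooth_partial)
  have m\<rho>[measurable]: "\<rho> \<in> borel_measurable borel" using c\<rho>(1) by (rule borel_measurable_continuous_onI)
  have m\<rho>b: "partial b \<rho> \<in> borel_measurable borel" if "b \<in> Basis" for b using c\<rho>(2)[OF that] by (rule borel_measurable_continuous_onI)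
  have int1: "integrable lborel (\<lambda>y. \<phi> (x - y) * k y)"
    if t: "\<phi> \<in> test_functions UNIV" "k \<in> borel_measurable borel" "\<And>y. \<bar>k y\<bar> \<le> 1" for \<phi> k and x :: 'a
  proof -
    obtain R where "\<And>x. R \<le> norm x \<Longrightarrow> \<phi> x = 0" using test_support_ball[OF t(1)] by metis
    then show ?thesis by (intro conv_integrable[of \<phi> R] smooth_continuous test_smooth[OF t(1)] t(2,3))
  qed
  define I where "I = (\<integral>x. \<rho> x \<partial>lborel)"
  have "integrable lborel \<rho>"
    by (rule integrable_zero_outside[OF c\<rho>(1), of 1]) (use \<rho>supp in fastforce)
  \<comment> \<open>A nonnegative function with integral 0 would vanish a.e., but \<rho> is positive
    on a nonempty open box.\<close>
  then have "I \<noteq> 0"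
  proof -
    assume i: "integrable lborel \<rho>"
    show "I \<noteq> 0"
    proof
      assume "I = 0"
      then have "AE x in lborel. \<rho> x = 0"
        using integral_nonneg_eq_0_iff_AE[OF i] \<rho>0 by (auto simp: I_def)
      then have "AE x in lborel. x \<notin> box l u"
        by eventually_elim (use bump_nonzero[of 1 l u] in \<open>auto simp: \<rho>_def\<close>)
      then have "box l u \<in> null_sets lborel" by (simp add: AE_iff_null_sets)
      then have "negligible (box l u)" by (simp add: negligible_iff_null_sets null_sets_completionI)
      then show False using lu(1) open_not_negligible[of "box l u"] by auto
    qed
  qed
  moreover have "0 \<le> I" unfolding I_def using \<rho>0 by (intro integral_nonneg_AE) auto
  ultimately have I: "0 < I" by simp
  define J where "J b = (\<integral>x. \<bar>partial b \<rho> x\<bar> \<partial>lborel)" for b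
  have J0: "0 \<le> J b" for b by (simp add: J_def)
  \<comment> \<open>The partial derivatives of the normalised kernel of radius \<open>r\<close> have
    L1 norm \<open>J b / I / r\<close>: the powers of \<open>r\<close> from substitution and
    normalisation cancel, and the chain rule leaves \<open>1 / r\<close>.\<close>
  define C where "C = (\<Sum>b\<in>Basis. J b) / I"
  show ?thesis
  proof (rule that[of C])
    show "0 \<le> C" using I J0 by (auto simp: C_def intro!: divide_nonneg_pos sum_nonneg)
    fix r :: real assume r: "0 < r"
    define \<rho>r where "\<rho>r x = \<rho> ((1 / r) *\<^sub>R x)" for x
    have \<rho>rsupp: "norm x < r" if "\<rho>r x \<noteq> 0" for x
      using \<rho>supp[of "(1 / r) *\<^sub>R x"] that r by (simp add: \<rho>r_def field_simps)
    have cl: "closure {x. \<rho>r x \<noteq> 0} \<subseteq> cball 0 r"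
    proof (rule closure_minimal)
      show "{x. \<rho>r x \<noteq> 0} \<subseteq> cball 0 r" using \<rho>rsupp less_imp_le by (fastforce simp: mem_cball)
    qed simp
    have \<rho>r: "\<rho>r \<in> test_functions UNIV"
    proof -
      have "smooth \<rho>r"
        using test_smooth[OF \<rho>] Ck_affine[of _ \<rho> "1 / r" 0] by (simp add: smooth_def \<rho>r_def[abs_def])
      moreover have "compact (closure {x. \<rho>r x \<noteq> 0})"
        using cl compact_eq_bounded_closed bounded_subset[OF bounded_cball] by blast
      ultimately show ?thesis by (simp add: test_functions_def)
    qed
    have prt: "partial b \<rho>r x = (1 / r) * partial b \<rho> ((1 / r) *\<^sub>R x)" for b x
      using partial_affine[of \<rho> b "1 / r" 0 x] smooth_differentiable[OF test_smooth[OF \<rho>]] by (simp add: \<rho>r_def[abs_def])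
    have psupp: "norm x \<le> r" if "partial b \<rho>r x \<noteq> 0" for b x
    proof -
      have "x \<in> closure {x. \<rho>r x \<noteq> 0}" using grad_zero_outside(1)[of x \<rho>r b] that by blast
      then have "x \<in> cball 0 r" using cl by blast
      then show ?thesis by simp
    qed
    have m[measurable]: "\<rho>r \<in> borel_measurable borel"
      using smooth_continuous[OF test_smooth[OF \<rho>r]] by (rule borel_measurable_continuous_onI)
    have mb: "partial b \<rho>r \<in> borel_measurable borel" if "b \<in> Basis" for b
      using smooth_continuous[OF smooth_partial[OF test_smooth[OF \<rho>r] that]] by (rule borel_measurable_continuous_onI)
    define A where "A = {x. 2 * r \<le> infdist x (- \<Omega>)}"
    have "closed A" unfolding A_def by (intro closed_Collect_le continuous_intros)
    define k :: "'a \<Rightarrow> real" where "k = indicator A"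
    have k: "k \<in> borel_measurable borel" "\<And>y. \<bar>k y\<bar> \<le> 1"
      unfolding k_def using \<open>closed A\<close> by (auto intro!: borel_measurable_indicator simp: indicator_def)
    define N where "N = r ^ DIM('a) * I"
    have N: "0 < N" using r I by (simp add: N_def)
    have intr: "(\<integral>y. \<rho>r (x - y) \<partial>lborel) = N" for x
      using integral_lborel_reflect[OF m] integral_lborel_scale[OF m\<rho> r] by (simp add: \<rho>r_def N_def I_def)
    have near: "infdist x (- \<Omega>) \<le> infdist y (- \<Omega>) + r" if "norm (x - y) \<le> r" for x y
      using infdist_triangle[of x "- \<Omega>" y] that by (simp add: dist_norm)
    define \<eta> where "\<eta> x = (1 / N) * conv k \<rho>r x" for x
    have sm: "smooth \<eta>"
      unfolding \<eta>_def[abs_def] by (intro smooth_mult smooth_const smooth_conv \<rho>r k)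
    have \<eta>0: "0 \<le> \<eta> x" for x
      unfolding \<eta>_def conv_def using N \<rho>0 by (auto intro!: mult_nonneg_nonneg integral_nonneg_AE simp: k_def \<rho>r_def)
    have \<eta>1: "\<eta> x \<le> 1" for x
    proof -
      have "conv k \<rho>r x \<le> (\<integral>y. \<rho>r (x - y) * 1 \<partial>lborel)"
        unfolding conv_def
        by (intro integral_mono int1 \<rho>r k) (auto simp: k_def \<rho>r_def indicator_def \<rho>0)
      then show ?thesis using intr[of x] N by (simp add: \<eta>_def field_simps)
    qed
    have supp: "r \<le> infdist x (- \<Omega>)" if "\<eta> x \<noteq> 0" for x
    proof (rule ccontr)
      assume "\<not> r \<le> infdist x (- \<Omega>)"
      then have "\<rho>r (x - y) * k y = 0" for y
        using near[of y x] \<rho>rsupp[of "x - y"] by (cases "\<rho>r (x - y) = 0") (auto simp: k_def A_def indicator_def norm_minus_commute)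
      then have "conv k \<rho>r x = (\<integral>y. 0 \<partial>(lborel :: 'a measure))" unfolding conv_def by (simp only:)
      then show False using that by (simp add: \<eta>_def)
    qed
    have cs: "closure {x. \<eta> x \<noteq> 0} \<subseteq> {x. r \<le> infdist x (- \<Omega>)}"
      using supp by (intro closure_minimal closed_Collect_le continuous_intros) auto
    also have "\<dots> \<subseteq> \<Omega>" using r by (auto intro: ccontr)
    finally have cs\<Omega>: "closure {x. \<eta> x \<noteq> 0} \<subseteq> \<Omega>" .
    have "\<eta> \<in> test_functions \<Omega>"
      using sm cs\<Omega> bounded_subset[OF \<Omega>(2) cs\<Omega>] by (auto simp: test_functions_def compact_eq_bounded_closed)
    moreover have pchi: "partial b \<eta> x = (1 / N) * conv k (partial b \<rho>r) x" if "b \<in> Basis" for b x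
    proof -
      have "partial b \<eta> x = (1 / N) * partial b (conv k \<rho>r) x + partial b (\<lambda>x. 1 / N) x * conv k \<rho>r x"
        unfolding \<eta>_def[abs_def] using smooth_differentiable[OF smooth_const] smooth_differentiable[OF smooth_conv[OF \<rho>r k]]
        by (intro partial_mult) auto
      also have "partial b (\<lambda>x. 1 / N) x = 0" by (simp add: partial_def)
      finally show ?thesis using partial_conv[OF \<rho>r k that] by simp
    qed
    moreover have "\<eta> x = 1 \<and> grad \<eta> x = 0" if x: "3 * r \<le> infdist x (- \<Omega>)" for x
    proof
      have kk: "k y = 1" if "norm (x - y) \<le> r" for y
        using near[OF that] x by (simp add: k_def A_def indicator_def)
      have "\<rho>r (x - y) * k y = \<rho>r (x - y)" for y
        using kk[of y] \<rho>rsupp[of "x - y"] by (cases "\<rho>r (x - y) = 0") auto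
      then have "conv k \<rho>r x = N" unfolding conv_def using intr[of x] by (simp only:)
      then show "\<eta> x = 1" using N by (simp add: \<eta>_def)
      \<comment> \<open>The point may lie on the edge of the region where \<eta> is known to be 1,
        so the gradient is read off from the convolution: only values \<open>k = 1\<close> meet the
        kernel, whose derivative has integral 0.\<close>
      have "partial b \<eta> x = 0" if b: "b \<in> Basis" for b
      proof -
        have "partial b \<rho>r (x - y) * k y = partial b \<rho>r (x - y)" for y
          using kk[of y] psupp[of b "x - y"] by (cases "partial b \<rho>r (x - y) = 0") auto
        then have "conv k (partial b \<rho>r) x = (\<integral>y. partial b \<rho>r (x - y) \<partial>lborel)" unfolding conv_def by (simp only:)
        also have "\<dots> = 0" using integral_lborel_reflect[OF mb[OF b]] integral_partial_zero[OF \<rho>r b] by simp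
        finally show ?thesis using pchi[OF b] by simp
      qed
      then show "grad \<eta> x = 0" by (simp add: grad_def)
    qed
    moreover have "norm (grad \<eta> x) \<le> C / r" for x
    proof -
      have pb: "\<bar>partial b \<eta> x\<bar> \<le> J b / I / r" if b: "b \<in> Basis" for b
      proof -
        have tb: "partial b \<rho>r \<in> test_functions UNIV" using \<rho>r b by (rule test_partial)
        have mab: "(\<lambda>z. \<bar>partial b \<rho> z\<bar>) \<in> borel_measurable borel" "(\<lambda>z. \<bar>partial b \<rho>r z\<bar>) \<in> borel_measurable borel"
          using m\<rho>b[OF b] mb[OF b] by measurable
        have "\<bar>conv k (partial b \<rho>r) x\<bar> \<le> (\<integral>y. \<bar>partial b \<rho>r (x - y) * k y\<bar> \<partial>lborel)"
          unfolding conv_def by (rule integral_abs_bound)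
        also have "\<dots> \<le> (\<integral>y. \<bar>partial b \<rho>r (x - y) * 1\<bar> \<partial>lborel)"
          by (intro integral_mono integrable_abs int1 tb k) (auto simp: k_def indicator_def)
        also have "\<dots> = (\<integral>y. \<bar>partial b \<rho>r y\<bar> \<partial>lborel)"
          using integral_lborel_reflect[OF mab(2), of x] by simp
        also have "\<dots> = (1 / r) * (\<integral>y. \<bar>partial b \<rho> ((1 / r) *\<^sub>R y)\<bar> \<partial>lborel)"
          using r by (simp add: prt abs_mult)
        also have "\<dots> = (1 / r) * (r ^ DIM('a) * J b)"
          using integral_lborel_scale[OF mab(1) r] by (simp add: J_def)
        finally have "(1 / N) * \<bar>conv k (partial b \<rho>r) x\<bar> \<le> (1 / N) * ((1 / r) * (r ^ DIM('a) * J b))"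
          using N by (intro mult_left_mono) auto
        also have "\<dots> = J b / I / r" using r I by (simp add: N_def)
        finally show ?thesis using pchi[OF b, of x] N by (simp add: abs_mult)
      qed
      have "norm (grad \<eta> x) \<le> (\<Sum>b\<in>Basis. \<bar>grad \<eta> x \<bullet> b\<bar>)" by (rule norm_le_l1)
      also have "\<dots> \<le> (\<Sum>b\<in>Basis. J b / I / r)" using pb by (intro sum_mono) (simp add: grad_inner_Basis)
      also have "\<dots> = C / r" by (simp add: C_def sum_divide_distrib)
      finally show ?thesis .
    qed
    ultimately show "\<exists>\<eta>\<in>test_functions \<Omega>. (\<forall>x. 0 \<le> \<eta> x \<and> \<eta> x \<le> 1) \<and>
      (\<forall>x. 3 * r \<le> infdist x (- \<Omega>) \<longrightarrow> \<eta> x = 1 \<and> grad \<eta> x = 0) \<and> (\<forall>x. norm (grad \<eta> x) \<le> C / r)"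
      using \<eta>0 \<eta>1 by (intro bexI[of _ \<eta>]) auto
  qed
qed

section \<open>Covering the layer along the boundary by finitely many charts\<close>

lemma Ck_Suc_Lipschitz:
  fixes \<gamma> :: "'a::euclidean_space \<Rightarrow> real"
  assumes \<gamma>: "Ck (Suc k) \<gamma>"
  obtains B where "0 \<le> B" "\<And>y y'. y \<in> cbox l u \<Longrightarrow> y' \<in> cbox l u \<Longrightarrow> \<bar>\<gamma> y - \<gamma> y'\<bar> \<le> B * norm (y - y')"
proof -
  have "continuous_on UNIV (grad \<gamma>)"
    unfolding grad_def[abs_def] using \<gamma> Ck_continuous by (intro continuous_intros) auto
  then have "bounded (grad \<gamma> ` cbox l u)"
    by (intro compact_imp_bounded compact_continuous_image compact_cbox) (rule continuous_on_subset, auto)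
  then obtain B where B: "B > 0" "\<And>y. y \<in> cbox l u \<Longrightarrow> norm (grad \<gamma> y) \<le> B"
    unfolding bounded_pos by auto
  have "norm (\<gamma> y - \<gamma> y') \<le> B * norm (y - y')" if "y \<in> cbox l u" "y' \<in> cbox l u" for y y'
  proof (rule differentiable_bound[where S = "cbox l u" and f = \<gamma> and f' = "\<lambda>x h. grad \<gamma> x \<bullet> h" and B = B, OF _ _ _ that])
    show "convex (cbox l u)" by (rule convex_box)
  next
    fix x assume x: "x \<in> cbox l u"
    show "(\<gamma> has_derivative (\<lambda>h. grad \<gamma> x \<bullet> h)) (at x within cbox l u)"
      by (rule has_derivative_at_withinI, rule has_derivative_partial) (use \<gamma> in simp)
    show "onorm (\<lambda>h. grad \<gamma> x \<bullet> h) \<le> B"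
    proof (rule onorm_le)
      fix h
      show "norm (grad \<gamma> x \<bullet> h) \<le> B * norm h"
        using Cauchy_Schwarz_ineq2[of "grad \<gamma> x" h] mult_right_mono[OF B(2)[OF x], of "norm h"] by simp
    qed
  qed
  then show ?thesis using B(1) that[of B] by simp
qed

text \<open>The distance to the closed complement is attained, and the segment to a nearest point of
  the complement crosses the frontier no farther away.\<close>

lemma nearest_frontier_point:
  fixes \<Omega> :: "'a::euclidean_space set"
  assumes \<Omega>: "open \<Omega>" "- \<Omega> \<noteq> {}" and x: "x \<in> \<Omega>" "infdist x (- \<Omega>) < r"
  obtains p where "p \<in> frontier \<Omega>" "dist x p < r"
proof -
  obtain a where a: "a \<in> - \<Omega>" "infdist x (- \<Omega>) = dist x a"
    using infdist_attains_inf[of "- \<Omega>" x] \<Omega> by (auto simp: closed_Compl)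
  have "closed_segment x a \<inter> frontier \<Omega> \<noteq> {}"
    by (rule connected_Int_frontier) (use x a in auto)
  then obtain p where p: "p \<in> closed_segment x a" "p \<in> frontier \<Omega>" by auto
  have "dist x p \<le> dist x a" using segment_bound(1)[OF p(1)] by (simp add: dist_norm norm_minus_commute)
  then show ?thesis using that p(2) a x by auto
qed

text \<open>By compactness finitely many balls of half the admissible radius cover \<open>S\<close>;
  the other half leaves room for a ball around any point of theirs.\<close>

lemma Lebesgue_number_ball:
  fixes S :: "'a::metric_space set"
  assumes S: "compact S" and cov: "S \<subseteq> \<Union>\<C>" and op: "\<And>V. V \<in> \<C> \<Longrightarrow> open V"
  shows "\<exists>e>0. \<forall>x\<in>S. \<exists>V\<in>\<C>. ball x e \<subseteq> V"
proof -
  have "\<exists>d>0. \<exists>V\<in>\<C>. ball x (2 * d) \<subseteq> V" if xS: "x \<in> S" for x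
  proof -
    obtain V where V: "V \<in> \<C>" "x \<in> V" using cov xS by auto
    then obtain d where "d > 0" "ball x d \<subseteq> V" using op open_contains_ball by metis
    then show ?thesis using V(1) by (intro exI[of _ "d / 2"]) auto
  qed
  then obtain d where d: "\<And>x. x \<in> S \<Longrightarrow> d x > 0" "\<And>x. x \<in> S \<Longrightarrow> \<exists>V\<in>\<C>. ball x (2 * d x) \<subseteq> V" by metis
  have "S \<subseteq> (\<Union>x\<in>S. ball x (d x))" using d(1) by auto
  then obtain F where F: "F \<subseteq> S" "finite F" "S \<subseteq> (\<Union>x\<in>F. ball x (d x))"
    using compactE_image[OF S, of S "\<lambda>x. ball x (d x)"] by auto
  define e where "e = Min (insert 1 (d ` F))"
  have e: "0 < e" "\<And>x. x \<in> F \<Longrightarrow> e \<le> d x" using F d(1) by (auto simp: e_def)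
  show ?thesis
  proof (intro exI[of _ e] conjI ballI e(1))
    fix x assume "x \<in> S"
    then obtain z where z: "z \<in> F" "x \<in> ball z (d z)" using F(3) by auto
    have "ball x e \<subseteq> ball z (2 * d z)"
    proof
      fix y assume "y \<in> ball x e"
      then show "y \<in> ball z (2 * d z)" using z e(2)[OF z(1)] dist_triangle[of z y x] by auto
    qed
    moreover obtain V where "V \<in> \<C>" "ball z (2 * d z) \<subseteq> V" using d(2)[of z] F(1) z(1) by auto
    ultimately show "\<exists>V\<in>\<C>. ball x e \<subseteq> V" by (meson order_trans)
  qed
qed

text \<open>A point at distance less than \<open>3 * r\<close> from the complement has a frontier
  point \<open>p\<close> that close, and a Lebesgue number of the finite chart cover puts both into
  one chart. There their horizontal and vertical distances are below \<open>3 * r\<close>, and the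
  Lipschitz constant of \<gamma> converts these into a bound on the depth below the graph.\<close>

lemma boundary_layer_cover:
  fixes \<Omega> :: "('n::euclidean_space \<times> real) set"
  assumes \<Omega>: "open \<Omega>" "bounded \<Omega>" and C2: "C2_boundary \<Omega>"
  shows "\<exists>T K r0. finite T \<and> 0 < K \<and> 0 < r0 \<and>
    (\<forall>R c \<alpha> h \<gamma>. (R, c, \<alpha>, h, \<gamma>) \<in> T \<longrightarrow> boundary_chart \<Omega> R c \<alpha> h \<gamma> \<and> K * r0 \<le> h / 2) \<and>
    (\<forall>r. 0 < r \<longrightarrow> r \<le> r0 \<longrightarrow> {x \<in> \<Omega>. infdist x (- \<Omega>) < 3 * r} \<subseteq> (\<Union>(R, c, \<alpha>, h, \<gamma>)\<in>T. chart_layer R c \<alpha> \<gamma> (K * r)))"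
proof -
  have ne: "- \<Omega> \<noteq> {}" using \<Omega>(2) not_bounded_UNIV by (metis Compl_UNIV_eq double_complement)
  define S :: "(('n \<times> real \<Rightarrow> 'n \<times> real) \<times> ('n \<times> real) \<times> 'n \<times> real \<times> ('n \<Rightarrow> real)) set"
    where "S = {(R, c, \<alpha>, h, \<gamma>). boundary_chart \<Omega> R c \<alpha> h \<gamma>}"
  define U :: "(('n \<times> real \<Rightarrow> 'n \<times> real) \<times> ('n \<times> real) \<times> 'n \<times> real \<times> ('n \<Rightarrow> real)) \<Rightarrow> ('n \<times> real) set"
    where "U = (\<lambda>(R, c, \<alpha>, h, \<gamma>). (\<lambda>z. c + R z) ` (box (- \<alpha>) \<alpha> \<times> {-h<..<h}))"
  have oU: "open (U ch)" if "ch \<in> S" for ch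
    using that by (auto simp: S_def U_def split: prod.splits intro!: open_chart_image open_Times dest: boundary_chartD)
  have "compact (frontier \<Omega>)" using \<Omega> by (simp add: compact_frontier_bounded)
  moreover have "frontier \<Omega> \<subseteq> (\<Union>ch\<in>S. U ch)"
  proof
    fix x assume "x \<in> frontier \<Omega>"
    then obtain R c \<alpha> h \<gamma> where "boundary_chart \<Omega> R c \<alpha> h \<gamma>" "x \<in> (\<lambda>z. c + R z) ` (box (- \<alpha>) \<alpha> \<times> {-h<..<h})"
      using C2 unfolding C2_boundary_def by blast
    then have "(R, c, \<alpha>, h, \<gamma>) \<in> S" "x \<in> U (R, c, \<alpha>, h, \<gamma>)" by (auto simp: S_def U_def)
    then show "x \<in> (\<Union>ch\<in>S. U ch)" by blast
  qed
  ultimately obtain T where T: "T \<subseteq> S" "finite T" "frontier \<Omega> \<subseteq> (\<Union>ch\<in>T. U ch)"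
    using compactE_image[of "frontier \<Omega>" S U] oU by blast
  have oV: "open V" if "V \<in> U ` T" for V using that T(1) oU by auto
  obtain e where e: "e > 0" "\<And>x. x \<in> frontier \<Omega> \<Longrightarrow> \<exists>V\<in>U ` T. ball x e \<subseteq> V"
    using Lebesgue_number_ball[OF \<open>compact (frontier \<Omega>)\<close> T(3) oV] by blast
  have "\<exists>B\<ge>0. \<forall>y\<in>box (- \<alpha>) \<alpha>. \<forall>y'\<in>box (- \<alpha>) \<alpha>. \<bar>\<gamma> y - \<gamma> y'\<bar> \<le> B * norm (y - y')"
    if "(R, c, \<alpha>, h, \<gamma>) \<in> T" for R c \<alpha> h \<gamma>
  proof -
    have "Ck (Suc 1) \<gamma>" using that T(1) boundary_chartD(4) by (fastforce simp: S_def numeral_2_eq_2)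
    then show ?thesis
      using Ck_Suc_Lipschitz[of 1 \<gamma> "- \<alpha>" \<alpha>] box_subset_cbox[of "- \<alpha>" \<alpha>] by (metis subset_iff)
  qed
  then have "\<forall>ch\<in>T. \<exists>B\<ge>0. case ch of (R, c, \<alpha>, h, \<gamma>) \<Rightarrow> \<forall>y\<in>box (- \<alpha>) \<alpha>. \<forall>y'\<in>box (- \<alpha>) \<alpha>. \<bar>\<gamma> y - \<gamma> y'\<bar> \<le> B * norm (y - y')"
    by auto
  then obtain B where B: "\<And>ch. ch \<in> T \<Longrightarrow> 0 \<le> B ch"
    "\<And>R c \<alpha> h \<gamma> y y'. (R, c, \<alpha>, h, \<gamma>) \<in> T \<Longrightarrow> y \<in> box (- \<alpha>) \<alpha> \<Longrightarrow> y' \<in> box (- \<alpha>) \<alpha> \<Longrightarrow> \<bar>\<gamma> y - \<gamma> y'\<bar> \<le> B (R, c, \<alpha>, h, \<gamma>) * norm (y - y')"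
    by (subst (asm) bchoice_iff) fastforce
  \<comment> \<open>In a chart with Lipschitz constant \<open>B\<close> the depth is at most
    \<open>3 * r\<close> from the vertical distance plus \<open>B * (3 * r)\<close> from the
    variation of \<gamma>. The sum over all charts dominates each single constant.\<close>
  define K where "K = 3 * (1 + (\<Sum>ch\<in>T. B ch))"
  have K: "0 < K" using B(1) by (auto simp: K_def intro!: add_pos_nonneg sum_nonneg)
  have BK: "3 * (1 + B ch) \<le> K" if "ch \<in> T" for ch
    using member_le_sum[of ch T B] B(1) T(2) that by (auto simp: K_def)
  \<comment> \<open>The bound \<open>e / 3\<close> keeps \<open>x\<close> in the ball of radius
    \<open>e\<close> about \<open>p\<close>; \<open>h / (2 * K)\<close> keeps the depth
    \<open>K * r\<close> within \<open>h / 2\<close>, as the layer estimates demand.\<close>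
  define r0 where "r0 = Min (insert (e / 3) ((\<lambda>(R, c, \<alpha>, h, \<gamma>). h / (2 * K)) ` T))"
  have r0: "0 < r0" "r0 \<le> e / 3" "\<And>R c \<alpha> h \<gamma>. (R, c, \<alpha>, h, \<gamma>) \<in> T \<Longrightarrow> r0 \<le> h / (2 * K)"
  proof -
    have "0 < h" if "(R, c, \<alpha>, h, \<gamma>) \<in> T" for R c \<alpha> h \<gamma>
      using that T(1) boundary_chartD(3) by (fastforce simp: S_def)
    then show "0 < r0" using e(1) K T(2) by (auto simp: r0_def)
    show "r0 \<le> e / 3" unfolding r0_def using T(2) by (intro Min_le) auto
    show "r0 \<le> h / (2 * K)" if "(R, c, \<alpha>, h, \<gamma>) \<in> T" for R c \<alpha> h \<gamma>
      unfolding r0_def using T(2) that by (intro Min_le) (auto intro: rev_image_eqI)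
  qed
  show ?thesis
  proof (rule exI[of _ T], rule exI[of _ K], rule exI[of _ r0], intro conjI allI impI T(2) K r0(1))
    fix R c \<alpha> h \<gamma> assume ch: "(R, c, \<alpha>, h, \<gamma>) \<in> T"
    have "K * r0 \<le> K * (h / (2 * K))" using K r0(3)[OF ch] by (intro mult_left_mono) auto
    then show "K * r0 \<le> h / 2" using K by simp
    show "boundary_chart \<Omega> R c \<alpha> h \<gamma>" using ch T(1) by (auto simp: S_def)
  next
    fix r assume r: "0 < r" "r \<le> r0"
    show "{x \<in> \<Omega>. infdist x (- \<Omega>) < 3 * r} \<subseteq> (\<Union>(R, c, \<alpha>, h, \<gamma>)\<in>T. chart_layer R c \<alpha> \<gamma> (K * r))"
    proof
      fix x assume "x \<in> {x \<in> \<Omega>. infdist x (- \<Omega>) < 3 * r}"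
      then have x: "x \<in> \<Omega>" "infdist x (- \<Omega>) < 3 * r" by auto
      obtain p where p: "p \<in> frontier \<Omega>" "dist x p < 3 * r" using nearest_frontier_point[OF \<Omega>(1) ne x] .
      obtain V where V: "V \<in> U ` T" "ball p e \<subseteq> V" using e(2)[OF p(1)] by blast
      then obtain R c \<alpha> h \<gamma> where ch: "(R, c, \<alpha>, h, \<gamma>) \<in> T" "V = U (R, c, \<alpha>, h, \<gamma>)" by auto
      have bc: "boundary_chart \<Omega> R c \<alpha> h \<gamma>" using ch(1) T(1) by (auto simp: S_def)
      have R: "orthogonal_transformation R" using bc by (rule boundary_chartD)
      have "p \<in> ball p e" "x \<in> ball p e" using e(1) p(2) r r0(2) by (auto simp: dist_commute)
      then have "p \<in> U (R, c, \<alpha>, h, \<gamma>)" "x \<in> U (R, c, \<alpha>, h, \<gamma>)" using V(2) ch(2) by auto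
      then obtain y t y' t' where
        y: "x = c + R (y, t)" "y \<in> box (- \<alpha>) \<alpha>" "t \<in> {-h<..<h}" and
        y': "p = c + R (y', t')" "y' \<in> box (- \<alpha>) \<alpha>" "t' \<in> {-h<..<h}"
        unfolding U_def by auto
      have t': "t' = \<gamma> y'" and t: "t < \<gamma> y"
        using bc y y' p(1) x(1) unfolding boundary_chart_def by blast+
      have "norm ((y, t) - (y', t')) = norm (R ((y, t) - (y', t')))"
        using orthogonal_transformation_norm[OF R] by simp
      also have "\<dots> = dist x p"
        using y(1) y'(1) by (simp only: linear_diff[OF orthogonal_transformation_linear[OF R]] dist_norm) simp
      finally have n: "norm ((y, t) - (y', t')) < 3 * r" using p(2) by simp
      have n1: "norm (y - y') < 3 * r" "\<bar>t - t'\<bar> < 3 * r"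
        using n norm_fst_le[of "y - y'" "t - t'"] norm_snd_le[of "t - t'" "y - y'"] by auto
      have "\<gamma> y - \<gamma> y' \<le> B (R, c, \<alpha>, h, \<gamma>) * norm (y - y')" using B(2)[OF ch(1) y(2) y'(2)] by simp
      also have "\<dots> \<le> B (R, c, \<alpha>, h, \<gamma>) * (3 * r)" using n1(1) B(1)[OF ch(1)] by (intro mult_left_mono) auto
      finally have "\<gamma> y - t < B (R, c, \<alpha>, h, \<gamma>) * (3 * r) + 3 * r" using n1(2) t' by linarith
      also have "\<dots> = 3 * (1 + B (R, c, \<alpha>, h, \<gamma>)) * r" by (simp add: algebra_simps)
      also have "\<dots> \<le> K * r" using BK[OF ch(1)] r(1) by (intro mult_right_mono) auto
      finally have "x \<in> chart_layer R c \<alpha> \<gamma> (K * r)"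
        unfolding y(1) mem_chart_layer[OF R] using y(2) t by simp
      then show "x \<in> (\<Union>(R, c, \<alpha>, h, \<gamma>)\<in>T. chart_layer R c \<alpha> \<gamma> (K * r))" using ch(1)
        by (intro UN_I[of "(R, c, \<alpha>, h, \<gamma>)"]) auto
    qed
  qed
qed

section \<open>Decay in shrinking layers\<close>

lemma nrm_cover:
  fixes w :: "'a::euclidean_space \<Rightarrow> 'b::euclidean_space"
  assumes w: "sqint (lebesgue_on \<Omega>) w" and I: "finite I" and m: "\<Omega> \<in> sets lebesgue" "S \<in> sets lebesgue" "\<And>i. i \<in> I \<Longrightarrow> L i \<in> sets lebesgue"
    and sub: "S \<subseteq> \<Omega>" "\<And>i. i \<in> I \<Longrightarrow> L i \<subseteq> \<Omega>" "S \<subseteq> (\<Union>i\<in>I. L i)"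
  shows "(nrm (lebesgue_on S) w)\<^sup>2 \<le> (\<Sum>i\<in>I. (nrm (lebesgue_on (L i)) w)\<^sup>2)"
proof -
  let ?f = "\<lambda>x. (norm (w x))\<^sup>2"
  have "integrable (lebesgue_on \<Omega>) ?f" using w by (simp add: sqint_def)
  note sb = integrable_lebesgue_on_subset[OF this m(1)]
  have i: "integrable lebesgue (\<lambda>x. ?f x * indicator (L i) x)" if "i \<in> I" for i
    using sb[OF m(3) sub(2)] that m(3) by (simp add: lebesgue_on_integrable_iff)
  have "(nrm (lebesgue_on S) w)\<^sup>2 = (\<integral>x. ?f x * indicator S x \<partial>lebesgue)"
    by (simp add: nrm_power2 lebesgue_on_integral_eq[OF m(2)])
  also have "\<dots> \<le> (\<integral>x. (\<Sum>i\<in>I. ?f x * indicator (L i) x) \<partial>lebesgue)"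
  proof (rule integral_mono)
    show "integrable lebesgue (\<lambda>x. ?f x * indicator S x)"
      using sb[OF m(2) sub(1)] m(2) by (simp add: lebesgue_on_integrable_iff)
    show "integrable lebesgue (\<lambda>x. \<Sum>i\<in>I. ?f x * indicator (L i) x)"
      using i by (rule Bochner_Integration.integrable_sum)
    fix x
    have "indicator S x \<le> (\<Sum>i\<in>I. indicator (L i) x :: real)"
    proof (cases "x \<in> S")
      case True
      then obtain j where j: "j \<in> I" "x \<in> L j" using sub(3) by auto
      then have "indicator (L j) x \<le> (\<Sum>i\<in>I. indicator (L i) x :: real)"
        using I by (intro member_le_sum) auto
      then show ?thesis using j True by simp
    qed (auto intro: sum_nonneg)
    then have "?f x * indicator S x \<le> ?f x * (\<Sum>i\<in>I. indicator (L i) x)" by (intro mult_left_mono) auto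
    then show "?f x * indicator S x \<le> (\<Sum>i\<in>I. ?f x * indicator (L i) x)" by (simp add: sum_distrib_left)
  qed
  also have "\<dots> = (\<Sum>i\<in>I. (\<integral>x. ?f x * indicator (L i) x \<partial>lebesgue))"
    using i by (rule Bochner_Integration.integral_sum)
  also have "\<dots> = (\<Sum>i\<in>I. (nrm (lebesgue_on (L i)) w)\<^sup>2)"
    using m(3) by (intro sum.cong) (auto simp: nrm_power2 lebesgue_on_integral_eq)
  finally show ?thesis .
qed

lemma open_infdist_less: "open \<Omega> \<Longrightarrow> open {x \<in> \<Omega>. infdist x (- \<Omega>) < r}"
  by (intro open_Collect_conj open_Collect_less continuous_intros) auto

text \<open>\<Omega> is open, so each of its points has positive distance from the complement and
  eventually leaves the layers; dominated convergence does the rest.\<close>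

lemma nrm_shrinking_layer:
  fixes W :: "'a::euclidean_space \<Rightarrow> 'b::euclidean_space"
  assumes \<Omega>: "open \<Omega>" "- \<Omega> \<noteq> {}" and W: "sqint (lebesgue_on \<Omega>) W" and r: "r \<longlonglongrightarrow> 0"
  shows "(\<lambda>n::nat. nrm (lebesgue_on {x \<in> \<Omega>. infdist x (- \<Omega>) < r n}) W) \<longlonglongrightarrow> 0"
proof -
  let ?T = "\<lambda>n. {x \<in> \<Omega>. infdist x (- \<Omega>) < r n}" and ?f = "\<lambda>x. (norm (W x))\<^sup>2"
  have Tm: "?T n \<in> sets lebesgue" for n using open_infdist_less[OF \<Omega>(1)] by simp
  have \<Omega>m: "\<Omega> \<in> sets lebesgue" using \<Omega> by simp
  have i: "integrable (lebesgue_on \<Omega>) ?f" using W by (simp add: sqint_def)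
  have "(\<lambda>n. \<integral>x. ?f x * indicator (?T n) x \<partial>lebesgue) \<longlonglongrightarrow> (\<integral>x. (0::real) \<partial>(lebesgue :: 'a measure))"
  proof (rule integral_dominated_convergence)
    show "integrable lebesgue (\<lambda>x. ?f x * indicator \<Omega> x)" using i \<Omega>m by (simp add: lebesgue_on_integrable_iff)
    have "integrable (lebesgue_on (?T n)) ?f" for n
      by (rule integrable_lebesgue_on_subset[OF i \<Omega>m Tm]) auto
    then show "(\<lambda>x. ?f x * indicator (?T n) x) \<in> borel_measurable lebesgue" for n
      using Tm by (simp add: lebesgue_on_integrable_iff borel_measurable_integrable)
    show "AE x in lebesgue. (\<lambda>n. ?f x * indicator (?T n) x) \<longlonglongrightarrow> 0"
    proof (rule AE_I2)
      fix x
      have "\<forall>\<^sub>F n in sequentially. ?f x * indicator (?T n) x = 0"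
      proof (cases "x \<in> \<Omega>")
        case True
        then have "0 < infdist x (- \<Omega>)"
          using \<Omega> by (metis ComplD closed_Compl in_closed_iff_infdist_zero infdist_nonneg order_le_less)
        then have "\<forall>\<^sub>F n in sequentially. r n < infdist x (- \<Omega>)" using order_tendstoD(2)[OF r] by blast
        then show ?thesis by eventually_elim (simp add: indicator_def)
      qed simp
      then show "(\<lambda>n. ?f x * indicator (?T n) x) \<longlonglongrightarrow> 0" by (rule tendsto_eventually)
    qed
    show "AE x in lebesgue. norm (?f x * indicator (?T n) x) \<le> ?f x * indicator \<Omega> x" for n
      by (auto simp: indicator_def)
  qed simp
  then have "(\<lambda>n. sqrt (\<integral>x. ?f x * indicator (?T n) x \<partial>lebesgue)) \<longlonglongrightarrow> sqrt 0"
    by (intro tendsto_real_sqrt) simp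
  then show ?thesis by (simp add: nrm_def lebesgue_on_integral_eq[OF Tm])
qed

text \<open>The gradient of a cutoff function supported in the layer of width \<open>3 / n\<close> is of size \<open>n\<close>: by this
  Hardy-type estimate, multiplying \<open>w\<close> by it changes the gradient only by \<open>o(1)\<close> in \<open>L\<^sup>2\<close>.\<close>

lemma boundary_layer_decay:
  fixes \<psi> :: "nat \<Rightarrow> 'n::euclidean_space \<times> real \<Rightarrow> real"
  assumes \<Omega>: "open \<Omega>" "bounded \<Omega>" and C2: "C2_boundary \<Omega>"
    and w: "sqint (lebesgue_on \<Omega>) w" and W: "sqint (lebesgue_on \<Omega>) W"
    and \<psi>: "\<And>n. smooth (\<psi> n)" "(\<lambda>n. nrm (lebesgue_on \<Omega>) (\<lambda>x. w x - \<psi> n x)) \<longlonglongrightarrow> 0"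
      "(\<lambda>n. nrm (lebesgue_on \<Omega>) (\<lambda>x. W x - grad (\<psi> n) x)) \<longlonglongrightarrow> 0"
    and tr: "\<And>R c \<alpha> h \<gamma>. boundary_chart \<Omega> R c \<alpha> h \<gamma> \<Longrightarrow> (\<lambda>n. nrm (lebesgue_on (box (- \<alpha>) \<alpha>)) (pullback R c \<gamma> (\<psi> n))) \<longlonglongrightarrow> 0"
  shows "(\<lambda>n. real (Suc n) * nrm (lebesgue_on {x \<in> \<Omega>. infdist x (- \<Omega>) < 3 * (1 / real (Suc n))}) w) \<longlonglongrightarrow> 0"
proof -
  have ne: "- \<Omega> \<noteq> {}" using \<Omega>(2) not_bounded_UNIV by (metis Compl_UNIV_eq double_complement)
  obtain T K r0 where T: "finite T" "0 < K" "0 < r0"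
    "\<And>R c \<alpha> h \<gamma>. (R, c, \<alpha>, h, \<gamma>) \<in> T \<Longrightarrow> boundary_chart \<Omega> R c \<alpha> h \<gamma> \<and> K * r0 \<le> h / 2"
    "\<And>r. 0 < r \<Longrightarrow> r \<le> r0 \<Longrightarrow> {x \<in> \<Omega>. infdist x (- \<Omega>) < 3 * r} \<subseteq> (\<Union>(R, c, \<alpha>, h, \<gamma>)\<in>T. chart_layer R c \<alpha> \<gamma> (K * r))"
    using boundary_layer_cover[OF \<Omega> C2] by auto
  let ?S = "\<lambda>r. {x \<in> \<Omega>. infdist x (- \<Omega>) < r}"
  have Sm: "?S r \<in> sets lebesgue" for r using open_infdist_less[OF \<Omega>(1)] by simp
  have \<Omega>m: "\<Omega> \<in> sets lebesgue" using \<Omega> by simp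
  \<comment> \<open>Each of the \<open>card T\<close> chart layers of depth \<open>K * r\<close>
    contributes at most \<open>(2 * K * r) ^ 2\<close> times the squared gradient norm in the layer
    of width \<open>K * r\<close>; the root of the sum yields this constant.\<close>
  let ?C = "sqrt (card T) * (2 * K)"
  have bound: "nrm (lebesgue_on (?S (3 * r))) w \<le> ?C * r * nrm (lebesgue_on (?S (K * r))) W"
    if r: "0 < r" "r \<le> r0" for r
  proof -
    define L :: "(('n \<times> real \<Rightarrow> 'n \<times> real) \<times> ('n \<times> real) \<times> 'n \<times> real \<times> ('n \<Rightarrow> real)) \<Rightarrow> ('n \<times> real) set"
      where "L = (\<lambda>(R, c, \<alpha>, h, \<gamma>). chart_layer R c \<alpha> \<gamma> (K * r))"
    have s: "0 < K * r" "K * r \<le> K * r0" using r T(2) by auto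
    have L: "L i \<subseteq> ?S (K * r)" "open (L i)" "nrm (lebesgue_on (L i)) w \<le> 2 * (K * r) * nrm (lebesgue_on (L i)) W" if i: "i \<in> T" for i
    proof -
      obtain R c \<alpha> h \<gamma> where ieq: "i = (R, c, \<alpha>, h, \<gamma>)" by (cases i) auto
      have bc: "boundary_chart \<Omega> R c \<alpha> h \<gamma>" "K * r \<le> h / 2" using T(4) i s ieq by fastforce+
      show "L i \<subseteq> ?S (K * r)" using chart_layer_subset[OF bc(1) s(1) bc(2) \<Omega>(1)] by (simp add: L_def ieq)
      show "open (L i)" using boundary_chartD[OF bc(1)] by (simp add: L_def ieq open_chart_layer)
      show "nrm (lebesgue_on (L i)) w \<le> 2 * (K * r) * nrm (lebesgue_on (L i)) W"
        using chart_layer_L2_bound[OF \<Omega> bc(1) s(1) bc(2) w W \<psi> tr[OF bc(1)]] by (simp add: L_def ieq)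
    qed
    have WS: "sqint (lebesgue_on (?S (K * r))) W" by (rule sqint_subset[OF W \<Omega>m Sm]) auto
    have "(nrm (lebesgue_on (?S (3 * r))) w)\<^sup>2 \<le> (\<Sum>i\<in>T. (nrm (lebesgue_on (L i)) w)\<^sup>2)"
    proof (rule nrm_cover[OF w T(1) \<Omega>m Sm])
      show "?S (3 * r) \<subseteq> (\<Union>i\<in>T. L i)" using T(5)[OF r] by (simp add: L_def)
      show "L i \<in> sets lebesgue" if "i \<in> T" for i using L(2)[OF that] by simp
      show "L i \<subseteq> \<Omega>" if "i \<in> T" for i using L(1)[OF that] by blast
    qed auto
    also have "\<dots> \<le> (\<Sum>i\<in>T. (2 * (K * r) * nrm (lebesgue_on (?S (K * r))) W)\<^sup>2)"
    proof (intro sum_mono power_mono)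
      fix i assume i: "i \<in> T"
      have "nrm (lebesgue_on (L i)) W \<le> nrm (lebesgue_on (?S (K * r))) W"
        using L(1,2)[OF i] by (intro sqint_subset(2)[OF WS Sm]) auto
      then have "2 * (K * r) * nrm (lebesgue_on (L i)) W \<le> 2 * (K * r) * nrm (lebesgue_on (?S (K * r))) W"
        using s by (intro mult_left_mono) auto
      with L(3)[OF i] show "nrm (lebesgue_on (L i)) w \<le> 2 * (K * r) * nrm (lebesgue_on (?S (K * r))) W" by linarith
    qed (simp add: nrm_nonneg)
    also have "\<dots> = (?C * r * nrm (lebesgue_on (?S (K * r))) W)\<^sup>2"
      by (simp add: power_mult_distrib)
    finally show ?thesis
      by (rule power2_le_imp_le) (use T(2) r in \<open>auto intro!: mult_nonneg_nonneg nrm_nonneg\<close>)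
  qed
  \<comment> \<open>After \<open>Suc n\<close> has cancelled \<open>r\<close>, smallness comes from
    the gradient alone, whose norm over shrinking layers tends to 0.\<close>
  have lim: "(\<lambda>n. ?C * nrm (lebesgue_on (?S (K * (1 / real (Suc n))))) W) \<longlonglongrightarrow> ?C * 0"
  proof (intro tendsto_mult tendsto_const nrm_shrinking_layer \<Omega>(1) ne W)
    show "(\<lambda>n. K * (1 / real (Suc n))) \<longlonglongrightarrow> 0"
      using tendsto_mult[OF tendsto_const LIMSEQ_inverse_real_of_nat, of K] by (simp add: divide_inverse)
  qed
  have "(\<lambda>n. inverse (real (Suc n))) \<longlonglongrightarrow> 0" by (rule LIMSEQ_inverse_real_of_nat)
  then have ev: "\<forall>\<^sub>F n in sequentially. inverse (real (Suc n)) < r0" using order_tendstoD(2) T(3) by blast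
  show ?thesis
  proof (rule tendsto_sandwich[OF _ _ tendsto_const])
    show "(\<lambda>n. ?C * nrm (lebesgue_on (?S (K * (1 / real (Suc n))))) W) \<longlonglongrightarrow> 0" using lim by simp
    show "\<forall>\<^sub>F n in sequentially. 0 \<le> real (Suc n) * nrm (lebesgue_on (?S (3 * (1 / real (Suc n))))) w"
      by (intro always_eventually allI mult_nonneg_nonneg nrm_nonneg) simp
    show "\<forall>\<^sub>F n in sequentially. real (Suc n) * nrm (lebesgue_on (?S (3 * (1 / real (Suc n))))) w
      \<le> ?C * nrm (lebesgue_on (?S (K * (1 / real (Suc n))))) W"
      using ev
    proof eventually_elim
      case (elim n)
      define r where "r = 1 / real (Suc n)"
      have r: "0 < r" "r \<le> r0" "real (Suc n) = 1 / r" using elim by (auto simp: r_def divide_inverse)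
      have "1 / r * nrm (lebesgue_on (?S (3 * r))) w \<le> 1 / r * (?C * r * nrm (lebesgue_on (?S (K * r))) W)"
        using r by (intro mult_left_mono bound) auto
      also have "\<dots> = ?C * nrm (lebesgue_on (?S (K * r))) W" using r(1) by simp
      finally show ?case unfolding r_def[symmetric] unfolding r(3) .
    qed
  qed
qed

section \<open>Green's formula\<close>

lemma has_trace_H1_approx:
  assumes \<Omega>: "open \<Omega>" "bounded \<Omega>" and tr: "has_trace \<Omega> u g"
  shows "\<exists>\<phi> :: nat \<Rightarrow> 'n::euclidean_space \<times> real \<Rightarrow> real. (\<forall>n. smooth (\<phi> n)) \<and>
    (\<lambda>n. nrm (lebesgue_on \<Omega>) (\<lambda>x. u x - \<phi> n x)) \<longlonglongrightarrow> 0 \<and>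
    (\<lambda>n. nrm (lebesgue_on \<Omega>) (\<lambda>x. weak_grad \<Omega> u x - grad (\<phi> n) x)) \<longlonglongrightarrow> 0 \<and>
    (\<forall>R c \<alpha> h \<gamma>. boundary_chart \<Omega> R c \<alpha> h \<gamma> \<longrightarrow> sqint (lebesgue_on (box (- \<alpha>) \<alpha>)) (pullback R c \<gamma> g) \<and>
      (\<lambda>n. nrm (lebesgue_on (box (- \<alpha>) \<alpha>)) (\<lambda>y. pullback R c \<gamma> g y - pullback R c \<gamma> (\<phi> n) y)) \<longlonglongrightarrow> 0)"
proof -
  obtain \<phi> :: "nat \<Rightarrow> _" where \<phi>: "\<And>n. smooth (\<phi> n)" "(\<lambda>n. sobolev_norm \<Omega> 1 (\<lambda>x. u x - \<phi> n x)) \<longlonglongrightarrow> 0"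
    "\<forall>R c \<alpha> h \<gamma>. boundary_chart \<Omega> R c \<alpha> h \<gamma> \<longrightarrow> pullback R c \<gamma> g \<in> L2 (box (- \<alpha>) \<alpha>) \<and>
           (\<lambda>n. L2_norm (box (- \<alpha>) \<alpha>) (\<lambda>y. pullback R c \<gamma> g y - pullback R c \<gamma> (\<phi> n) y)) \<longlonglongrightarrow> 0"
    using tr unfolding has_trace_def by blast
  have u: "u \<in> sobolev \<Omega> 1" using tr by (simp add: has_trace_def)
  show ?thesis
    using \<phi>(1,3) H1_approx[OF \<Omega> u \<phi>(1,2)] unfolding L2_iff_sqint L2_norm_eq_nrm by (intro exI[of _ \<phi>] conjI) auto
qed

text \<open>Test with \<open>\<eta> (u - u')\<close> for cutoff functions \<open>\<eta>\<close> tending to \<open>1\<close>.\<close>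

lemma green_equal_traces:
  fixes \<Omega> :: "('n::euclidean_space \<times> real) set"
  assumes \<Omega>: "open \<Omega>" "bounded \<Omega>" and C2: "C2_boundary \<Omega>"
    and tr: "has_trace \<Omega> u g" "has_trace \<Omega> u' g"
    and div: "has_weak_div \<Omega> F D" and F: "sqint (lebesgue_on \<Omega>) F" and D: "sqint (lebesgue_on \<Omega>) D"
  shows "(\<integral>x. F x \<bullet> (weak_grad \<Omega> u x - weak_grad \<Omega> u' x) \<partial>lebesgue_on \<Omega>) = - (\<integral>x. D x * (u x - u' x) \<partial>lebesgue_on \<Omega>)"
proof -
  let ?M = "lebesgue_on \<Omega>"
  have u1: "u \<in> sobolev \<Omega> 1" "u' \<in> sobolev \<Omega> 1" using tr by (auto simp: has_trace_def)
  note s = sobolev1_weak_grad(1,2)[OF \<Omega> u1(1)] sobolev1_weak_grad(1,2)[OF \<Omega> u1(2)]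
  define w where "w x = u x - u' x" for x
  define W where "W x = weak_grad \<Omega> u x - weak_grad \<Omega> u' x" for x
  have sw: "sqint ?M w" "sqint ?M W" unfolding w_def[abs_def] W_def[abs_def] using s by (auto intro: sqint_diff)
  obtain p :: "nat \<Rightarrow> _" where p: "\<And>n. smooth (p n)" "(\<lambda>n. nrm ?M (\<lambda>x. u x - p n x)) \<longlonglongrightarrow> 0"
    "(\<lambda>n. nrm ?M (\<lambda>x. weak_grad \<Omega> u x - grad (p n) x)) \<longlonglongrightarrow> 0"
    "\<forall>R c \<alpha> h \<gamma>. boundary_chart \<Omega> R c \<alpha> h \<gamma> \<longrightarrow> sqint (lebesgue_on (box (- \<alpha>) \<alpha>)) (pullback R c \<gamma> g) \<and>
      (\<lambda>n. nrm (lebesgue_on (box (- \<alpha>) \<alpha>)) (\<lambda>y. pullback R c \<gamma> g y - pullback R c \<gamma> (p n) y)) \<longlonglongrightarrow> 0"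
    using has_trace_H1_approx[OF \<Omega> tr(1)] by blast
  obtain p' :: "nat \<Rightarrow> _" where p': "\<And>n. smooth (p' n)" "(\<lambda>n. nrm ?M (\<lambda>x. u' x - p' n x)) \<longlonglongrightarrow> 0"
    "(\<lambda>n. nrm ?M (\<lambda>x. weak_grad \<Omega> u' x - grad (p' n) x)) \<longlonglongrightarrow> 0"
    "\<forall>R c \<alpha> h \<gamma>. boundary_chart \<Omega> R c \<alpha> h \<gamma> \<longrightarrow> sqint (lebesgue_on (box (- \<alpha>) \<alpha>)) (pullback R c \<gamma> g) \<and>
      (\<lambda>n. nrm (lebesgue_on (box (- \<alpha>) \<alpha>)) (\<lambda>y. pullback R c \<gamma> g y - pullback R c \<gamma> (p' n) y)) \<longlonglongrightarrow> 0"
    using has_trace_H1_approx[OF \<Omega> tr(2)] by blast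
  \<comment> \<open>The traces of both sequences converge to the same \<open>g\<close>, so those of
    the differences tend to 0 in every chart. This is how the zero trace of \<open>u - u'\<close> is
    used.\<close>
  define \<psi> where "\<psi> n x = p n x - p' n x" for n x
  have \<psi>: "smooth (\<psi> n)" for n unfolding \<psi>_def[abs_def] by (intro smooth_diff p(1) p'(1))
  have sq: "sqint ?M (p n)" "sqint ?M (grad (p n))" "sqint ?M (p' n)" "sqint ?M (grad (p' n))"
    "sqint ?M (\<psi> n)" "sqint ?M (grad (\<psi> n))" for n
    by (intro continuous_sqint \<Omega> smooth_continuous smooth_continuous_grad p(1) p'(1) \<psi>)+
  have g\<psi>: "grad (\<psi> n) x = grad (p n) x - grad (p' n) x" for n x
    unfolding \<psi>_def[abs_def] using smooth_differentiable[OF p(1)] smooth_differentiable[OF p'(1)] by (intro grad_diff)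
  have L1: "(\<lambda>n. nrm ?M (\<lambda>x. w x - \<psi> n x)) \<longlonglongrightarrow> 0"
  proof (rule tendsto_sandwich[OF _ _ tendsto_const])
    show "(\<lambda>n. nrm ?M (\<lambda>x. u x - p n x) + nrm ?M (\<lambda>x. u' x - p' n x)) \<longlonglongrightarrow> 0"
      using tendsto_add[OF p(2) p'(2)] by simp
    have "nrm ?M (\<lambda>x. w x - \<psi> n x) \<le> nrm ?M (\<lambda>x. u x - p n x) + nrm ?M (\<lambda>x. u' x - p' n x)" for n
      using nrm_triangle_diff[OF sqint_diff[OF s(1) sq(1)[of n]] sqint_diff[OF s(3) sq(3)[of n]]]
      by (simp add: w_def \<psi>_def algebra_simps)
    then show "\<forall>\<^sub>F n in sequentially. nrm ?M (\<lambda>x. w x - \<psi> n x) \<le> nrm ?M (\<lambda>x. u x - p n x) + nrm ?M (\<lambda>x. u' x - p' n x)"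
      by simp
  qed (simp add: nrm_nonneg)
  have L2: "(\<lambda>n. nrm ?M (\<lambda>x. W x - grad (\<psi> n) x)) \<longlonglongrightarrow> 0"
  proof (rule tendsto_sandwich[OF _ _ tendsto_const])
    show "(\<lambda>n. nrm ?M (\<lambda>x. weak_grad \<Omega> u x - grad (p n) x) + nrm ?M (\<lambda>x. weak_grad \<Omega> u' x - grad (p' n) x)) \<longlonglongrightarrow> 0"
      using tendsto_add[OF p(3) p'(3)] by simp
    have "nrm ?M (\<lambda>x. W x - grad (\<psi> n) x) \<le> nrm ?M (\<lambda>x. weak_grad \<Omega> u x - grad (p n) x) + nrm ?M (\<lambda>x. weak_grad \<Omega> u' x - grad (p' n) x)" for n
      using nrm_triangle_diff[OF sqint_diff[OF s(2) sq(2)[of n]] sqint_diff[OF s(4) sq(4)[of n]]]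
      by (simp add: W_def g\<psi> algebra_simps)
    then show "\<forall>\<^sub>F n in sequentially. nrm ?M (\<lambda>x. W x - grad (\<psi> n) x) \<le> nrm ?M (\<lambda>x. weak_grad \<Omega> u x - grad (p n) x) + nrm ?M (\<lambda>x. weak_grad \<Omega> u' x - grad (p' n) x)"
      by simp
  qed (simp add: nrm_nonneg)
  have L3: "(\<lambda>n. nrm (lebesgue_on (box (- \<alpha>) \<alpha>)) (pullback R c \<gamma> (\<psi> n))) \<longlonglongrightarrow> 0"
    if ch: "boundary_chart \<Omega> R c \<alpha> h \<gamma>" for R c \<alpha> h \<gamma>
  proof -
    let ?B = "lebesgue_on (box (- \<alpha>) \<alpha>)"
    note chD = boundary_chartD[OF ch]
    have sg: "sqint ?B (pullback R c \<gamma> g)" using p(4) ch by blast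
    have sp: "sqint ?B (pullback R c \<gamma> (p n))" "sqint ?B (pullback R c \<gamma> (p' n))" for n
      by (intro continuous_sqint open_box bounded_box pullback_continuous chD p(1) p'(1))+
    have l1: "(\<lambda>n. nrm ?B (\<lambda>y. pullback R c \<gamma> g y - pullback R c \<gamma> (p' n) y)) \<longlonglongrightarrow> 0"
      using p'(4) ch by blast
    have l2: "(\<lambda>n. nrm ?B (\<lambda>y. pullback R c \<gamma> g y - pullback R c \<gamma> (p n) y)) \<longlonglongrightarrow> 0"
      using p(4) ch by blast
    show ?thesis
    proof (rule tendsto_sandwich[OF _ _ tendsto_const])
      show "(\<lambda>n. nrm ?B (\<lambda>y. pullback R c \<gamma> g y - pullback R c \<gamma> (p' n) y) + nrm ?B (\<lambda>y. pullback R c \<gamma> g y - pullback R c \<gamma> (p n) y)) \<longlonglongrightarrow> 0"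
        using tendsto_add[OF l1 l2] by simp
      have "nrm ?B (pullback R c \<gamma> (\<psi> n)) \<le> nrm ?B (\<lambda>y. pullback R c \<gamma> g y - pullback R c \<gamma> (p' n) y) + nrm ?B (\<lambda>y. pullback R c \<gamma> g y - pullback R c \<gamma> (p n) y)" for n
        using nrm_triangle_diff[OF sqint_diff[OF sg sp(2)[of n]] sqint_diff[OF sg sp(1)[of n]]]
        by (simp add: pullback_def \<psi>_def)
      then show "\<forall>\<^sub>F n in sequentially. nrm ?B (pullback R c \<gamma> (\<psi> n)) \<le> nrm ?B (\<lambda>y. pullback R c \<gamma> g y - pullback R c \<gamma> (p' n) y) + nrm ?B (\<lambda>y. pullback R c \<gamma> g y - pullback R c \<gamma> (p n) y)"
        by simp
    qed (simp add: nrm_nonneg)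
  qed
  note decay = boundary_layer_decay[OF \<Omega> C2 sw \<psi> L1 L2 L3]
  obtain C where C: "0 \<le> C" "\<And>r. 0 < r \<Longrightarrow> \<exists>\<eta>\<in>test_functions \<Omega>. (\<forall>x. 0 \<le> \<eta> x \<and> \<eta> x \<le> 1) \<and>
      (\<forall>x. 3 * r \<le> infdist x (- \<Omega>) \<longrightarrow> \<eta> x = 1 \<and> grad \<eta> x = 0) \<and> (\<forall>x. norm (grad \<eta> x) \<le> C / r)"
    using cutoff_functions[OF \<Omega>] by blast
  have "\<forall>n. \<exists>\<eta>. \<eta> \<in> test_functions \<Omega> \<and> (\<forall>x. 0 \<le> \<eta> x \<and> \<eta> x \<le> 1) \<and>
      (\<forall>x. 3 * (1 / real (Suc n)) \<le> infdist x (- \<Omega>) \<longrightarrow> \<eta> x = 1 \<and> grad \<eta> x = 0) \<and> (\<forall>x. norm (grad \<eta> x) \<le> C * real (Suc n))"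
  proof
    fix n
    have "0 < 1 / real (Suc n)" by simp
    moreover have "C / (1 / real (Suc n)) = C * real (Suc n)" by simp
    ultimately show "\<exists>\<eta>. \<eta> \<in> test_functions \<Omega> \<and> (\<forall>x. 0 \<le> \<eta> x \<and> \<eta> x \<le> 1) \<and>
      (\<forall>x. 3 * (1 / real (Suc n)) \<le> infdist x (- \<Omega>) \<longrightarrow> \<eta> x = 1 \<and> grad \<eta> x = 0) \<and> (\<forall>x. norm (grad \<eta> x) \<le> C * real (Suc n))"
      using C(2)[of "1 / real (Suc n)"] by (simp only: Bex_def)
  qed
  from choice[OF this] obtain \<eta> where H: "\<forall>n. \<eta> n \<in> test_functions \<Omega> \<and> (\<forall>x. 0 \<le> \<eta> n x \<and> \<eta> n x \<le> 1) \<and>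
      (\<forall>x. 3 * (1 / real (Suc n)) \<le> infdist x (- \<Omega>) \<longrightarrow> \<eta> n x = 1 \<and> grad (\<eta> n) x = 0) \<and> (\<forall>x. norm (grad (\<eta> n) x) \<le> C * real (Suc n))" ..
  have \<eta>: "\<eta> n \<in> test_functions \<Omega>" "0 \<le> \<eta> n x" "\<eta> n x \<le> 1"
    "3 * (1 / real (Suc n)) \<le> infdist x (- \<Omega>) \<Longrightarrow> \<eta> n x = 1"
    "3 * (1 / real (Suc n)) \<le> infdist x (- \<Omega>) \<Longrightarrow> grad (\<eta> n) x = 0"
    "norm (grad (\<eta> n) x) \<le> C * real (Suc n)"
    for n x
    using H by blast+
  have sm\<eta>: "smooth (\<eta> n)" for n using \<eta>(1) by (rule test_smooth)
  have m\<eta>: "\<eta> n \<in> borel_measurable ?M" "grad (\<eta> n) \<in> borel_measurable ?M" for n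
    by (intro continuous_measurable_lebesgue_on smooth_continuous smooth_continuous_grad sm\<eta>)+
  have cutF: "sqint ?M (\<lambda>x. \<eta> n x *\<^sub>R F x)" "sqint ?M (\<lambda>x. \<eta> n x * D x)" for n
    using \<eta>(2,3) m\<eta> by (auto intro!: sqint_bounded_scaleR[OF F, of _ 1] sqint_bounded_mult[OF D, of _ 1])
  have cutG: "sqint ?M (\<lambda>x. F x \<bullet> grad (\<eta> n) x)" for n
  proof (rule sqint_dominated[OF F, where C = "C * real (Suc n)"])
    show "(\<lambda>x. F x \<bullet> grad (\<eta> n) x) \<in> borel_measurable ?M"
      using sqint_measurable[OF F] m\<eta>(2) by (intro borel_measurable_inner)
    have "norm (F x \<bullet> grad (\<eta> n) x) \<le> C * real (Suc n) * norm (F x)" for x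
      using Cauchy_Schwarz_ineq2[of "F x" "grad (\<eta> n) x"] mult_left_mono[OF \<eta>(6)[of n x], of "norm (F x)"]
      by (simp add: mult_ac)
    then show "AE x in ?M. norm (F x \<bullet> grad (\<eta> n) x) \<le> C * real (Suc n) * norm (F x)" by simp
  qed
  \<comment> \<open>For fixed \<open>n\<close> the products of \<open>\<eta> n\<close> with
    \<open>\<psi> m\<close> are test functions; the limit in \<open>m\<close> is taken before the
    one in \<open>n\<close>.\<close>
  have eq: "(\<integral>x. (\<eta> n x *\<^sub>R F x) \<bullet> W x \<partial>?M) + (\<integral>x. (F x \<bullet> grad (\<eta> n) x) * w x \<partial>?M) = - (\<integral>x. (\<eta> n x * D x) * w x \<partial>?M)" for n
  proof -
    have e: "(\<integral>x. (\<eta> n x *\<^sub>R F x) \<bullet> grad (\<psi> m) x \<partial>?M) + (\<integral>x. (F x \<bullet> grad (\<eta> n) x) * \<psi> m x \<partial>?M) = - (\<integral>x. (\<eta> n x * D x) * \<psi> m x \<partial>?M)" for m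
    proof -
      have g: "grad (\<lambda>x. \<eta> n x * \<psi> m x) x = \<eta> n x *\<^sub>R grad (\<psi> m) x + \<psi> m x *\<^sub>R grad (\<eta> n) x" for x
        by (intro grad_mult smooth_differentiable sm\<eta> \<psi>)
      have "(\<integral>x. (\<eta> n x *\<^sub>R F x) \<bullet> grad (\<psi> m) x \<partial>?M) + (\<integral>x. (F x \<bullet> grad (\<eta> n) x) * \<psi> m x \<partial>?M)
        = (\<integral>x. (\<eta> n x *\<^sub>R F x) \<bullet> grad (\<psi> m) x + (F x \<bullet> grad (\<eta> n) x) * \<psi> m x \<partial>?M)"
        by (intro Bochner_Integration.integral_add[symmetric] sqint_inner_integrable sqint_mult_integrable cutF cutG sq)
      also have "\<dots> = (\<integral>x. F x \<bullet> grad (\<lambda>x. \<eta> n x * \<psi> m x) x \<partial>?M)"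
        unfolding g by (intro Bochner_Integration.integral_cong) (auto simp: inner_add_right)
      also have "\<dots> = - (\<integral>x. D x * (\<eta> n x * \<psi> m x) \<partial>?M)"
        by (rule has_weak_div_grad[OF div test_mult_smooth[OF \<eta>(1) \<psi>]])
      finally show ?thesis by (simp add: mult_ac)
    qed
    show ?thesis
      using tendsto_add[OF nrm_tendsto_inner[OF sq(6) sw(2) cutF(1)[of n] L2] nrm_tendsto_mult[OF sq(5) sw(1) cutG[of n] L1]]
        tendsto_minus[OF nrm_tendsto_mult[OF sq(5) sw(1) cutF(2)[of n] L1]]
      unfolding e by (rule LIMSEQ_unique)
  qed
  have \<eta>1: "(\<lambda>n. \<eta> n x) \<longlonglongrightarrow> 1" if "x \<in> \<Omega>" for x
  proof (rule tendsto_eventually)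
    have "- \<Omega> \<noteq> {}" using \<Omega>(2) not_bounded_UNIV by (metis Compl_UNIV_eq double_complement)
    then have "0 < infdist x (- \<Omega>) / 3"
      using \<Omega>(1) that by (simp add: order_less_le infdist_nonneg) (metis ComplD closed_Compl in_closed_iff_infdist_zero)
    then have "\<forall>\<^sub>F n in sequentially. inverse (real (Suc n)) < infdist x (- \<Omega>) / 3"
      using order_tendstoD(2)[OF LIMSEQ_inverse_real_of_nat] by blast
    then show "\<forall>\<^sub>F n in sequentially. \<eta> n x = 1"
    proof eventually_elim
      case (elim n)
      then have "3 * (1 / real (Suc n)) \<le> infdist x (- \<Omega>)" unfolding inverse_eq_divide by linarith
      then show ?case by (rule \<eta>(4))
    qed
  qed
  have dom: "(\<lambda>n. \<integral>x. \<eta> n x * f x \<partial>?M) \<longlonglongrightarrow> (\<integral>x. f x \<partial>?M)" if f: "integrable ?M f" for f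
  proof (rule integral_dominated_convergence[where w = "\<lambda>x. \<bar>f x\<bar>"])
    show "AE x in ?M. (\<lambda>n. \<eta> n x * f x) \<longlonglongrightarrow> f x"
    proof (rule AE_I2)
      fix x assume "x \<in> space ?M"
      then have "(\<lambda>n. \<eta> n x * f x) \<longlonglongrightarrow> 1 * f x" by (intro tendsto_intros \<eta>1) simp
      then show "(\<lambda>n. \<eta> n x * f x) \<longlonglongrightarrow> f x" by simp
    qed
    show "AE x in ?M. norm (\<eta> n x * f x) \<le> \<bar>f x\<bar>" for n
      using \<eta>(2,3) by (intro AE_I2) (simp add: abs_mult mult_left_le_one_le)
    show "(\<lambda>x. \<eta> n x * f x) \<in> borel_measurable ?M" for n
      using m\<eta>(1) borel_measurable_integrable[OF f] by (intro borel_measurable_times)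
  qed (use f in auto)
  have T1: "(\<lambda>n. \<integral>x. (\<eta> n x *\<^sub>R F x) \<bullet> W x \<partial>?M) \<longlonglongrightarrow> (\<integral>x. F x \<bullet> W x \<partial>?M)"
    using dom[OF sqint_inner_integrable[OF F sw(2)]] by simp
  have T3: "(\<lambda>n. \<integral>x. (\<eta> n x * D x) * w x \<partial>?M) \<longlonglongrightarrow> (\<integral>x. D x * w x \<partial>?M)"
    using dom[OF sqint_mult_integrable[OF D sw(1)]] by (simp add: mult.assoc)
  \<comment> \<open>The gradient of the cutoff lives in the layer of width \<open>3 / Suc n\<close>
    and has size at most \<open>C * Suc n\<close>, which is the factor that \<open>decay\<close>
    tolerates.\<close>
  have T2: "(\<lambda>n. \<integral>x. (F x \<bullet> grad (\<eta> n) x) * w x \<partial>?M) \<longlonglongrightarrow> 0"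
  proof (rule Lim_null_comparison)
    let ?S = "\<lambda>n. {x \<in> \<Omega>. infdist x (- \<Omega>) < 3 * (1 / real (Suc n))}"
    show "(\<lambda>n. C * nrm ?M F * (real (Suc n) * nrm (lebesgue_on (?S n)) w)) \<longlonglongrightarrow> 0"
      using tendsto_mult_right_zero[OF decay] by simp
    show "\<forall>\<^sub>F n in sequentially. norm (\<integral>x. (F x \<bullet> grad (\<eta> n) x) * w x \<partial>?M) \<le> C * nrm ?M F * (real (Suc n) * nrm (lebesgue_on (?S n)) w)"
    proof (intro always_eventually allI)
      fix n
      have Sm: "?S n \<in> sets lebesgue" "\<Omega> \<in> sets lebesgue" "?S n \<subseteq> \<Omega>" using open_infdist_less[OF \<Omega>(1)] \<Omega>(1) by auto
      note subS = sqint_subset[OF _ Sm(2,1,3)]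
      have "(\<integral>x. (F x \<bullet> grad (\<eta> n) x) * w x \<partial>?M) = (\<integral>x. (F x \<bullet> grad (\<eta> n) x) * w x \<partial>lebesgue_on (?S n))"
        unfolding lebesgue_on_integral_eq[OF Sm(1)] lebesgue_on_integral_eq[OF Sm(2)]
      proof (intro Bochner_Integration.integral_cong refl)
        fix x
        show "(F x \<bullet> grad (\<eta> n) x) * w x * indicator \<Omega> x = (F x \<bullet> grad (\<eta> n) x) * w x * indicator (?S n) x"
          using \<eta>(5)[of n x] by (cases "3 * (1 / real (Suc n)) \<le> infdist x (- \<Omega>)") (auto simp: indicator_def)
      qed
      also have "norm \<dots> \<le> nrm (lebesgue_on (?S n)) (\<lambda>x. F x \<bullet> grad (\<eta> n) x) * nrm (lebesgue_on (?S n)) w"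
        unfolding real_norm_def by (intro nrm_Cauchy_Schwarz_mult subS(1) cutG sw(1))
      also have "\<dots> \<le> (C * real (Suc n) * nrm ?M F) * nrm (lebesgue_on (?S n)) w"
      proof (rule mult_right_mono)
        have "nrm (lebesgue_on (?S n)) (\<lambda>x. F x \<bullet> grad (\<eta> n) x) \<le> nrm ?M (\<lambda>x. F x \<bullet> grad (\<eta> n) x)"
          by (rule subS(2)[OF cutG])
        also have "\<dots> \<le> C * real (Suc n) * nrm ?M F"
        proof (rule nrm_dominated[OF F sqint_measurable[OF cutG]])
          have "norm (F x \<bullet> grad (\<eta> n) x) \<le> C * real (Suc n) * norm (F x)" for x
            using Cauchy_Schwarz_ineq2[of "F x" "grad (\<eta> n) x"] mult_left_mono[OF \<eta>(6)[of n x], of "norm (F x)"]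
            by (simp add: mult_ac)
          then show "AE x in ?M. norm (F x \<bullet> grad (\<eta> n) x) \<le> C * real (Suc n) * norm (F x)" by simp
        qed (use C(1) in simp)
        finally show "nrm (lebesgue_on (?S n)) (\<lambda>x. F x \<bullet> grad (\<eta> n) x) \<le> C * real (Suc n) * nrm ?M F" .
      qed (rule nrm_nonneg)
      finally show "norm (\<integral>x. (F x \<bullet> grad (\<eta> n) x) * w x \<partial>?M) \<le> C * nrm ?M F * (real (Suc n) * nrm (lebesgue_on (?S n)) w)"
        by (simp only: mult_ac)
    qed
  qed
  have "(\<integral>x. F x \<bullet> W x \<partial>?M) + 0 = - (\<integral>x. D x * w x \<partial>?M)"
    using tendsto_add[OF T1 T2] tendsto_minus[OF T3] unfolding eq by (rule LIMSEQ_unique)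
  then show ?thesis by (simp add: w_def W_def)
qed

section \<open>Fractional Sobolev norms\<close>

text \<open>Compare the kernel with a sum over dyadic balls; the series is geometric with ratio \<open>2\<^sup>2\<^sup>\<theta>\<^sup>-\<^sup>2\<close>.\<close>

lemma riesz_kernel_finite:
  fixes \<theta> \<rho> :: real
  assumes \<theta>: "0 < \<theta>" "\<theta> < 1" and \<rho>: "0 < \<rho>"
  shows "(\<integral>\<^sup>+(z::'a::euclidean_space). ennreal ((norm z)\<^sup>2 / norm z powr (real DIM('a) + 2 * \<theta>)) * indicator (ball 0 \<rho>) z \<partial>lborel) < \<infinity>"
proof -
  define d where "d = real DIM('a)"
  define r where "r k = \<rho> / 2 ^ k" for k :: nat
  have r: "0 < r k" "r (Suc k) = r k / 2" for k using \<rho> by (auto simp: r_def)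
  \<comment> \<open>A bound for the kernel on the dyadic shell between \<open>r k / 2\<close> and
    \<open>r k\<close>: numerator at the outer radius, denominator at the inner one.\<close>
  define a where "a k = (r k)\<^sup>2 / (r k / 2) powr (d + 2 * \<theta>)" for k
  have a0: "0 \<le> a k" for k by (simp add: a_def)
  define V where "V = measure lborel (ball (0::'a) 1)"
  have pt: "ennreal ((norm z)\<^sup>2 / norm z powr (d + 2 * \<theta>)) * indicator (ball 0 \<rho>) z \<le> (\<Sum>k. ennreal (a k) * indicator (ball 0 (r k)) z)" for z :: 'a
  proof (cases "z \<noteq> 0 \<and> z \<in> ball 0 \<rho>")
    case False
    then show ?thesis by auto
  next
    case True
    then have z: "0 < norm z" "norm z < \<rho>" by auto
    have "(\<lambda>k. \<rho> * (1 / 2) ^ k) \<longlonglongrightarrow> \<rho> * 0" by (intro tendsto_intros LIMSEQ_realpow_zero) auto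
    then have "\<forall>\<^sub>F k in sequentially. \<rho> * (1 / 2) ^ k < norm z" using order_tendstoD(2) z(1) by fastforce
    then obtain N where "\<rho> * (1 / 2) ^ N < norm z" by (auto simp: eventually_sequentially)
    then have N: "r N \<le> norm z" by (simp add: r_def power_one_over less_imp_le)
    \<comment> \<open>The first dyadic radius not exceeding \<open>norm z\<close>. It is not
      \<open>r 0\<close>, because \<open>norm z < \<rho>\<close>, and its predecessor
      \<open>j\<close> is the index of the shell that contains \<open>z\<close>.\<close>
    define k where "k = (LEAST k. r k \<le> norm z)"
    have k: "r k \<le> norm z" unfolding k_def using N by (rule LeastI)
    then have "k \<noteq> 0" using z(2) by (auto simp: r_def intro: ccontr)
    then obtain j where j: "k = Suc j" using not0_implies_Suc by blast
    then have "\<not> r j \<le> norm z" unfolding k_def by (metis k_def lessI not_less_Least)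
    then have zj: "r j / 2 \<le> norm z" "norm z < r j" using k r(2) j by auto
    have "(norm z)\<^sup>2 / norm z powr (d + 2 * \<theta>) \<le> a j"
      unfolding a_def
    proof (rule frac_le)
      show "(norm z)\<^sup>2 \<le> (r j)\<^sup>2" using zj by (intro power_mono) auto
      show "(r j / 2) powr (d + 2 * \<theta>) \<le> norm z powr (d + 2 * \<theta>)"
        using zj r(1)[of j] \<theta> by (intro powr_mono2) (auto simp: d_def)
    qed (use r(1)[of j] in auto)
    then have "ennreal ((norm z)\<^sup>2 / norm z powr (d + 2 * \<theta>)) * indicator (ball 0 \<rho>) z \<le> ennreal (a j) * indicator (ball 0 (r j)) z"
      using zj z(2) by (simp add: ennreal_leI)
    also have "\<dots> \<le> (\<Sum>k. ennreal (a k) * indicator (ball 0 (r k)) z)"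
    proof -
      have "(\<Sum>k\<in>{j}. ennreal (a k) * indicator (ball 0 (r k)) z) \<le> (\<Sum>k. ennreal (a k) * indicator (ball 0 (r k)) z)"
        by (intro sum_le_suminf) auto
      then show ?thesis by (simp only: sum.insert finite.emptyI empty_iff not_False_eq_True sum.empty add_0_right)
    qed
    finally show ?thesis .
  qed
  define q where "q = (1 / 2) powr (2 - 2 * \<theta>)"
  have q: "0 < q" "q < 1" unfolding q_def using \<theta> powr_less_mono'[of "1/2" 0 "2 - 2 * \<theta>"] by auto
  define c where "c = V * 2 powr (d + 2 * \<theta>) * \<rho> powr (2 - 2 * \<theta>)"
  have c: "0 \<le> c" by (simp add: c_def V_def)
  have trm: "a k * measure lborel (ball (0::'a) (r k)) = c * q ^ k" for k
  proof -
    have "measure lborel (ball (0::'a) (r k)) = r k powr d * V"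
      using content_ball_conv_unit_ball[of "r k" "0::'a"] r(1)[of k] by (simp add: V_def d_def powr_realpow)
    then have "a k * measure lborel (ball (0::'a) (r k)) = V * ((r k) powr 2 * r k powr d / (r k / 2) powr (d + 2 * \<theta>))"
      using r(1)[of k] by (simp add: a_def powr_realpow)
    also have "(r k / 2) powr (d + 2 * \<theta>) = r k powr d * r k powr (2 * \<theta>) / 2 powr (d + 2 * \<theta>)"
      using r(1)[of k] by (simp add: powr_divide powr_add)
    also have "V * ((r k) powr 2 * r k powr d / (r k powr d * r k powr (2 * \<theta>) / 2 powr (d + 2 * \<theta>)))
       = V * 2 powr (d + 2 * \<theta>) * r k powr (2 - 2 * \<theta>)"
      using r(1)[of k] by (simp add: powr_diff)
    also have "r k powr (2 - 2 * \<theta>) = \<rho> powr (2 - 2 * \<theta>) * q ^ k"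
    proof -
      have "r k = \<rho> * (1 / 2) ^ k" by (simp add: r_def power_one_over)
      then have "r k powr (2 - 2 * \<theta>) = \<rho> powr (2 - 2 * \<theta>) * ((1 / 2) ^ k) powr (2 - 2 * \<theta>)"
        using \<rho> by (simp add: powr_mult)
      also have "((1 / 2 :: real) ^ k) powr (2 - 2 * \<theta>) = q ^ k"
        unfolding q_def by (simp add: powr_powr powr_power mult.commute flip: powr_realpow)
      finally show ?thesis .
    qed
    finally show ?thesis by (simp add: c_def mult_ac)
  qed
  have "(\<integral>\<^sup>+(z::'a). ennreal ((norm z)\<^sup>2 / norm z powr (d + 2 * \<theta>)) * indicator (ball 0 \<rho>) z \<partial>lborel)
     \<le> (\<integral>\<^sup>+(z::'a). (\<Sum>k. ennreal (a k) * indicator (ball 0 (r k)) z) \<partial>lborel)"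
    by (rule nn_integral_mono) (rule pt)
  also have "\<dots> = (\<Sum>k. \<integral>\<^sup>+(z::'a). ennreal (a k) * indicator (ball 0 (r k)) z \<partial>lborel)"
  proof (rule nn_integral_suminf)
    have [measurable]: "ball (0::'a) (r k) \<in> sets borel" for k by simp
    show "(\<lambda>z::'a. ennreal (a k) * indicator (ball 0 (r k)) z) \<in> borel_measurable lborel" for k by measurable
  qed
  also have "\<dots> = (\<Sum>k. ennreal (c * q ^ k))"
  proof (rule suminf_cong)
    fix k
    have "(\<integral>\<^sup>+(z::'a). ennreal (a k) * indicator (ball 0 (r k)) z \<partial>lborel) = ennreal (a k) * emeasure lborel (ball (0::'a) (r k))"
      by (rule nn_integral_cmult_indicator) simp
    also have "emeasure lborel (ball (0::'a) (r k)) = ennreal (measure lborel (ball (0::'a) (r k)))"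
      using emeasure_lborel_ball_finite[of "0::'a" "r k"] by (intro emeasure_eq_ennreal_measure) simp
    finally show "(\<integral>\<^sup>+(z::'a). ennreal (a k) * indicator (ball 0 (r k)) z \<partial>lborel) = ennreal (c * q ^ k)"
      using a0 by (simp add: ennreal_mult'' trm flip: ennreal_mult)
  qed
  also have "\<dots> < \<infinity>"
  proof -
    have "summable (\<lambda>k. c * q ^ k)" using q by (intro summable_mult summable_geometric) auto
    then have "(\<Sum>k. ennreal (c * q ^ k)) \<noteq> top" using c q by (intro ennreal_suminf_neq_top) auto
    then show ?thesis by (simp add: less_top)
  qed
  finally show ?thesis by (simp add: d_def)
qed

lemma nn_integral_lebesgue_on_le:
  assumes "S \<in> sets lebesgue"
  shows "(\<integral>\<^sup>+x. f x \<partial>lebesgue_on S) = (\<integral>\<^sup>+x. f x * indicator S x \<partial>lborel)"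
  using assms by (subst nn_integral_restrict_space) (auto simp: nn_integral_completion)

text \<open>The Lipschitz bound reduces the integrand to the kernel of
  \<open>riesz_kernel_finite\<close> in \<open>z = y - x\<close>, which is integrable near 0 because
  \<open>\<theta> < 1\<close>; differences of points of \<Omega> stay in a fixed ball.\<close>

lemma gagliardo_finite_Lipschitz:
  fixes f :: "'a::euclidean_space \<Rightarrow> real"
  assumes \<Omega>: "open \<Omega>" "bounded \<Omega>" and \<theta>: "0 < \<theta>" "\<theta> < 1" and f: "\<And>x y. \<bar>f x - f y\<bar> \<le> B * norm (x - y)"
  shows "gagliardo_sq \<Omega> \<theta> f < \<infinity>"
proof -
  let ?M = "lebesgue_on \<Omega>"
  let ?k = "\<lambda>z::'a. (norm z)\<^sup>2 / norm z powr (real DIM('a) + 2 * \<theta>)"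
  have \<Omega>m: "\<Omega> \<in> sets lebesgue" using \<Omega> by simp
  obtain R where R: "R > 0" "\<Omega> \<subseteq> ball 0 R" using bounded_subset_ballD[OF \<Omega>(2)] by blast
  define I where "I = (\<integral>\<^sup>+z. ennreal (?k z) * indicator (ball 0 (2 * R)) z \<partial>lborel)"
  have I: "I < \<infinity>" unfolding I_def using riesz_kernel_finite[OF \<theta>, of "2 * R"] R(1) by simp
  have [measurable]: "?k \<in> borel_measurable borel" by measurable
  have [measurable]: "ball (0::'a) (2 * R) \<in> sets borel" by simp
  have inner: "(\<integral>\<^sup>+y. ennreal ((f x - f y)\<^sup>2 / dist x y powr (real DIM('a) + 2 * \<theta>)) \<partial>?M) \<le> ennreal (B\<^sup>2) * I" if x: "x \<in> \<Omega>" for x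
  proof -
    have pt: "ennreal ((f x - f y)\<^sup>2 / dist x y powr (real DIM('a) + 2 * \<theta>)) * indicator \<Omega> y \<le> ennreal (B\<^sup>2) * (ennreal (?k (y + - x)) * indicator (ball 0 (2 * R)) (y + - x))" for y
    proof (cases "y \<in> \<Omega>")
      case True
      then have "norm x < R" "norm y < R" using x R by auto
      then have b: "y + - x \<in> ball 0 (2 * R)" using norm_triangle_ineq4[of y x] by simp
      have "(f x - f y)\<^sup>2 \<le> (B * norm (x - y))\<^sup>2" using f[of x y] by (metis abs_ge_zero abs_le_square_iff abs_of_nonneg order_trans)
      then have "(f x - f y)\<^sup>2 / dist x y powr (real DIM('a) + 2 * \<theta>) \<le> (B * norm (x - y))\<^sup>2 / dist x y powr (real DIM('a) + 2 * \<theta>)"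
        by (rule divide_right_mono) simp
      also have "\<dots> = B\<^sup>2 * ?k (y + - x)" by (simp add: dist_norm norm_minus_commute power_mult_distrib)
      finally show ?thesis using True b by (simp add: ennreal_leI flip: ennreal_mult)
    qed simp
    have "(\<integral>\<^sup>+y. ennreal ((f x - f y)\<^sup>2 / dist x y powr (real DIM('a) + 2 * \<theta>)) \<partial>?M)
      \<le> (\<integral>\<^sup>+y. ennreal (B\<^sup>2) * (ennreal (?k (y + - x)) * indicator (ball 0 (2 * R)) (y + - x)) \<partial>lborel)"
      unfolding nn_integral_lebesgue_on_le[OF \<Omega>m] by (rule nn_integral_mono) (rule pt)
    also have "\<dots> = (\<integral>\<^sup>+y. ennreal (B\<^sup>2) * (ennreal (?k y) * indicator (ball 0 (2 * R)) y) \<partial>lborel)"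
      by (rule nn_integral_translate[of "\<lambda>y. ennreal (B\<^sup>2) * (ennreal (?k y) * indicator (ball 0 (2 * R)) y)"]) measurable
    also have "\<dots> = ennreal (B\<^sup>2) * I" unfolding I_def by (rule nn_integral_cmult) measurable
    finally show ?thesis .
  qed
  have "gagliardo_sq \<Omega> \<theta> f \<le> (\<integral>\<^sup>+x. ennreal (B\<^sup>2) * I \<partial>?M)"
    unfolding gagliardo_sq_def by (rule nn_integral_mono) (simp add: inner)
  also have "\<dots> = ennreal (B\<^sup>2) * I * emeasure ?M (space ?M)" by simp
  also have "\<dots> < \<infinity>"
    using I finite_measure.emeasure_finite[OF finite_measure_bounded[OF \<Omega>]] by (auto simp: ennreal_mult_less_top less_top)
  finally show ?thesis .
qed

lemma test_Lipschitz:
  fixes \<phi> :: "'a::euclidean_space \<Rightarrow> real"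
  assumes \<phi>: "\<phi> \<in> test_functions \<Omega>"
  obtains B where "\<And>x y. \<bar>\<phi> x - \<phi> y\<bar> \<le> B * norm (x - y)"
proof -
  obtain R where "\<And>x. R \<le> norm x \<Longrightarrow> grad \<phi> x = 0" using test_support_ball[OF \<phi>] by metis
  then obtain B where B: "\<And>x. norm (grad \<phi> x) \<le> B"
    using bounded_if_zero_outside[OF smooth_continuous_grad[OF test_smooth[OF \<phi>]]] by metis
  have "\<bar>\<phi> x - \<phi> y\<bar> \<le> B * norm (x - y)" for x y
  proof -
    obtain \<xi> where "\<phi> (y + (x - y)) - \<phi> y = grad \<phi> (y + \<xi> *\<^sub>R (x - y)) \<bullet> (x - y)"
      using line_mvt[OF test_smooth[OF \<phi>]] by blast
    then show ?thesis
      using Cauchy_Schwarz_ineq2[of "grad \<phi> (y + \<xi> *\<^sub>R (x - y))" "x - y"] mult_right_mono[OF B, of "norm (x - y)"]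
      by (simp add: order_trans)
  qed
  then show ?thesis by (rule that)
qed

text \<open>\<open>h\<close> is prescribed a.e. only, as for a derivative picked by
  \<open>weak_deriv\<close>, and the identity is inserted in one variable at a time. The rest is
  \<open>(a - b) ^ 2 \<le> 2 * a ^ 2 + 2 * b ^ 2\<close>, where additivity of the integrals rests on
  joint measurability of the integrands.\<close>

lemma gagliardo_diff_finite:
  fixes f g :: "'a::euclidean_space \<Rightarrow> real"
  assumes \<Omega>: "open \<Omega>" "bounded \<Omega>"
    and m: "f \<in> borel_measurable (lebesgue_on \<Omega>)" "g \<in> borel_measurable (lebesgue_on \<Omega>)"
    and fin: "gagliardo_sq \<Omega> \<theta> f < \<infinity>" "gagliardo_sq \<Omega> \<theta> g < \<infinity>"
    and h: "AE x in lebesgue_on \<Omega>. h x = f x - g x"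
  shows "gagliardo_sq \<Omega> \<theta> h < \<infinity>"
proof -
  let ?M = "lebesgue_on \<Omega>"
  note m[measurable]
  interpret finite_measure ?M using finite_measure_bounded[OF \<Omega>] .
  have id[measurable]: "(\<lambda>x. x) \<in> ?M \<rightarrow>\<^sub>M borel"
    by (rule continuous_measurable_lebesgue_on) (rule continuous_on_id)
  let ?d = "\<lambda>x y::'a. dist x y powr (real DIM('a) + 2 * \<theta>)"
  have [measurable]: "(\<lambda>p. ?d (fst p) (snd p)) \<in> borel_measurable (?M \<Otimes>\<^sub>M ?M)"
  proof -
    have "fst \<in> ?M \<Otimes>\<^sub>M ?M \<rightarrow>\<^sub>M borel" "snd \<in> ?M \<Otimes>\<^sub>M ?M \<rightarrow>\<^sub>M borel"
      using measurable_compose[OF measurable_fst id] measurable_compose[OF measurable_snd id] by simp_all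
    then have 1: "(\<lambda>p. (fst p, snd p)) \<in> ?M \<Otimes>\<^sub>M ?M \<rightarrow>\<^sub>M borel \<Otimes>\<^sub>M borel" by (rule measurable_Pair)
    have 2: "(\<lambda>p. ?d (fst p) (snd p)) \<in> borel_measurable (borel \<Otimes>\<^sub>M borel)" by measurable
    show ?thesis using measurable_compose[OF 1 2] by simp
  qed
  have jm[measurable]: "(\<lambda>(x, y). ennreal ((k x - k y)\<^sup>2 / ?d x y)) \<in> borel_measurable (?M \<Otimes>\<^sub>M ?M)"
    if [measurable]: "k \<in> borel_measurable ?M" for k :: "'a \<Rightarrow> real"
    unfolding case_prod_beta by measurable
  have im: "(\<lambda>x. \<integral>\<^sup>+y. ennreal ((k x - k y)\<^sup>2 / ?d x y) \<partial>?M) \<in> borel_measurable ?M"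
    and ims: "x \<in> \<Omega> \<Longrightarrow> (\<lambda>y. ennreal ((k x - k y)\<^sup>2 / ?d x y)) \<in> borel_measurable ?M"
    if k: "k \<in> borel_measurable ?M" for k :: "'a \<Rightarrow> real" and x
    using borel_measurable_nn_integral[OF jm[OF k]] measurable_Pair2[OF jm[OF k], of x] by auto
  have "gagliardo_sq \<Omega> \<theta> h \<le> (\<integral>\<^sup>+x. 2 * (\<integral>\<^sup>+y. ennreal ((f x - f y)\<^sup>2 / ?d x y) \<partial>?M) + 2 * (\<integral>\<^sup>+y. ennreal ((g x - g y)\<^sup>2 / ?d x y) \<partial>?M) \<partial>?M)"
    unfolding gagliardo_sq_def
  proof (rule nn_integral_mono_AE)
    show "AE x in ?M. (\<integral>\<^sup>+y. ennreal ((h x - h y)\<^sup>2 / ?d x y) \<partial>?M)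
       \<le> 2 * (\<integral>\<^sup>+y. ennreal ((f x - f y)\<^sup>2 / ?d x y) \<partial>?M) + 2 * (\<integral>\<^sup>+y. ennreal ((g x - g y)\<^sup>2 / ?d x y) \<partial>?M)"
      using h AE_space
    proof eventually_elim
      case (elim x)
      then have x: "x \<in> \<Omega>" by simp
      have "(\<integral>\<^sup>+y. ennreal ((h x - h y)\<^sup>2 / ?d x y) \<partial>?M) \<le> (\<integral>\<^sup>+y. 2 * ennreal ((f x - f y)\<^sup>2 / ?d x y) + 2 * ennreal ((g x - g y)\<^sup>2 / ?d x y) \<partial>?M)"
      proof (rule nn_integral_mono_AE)
        show "AE y in ?M. ennreal ((h x - h y)\<^sup>2 / ?d x y) \<le> 2 * ennreal ((f x - f y)\<^sup>2 / ?d x y) + 2 * ennreal ((g x - g y)\<^sup>2 / ?d x y)"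
          using h
        proof eventually_elim
          case (elim y)
          have e2: "ennreal (2 * A + 2 * B) = 2 * ennreal A + 2 * ennreal B" if "0 \<le> A" "0 \<le> B" for A B
            using that by (simp add: ennreal_mult)
          have "(h x - h y)\<^sup>2 \<le> 2 * (f x - f y)\<^sup>2 + 2 * (g x - g y)\<^sup>2"
          proof -
            have gen: "(a - b)\<^sup>2 \<le> 2 * a\<^sup>2 + 2 * b\<^sup>2" for a b :: real
              using norm_add_power2_le[of a "- b"] by simp
            have "h x - h y = (f x - f y) - (g x - g y)" using elim \<open>h x = f x - g x\<close> by simp
            then show ?thesis using gen[of "f x - f y" "g x - g y"] by simp
          qed
          then have "(h x - h y)\<^sup>2 / ?d x y \<le> (2 * (f x - f y)\<^sup>2 + 2 * (g x - g y)\<^sup>2) / ?d x y"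
            by (rule divide_right_mono) simp
          also have "\<dots> = 2 * ((f x - f y)\<^sup>2 / ?d x y) + 2 * ((g x - g y)\<^sup>2 / ?d x y)"
            by (simp add: add_divide_distrib)
          finally have "ennreal ((h x - h y)\<^sup>2 / ?d x y) \<le> ennreal (2 * ((f x - f y)\<^sup>2 / ?d x y) + 2 * ((g x - g y)\<^sup>2 / ?d x y))"
            by (rule ennreal_leI)
          also have "ennreal (2 * ((f x - f y)\<^sup>2 / ?d x y) + 2 * ((g x - g y)\<^sup>2 / ?d x y))
              = 2 * ennreal ((f x - f y)\<^sup>2 / ?d x y) + 2 * ennreal ((g x - g y)\<^sup>2 / ?d x y)"
            by (rule e2) simp_all
          finally show ?case .
        qed
      qed
      also have "\<dots> = (\<integral>\<^sup>+y. 2 * ennreal ((f x - f y)\<^sup>2 / ?d x y) \<partial>?M) + (\<integral>\<^sup>+y. 2 * ennreal ((g x - g y)\<^sup>2 / ?d x y) \<partial>?M)"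
        using ims[OF m(1) x] ims[OF m(2) x] by (intro nn_integral_add) auto
      also have "\<dots> = 2 * (\<integral>\<^sup>+y. ennreal ((f x - f y)\<^sup>2 / ?d x y) \<partial>?M) + 2 * (\<integral>\<^sup>+y. ennreal ((g x - g y)\<^sup>2 / ?d x y) \<partial>?M)"
        using ims[OF m(1) x] ims[OF m(2) x] by (simp add: nn_integral_cmult)
      finally show ?case .
    qed
  qed
  also have "\<dots> = 2 * gagliardo_sq \<Omega> \<theta> f + 2 * gagliardo_sq \<Omega> \<theta> g"
    unfolding gagliardo_sq_def using im[OF m(1)] im[OF m(2)] by (simp add: nn_integral_add nn_integral_cmult)
  also have "\<dots> < \<infinity>" using fin by (auto simp: ennreal_mult_less_top ennreal_add_less_top)
  finally show ?thesis .
qed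

section \<open>From test functions to the dual norm\<close>

lemma sobolev_norm_sq_frac:
  assumes "0 < \<epsilon>" "\<epsilon> < 1"
  shows "sobolev_norm_sq \<Omega> (1 + \<epsilon>) u =
     (\<Sum>j\<le>1. \<Sum>bs\<in>words j. \<integral>\<^sup>+x. ennreal ((weak_deriv \<Omega> bs u x)\<^sup>2) \<partial>lebesgue_on \<Omega>)
     + (\<Sum>b\<in>Basis. gagliardo_sq \<Omega> \<epsilon> (weak_deriv \<Omega> [b] u))"
proof -
  have "\<lfloor>1 + \<epsilon>\<rfloor> = 1" using assms by linarith
  then have "nat \<lfloor>1 + \<epsilon>\<rfloor> = 1" "frac (1 + \<epsilon>) = \<epsilon>" by (simp_all add: frac_def)
  then show ?thesis using assms by (simp only: sobolev_norm_sq_def sum_words_1) simp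
qed

lemma sobolev_frac_imp_1:
  assumes "0 < \<epsilon>" "\<epsilon> < 1" "u \<in> sobolev \<Omega> (1 + \<epsilon>)"
  shows "u \<in> sobolev \<Omega> 1"
proof -
  have "\<lfloor>1 + \<epsilon>\<rfloor> = 1" using assms by linarith
  then have n: "nat \<lfloor>1 + \<epsilon>\<rfloor> = nat \<lfloor>1::real\<rfloor>" by simp
  have "nat \<lfloor>1::real\<rfloor> = 1" by simp
  then have "sobolev_norm_sq \<Omega> 1 u \<le> sobolev_norm_sq \<Omega> (1 + \<epsilon>) u"
    unfolding sobolev_norm_sq_frac[OF assms(1,2)] by (simp only: sobolev_norm_sq_def) simp
  then show ?thesis using assms(3) unfolding sobolev_def n by auto
qed

text \<open>Pitfall: \<^const>\<open>sobolev_norm\<close> is \<open>0\<close> where the squared norm is infinite, so the finiteness of all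
  Gagliardo seminorms involved has to be checked.\<close>

lemma sobolev_frac_diff_test:
  fixes u :: "'a::euclidean_space \<Rightarrow> real"
  assumes \<Omega>: "open \<Omega>" "bounded \<Omega>" and \<epsilon>: "0 < \<epsilon>" "\<epsilon> < 1" and u: "u \<in> sobolev \<Omega> (1 + \<epsilon>)" and \<phi>: "\<phi> \<in> test_functions \<Omega>"
  shows "nrm (lebesgue_on \<Omega>) (\<lambda>x. u x - \<phi> x) \<le> sobolev_norm \<Omega> (1 + \<epsilon>) (\<lambda>x. u x - \<phi> x)"
    "nrm (lebesgue_on \<Omega>) (\<lambda>x. weak_grad \<Omega> u x - grad \<phi> x) \<le> sobolev_norm \<Omega> (1 + \<epsilon>) (\<lambda>x. u x - \<phi> x)"
proof -
  let ?M = "lebesgue_on \<Omega>"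
  have u1: "u \<in> sobolev \<Omega> 1" using sobolev_frac_imp_1[OF \<epsilon> u] .
  note g = sobolev1_weak_grad[OF \<Omega> u1]
  have sm: "smooth \<phi>" using \<phi> by (rule test_smooth)
  define v where "v x = u x - \<phi> x" for x
  have sv: "sqint ?M v"
    unfolding v_def[abs_def] by (rule sqint_diff[OF g(1)]) (intro continuous_sqint \<Omega> smooth_continuous sm)
  have sD: "sqint ?M (\<lambda>x. weak_grad \<Omega> u x - grad \<phi> x)"
    by (rule sqint_diff[OF g(2)]) (intro continuous_sqint \<Omega> smooth_continuous_grad sm)
  have sb: "sqint ?M (\<lambda>x. (weak_grad \<Omega> u x - grad \<phi> x) \<bullet> b)" if "b \<in> Basis" for b
    using sD by (rule sqint_dominated[where C = 1]) (use sqint_measurable[OF sD] that in \<open>auto simp: Basis_le_norm\<close>)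
  have wd: "has_weak_deriv \<Omega> [b] v (\<lambda>x. (weak_grad \<Omega> u x - grad \<phi> x) \<bullet> b)" if b: "b \<in> Basis" for b
  proof -
    have "has_weak_deriv \<Omega> [b] v (\<lambda>x. weak_grad \<Omega> u x \<bullet> b - partial b \<phi> x)"
      unfolding v_def[abs_def] using b by (intro has_weak_deriv_diff \<Omega> g(3) has_weak_deriv_smooth sm) auto
    then show ?thesis using b by (simp add: inner_diff_left grad_inner_Basis)
  qed
  have H1: "(\<Sum>j\<le>1. \<Sum>bs\<in>words j. \<integral>\<^sup>+x. ennreal ((weak_deriv \<Omega> bs v x)\<^sup>2) \<partial>?M)
    = ennreal ((nrm ?M v)\<^sup>2 + (nrm ?M (\<lambda>x. weak_grad \<Omega> u x - grad \<phi> x))\<^sup>2)"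
    using sobolev_norm_sq_H1_part[OF \<Omega> sv wd sb] nrm_components(2)[OF sb] by simp
  have G: "gagliardo_sq \<Omega> \<epsilon> (weak_deriv \<Omega> [b] v) < \<infinity>" if b: "b \<in> Basis" for b
  proof (rule gagliardo_diff_finite[OF \<Omega>])
    have "sobolev_norm_sq \<Omega> (1 + \<epsilon>) u < \<infinity>" using u by (simp add: sobolev_def)
    then have "(\<Sum>b\<in>Basis. gagliardo_sq \<Omega> \<epsilon> (weak_deriv \<Omega> [b] u)) < \<infinity>"
      unfolding sobolev_norm_sq_frac[OF \<epsilon>] by (auto simp: ennreal_add_less_top)
    then show "gagliardo_sq \<Omega> \<epsilon> (weak_deriv \<Omega> [b] u) < \<infinity>"
      using b member_le_sum[of b Basis "\<lambda>b. gagliardo_sq \<Omega> \<epsilon> (weak_deriv \<Omega> [b] u)"] by (auto intro: le_less_trans)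
    obtain B where "\<And>x y. \<bar>partial b \<phi> x - partial b \<phi> y\<bar> \<le> B * norm (x - y)"
      using test_Lipschitz[OF test_partial[OF \<phi> b]] by blast
    then show "gagliardo_sq \<Omega> \<epsilon> (partial b \<phi>) < \<infinity>" by (rule gagliardo_finite_Lipschitz[OF \<Omega> \<epsilon>])
    show "partial b \<phi> \<in> borel_measurable ?M"
      by (intro continuous_measurable_lebesgue_on smooth_continuous smooth_partial sm b)
    have "(\<lambda>x. weak_grad \<Omega> u x \<bullet> b) \<in> borel_measurable ?M" using sqint_measurable[OF g(2)] by measurable
    then show "weak_deriv \<Omega> [b] u \<in> borel_measurable ?M" using b by (simp add: weak_grad_inner)
    show "AE x in ?M. weak_deriv \<Omega> [b] v x = weak_deriv \<Omega> [b] u x - partial b \<phi> x"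
      using weak_deriv_AE[OF \<Omega>(1) wd[OF b]] by eventually_elim (use b in \<open>simp add: inner_diff_left grad_inner_Basis weak_grad_inner\<close>)
  qed
  define E where "E = (\<Sum>b\<in>Basis. gagliardo_sq \<Omega> \<epsilon> (weak_deriv \<Omega> [b] v))"
  have E: "E < \<infinity>" unfolding E_def using G by (simp add: less_top)
  then obtain e where e: "E = ennreal e" "0 \<le> e" by (cases E) auto
  have "sobolev_norm \<Omega> (1 + \<epsilon>) v = sqrt ((nrm ?M v)\<^sup>2 + (nrm ?M (\<lambda>x. weak_grad \<Omega> u x - grad \<phi> x))\<^sup>2 + e)"
    unfolding sobolev_norm_def sobolev_norm_sq_frac[OF \<epsilon>] H1 E_def[symmetric] e(1)
    using e(2) by (subst ennreal_plus[symmetric]) (auto simp del: ennreal_plus)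
  then show "nrm ?M (\<lambda>x. u x - \<phi> x) \<le> sobolev_norm \<Omega> (1 + \<epsilon>) (\<lambda>x. u x - \<phi> x)"
    "nrm ?M (\<lambda>x. weak_grad \<Omega> u x - grad \<phi> x) \<le> sobolev_norm \<Omega> (1 + \<epsilon>) (\<lambda>x. u x - \<phi> x)"
    using e(2) by (auto simp: v_def[abs_def] intro!: real_le_rsqrt)
qed

lemma zero_test: "(\<lambda>x. 0) \<in> test_functions \<Omega>"
  by (simp add: test_functions_def smooth_const)

text \<open>The bound extends from test functions to \<open>sobolev0\<close> by density, the pairing
  with \<open>p\<close> being continuous in L2. The factor 2 arises because the norms of
  \<open>v\<close> and of its weak gradient are each at most 1.\<close>

lemma sobolev0_test_bound:
  fixes v p :: "'a::euclidean_space \<Rightarrow> real"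
  assumes \<Omega>: "open \<Omega>" "bounded \<Omega>" and \<epsilon>: "0 < \<epsilon>" "\<epsilon> < 1"
    and v: "v \<in> sobolev0 \<Omega> (1 + \<epsilon>)" "sobolev_norm \<Omega> (1 + \<epsilon>) v \<le> 1"
    and p: "sqint (lebesgue_on \<Omega>) p" and K: "0 \<le> K"
    and bound: "\<And>\<phi>. \<phi> \<in> test_functions \<Omega> \<Longrightarrow> \<bar>\<integral>x. p x * \<phi> x \<partial>lebesgue_on \<Omega>\<bar>
      \<le> K * (nrm (lebesgue_on \<Omega>) \<phi> + nrm (lebesgue_on \<Omega>) (grad \<phi>))"
  shows "\<bar>\<integral>x. p x * v x \<partial>lebesgue_on \<Omega>\<bar> \<le> 2 * K"
proof (rule field_le_epsilon)
  let ?M = "lebesgue_on \<Omega>"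
  fix d :: real assume d: "0 < d"
  have vs: "v \<in> sobolev \<Omega> (1 + \<epsilon>)" using v(1) by (simp add: sobolev0_def)
  note g = sobolev1_weak_grad(1,2)[OF \<Omega> sobolev_frac_imp_1[OF \<epsilon> vs]]
  \<comment> \<open>Approximating within \<open>e\<close> costs \<open>2 * K * e\<close> in the
    bound and \<open>nrm ?M p * e\<close> in the pairing; the 1 keeps \<open>c\<close>
    positive.\<close>
  define c where "c = nrm ?M p + 2 * K + 1"
  have c: "0 < c" using K nrm_nonneg[of ?M p] by (simp add: c_def)
  define e where "e = d / c"
  have e: "0 < e" using d c by (simp add: e_def)
  obtain \<phi> where \<phi>: "\<phi> \<in> test_functions \<Omega>" "sobolev_norm \<Omega> (1 + \<epsilon>) (\<lambda>x. v x - \<phi> x) < e"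
    using v(1) e unfolding sobolev0_def by blast
  have s\<phi>: "sqint ?M \<phi>" "sqint ?M (grad \<phi>)"
    by (intro continuous_sqint \<Omega> smooth_continuous smooth_continuous_grad test_smooth[OF \<phi>(1)])+
  have n: "nrm ?M (\<lambda>x. v x - \<phi> x) \<le> e" "nrm ?M (\<lambda>x. weak_grad \<Omega> v x - grad \<phi> x) \<le> e"
    using sobolev_frac_diff_test[OF \<Omega> \<epsilon> vs \<phi>(1)] \<phi>(2) by auto
  \<comment> \<open>Comparison with the test function 0 bounds \<open>v\<close> itself.\<close>
  have n1: "nrm ?M v \<le> 1" "nrm ?M (weak_grad \<Omega> v) \<le> 1"
    using sobolev_frac_diff_test[OF \<Omega> \<epsilon> vs zero_test] v(2) by (auto simp: grad_const)
  have n2: "nrm ?M \<phi> \<le> 1 + e" "nrm ?M (grad \<phi>) \<le> 1 + e"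
    using nrm_triangle_diff[OF g(1) sqint_diff[OF g(1) s\<phi>(1)]] nrm_triangle_diff[OF g(2) sqint_diff[OF g(2) s\<phi>(2)]] n n1 by auto
  have "(\<integral>x. p x * v x \<partial>?M) = (\<integral>x. p x * \<phi> x \<partial>?M) + (\<integral>x. p x * (v x - \<phi> x) \<partial>?M)"
    using sqint_mult_integrable[OF p g(1)] sqint_mult_integrable[OF p s\<phi>(1)] by (simp add: right_diff_distrib)
  then have "\<bar>\<integral>x. p x * v x \<partial>?M\<bar> \<le> \<bar>\<integral>x. p x * \<phi> x \<partial>?M\<bar> + \<bar>\<integral>x. p x * (v x - \<phi> x) \<partial>?M\<bar>" by simp
  also have "\<dots> \<le> K * ((1 + e) + (1 + e)) + nrm ?M p * e"
  proof (rule add_mono)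
    show "\<bar>\<integral>x. p x * \<phi> x \<partial>?M\<bar> \<le> K * ((1 + e) + (1 + e))"
      using bound[OF \<phi>(1)] mult_left_mono[OF add_mono[OF n2] K] by linarith
    show "\<bar>\<integral>x. p x * (v x - \<phi> x) \<partial>?M\<bar> \<le> nrm ?M p * e"
      using nrm_Cauchy_Schwarz_mult[OF p sqint_diff[OF g(1) s\<phi>(1)]] mult_left_mono[OF n(1) nrm_nonneg[of ?M p]] by linarith
  qed
  also have "\<dots> = 2 * K + (2 * K + nrm ?M p) * e" by (simp add: algebra_simps)
  also have "\<dots> \<le> 2 * K + c * e" using e by (intro add_left_mono mult_right_mono) (auto simp: c_def)
  also have "c * e = d" using c by (simp add: e_def)
  finally show "\<bar>\<integral>x. p x * v x \<partial>?M\<bar> \<le> 2 * K + d" .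
qed

section \<open>The stability estimate\<close>

definition reg_inv :: "real \<Rightarrow> real \<Rightarrow> real" where
  "reg_inv \<delta> s = s / (s\<^sup>2 + \<delta>)"

definition reg_inv_deriv :: "real \<Rightarrow> real \<Rightarrow> real" where
  "reg_inv_deriv \<delta> s = (\<delta> - s\<^sup>2) / (s\<^sup>2 + \<delta>)\<^sup>2"

text \<open>For \<open>\<delta> = 0\<close> this is \<open>- 1 / s ^ 3\<close>, with derivative
  \<open>3 / s ^ 4\<close>. Multiplied by the squares of \<phi> and of the gradient of
  \<open>v\<close>, that derivative at \<open>v\<close> is three times the square to be bounded in
  \<open>weighted_gradient_bound\<close>.\<close>

definition reg_cube :: "real \<Rightarrow> real \<Rightarrow> real" where
  "reg_cube \<delta> s = - s / (s\<^sup>2 + \<delta>)\<^sup>2"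

definition reg_cube_deriv :: "real \<Rightarrow> real \<Rightarrow> real" where
  "reg_cube_deriv \<delta> s = (3 * s\<^sup>2 - \<delta>) / (s\<^sup>2 + \<delta>) ^ 3"

lemma reg_pos: "0 < \<delta> \<Longrightarrow> 0 < (s::real)\<^sup>2 + \<delta>"
  by (simp add: add_nonneg_pos)

text \<open>Smooth approximations of a function bounded away from 0 may still vanish, so the
  substitute for the reciprocal has to be smooth along every smooth \<open>f\<close>; the positive
  denominator provides that.\<close>

lemma reg_smooth:
  assumes "0 < \<delta>" "smooth f"
  shows "smooth (\<lambda>x. reg_inv \<delta> (f x))" "smooth (\<lambda>x. reg_cube \<delta> (f x))"
proof -
  have d: "smooth (\<lambda>x. (f x)\<^sup>2 + \<delta>)" by (intro smooth_add smooth_power smooth_const assms)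
  have n: "(f x)\<^sup>2 + \<delta> \<noteq> 0" for x using reg_pos[OF assms(1), of "f x"] by simp
  show "smooth (\<lambda>x. reg_inv \<delta> (f x))"
    unfolding reg_inv_def by (intro smooth_divide d assms n)
  have "smooth (\<lambda>x. 0 - f x)" by (intro smooth_diff smooth_const assms)
  then show "smooth (\<lambda>x. reg_cube \<delta> (f x))"
    unfolding reg_cube_def using n by (intro smooth_divide smooth_power d) auto
qed

lemma reg_deriv:
  assumes "0 < \<delta>"
  shows "(reg_inv \<delta> has_real_derivative reg_inv_deriv \<delta> s) (at s)"
    "(reg_cube \<delta> has_real_derivative reg_cube_deriv \<delta> s) (at s)"
proof -
  have n: "s\<^sup>2 + \<delta> \<noteq> 0" using reg_pos[OF assms, of s] by simp
  have D: "((\<lambda>s. s\<^sup>2 + \<delta>) has_real_derivative 2 * s) (at s)" by (auto intro!: derivative_eq_intros)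
  have "((\<lambda>s. s / (s\<^sup>2 + \<delta>)) has_real_derivative (1 * (s\<^sup>2 + \<delta>) - s * (2 * s)) / ((s\<^sup>2 + \<delta>) * (s\<^sup>2 + \<delta>))) (at s)"
    by (rule DERIV_divide[OF DERIV_ident D n])
  moreover have "(1 * (s\<^sup>2 + \<delta>) - s * (2 * s)) / ((s\<^sup>2 + \<delta>) * (s\<^sup>2 + \<delta>)) = reg_inv_deriv \<delta> s"
    by (simp add: reg_inv_deriv_def power2_eq_square)
  ultimately show "(reg_inv \<delta> has_real_derivative reg_inv_deriv \<delta> s) (at s)" by (simp add: reg_inv_def[abs_def])
  have D2: "((\<lambda>s. (s\<^sup>2 + \<delta>)\<^sup>2) has_real_derivative 2 * (s\<^sup>2 + \<delta>) * (2 * s)) (at s)"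
    by (auto intro!: derivative_eq_intros)
  have "((\<lambda>s. - s / (s\<^sup>2 + \<delta>)\<^sup>2) has_real_derivative ((- 1) * (s\<^sup>2 + \<delta>)\<^sup>2 - (- s) * (2 * (s\<^sup>2 + \<delta>) * (2 * s))) / ((s\<^sup>2 + \<delta>)\<^sup>2 * (s\<^sup>2 + \<delta>)\<^sup>2)) (at s)"
    using n by (intro DERIV_divide D2 DERIV_minus DERIV_ident) simp
  moreover have "((- 1) * (s\<^sup>2 + \<delta>)\<^sup>2 - (- s) * (2 * (s\<^sup>2 + \<delta>) * (2 * s))) / ((s\<^sup>2 + \<delta>)\<^sup>2 * (s\<^sup>2 + \<delta>)\<^sup>2) = reg_cube_deriv \<delta> s"
  proof -
    define t where "t = s\<^sup>2 + \<delta>"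
    have t: "t \<noteq> 0" using n by (simp add: t_def)
    have "((- 1) * t\<^sup>2 - (- s) * (2 * t * (2 * s))) / (t\<^sup>2 * t\<^sup>2) = (4 * s\<^sup>2 - t) / t ^ 3"
      using t by (simp add: field_simps power2_eq_square power3_eq_cube)
    moreover have "4 * s\<^sup>2 - t = 3 * s\<^sup>2 - \<delta>" by (simp add: t_def)
    ultimately show ?thesis by (simp add: reg_cube_deriv_def t_def)
  qed
  ultimately show "(reg_cube \<delta> has_real_derivative reg_cube_deriv \<delta> s) (at s)" by (simp add: reg_cube_def[abs_def])
qed

lemma reg_deriv_continuous:
  assumes "0 < \<delta>"
  shows "continuous_on UNIV (reg_inv_deriv \<delta>)" "continuous_on UNIV (reg_cube_deriv \<delta>)"
proof -
  have "s\<^sup>2 + \<delta> \<noteq> 0" for s using reg_pos[OF assms, of s] by simp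
  then show "continuous_on UNIV (reg_inv_deriv \<delta>)" "continuous_on UNIV (reg_cube_deriv \<delta>)"
    unfolding reg_inv_deriv_def[abs_def] reg_cube_deriv_def[abs_def] by (auto intro!: continuous_intros)
qed

text \<open>The inequality of arithmetic and geometric mean for \<open>s ^ 2\<close> and
  \<delta>.\<close>

lemma reg_abs_le:
  assumes "0 < (\<delta>::real)"
  shows "\<bar>s\<bar> \<le> (s\<^sup>2 + \<delta>) / (2 * sqrt \<delta>)"
proof -
  have "0 \<le> (\<bar>s\<bar> - sqrt \<delta>)\<^sup>2" by simp
  then have "\<bar>s\<bar> * (2 * sqrt \<delta>) \<le> s\<^sup>2 + \<delta>" using assms by (simp add: power2_diff mult_ac)
  then show ?thesis using assms by (simp add: le_divide_eq)
qed

text \<open>\<open>weak_div_test_compose\<close> takes one common bound for a function and its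
  derivative, hence the sum of the two separate bounds. It blows up as \<delta> tends to 0 and
  serves to admit \<open>reg_inv\<close> as a nonlinearity for fixed \<delta>.\<close>

lemma reg_inv_bounded:
  assumes "0 < \<delta>"
  shows "\<bar>reg_inv \<delta> s\<bar> \<le> 1 / (2 * sqrt \<delta>) + 1 / \<delta>" "\<bar>reg_inv_deriv \<delta> s\<bar> \<le> 1 / (2 * sqrt \<delta>) + 1 / \<delta>"
proof -
  define t where "t = s\<^sup>2 + \<delta>"
  have t: "0 < t" "\<delta> \<le> t" using reg_pos[OF assms, of s] by (auto simp: t_def)
  have "\<bar>s\<bar> / t \<le> (t / (2 * sqrt \<delta>)) / t"
    using reg_abs_le[OF assms, of s] t by (intro divide_right_mono) (auto simp: t_def)
  then have "\<bar>reg_inv \<delta> s\<bar> \<le> 1 / (2 * sqrt \<delta>)"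
    using t by (simp add: reg_inv_def abs_divide t_def[symmetric])
  then show "\<bar>reg_inv \<delta> s\<bar> \<le> 1 / (2 * sqrt \<delta>) + 1 / \<delta>" using assms by (simp add: add_increasing2)
  have "\<bar>\<delta> - s\<^sup>2\<bar> \<le> t" using assms by (simp add: t_def abs_le_iff)
  then have "\<bar>reg_inv_deriv \<delta> s\<bar> \<le> t / t\<^sup>2"
    unfolding reg_inv_deriv_def t_def[symmetric] abs_divide using t by (simp add: divide_right_mono)
  also have "\<dots> = 1 / t" using t by (simp add: power2_eq_square)
  also have "\<dots> \<le> 1 / \<delta>" by (intro divide_left_mono mult_pos_pos t assms) auto
  finally show "\<bar>reg_inv_deriv \<delta> s\<bar> \<le> 1 / (2 * sqrt \<delta>) + 1 / \<delta>" using assms by (simp add: add_increasing)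
qed

text \<open>These bounds are uniform in \<delta> and thus survive the limit in
  \<open>coefficient_difference_bound\<close>, where \<delta> tends to 0.\<close>

lemma reg_inv_le:
  assumes "0 < \<delta>" "s \<noteq> 0"
  shows "\<bar>reg_inv \<delta> s\<bar> \<le> 1 / \<bar>s\<bar>" "\<bar>reg_inv_deriv \<delta> s\<bar> \<le> 1 / s\<^sup>2"
proof -
  define t where "t = s\<^sup>2 + \<delta>"
  have s2: "0 < s\<^sup>2" using assms by simp
  have t: "0 < t" "s\<^sup>2 \<le> t" using reg_pos[OF assms(1), of s] assms by (auto simp: t_def)
  have "\<bar>s\<bar> / t \<le> \<bar>s\<bar> / s\<^sup>2" by (intro divide_left_mono mult_pos_pos t s2) auto
  also have "\<dots> = 1 / \<bar>s\<bar>" using assms(2) by (simp add: power2_eq_square divide_simps abs_if)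
  finally show "\<bar>reg_inv \<delta> s\<bar> \<le> 1 / \<bar>s\<bar>" using t by (simp add: reg_inv_def abs_divide t_def[symmetric])
  have "\<bar>\<delta> - s\<^sup>2\<bar> \<le> t" using assms by (simp add: t_def abs_le_iff)
  then have "\<bar>reg_inv_deriv \<delta> s\<bar> \<le> t / t\<^sup>2"
    unfolding reg_inv_deriv_def t_def[symmetric] abs_divide using t by (simp add: divide_right_mono)
  also have "\<dots> = 1 / t" using t by (simp add: power2_eq_square)
  also have "\<dots> \<le> 1 / s\<^sup>2" by (intro divide_left_mono mult_pos_pos t s2) auto
  finally show "\<bar>reg_inv_deriv \<delta> s\<bar> \<le> 1 / s\<^sup>2" .
qed

text \<open>As for \<open>reg_inv\<close>, one common bound for the function and its derivative;
  \<delta> stays fixed where it is used.\<close>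

lemma reg_cube_bounded:
  assumes "0 < \<delta>"
  shows "\<bar>reg_cube \<delta> s\<bar> \<le> 1 / (2 * sqrt \<delta> * \<delta>) + 3 / \<delta>\<^sup>2" "\<bar>reg_cube_deriv \<delta> s\<bar> \<le> 1 / (2 * sqrt \<delta> * \<delta>) + 3 / \<delta>\<^sup>2"
proof -
  define t where "t = s\<^sup>2 + \<delta>"
  have t: "0 < t" "\<delta> \<le> t" using reg_pos[OF assms, of s] by (auto simp: t_def)
  have "\<bar>reg_cube \<delta> s\<bar> = \<bar>s\<bar> / t\<^sup>2" by (simp add: reg_cube_def abs_divide t_def)
  also have "\<dots> \<le> (t / (2 * sqrt \<delta>)) / t\<^sup>2"
    using reg_abs_le[OF assms, of s] by (intro divide_right_mono) (auto simp: t_def)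
  also have "\<dots> = 1 / (2 * sqrt \<delta>) / t" using t by (simp add: power2_eq_square)
  also have "\<dots> \<le> 1 / (2 * sqrt \<delta>) / \<delta>"
    using less_imp_le[OF assms] by (intro divide_left_mono mult_pos_pos t assms) auto
  finally have "\<bar>reg_cube \<delta> s\<bar> \<le> 1 / (2 * sqrt \<delta> * \<delta>)" by simp
  then show "\<bar>reg_cube \<delta> s\<bar> \<le> 1 / (2 * sqrt \<delta> * \<delta>) + 3 / \<delta>\<^sup>2" using assms by (simp add: add_increasing2)
  have "\<bar>3 * s\<^sup>2 - \<delta>\<bar> \<le> 3 * t" using assms by (simp add: t_def abs_le_iff)
  then have "\<bar>reg_cube_deriv \<delta> s\<bar> \<le> 3 * t / t ^ 3"
    unfolding reg_cube_deriv_def t_def[symmetric] abs_divide using t by (simp add: divide_right_mono)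
  also have "\<dots> = 3 / t\<^sup>2" using t by (simp add: power2_eq_square power3_eq_cube)
  also have "\<dots> \<le> 3 / \<delta>\<^sup>2"
  proof (rule divide_left_mono)
    show "\<delta>\<^sup>2 \<le> t\<^sup>2" using t(2) assms by (intro power_mono) (simp_all add: less_imp_le)
    show "0 < t\<^sup>2 * \<delta>\<^sup>2" by (intro mult_pos_pos zero_less_power t(1) assms)
  qed simp
  finally show "\<bar>reg_cube_deriv \<delta> s\<bar> \<le> 1 / (2 * sqrt \<delta> * \<delta>) + 3 / \<delta>\<^sup>2" using assms by (simp add: add_increasing)
qed

lemma reg_cube_le:
  assumes "0 < \<delta>" "s \<noteq> 0"
  shows "\<bar>reg_cube \<delta> s\<bar> \<le> 1 / \<bar>s\<bar> ^ 3"
proof -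
  have s2: "0 < s\<^sup>2" using assms by simp
  have "\<bar>reg_cube \<delta> s\<bar> = \<bar>s\<bar> / (s\<^sup>2 + \<delta>)\<^sup>2" by (simp add: reg_cube_def abs_divide)
  also have "\<dots> \<le> \<bar>s\<bar> / (s\<^sup>2)\<^sup>2" 
  proof (rule divide_left_mono)
    show "(s\<^sup>2)\<^sup>2 \<le> (s\<^sup>2 + \<delta>)\<^sup>2" using assms(1) by (intro power_mono) auto
    show "0 < (s\<^sup>2 + \<delta>)\<^sup>2 * (s\<^sup>2)\<^sup>2" by (intro mult_pos_pos zero_less_power s2 reg_pos assms(1))
  qed simp
  also have "\<dots> = \<bar>s\<bar> / (\<bar>s\<bar> * \<bar>s\<bar> ^ 3)"
  proof -
    have "(s\<^sup>2)\<^sup>2 = \<bar>s\<bar>\<^sup>2 * \<bar>s\<bar>\<^sup>2" by (simp only: power2_abs power2_eq_square[of "s\<^sup>2"])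
    also have "\<dots> = \<bar>s\<bar> * \<bar>s\<bar> ^ 3" by (simp only: power2_eq_square power3_eq_cube mult.assoc)
    finally show ?thesis by (simp only:)
  qed
  also have "\<dots> = 1 / \<bar>s\<bar> ^ 3" using assms(2) by simp
  finally show ?thesis .
qed

text \<open>The choice \<open>\<delta> \<le> s\<^sup>2\<close> makes the derivative of the bounded function \<^term>\<open>reg_cube \<delta>\<close> comparable
  to \<open>s\<^sup>-\<^sup>4 = (d(1/s)/ds)\<^sup>2\<close>.\<close>

lemma reg_cube_deriv_ge:
  assumes "0 < \<delta>" "\<delta> \<le> s\<^sup>2"
  shows "1 / (4 * s ^ 4) \<le> reg_cube_deriv \<delta> s"
proof -
  define t where "t = s\<^sup>2"
  have t: "0 < t" "\<delta> \<le> t" using assms by (auto simp: t_def)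
  have s4: "s ^ 4 = t\<^sup>2" by (simp add: t_def flip: power_mult)
  have "1 / (4 * t\<^sup>2) = (2 * t) / (2 * t) ^ 3" using t by (simp add: power2_eq_square power3_eq_cube)
  also have "\<dots> \<le> (2 * t) / (t + \<delta>) ^ 3"
    using t assms(1) by (intro divide_left_mono power_mono mult_pos_pos) auto
  also have "\<dots> \<le> (3 * t - \<delta>) / (t + \<delta>) ^ 3"
    using t assms(1) by (intro divide_right_mono) auto
  finally show ?thesis by (simp add: reg_cube_deriv_def s4 t_def[symmetric])
qed

lemma test_power2: "\<phi> \<in> test_functions \<Omega> \<Longrightarrow> (\<lambda>x. (\<phi> x)\<^sup>2) \<in> test_functions \<Omega>"
  using test_mult_smooth[of \<phi> \<Omega> \<phi>] by (simp add: power2_eq_square test_smooth)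

section \<open>A priori estimates for the boundary value problem\<close>

lemma solves_divergence_data:
  assumes \<Omega>: "open \<Omega>" "bounded \<Omega>" and u: "solves \<Omega> a f g q u"
    and a: "a \<in> borel_measurable (lebesgue_on \<Omega>)" "AE x in lebesgue_on \<Omega>. \<bar>a x\<bar> \<le> A"
    and f: "sqint (lebesgue_on \<Omega>) f"
    and q: "q \<in> borel_measurable (lebesgue_on \<Omega>)" "AE x in lebesgue_on \<Omega>. \<bar>q x\<bar> \<le> Q"
  obtains D where "has_weak_div \<Omega> (\<lambda>x. a x *\<^sub>R weak_grad \<Omega> u x) D" "sqint (lebesgue_on \<Omega>) D"
    "AE x in lebesgue_on \<Omega>. D x = q x * u x - f x" "sqint (lebesgue_on \<Omega>) u"
    "sqint (lebesgue_on \<Omega>) (weak_grad \<Omega> u)" "sqint (lebesgue_on \<Omega>) (\<lambda>x. a x *\<^sub>R weak_grad \<Omega> u x)" "has_trace \<Omega> u g"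
proof -
  obtain D where D: "has_weak_div \<Omega> (\<lambda>x. a x *\<^sub>R weak_grad \<Omega> u x) D" "AE x in lebesgue_on \<Omega>. - D x + q x * u x = f x"
    and tr: "has_trace \<Omega> u g"
    using u unfolding solves_def by blast
  have u1: "u \<in> sobolev \<Omega> 1" using tr by (simp add: has_trace_def)
  note g = sobolev1_weak_grad(1,2)[OF \<Omega> u1]
  have ae: "AE x in lebesgue_on \<Omega>. q x * u x - f x = D x" using D(2) by eventually_elim simp
  have \<Omega>m: "\<Omega> \<in> sets lebesgue" using \<Omega> by simp
  have "sqint (lebesgue_on \<Omega>) (\<lambda>x. q x * u x - f x)"
    by (rule sqint_diff[OF sqint_bounded_mult[OF g(1) q] f])
  then have sD: "sqint (lebesgue_on \<Omega>) D" using sqint_AE[OF \<Omega>m _ ae] by blast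
  have ae': "AE x in lebesgue_on \<Omega>. D x = q x * u x - f x" using ae by eventually_elim simp
  show ?thesis
    by (rule that[OF D(1) sD ae' g sqint_bounded_scaleR[OF g(2) a] tr])
qed

text \<open>Young's inequality splits the mixed term so that half of \<open>X ^ 2\<close> can be
  absorbed on the left.\<close>

lemma quadratic_bound:
  fixes X N \<alpha> \<beta> \<kappa> :: real
  assumes "0 < \<alpha>" "0 \<le> \<beta>" "0 \<le> \<kappa>" "0 \<le> N" and le: "\<alpha> * X\<^sup>2 \<le> \<beta> * X * N + \<kappa> * N\<^sup>2"
  shows "X \<le> sqrt (2 * \<kappa> / \<alpha> + (\<beta> / \<alpha>)\<^sup>2) * N"
proof (rule power2_le_imp_le)
  define b where "b = \<beta> / \<alpha>"
  define k where "k = \<kappa> / \<alpha>"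
  have "X\<^sup>2 \<le> b * X * N + k * N\<^sup>2"
    using le assms(1) by (simp add: b_def k_def field_simps)
  moreover have "2 * (b * X * N) \<le> X\<^sup>2 + (b * N)\<^sup>2"
    using sum_squares_bound[of X "b * N"] by (simp add: mult_ac)
  ultimately have "X\<^sup>2 \<le> 2 * k * N\<^sup>2 + (b * N)\<^sup>2" by linarith
  also have "\<dots> = (2 * k + b\<^sup>2) * N\<^sup>2" by (simp add: algebra_simps power_mult_distrib)
  also have "\<dots> = (sqrt (2 * k + b\<^sup>2) * N)\<^sup>2"
    using assms by (simp add: power_mult_distrib k_def)
  finally show "X\<^sup>2 \<le> (sqrt (2 * \<kappa> / \<alpha> + (\<beta> / \<alpha>)\<^sup>2) * N)\<^sup>2" by (simp add: b_def k_def)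
qed (use assms in simp)

text \<open>Testing the equation with \<open>\<phi>\<^sup>2 H(v)\<close>, \<open>H' \<approx> v\<^sup>-\<^sup>4\<close>, bounds \<open>\<phi> \<nabla>(1/v)\<close> in
  \<open>L\<^sup>2\<close> without using any Sobolev embedding for \<open>\<nabla>v\<close>.\<close>

lemma weighted_gradient_bound:
  fixes \<Omega> :: "'a::euclidean_space set" and a v D f q :: "'a \<Rightarrow> real" and G :: "'a \<Rightarrow> 'a"
  assumes dim: "DIM('a) \<le> 3" and \<Omega>: "open \<Omega>" "bounded \<Omega>"
    and a: "a \<in> borel_measurable (lebesgue_on \<Omega>)" "AE x in lebesgue_on \<Omega>. \<bar>a x\<bar> \<le> A" "0 < a0" "AE x in lebesgue_on \<Omega>. a0 \<le> a x"
    and f: "sqint (lebesgue_on \<Omega>) f"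
    and q: "AE x in lebesgue_on \<Omega>. \<bar>q x\<bar> \<le> Q"
    and D: "has_weak_div \<Omega> (\<lambda>x. a x *\<^sub>R G x) D" "sqint (lebesgue_on \<Omega>) D" "AE x in lebesgue_on \<Omega>. D x = q x * v x - f x"
    and v: "sqint (lebesgue_on \<Omega>) v" "sqint (lebesgue_on \<Omega>) G" "sqint (lebesgue_on \<Omega>) (\<lambda>x. a x *\<^sub>R G x)"
    and c0: "0 < c0" "AE x in lebesgue_on \<Omega>. c0 \<le> \<bar>v x\<bar>"
    and \<psi>: "\<And>n. smooth (\<psi> n)" "(\<lambda>n. nrm (lebesgue_on \<Omega>) (\<lambda>x. v x - \<psi> n x)) \<longlonglongrightarrow> 0"
      "(\<lambda>n. nrm (lebesgue_on \<Omega>) (\<lambda>x. G x - grad (\<psi> n) x)) \<longlonglongrightarrow> 0"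
  obtains C where "0 \<le> C" "\<And>\<phi>. \<phi> \<in> test_functions \<Omega> \<Longrightarrow> sqint (lebesgue_on \<Omega>) (\<lambda>x. (\<phi> x / (v x)\<^sup>2) *\<^sub>R G x)"
    "\<And>\<phi>. \<phi> \<in> test_functions \<Omega> \<Longrightarrow> nrm (lebesgue_on \<Omega>) (\<lambda>x. (\<phi> x / (v x)\<^sup>2) *\<^sub>R G x)
       \<le> C * (nrm (lebesgue_on \<Omega>) \<phi> + nrm (lebesgue_on \<Omega>) (grad \<phi>))"
proof -
  let ?M = "lebesgue_on \<Omega>"
  obtain Cf where Cf: "0 \<le> Cf" "\<And>\<phi>. \<phi> \<in> test_functions \<Omega> \<Longrightarrow> integrable ?M (\<lambda>x. \<bar>f x\<bar> * (\<phi> x)\<^sup>2)"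
    "\<And>\<phi>. \<phi> \<in> test_functions \<Omega> \<Longrightarrow> (\<integral>x. \<bar>f x\<bar> * (\<phi> x)\<^sup>2 \<partial>?M) \<le> Cf * (nrm ?M (grad \<phi>))\<^sup>2"
    using test_weighted_bound[OF dim \<Omega> f] by blast
  define A' where "A' = \<bar>A\<bar>"
  define Q' where "Q' = \<bar>Q\<bar>"
  have A': "0 \<le> A'" "AE x in ?M. \<bar>a x\<bar> \<le> A'" using a(2) unfolding A'_def by (simp, eventually_elim, simp)
  have Q': "0 \<le> Q'" "AE x in ?M. \<bar>q x\<bar> \<le> Q'" using q unfolding Q'_def by (simp, eventually_elim, simp)
  \<comment> \<open>The lower bound on |v| gives \<delta> \<le> v^2 a.e., as
    \<open>reg_cube_deriv_ge\<close> requires. Here \<delta> stays fixed.\<close>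
  define \<delta> where "\<delta> = c0\<^sup>2"
  have \<delta>: "0 < \<delta>" using c0(1) by (simp add: \<delta>_def)
  define H where "H = reg_cube \<delta>"
  define H' where "H' = reg_cube_deriv \<delta>"
  note [measurable] = a(1) sqint_measurable[OF v(1)] sqint_measurable[OF v(2)] sqint_measurable[OF D(2)] sqint_measurable[OF f]
  have [measurable]: "H \<in> borel_measurable borel" "H' \<in> borel_measurable borel"
    using reg_deriv(2)[OF \<delta>] reg_deriv_continuous(2)[OF \<delta>]
    by (auto simp: H_def H'_def continuous_on_eq_continuous_at intro!: borel_measurable_continuous_onI DERIV_isCont)
  \<comment> \<open>\<alpha> combines ellipticity with the 1/4 of \<open>reg_cube_deriv_ge\<close>.
    In \<beta> the 2 is from the gradient of \<phi>^2 and \<open>1 / c0\<close> from |H(v)| \<le> 1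
    / (c0 v^2), where 1 / v^2 goes into \<open>Y\<close>. The two terms of \<kappa> come from
    \<open>q v\<close> and from \<open>f\<close> on the right of the equation, the second through
    \<open>test_weighted_bound\<close>.\<close>
  define \<alpha> \<beta> \<kappa> where "\<alpha> = a0 / 4" and "\<beta> = 2 * A' / c0" and "\<kappa> = Q' / c0\<^sup>2 + Cf / c0 ^ 3"
  have pos: "0 < \<alpha>" "0 \<le> \<beta>" "0 \<le> \<kappa>" using a(3) A'(1) Q'(1) c0(1) Cf(1) by (auto simp: \<alpha>_def \<beta>_def \<kappa>_def)
  have main: "sqint ?M (\<lambda>x. (\<phi> x / (v x)\<^sup>2) *\<^sub>R G x) \<and> nrm ?M (\<lambda>x. (\<phi> x / (v x)\<^sup>2) *\<^sub>R G x)
       \<le> sqrt (2 * \<kappa> / \<alpha> + (\<beta> / \<alpha>)\<^sup>2) * (nrm ?M \<phi> + nrm ?M (grad \<phi>))" if \<phi>: "\<phi> \<in> test_functions \<Omega>" for \<phi>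
  proof
    have sm: "smooth \<phi>" using \<phi> by (rule test_smooth)
    have s\<phi>: "sqint ?M \<phi>" "sqint ?M (grad \<phi>)"
      by (intro continuous_sqint \<Omega> smooth_continuous smooth_continuous_grad sm)+
    note [measurable] = s\<phi>[THEN sqint_measurable]
    obtain R where R: "\<And>x. R \<le> norm x \<Longrightarrow> \<phi> x = 0" using test_support_ball[OF \<phi>] by metis
    obtain B where B: "B > 0" "\<And>x. norm (\<phi> x) \<le> B"
      using bounded_if_zero_outside[OF smooth_continuous[OF sm] R] by metis
    define Y where "Y x = (\<phi> x / (v x)\<^sup>2) *\<^sub>R G x" for x
    \<comment> \<open>A qualitative statement, whose bound involves the supremum of \<phi>: the norm
      of \<open>Y\<close> has to be finite before it can be absorbed.\<close>
    have sY: "sqint ?M Y"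
      unfolding Y_def
    proof (rule sqint_bounded_scaleR[OF v(2)])
      show "AE x in ?M. \<bar>\<phi> x / (v x)\<^sup>2\<bar> \<le> B / c0\<^sup>2"
        using c0(2)
      proof eventually_elim
        case (elim x)
        then have "c0\<^sup>2 \<le> (v x)\<^sup>2" using c0(1) by (metis abs_le_square_iff abs_of_pos)
        then have "\<bar>\<phi> x\<bar> / (v x)\<^sup>2 \<le> B / c0\<^sup>2" using B(2)[of x] B(1) c0(1) by (intro frac_le) auto
        then show ?case by (simp add: abs_divide)
      qed
    qed measurable
    then show "sqint ?M (\<lambda>x. (\<phi> x / (v x)\<^sup>2) *\<^sub>R G x)" by (simp add: Y_def[abs_def])
    have g2: "grad (\<lambda>x. (\<phi> x)\<^sup>2) x = (2 * \<phi> x) *\<^sub>R grad \<phi> x" for x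
      using grad_mult[OF smooth_differentiable[OF sm] smooth_differentiable[OF sm], of x]
      by (simp add: power2_eq_square scaleR_add_left[symmetric])
    have T: "(\<integral>x. (a x *\<^sub>R G x) \<bullet> (H (v x) *\<^sub>R grad (\<lambda>x. (\<phi> x)\<^sup>2) x + ((\<phi> x)\<^sup>2 * H' (v x)) *\<^sub>R G x) \<partial>?M) = - (\<integral>x. D x * ((\<phi> x)\<^sup>2 * H (v x)) \<partial>?M)"
      unfolding H_def H'_def
      by (rule weak_div_test_compose[OF \<Omega> D(1) v(3) D(2) v(1,2) \<psi> reg_smooth(2)[OF \<delta>] reg_deriv(2)[OF \<delta>]
            reg_deriv_continuous(2)[OF \<delta>] reg_cube_bounded[OF \<delta>] test_power2[OF \<phi>]])
    define P1 where "P1 x = a x * (\<phi> x)\<^sup>2 * H' (v x) * (norm (G x))\<^sup>2" for x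
    define P2 where "P2 x = 2 * a x * \<phi> x * H (v x) * (G x \<bullet> grad \<phi> x)" for x
    define P3 where "P3 x = D x * ((\<phi> x)\<^sup>2 * H (v x))" for x
    have Teq: "(\<integral>x. P2 x + P1 x \<partial>?M) = - (\<integral>x. P3 x \<partial>?M)"
      using T by (simp add: P1_def P2_def P3_def g2 inner_add_right power2_norm_eq_inner mult_ac)
    define E where "E x = Q' / c0\<^sup>2 * (\<phi> x)\<^sup>2 + 1 / c0 ^ 3 * (\<bar>f x\<bar> * (\<phi> x)\<^sup>2)" for x
    define N2 where "N2 x = \<beta> * (norm (Y x) * norm (grad \<phi> x))" for x
    have pw: "AE x in ?M. \<alpha> * (norm (Y x))\<^sup>2 \<le> P1 x \<and> \<bar>P2 x\<bar> \<le> N2 x \<and> \<bar>P3 x\<bar> \<le> E x"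
      using c0(2) a(4) A'(2) Q'(2) D(3)
    proof eventually_elim
      case (elim x)
      have v0: "v x \<noteq> 0" using elim(1) c0(1) by auto
      have av: "0 < \<bar>v x\<bar>" using v0 by simp
      have v2: "c0\<^sup>2 \<le> (v x)\<^sup>2" using elim(1) c0(1) by (metis abs_le_square_iff abs_of_pos)
      have nY: "norm (Y x) = \<bar>\<phi> x\<bar> / (v x)\<^sup>2 * norm (G x)" by (simp add: Y_def abs_divide)
      have "\<alpha> * (norm (Y x))\<^sup>2 = a0 * ((\<phi> x)\<^sup>2 * (norm (G x))\<^sup>2) * (1 / (4 * (v x) ^ 4))"
        unfolding nY \<alpha>_def using v0 by (simp add: power_mult_distrib power_divide flip: power_mult)
      also have "\<dots> \<le> a x * ((\<phi> x)\<^sup>2 * (norm (G x))\<^sup>2) * H' (v x)"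
        using elim(2) a(3) reg_cube_deriv_ge[OF \<delta>, of "v x"] v2
        by (intro mult_mono) (auto simp: H'_def \<delta>_def)
      also have "\<dots> = P1 x" by (simp add: P1_def mult_ac)
      finally have 1: "\<alpha> * (norm (Y x))\<^sup>2 \<le> P1 x" .
      have Hb: "\<bar>H (v x)\<bar> \<le> 1 / \<bar>v x\<bar> ^ 3" unfolding H_def using reg_cube_le[OF \<delta> v0] .
      have v3: "1 / \<bar>v x\<bar> ^ 3 \<le> 1 / c0 * (1 / (v x)\<^sup>2)"
      proof -
        have "c0 * (v x)\<^sup>2 \<le> \<bar>v x\<bar> * (v x)\<^sup>2" using elim(1) by (intro mult_right_mono) auto
        also have "\<bar>v x\<bar> * (v x)\<^sup>2 = \<bar>v x\<bar> ^ 3"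
          by (subst power2_abs[symmetric]) (simp only: power3_eq_cube power2_eq_square mult.assoc)
        finally show ?thesis using c0(1) v0 by (simp add: frac_le)
      qed
      have "\<bar>P2 x\<bar> = 2 * \<bar>a x\<bar> * (\<bar>\<phi> x\<bar> * \<bar>H (v x)\<bar> * \<bar>G x \<bullet> grad \<phi> x\<bar>)"
        by (simp add: P2_def abs_mult mult_ac)
      also have "\<dots> \<le> 2 * A' * (\<bar>\<phi> x\<bar> * (1 / c0 * (1 / (v x)\<^sup>2)) * (norm (G x) * norm (grad \<phi> x)))"
        using elim(3) Hb v3 Cauchy_Schwarz_ineq2[of "G x" "grad \<phi> x"] A'(1) c0(1)
        by (intro mult_mono) auto
      also have "\<dots> = N2 x" by (simp add: N2_def nY \<beta>_def)
      finally have 2: "\<bar>P2 x\<bar> \<le> N2 x" .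
      have "\<bar>D x\<bar> * \<bar>H (v x)\<bar> \<le> (Q' * \<bar>v x\<bar> + \<bar>f x\<bar>) * (1 / \<bar>v x\<bar> ^ 3)"
      proof (rule mult_mono[OF _ Hb])
        have "\<bar>q x * v x\<bar> \<le> Q' * \<bar>v x\<bar>" unfolding abs_mult using elim(4) by (intro mult_right_mono) auto
        then show "\<bar>D x\<bar> \<le> Q' * \<bar>v x\<bar> + \<bar>f x\<bar>" using elim(5) by linarith
      qed (use Q'(1) in auto)
      also have "\<dots> = Q' * (1 / (v x)\<^sup>2) + \<bar>f x\<bar> * (1 / \<bar>v x\<bar> ^ 3)"
        using v0 by (simp add: power3_eq_cube power2_eq_square divide_simps distrib_right)
      also have "\<dots> \<le> Q' * (1 / c0\<^sup>2) + \<bar>f x\<bar> * (1 / c0 ^ 3)"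
      proof (intro add_mono mult_left_mono)
        show "1 / (v x)\<^sup>2 \<le> 1 / c0\<^sup>2" using v2 c0(1) by (intro divide_left_mono) (use v0 in auto)
        show "1 / \<bar>v x\<bar> ^ 3 \<le> 1 / c0 ^ 3" using elim(1) c0(1) by (intro divide_left_mono power_mono mult_pos_pos) auto
      qed (use Q'(1) in auto)
      finally have "\<bar>D x\<bar> * \<bar>H (v x)\<bar> * (\<phi> x)\<^sup>2 \<le> (Q' * (1 / c0\<^sup>2) + \<bar>f x\<bar> * (1 / c0 ^ 3)) * (\<phi> x)\<^sup>2"
        by (rule mult_right_mono) simp
      then have 3: "\<bar>P3 x\<bar> \<le> E x" by (simp add: P3_def E_def abs_mult algebra_simps)
      show ?case using 1 2 3 by blast
    qed
    have iE: "integrable ?M E"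
      unfolding E_def using Cf(2)[OF \<phi>] s\<phi>(1) by (simp add: sqint_def)
    have iN2: "integrable ?M N2" unfolding N2_def by (intro integrable_mult_right sqint_prod_integrable sY s\<phi>(2))
    have iP3: "integrable ?M P3"
    proof (rule Bochner_Integration.integrable_bound[OF iE])
      show "P3 \<in> borel_measurable ?M" unfolding P3_def by measurable
    qed (use pw in eventually_elim, auto intro: order_trans[OF _ abs_ge_self])
    have iP2: "integrable ?M P2"
    proof (rule Bochner_Integration.integrable_bound[OF iN2])
      show "P2 \<in> borel_measurable ?M" unfolding P2_def by measurable
    qed (use pw in eventually_elim, auto intro: order_trans[OF _ abs_ge_self])
    \<comment> \<open>For fixed \<phi> and \<delta> all factors besides the squared norm of
      \<open>G\<close> are bounded.\<close>
    have iP1: "integrable ?M P1"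
    proof -
      define CH where "CH = 1 / (2 * sqrt \<delta> * \<delta>) + 3 / \<delta>\<^sup>2"
      have H'b: "\<bar>H' s\<bar> \<le> CH" for s unfolding H'_def CH_def by (rule reg_cube_bounded(2)[OF \<delta>])
      then have CH0: "0 \<le> CH" by (metis abs_ge_zero order_trans)
      show ?thesis
      proof (rule Bochner_Integration.integrable_bound)
        show "integrable ?M (\<lambda>x. A' * B\<^sup>2 * CH * (norm (G x))\<^sup>2)" using v(2) by (simp add: sqint_def)
        show "P1 \<in> borel_measurable ?M" unfolding P1_def by measurable
        show "AE x in ?M. norm (P1 x) \<le> norm (A' * B\<^sup>2 * CH * (norm (G x))\<^sup>2)"
          using A'(2)
        proof eventually_elim
          case (elim x)
          have "(\<phi> x)\<^sup>2 \<le> B\<^sup>2" using B(2)[of x] B(1) by (simp add: abs_le_square_iff[symmetric])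
          then have "\<bar>a x\<bar> * (\<phi> x)\<^sup>2 * \<bar>H' (v x)\<bar> * (norm (G x))\<^sup>2 \<le> A' * B\<^sup>2 * CH * (norm (G x))\<^sup>2"
            using elim H'b A'(1) CH0 by (intro mult_mono) auto
          then show ?case using A'(1) CH0 by (simp add: P1_def abs_mult)
        qed
      qed
    qed
    define X where "X = nrm ?M Y"
    define NN where "NN = nrm ?M \<phi> + nrm ?M (grad \<phi>)"
    have NN: "0 \<le> NN" "nrm ?M \<phi> \<le> NN" "nrm ?M (grad \<phi>) \<le> NN" by (auto simp: NN_def nrm_nonneg)
    have "\<alpha> * X\<^sup>2 = (\<integral>x. \<alpha> * (norm (Y x))\<^sup>2 \<partial>?M)" by (simp add: X_def nrm_power2)
    also have "\<dots> \<le> (\<integral>x. P1 x \<partial>?M)"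
      using sY pw by (intro integral_mono_AE iP1) (auto simp: sqint_def elim: AE_mp)
    also have "\<dots> = - (\<integral>x. P2 x \<partial>?M) - (\<integral>x. P3 x \<partial>?M)"
      using Teq iP1 iP2 by simp
    also have "\<dots> \<le> (\<integral>x. N2 x \<partial>?M) + (\<integral>x. E x \<partial>?M)"
    proof -
      have "\<bar>\<integral>x. P2 x \<partial>?M\<bar> \<le> (\<integral>x. N2 x \<partial>?M)"
        by (rule order_trans[OF integral_abs_bound], rule integral_mono_AE) (use iP2 iN2 pw in \<open>auto elim: AE_mp\<close>)
      moreover have "\<bar>\<integral>x. P3 x \<partial>?M\<bar> \<le> (\<integral>x. E x \<partial>?M)"
        by (rule order_trans[OF integral_abs_bound], rule integral_mono_AE) (use iP3 iE pw in \<open>auto elim: AE_mp\<close>)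
      ultimately show ?thesis by linarith
    qed
    also have "(\<integral>x. N2 x \<partial>?M) \<le> \<beta> * X * NN"
    proof -
      have "(\<integral>x. N2 x \<partial>?M) = \<beta> * (\<integral>x. norm (Y x) * norm (grad \<phi> x) \<partial>?M)" by (simp add: N2_def)
      also have "\<dots> \<le> \<beta> * (X * nrm ?M (grad \<phi>))"
        unfolding X_def by (intro mult_left_mono nrm_Cauchy_Schwarz sY s\<phi>(2) pos)
      also have "\<dots> \<le> \<beta> * (X * NN)"
        using NN(3) pos(2) by (intro mult_left_mono) (auto simp: X_def nrm_nonneg)
      finally show ?thesis by (simp add: mult.assoc)
    qed
    also have "(\<integral>x. E x \<partial>?M) \<le> \<kappa> * NN\<^sup>2"
    proof -
      have "(\<integral>x. E x \<partial>?M) = Q' / c0\<^sup>2 * (nrm ?M \<phi>)\<^sup>2 + 1 / c0 ^ 3 * (\<integral>x. \<bar>f x\<bar> * (\<phi> x)\<^sup>2 \<partial>?M)"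
        unfolding E_def using Cf(2)[OF \<phi>] s\<phi>(1) by (simp add: sqint_def nrm_power2)
      also have "\<dots> \<le> Q' / c0\<^sup>2 * NN\<^sup>2 + 1 / c0 ^ 3 * (Cf * NN\<^sup>2)"
      proof (intro add_mono mult_left_mono)
        show "(nrm ?M \<phi>)\<^sup>2 \<le> NN\<^sup>2" using NN(2) by (intro power_mono) (auto simp: nrm_nonneg)
        have "Cf * (nrm ?M (grad \<phi>))\<^sup>2 \<le> Cf * NN\<^sup>2"
          using NN(3) Cf(1) by (intro mult_left_mono power_mono) (auto simp: nrm_nonneg)
        with Cf(3)[OF \<phi>] show "(\<integral>x. \<bar>f x\<bar> * (\<phi> x)\<^sup>2 \<partial>?M) \<le> Cf * NN\<^sup>2" by linarith
      qed (use Q'(1) c0(1) in auto)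
      also have "\<dots> = \<kappa> * NN\<^sup>2" by (simp add: \<kappa>_def algebra_simps)
      finally show ?thesis .
    qed
    finally have "\<alpha> * X\<^sup>2 \<le> \<beta> * X * NN + \<kappa> * NN\<^sup>2" by simp
    from quadratic_bound[OF pos NN(1) this]
    show "nrm ?M (\<lambda>x. (\<phi> x / (v x)\<^sup>2) *\<^sub>R G x) \<le> sqrt (2 * \<kappa> / \<alpha> + (\<beta> / \<alpha>)\<^sup>2) * (nrm ?M \<phi> + nrm ?M (grad \<phi>))"
      by (simp add: X_def NN_def Y_def[abs_def])
  qed
  show ?thesis
    by (rule that[of "sqrt (2 * \<kappa> / \<alpha> + (\<beta> / \<alpha>)\<^sup>2)"]) (use main pos in auto)
qed

lemma admissibleD:
  assumes "open \<Omega>" "q \<in> admissible \<Omega> q_lo q_hi" "0 < q_lo"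
  shows "sqint (lebesgue_on \<Omega>) q" "AE x in lebesgue_on \<Omega>. \<bar>q x\<bar> \<le> q_hi" "AE x in lebesgue_on \<Omega>. q_lo \<le> q x"
proof -
  show "sqint (lebesgue_on \<Omega>) q" using assms(2) by (simp add: admissible_def L2_iff_sqint)
  have ae: "AE x in lebesgue_on \<Omega>. q_lo \<le> q x \<and> q x \<le> q_hi" using assms(2) by (simp add: admissible_def)
  show "AE x in lebesgue_on \<Omega>. \<bar>q x\<bar> \<le> q_hi" using ae by eventually_elim (use assms(3) in auto)
  show "AE x in lebesgue_on \<Omega>. q_lo \<le> q x" using ae by eventually_elim auto
qed

text \<open>Ellipticity and the lower bound on \<open>q\<close> make the left side quadratic, while
  \<open>p\<close> is merely bounded, so the right side is linear in the norm of \<open>w\<close>;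
  this is the source of the exponent 1/2. The second inequality is an a priori bound on that norm in
  disguise: it lets the term of order 0 in the duality estimate be measured by the same square
  root.\<close>

lemma energy_estimate:
  fixes W :: "'b \<Rightarrow> 'a::euclidean_space" and w p v q a :: "'b \<Rightarrow> real"
  assumes s: "sqint M w" "sqint M W" "sqint M v"
    and m: "a \<in> borel_measurable M" "q \<in> borel_measurable M" "p \<in> borel_measurable M"
    and a: "AE x in M. \<bar>a x\<bar> \<le> A" "0 < a0" "AE x in M. a0 \<le> a x"
    and q: "AE x in M. \<bar>q x\<bar> \<le> Q" "0 < q0" "AE x in M. q0 \<le> q x" and p: "AE x in M. \<bar>p x\<bar> \<le> P" "0 \<le> P"
    and eq: "(\<integral>x. (a x *\<^sub>R W x) \<bullet> W x \<partial>M) = - (\<integral>x. (q x * w x + p x * v x) * w x \<partial>M)"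
  shows "nrm M W \<le> sqrt (P * nrm M v / a0) * sqrt (nrm M w)" "nrm M w \<le> sqrt (P * nrm M v / q0) * sqrt (nrm M w)"
proof -
  have sa: "sqint M (\<lambda>x. a x *\<^sub>R W x)" using s(2) m(1) a(1) by (rule sqint_bounded_scaleR)
  have sq: "sqint M (\<lambda>x. q x * w x)" using s(1) m(2) q(1) by (rule sqint_bounded_mult)
  have sp: "sqint M (\<lambda>x. p x * v x)" using s(3) m(3) p(1) by (rule sqint_bounded_mult)
  have "a0 * (nrm M W)\<^sup>2 = (\<integral>x. a0 * (norm (W x))\<^sup>2 \<partial>M)" by (simp add: nrm_power2)
  also have "\<dots> \<le> (\<integral>x. (a x *\<^sub>R W x) \<bullet> W x \<partial>M)"
  proof (rule integral_mono_AE)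
    show "integrable M (\<lambda>x. a0 * (norm (W x))\<^sup>2)" using s(2) by (simp add: sqint_def)
    show "integrable M (\<lambda>x. (a x *\<^sub>R W x) \<bullet> W x)" using sa s(2) by (rule sqint_inner_integrable)
    show "AE x in M. a0 * (norm (W x))\<^sup>2 \<le> (a x *\<^sub>R W x) \<bullet> W x"
      using a(3) by eventually_elim (simp add: power2_norm_eq_inner mult_right_mono)
  qed
  finally have 1: "a0 * (nrm M W)\<^sup>2 \<le> (\<integral>x. (a x *\<^sub>R W x) \<bullet> W x \<partial>M)" .
  have "q0 * (nrm M w)\<^sup>2 = (\<integral>x. q0 * (w x)\<^sup>2 \<partial>M)" by (simp add: nrm_power2)
  also have "\<dots> \<le> (\<integral>x. (q x * w x) * w x \<partial>M)"
  proof (rule integral_mono_AE)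
    show "integrable M (\<lambda>x. q0 * (w x)\<^sup>2)" using s(1) by (simp add: sqint_def)
    show "integrable M (\<lambda>x. (q x * w x) * w x)" using sq s(1) by (rule sqint_mult_integrable)
    show "AE x in M. q0 * (w x)\<^sup>2 \<le> (q x * w x) * w x"
      using q(3)
    proof eventually_elim
      case (elim x)
      then have "q0 * (w x * w x) \<le> q x * (w x * w x)" by (rule mult_right_mono) simp
      then show ?case by (simp only: power2_eq_square mult.assoc)
    qed
  qed
  finally have 2: "q0 * (nrm M w)\<^sup>2 \<le> (\<integral>x. (q x * w x) * w x \<partial>M)" .
  have split: "(\<integral>x. (q x * w x + p x * v x) * w x \<partial>M) = (\<integral>x. (q x * w x) * w x \<partial>M) + (\<integral>x. (p x * v x) * w x \<partial>M)"
    using sqint_mult_integrable[OF sq s(1)] sqint_mult_integrable[OF sp s(1)] by (simp add: distrib_right)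
  have "\<bar>\<integral>x. (p x * v x) * w x \<partial>M\<bar> \<le> nrm M (\<lambda>x. p x * v x) * nrm M w"
    using sp s(1) by (rule nrm_Cauchy_Schwarz_mult)
  also have "nrm M (\<lambda>x. p x * v x) \<le> P * nrm M v"
  proof (rule nrm_dominated[OF s(3) sqint_measurable[OF sp] _ p(2)])
    show "AE x in M. norm (p x * v x) \<le> P * norm (v x)"
      using p(1) by eventually_elim (simp add: abs_mult mult_right_mono)
  qed
  then have "nrm M (\<lambda>x. p x * v x) * nrm M w \<le> P * nrm M v * nrm M w"
    by (rule mult_right_mono) (rule nrm_nonneg)
  finally have 3: "\<bar>\<integral>x. (p x * v x) * w x \<partial>M\<bar> \<le> P * nrm M v * nrm M w" .
  have tot: "a0 * (nrm M W)\<^sup>2 + q0 * (nrm M w)\<^sup>2 \<le> P * nrm M v * nrm M w"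
    using 1 2 3 eq split by linarith
  have nn: "0 \<le> a0 * (nrm M W)\<^sup>2" "0 \<le> q0 * (nrm M w)\<^sup>2" using a(2) q(2) by auto
  have "(nrm M W)\<^sup>2 \<le> P * nrm M v / a0 * nrm M w"
    using tot nn a(2) by (simp add: field_simps)
  then show "nrm M W \<le> sqrt (P * nrm M v / a0) * sqrt (nrm M w)"
    unfolding real_sqrt_mult[symmetric] by (rule real_le_rsqrt)
  have "(nrm M w)\<^sup>2 \<le> P * nrm M v / q0 * nrm M w"
    using tot nn q(2) by (simp add: field_simps)
  then show "nrm M w \<le> sqrt (P * nrm M v / q0) * sqrt (nrm M w)"
    unfolding real_sqrt_mult[symmetric] by (rule real_le_rsqrt)
qed

text \<open>The identity \<open>p v = div (a W) - q w\<close> is tested with \<open>\<phi> / v\<close>, regularised to \<open>\<phi> v / (v\<^sup>2 + \<delta>)\<close>.\<close>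

lemma coefficient_difference_bound:
  fixes \<Omega> :: "'a::euclidean_space set" and Fu Fv :: "'a \<Rightarrow> 'a" and Du Dv v p r w a :: "'a \<Rightarrow> real" and G W :: "'a \<Rightarrow> 'a"
  assumes \<Omega>: "open \<Omega>" "bounded \<Omega>"
    and u: "has_weak_div \<Omega> Fu Du" "sqint (lebesgue_on \<Omega>) Fu" "sqint (lebesgue_on \<Omega>) Du"
    and v: "has_weak_div \<Omega> Fv Dv" "sqint (lebesgue_on \<Omega>) Fv" "sqint (lebesgue_on \<Omega>) Dv"
    and F: "\<And>x. Fu x - Fv x = a x *\<^sub>R W x" and D: "AE x in lebesgue_on \<Omega>. Du x - Dv x = r x * w x + p x * v x"
    and s: "sqint (lebesgue_on \<Omega>) v" "sqint (lebesgue_on \<Omega>) G" "sqint (lebesgue_on \<Omega>) w" "sqint (lebesgue_on \<Omega>) W"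
    and a: "a \<in> borel_measurable (lebesgue_on \<Omega>)" "AE x in lebesgue_on \<Omega>. \<bar>a x\<bar> \<le> A" "0 \<le> A"
    and r: "r \<in> borel_measurable (lebesgue_on \<Omega>)" "AE x in lebesgue_on \<Omega>. \<bar>r x\<bar> \<le> Q" "0 \<le> Q"
    and p: "p \<in> borel_measurable (lebesgue_on \<Omega>)" "AE x in lebesgue_on \<Omega>. \<bar>p x\<bar> \<le> P"
    and c0: "0 < c0" "AE x in lebesgue_on \<Omega>. c0 \<le> \<bar>v x\<bar>"
    and \<psi>: "\<And>n. smooth (\<psi> n)" "(\<lambda>n. nrm (lebesgue_on \<Omega>) (\<lambda>x. v x - \<psi> n x)) \<longlonglongrightarrow> 0"
      "(\<lambda>n. nrm (lebesgue_on \<Omega>) (\<lambda>x. G x - grad (\<psi> n) x)) \<longlonglongrightarrow> 0"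
    and \<phi>: "\<phi> \<in> test_functions \<Omega>" and Y: "sqint (lebesgue_on \<Omega>) (\<lambda>x. (\<phi> x / (v x)\<^sup>2) *\<^sub>R G x)"
  shows "\<bar>\<integral>x. p x * \<phi> x \<partial>lebesgue_on \<Omega>\<bar>
    \<le> A * nrm (lebesgue_on \<Omega>) W * (1 / c0 * nrm (lebesgue_on \<Omega>) (grad \<phi>) + nrm (lebesgue_on \<Omega>) (\<lambda>x. (\<phi> x / (v x)\<^sup>2) *\<^sub>R G x))
      + Q * nrm (lebesgue_on \<Omega>) w * (1 / c0 * nrm (lebesgue_on \<Omega>) \<phi>)"
    (is "_ \<le> ?RHS")
proof -
  let ?M = "lebesgue_on \<Omega>"
  \<comment> \<open>The right-hand side of \<open>bound\<close> will be free of \<open>n\<close>, so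
    that the limit concerns the left-hand side alone.\<close>
  define \<delta> where "\<delta> n = 1 / real (Suc n)" for n
  have \<delta>: "0 < \<delta> n" for n by (simp add: \<delta>_def)
  define h where "h n = reg_inv (\<delta> n)" for n
  define h' where "h' n = reg_inv_deriv (\<delta> n)" for n
  have sm: "smooth \<phi>" using \<phi> by (rule test_smooth)
  have s\<phi>: "sqint ?M \<phi>" "sqint ?M (grad \<phi>)"
    by (intro continuous_sqint \<Omega> smooth_continuous smooth_continuous_grad sm)+
  note [measurable] = s\<phi>[THEN sqint_measurable] s[THEN sqint_measurable] a(1) r(1) p(1)
    u(2,3)[THEN sqint_measurable] v(2,3)[THEN sqint_measurable]
  have [measurable]: "h n \<in> borel_measurable borel" "h' n \<in> borel_measurable borel" for n
    using reg_deriv(1)[OF \<delta>] reg_deriv_continuous(1)[OF \<delta>]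
    by (auto simp: h_def h'_def continuous_on_eq_continuous_at intro!: borel_measurable_continuous_onI DERIV_isCont)
  have v0: "AE x in ?M. v x \<noteq> 0 \<and> 1 / \<bar>v x\<bar> \<le> 1 / c0"
    using c0(2) by eventually_elim (use c0(1) in \<open>auto intro!: divide_left_mono mult_pos_pos\<close>)
  have bound: "\<bar>\<integral>x. p x * v x * (\<phi> x * h n (v x)) \<partial>?M\<bar> \<le> ?RHS" for n
  proof -
    define Z where "Z x = h n (v x) *\<^sub>R grad \<phi> x + (\<phi> x * h' n (v x)) *\<^sub>R G x" for x
    define k where "k x = \<phi> x * h n (v x)" for x
    have hb: "AE x in ?M. \<bar>h n (v x)\<bar> \<le> 1 / c0"
      using v0 by eventually_elim (use reg_inv_le(1)[OF \<delta>] in \<open>auto simp: h_def intro: order_trans\<close>)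
    have s1: "sqint ?M (\<lambda>x. h n (v x) *\<^sub>R grad \<phi> x)" by (rule sqint_bounded_scaleR[OF s\<phi>(2) _ hb]) measurable
    have n1: "nrm ?M (\<lambda>x. h n (v x) *\<^sub>R grad \<phi> x) \<le> 1 / c0 * nrm ?M (grad \<phi>)"
    proof (rule nrm_dominated[OF s\<phi>(2) sqint_measurable[OF s1]])
      show "AE x in ?M. norm (h n (v x) *\<^sub>R grad \<phi> x) \<le> 1 / c0 * norm (grad \<phi> x)"
        using hb by eventually_elim (simp only: norm_scaleR, intro mult_right_mono norm_ge_zero)
    qed (use c0(1) in simp)
    \<comment> \<open>The derivative of the regularised reciprocal is at most 1 / v^2 in absolute
      value whatever \<open>n\<close> is, so this term is dominated by the function in hypothesis
      \<open>Y\<close>.\<close>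
    have h'b: "AE x in ?M. norm ((\<phi> x * h' n (v x)) *\<^sub>R G x) \<le> 1 * norm ((\<phi> x / (v x)\<^sup>2) *\<^sub>R G x)"
      using v0
    proof eventually_elim
      case (elim x)
      then have "\<bar>h' n (v x)\<bar> \<le> 1 / (v x)\<^sup>2" unfolding h'_def using reg_inv_le(2)[OF \<delta>] by blast
      then have "\<bar>\<phi> x\<bar> * \<bar>h' n (v x)\<bar> * norm (G x) \<le> \<bar>\<phi> x\<bar> * (1 / (v x)\<^sup>2) * norm (G x)"
        by (intro mult_right_mono mult_left_mono) auto
      then show ?case by (simp add: abs_mult abs_divide)
    qed
    have s2: "sqint ?M (\<lambda>x. (\<phi> x * h' n (v x)) *\<^sub>R G x)" by (rule sqint_dominated[OF Y _ h'b]) measurable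
    have n2: "nrm ?M (\<lambda>x. (\<phi> x * h' n (v x)) *\<^sub>R G x) \<le> 1 * nrm ?M (\<lambda>x. (\<phi> x / (v x)\<^sup>2) *\<^sub>R G x)"
      by (rule nrm_dominated[OF Y sqint_measurable[OF s2] h'b]) simp
    have sZ: "sqint ?M Z" unfolding Z_def by (rule sqint_add[OF s1 s2])
    have nZ: "nrm ?M Z \<le> 1 / c0 * nrm ?M (grad \<phi>) + nrm ?M (\<lambda>x. (\<phi> x / (v x)\<^sup>2) *\<^sub>R G x)"
      unfolding Z_def using nrm_triangle[OF s1 s2] n1 n2 by linarith
    have sk: "sqint ?M k" unfolding k_def using sqint_bounded_mult[OF s\<phi>(1) _ hb] by (simp add: mult.commute)
    have nk: "nrm ?M k \<le> 1 / c0 * nrm ?M \<phi>"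
    proof (rule nrm_dominated[OF s\<phi>(1) sqint_measurable[OF sk]])
      show "AE x in ?M. norm (k x) \<le> 1 / c0 * norm (\<phi> x)"
        using hb unfolding k_def
      proof eventually_elim
        case (elim x)
        then have "\<bar>h n (v x)\<bar> * \<bar>\<phi> x\<bar> \<le> 1 / c0 * \<bar>\<phi> x\<bar>" by (rule mult_right_mono) simp
        then show ?case by (simp add: abs_mult mult.commute)
      qed
    qed (use c0(1) in simp)
    \<comment> \<open>Both equations are tested with the same function \<phi> h(v) and then
      subtracted, since a divergence is given for each flux separately.\<close>
    note T = weak_div_test_compose[OF \<Omega> _ _ _ s(1,2) \<psi> reg_smooth(1)[OF \<delta>] reg_deriv(1)[OF \<delta>]
            reg_deriv_continuous(1)[OF \<delta>] reg_inv_bounded[OF \<delta>] \<phi>, of _ _ n, folded h_def h'_def]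
    have Tu: "(\<integral>x. Fu x \<bullet> Z x \<partial>?M) = - (\<integral>x. Du x * k x \<partial>?M)" unfolding Z_def k_def by (rule T[OF u])
    have Tv: "(\<integral>x. Fv x \<bullet> Z x \<partial>?M) = - (\<integral>x. Dv x * k x \<partial>?M)" unfolding Z_def k_def by (rule T[OF v])
    have sq: "sqint ?M (\<lambda>x. r x * w x)" using s(3) r(1,2) by (rule sqint_bounded_mult)
    have sp: "sqint ?M (\<lambda>x. p x * v x)" using s(1) p by (rule sqint_bounded_mult)
    have sa: "sqint ?M (\<lambda>x. a x *\<^sub>R W x)" using s(4) a(1,2) by (rule sqint_bounded_scaleR)
    have "(\<integral>x. (a x *\<^sub>R W x) \<bullet> Z x \<partial>?M) = (\<integral>x. Fu x \<bullet> Z x \<partial>?M) - (\<integral>x. Fv x \<bullet> Z x \<partial>?M)"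
      unfolding F[symmetric] using sqint_inner_integrable[OF u(2) sZ] sqint_inner_integrable[OF v(2) sZ]
      by (simp add: inner_diff_left)
    also have "\<dots> = - (\<integral>x. (Du x - Dv x) * k x \<partial>?M)"
      unfolding Tu Tv using sqint_mult_integrable[OF u(3) sk] sqint_mult_integrable[OF v(3) sk]
      by (simp add: left_diff_distrib)
    also have "(\<integral>x. (Du x - Dv x) * k x \<partial>?M) = (\<integral>x. (r x * w x + p x * v x) * k x \<partial>?M)"
    proof (rule integral_cong_AE)
      note sqint_measurable[OF sk, measurable]
      show "(\<lambda>x. (Du x - Dv x) * k x) \<in> borel_measurable ?M" "(\<lambda>x. (r x * w x + p x * v x) * k x) \<in> borel_measurable ?M"
        by measurable
      show "AE x in ?M. (Du x - Dv x) * k x = (r x * w x + p x * v x) * k x" using D by eventually_elim simp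
    qed
    also have "\<dots> = (\<integral>x. (r x * w x) * k x \<partial>?M) + (\<integral>x. p x * v x * k x \<partial>?M)"
      using sqint_mult_integrable[OF sq sk] sqint_mult_integrable[OF sp sk] by (simp add: distrib_right)
    finally have eq: "(\<integral>x. p x * v x * k x \<partial>?M) = - (\<integral>x. (a x *\<^sub>R W x) \<bullet> Z x \<partial>?M) - (\<integral>x. (r x * w x) * k x \<partial>?M)" by simp
    have "\<bar>\<integral>x. (a x *\<^sub>R W x) \<bullet> Z x \<partial>?M\<bar> \<le> nrm ?M (\<lambda>x. a x *\<^sub>R W x) * nrm ?M Z"
      using sa sZ by (rule nrm_Cauchy_Schwarz_inner)
    also have "\<dots> \<le> (A * nrm ?M W) * (1 / c0 * nrm ?M (grad \<phi>) + nrm ?M (\<lambda>x. (\<phi> x / (v x)\<^sup>2) *\<^sub>R G x))"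
    proof (rule mult_mono[OF _ nZ])
      show "nrm ?M (\<lambda>x. a x *\<^sub>R W x) \<le> A * nrm ?M W"
        by (rule nrm_dominated[OF s(4) sqint_measurable[OF sa] _ a(3)])
          (use a(2) in eventually_elim, simp add: mult_right_mono)
    qed (use a(3) in \<open>auto simp: nrm_nonneg\<close>)
    finally have b1: "\<bar>\<integral>x. (a x *\<^sub>R W x) \<bullet> Z x \<partial>?M\<bar> \<le> A * nrm ?M W * (1 / c0 * nrm ?M (grad \<phi>) + nrm ?M (\<lambda>x. (\<phi> x / (v x)\<^sup>2) *\<^sub>R G x))" .
    have "\<bar>\<integral>x. (r x * w x) * k x \<partial>?M\<bar> \<le> nrm ?M (\<lambda>x. r x * w x) * nrm ?M k"
      using sq sk by (rule nrm_Cauchy_Schwarz_mult)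
    also have "\<dots> \<le> (Q * nrm ?M w) * (1 / c0 * nrm ?M \<phi>)"
    proof (rule mult_mono[OF _ nk])
      show "nrm ?M (\<lambda>x. r x * w x) \<le> Q * nrm ?M w"
        by (rule nrm_dominated[OF s(3) sqint_measurable[OF sq] _ r(3)])
          (use r(2) in eventually_elim, simp add: abs_mult mult_right_mono)
    qed (use r(3) in \<open>auto simp: nrm_nonneg\<close>)
    finally have b2: "\<bar>\<integral>x. (r x * w x) * k x \<partial>?M\<bar> \<le> Q * nrm ?M w * (1 / c0 * nrm ?M \<phi>)" .
    show ?thesis using b1 b2 eq unfolding k_def by linarith
  qed
  have "(\<lambda>n. \<integral>x. p x * v x * (\<phi> x * h n (v x)) \<partial>?M) \<longlonglongrightarrow> (\<integral>x. p x * \<phi> x \<partial>?M)"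
  proof (rule integral_dominated_convergence)
    have "sqint ?M (\<lambda>x. p x * \<phi> x)" using s\<phi>(1) p by (rule sqint_bounded_mult)
    then have "integrable ?M (\<lambda>x. p x * \<phi> x)" by (rule sqint_integrable[OF finite_measure_bounded[OF \<Omega>]])
    then show "integrable ?M (\<lambda>x. \<bar>p x * \<phi> x\<bar>)" by simp
    show "(\<lambda>x. p x * \<phi> x) \<in> borel_measurable ?M" by measurable
    show "(\<lambda>x. p x * v x * (\<phi> x * h n (v x))) \<in> borel_measurable ?M" for n by measurable
    \<comment> \<open>The product of \<open>v\<close> with its regularised reciprocal lies in [0, 1]
      and tends to 1 where \<open>v\<close> is not 0, so the factor \<open>v\<close> next to
      \<open>p\<close> disappears in the limit.\<close>
    have vh: "v x * h n (v x) = (v x)\<^sup>2 / ((v x)\<^sup>2 + \<delta> n)" for n x by (simp add: h_def reg_inv_def power2_eq_square)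
    have e: "p x * v x * (\<phi> x * h n (v x)) = p x * \<phi> x * ((v x)\<^sup>2 / ((v x)\<^sup>2 + \<delta> n))" for n x
      using vh[where n = n and x = x] by (metis mult.assoc mult.left_commute)
    have \<delta>0: "\<delta> \<longlonglongrightarrow> 0" using LIMSEQ_inverse_real_of_nat by (simp add: \<delta>_def[abs_def] inverse_eq_divide)
    show "AE x in ?M. (\<lambda>n. p x * v x * (\<phi> x * h n (v x))) \<longlonglongrightarrow> p x * \<phi> x"
      using v0
    proof eventually_elim
      case (elim x)
      have "(\<lambda>n. p x * \<phi> x * ((v x)\<^sup>2 / ((v x)\<^sup>2 + \<delta> n))) \<longlonglongrightarrow> p x * \<phi> x * ((v x)\<^sup>2 / ((v x)\<^sup>2 + 0))"
        using elim by (intro tendsto_intros \<delta>0) auto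
      then show ?case unfolding e using elim by simp
    qed
    show "AE x in ?M. norm (p x * v x * (\<phi> x * h n (v x))) \<le> \<bar>p x * \<phi> x\<bar>" for n
    proof (intro AE_I2)
      fix x
      have "(v x)\<^sup>2 \<le> (v x)\<^sup>2 + \<delta> n" "0 < (v x)\<^sup>2 + \<delta> n" using \<delta>[of n] reg_pos[OF \<delta>, of "v x" n] by auto
      then have "\<bar>(v x)\<^sup>2 / ((v x)\<^sup>2 + \<delta> n)\<bar> \<le> 1" by (simp add: abs_divide divide_le_eq)
      then have "\<bar>p x * \<phi> x\<bar> * \<bar>(v x)\<^sup>2 / ((v x)\<^sup>2 + \<delta> n)\<bar> \<le> \<bar>p x * \<phi> x\<bar>" by (rule mult_left_le) simp
      then show "norm (p x * v x * (\<phi> x * h n (v x))) \<le> \<bar>p x * \<phi> x\<bar>" unfolding e real_norm_def abs_mult[of "p x * \<phi> x"] .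
    qed
  qed
  then have "(\<lambda>n. \<bar>\<integral>x. p x * v x * (\<phi> x * h n (v x)) \<partial>?M\<bar>) \<longlonglongrightarrow> \<bar>\<integral>x. p x * \<phi> x \<partial>?M\<bar>"
    by (rule tendsto_rabs)
  then show ?thesis by (rule LIMSEQ_le_const2) (use bound in blast)
qed

theorem theorem3p5:
  fixes \<Omega> :: "('n::euclidean_space \<times> real) set"
    and a f g q_true u_true :: "'n \<times> real \<Rightarrow> real"
    and a0 q_lo q_hi c0 \<epsilon> :: real
  assumes dim: "DIM('n \<times> real) = 2 \<or> DIM('n \<times> real) = 3"
    and domain: "open \<Omega>" "bounded \<Omega>" "connected \<Omega>" "\<Omega> \<noteq> {}" "C2_boundary \<Omega>"
    and a: "a \<in> W1infty \<Omega>" "0 < a0" "AE x in lebesgue_on \<Omega>. a0 \<le> a x"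
    and f: "f \<in> L2 \<Omega>"
    and g: "g \<in> boundary_sobolev \<Omega> (3/2)"
    and bounds: "0 < q_lo" "q_lo \<le> q_hi"
    and q_true: "q_true \<in> admissible \<Omega> q_lo q_hi"
    and u_true: "solves \<Omega> a f g q_true u_true"
    and nonvanishing: "0 < c0" "AE x in lebesgue_on \<Omega>. c0 \<le> \<bar>u_true x\<bar>"
    and \<epsilon>: "0 < \<epsilon>" "\<epsilon> < 1/2"
  shows "\<exists>C>0. \<forall>q\<in>admissible \<Omega> q_lo q_hi. \<forall>u. solves \<Omega> a f g q u \<longrightarrow>
           neg_sobolev_norm \<Omega> (1 + \<epsilon>) (\<lambda>x. q x - q_true x)
             \<le> ennreal (C * L2_norm \<Omega> (\<lambda>x. u x - u_true x) powr (1/2))"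
proof -
  let ?M = "lebesgue_on \<Omega>"
  note \<Omega> = domain(1,2)
  have aL: "a \<in> Linfty \<Omega>" using a(1) by (simp add: W1infty_def)
  then obtain A0 where A0: "AE x in ?M. \<bar>a x\<bar> \<le> A0" by (auto simp: Linfty_def)
  have am: "a \<in> borel_measurable ?M" using aL by (simp add: Linfty_def)
  define A where "A = \<bar>A0\<bar>"
  have A: "0 \<le> A" "AE x in ?M. \<bar>a x\<bar> \<le> A" using A0 unfolding A_def by (simp, eventually_elim, simp)
  have sf: "sqint ?M f" using f by (simp add: L2_iff_sqint)
  have qhi: "0 \<le> q_hi" using bounds by simp
  note qt = admissibleD[OF \<Omega>(1) q_true bounds(1)]
  define v where "v = u_true"
  obtain Dv where Dv: "has_weak_div \<Omega> (\<lambda>x. a x *\<^sub>R weak_grad \<Omega> v x) Dv" "sqint ?M Dv"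
    "AE x in ?M. Dv x = q_true x * v x - f x" "sqint ?M v" "sqint ?M (weak_grad \<Omega> v)"
    "sqint ?M (\<lambda>x. a x *\<^sub>R weak_grad \<Omega> v x)" "has_trace \<Omega> v g"
    unfolding v_def by (rule solves_divergence_data[OF \<Omega> u_true am A(2) sf sqint_measurable[OF qt(1)] qt(2)])
  have v0: "AE x in ?M. c0 \<le> \<bar>v x\<bar>" using nonvanishing(2) by (simp add: v_def)
  obtain \<psi> :: "nat \<Rightarrow> _" where \<psi>: "\<And>n. smooth (\<psi> n)" "(\<lambda>n. nrm ?M (\<lambda>x. v x - \<psi> n x)) \<longlonglongrightarrow> 0"
    "(\<lambda>n. nrm ?M (\<lambda>x. weak_grad \<Omega> v x - grad (\<psi> n) x)) \<longlonglongrightarrow> 0"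
    using has_trace_H1_approx[OF \<Omega> Dv(7)] by blast
  have dim3: "DIM('n \<times> real) \<le> 3" using dim by linarith
  obtain C1 where C1: "0 \<le> C1" "\<And>\<phi>. \<phi> \<in> test_functions \<Omega> \<Longrightarrow> sqint ?M (\<lambda>x. (\<phi> x / (v x)\<^sup>2) *\<^sub>R weak_grad \<Omega> v x)"
    "\<And>\<phi>. \<phi> \<in> test_functions \<Omega> \<Longrightarrow> nrm ?M (\<lambda>x. (\<phi> x / (v x)\<^sup>2) *\<^sub>R weak_grad \<Omega> v x)
       \<le> C1 * (nrm ?M \<phi> + nrm ?M (grad \<phi>))"
    by (rule weighted_gradient_bound[OF dim3 \<Omega> am A(2) a(2,3) sf qt(2) Dv(1,2,3,4,5,6) nonvanishing(1) v0 \<psi>]) blast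
  \<comment> \<open>Both coefficients are at most \<open>q_hi\<close> in absolute value a.e., so
    \<open>P\<close> bounds their difference. \<open>K1\<close> and \<open>K2\<close> are the
    constants of \<open>energy_estimate\<close> for the fixed \<open>v\<close>, and all constants
    are chosen before \<open>q\<close> is.\<close>
  define P where "P = 2 * q_hi"
  define K1 where "K1 = sqrt (P * nrm ?M v / a0)"
  define K2 where "K2 = sqrt (P * nrm ?M v / q_lo)"
  define K where "K = A * K1 * (1 / c0 + C1) + q_hi * K2 * (1 / c0)"
  have K12: "0 \<le> K1" "0 \<le> K2" using a(2) bounds(1) qhi by (auto simp: K1_def K2_def P_def nrm_nonneg)
  have K: "0 \<le> K" using K12 A(1) C1(1) qhi nonvanishing(1) by (auto simp: K_def)
  show ?thesis
  \<comment> \<open>The 2 is that of \<open>sobolev0_test_bound\<close>; adding 1 makes the constant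
    positive even if \<open>K = 0\<close>.\<close>
  proof (intro exI[of _ "2 * K + 1"] conjI ballI allI impI)
    show "0 < 2 * K + 1" using K by simp
    fix q u assume q: "q \<in> admissible \<Omega> q_lo q_hi" and u: "solves \<Omega> a f g q u"
    note qq = admissibleD[OF \<Omega>(1) q bounds(1)]
    obtain Du where Du: "has_weak_div \<Omega> (\<lambda>x. a x *\<^sub>R weak_grad \<Omega> u x) Du" "sqint ?M Du"
      "AE x in ?M. Du x = q x * u x - f x" "sqint ?M u" "sqint ?M (weak_grad \<Omega> u)"
      "sqint ?M (\<lambda>x. a x *\<^sub>R weak_grad \<Omega> u x)" "has_trace \<Omega> u g"
      by (rule solves_divergence_data[OF \<Omega> u am A(2) sf sqint_measurable[OF qq(1)] qq(2)])
    define w where "w x = u x - v x" for x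
    define W where "W x = weak_grad \<Omega> u x - weak_grad \<Omega> v x" for x
    define p where "p x = q x - q_true x" for x
    have sw: "sqint ?M w" "sqint ?M W" "sqint ?M p"
      unfolding w_def W_def p_def by (intro sqint_diff Du Dv qq qt)+
    have pb: "AE x in ?M. \<bar>p x\<bar> \<le> P"
      using qq(2) qt(2) by eventually_elim (simp add: p_def P_def)
    \<comment> \<open>The splitting \<open>q u - q_true v = q w + p v\<close> attaches
      \<open>q\<close> to the small quantity and \<open>p\<close> to the fixed solution, while
      \<open>f\<close> cancels.\<close>
    have DD: "AE x in ?M. Du x - Dv x = q x * w x + p x * v x"
      using Du(3) Dv(3) by eventually_elim (simp add: w_def p_def algebra_simps)
    have FF: "a x *\<^sub>R weak_grad \<Omega> u x - a x *\<^sub>R weak_grad \<Omega> v x = a x *\<^sub>R W x" for x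
      by (simp add: W_def scaleR_diff_right)
    \<comment> \<open>Green's formula is applied to the flux of each solution against the same
      difference, whose traces cancel. \<open>W\<close> is the difference of the weak gradients, so
      \<open>weak_grad\<close> of \<open>w\<close> is never formed.\<close>
    have G: "(\<integral>x. (a x *\<^sub>R weak_grad \<Omega> u x) \<bullet> W x \<partial>?M) = - (\<integral>x. Du x * w x \<partial>?M)"
      "(\<integral>x. (a x *\<^sub>R weak_grad \<Omega> v x) \<bullet> W x \<partial>?M) = - (\<integral>x. Dv x * w x \<partial>?M)"
      unfolding W_def w_def
      by (rule green_equal_traces[OF \<Omega> domain(5) Du(7) Dv(7) Du(1,6,2)],
          rule green_equal_traces[OF \<Omega> domain(5) Du(7) Dv(7) Dv(1,6,2)])
    have "(\<integral>x. (a x *\<^sub>R W x) \<bullet> W x \<partial>?M) = (\<integral>x. (a x *\<^sub>R weak_grad \<Omega> u x) \<bullet> W x \<partial>?M) - (\<integral>x. (a x *\<^sub>R weak_grad \<Omega> v x) \<bullet> W x \<partial>?M)"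
      unfolding FF[symmetric] using sqint_inner_integrable[OF Du(6) sw(2)] sqint_inner_integrable[OF Dv(6) sw(2)]
      by (simp add: inner_diff_left)
    also have "\<dots> = - (\<integral>x. (Du x - Dv x) * w x \<partial>?M)"
      unfolding G using sqint_mult_integrable[OF Du(2) sw(1)] sqint_mult_integrable[OF Dv(2) sw(1)]
      by (simp add: left_diff_distrib)
    also have "(\<integral>x. (Du x - Dv x) * w x \<partial>?M) = (\<integral>x. (q x * w x + p x * v x) * w x \<partial>?M)"
    proof (rule integral_cong_AE)
      note [measurable] = sqint_measurable[OF sw(1)] sqint_measurable[OF sw(3)] sqint_measurable[OF Du(2)] sqint_measurable[OF Dv(2)]
        sqint_measurable[OF qq(1)] sqint_measurable[OF Dv(4)]
      show "(\<lambda>x. (Du x - Dv x) * w x) \<in> borel_measurable ?M" "(\<lambda>x. (q x * w x + p x * v x) * w x) \<in> borel_measurable ?M"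
        by measurable
      show "AE x in ?M. (Du x - Dv x) * w x = (q x * w x + p x * v x) * w x" using DD by eventually_elim simp
    qed
    finally have eq: "(\<integral>x. (a x *\<^sub>R W x) \<bullet> W x \<partial>?M) = - (\<integral>x. (q x * w x + p x * v x) * w x \<partial>?M)" .
    have P0: "0 \<le> P" using qhi by (simp add: P_def)
    define t where "t = sqrt (nrm ?M w)"
    have t: "0 \<le> t" by (simp add: t_def nrm_nonneg)
    have en: "nrm ?M W \<le> K1 * t" "nrm ?M w \<le> K2 * t"
      unfolding K1_def K2_def t_def
      by (rule energy_estimate[OF sw(1,2) Dv(4) am sqint_measurable[OF qq(1)] sqint_measurable[OF sw(3)] A(2) a(2,3)
            qq(2) bounds(1) qq(3) pb P0 eq])+
    have main: "\<bar>\<integral>x. p x * \<phi> x \<partial>?M\<bar> \<le> (K * t) * (nrm ?M \<phi> + nrm ?M (grad \<phi>))" if \<phi>: "\<phi> \<in> test_functions \<Omega>" for \<phi>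
    proof -
      define N where "N = nrm ?M \<phi> + nrm ?M (grad \<phi>)"
      have N: "0 \<le> N" "nrm ?M \<phi> \<le> N" "nrm ?M (grad \<phi>) \<le> N" by (auto simp: N_def nrm_nonneg)
      have c: "0 \<le> 1 / c0" using nonvanishing(1) by simp
      have "\<bar>\<integral>x. p x * \<phi> x \<partial>?M\<bar> \<le> A * nrm ?M W * (1 / c0 * nrm ?M (grad \<phi>) + nrm ?M (\<lambda>x. (\<phi> x / (v x)\<^sup>2) *\<^sub>R weak_grad \<Omega> v x))
        + q_hi * nrm ?M w * (1 / c0 * nrm ?M \<phi>)"
        by (rule coefficient_difference_bound[OF \<Omega> Du(1,6,2) Dv(1,6,2) FF DD Dv(4,5) sw(1,2) am A(2,1)
              sqint_measurable[OF qq(1)] qq(2) qhi sqint_measurable[OF sw(3)] pb nonvanishing(1) v0 \<psi> \<phi> C1(2)[OF \<phi>]])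
      also have "\<dots> \<le> A * (K1 * t) * (1 / c0 * N + C1 * N) + q_hi * (K2 * t) * (1 / c0 * N)"
      proof (rule add_mono)
        show "A * nrm ?M W * (1 / c0 * nrm ?M (grad \<phi>) + nrm ?M (\<lambda>x. (\<phi> x / (v x)\<^sup>2) *\<^sub>R weak_grad \<Omega> v x)) \<le> A * (K1 * t) * (1 / c0 * N + C1 * N)"
          using en(1) N(3) C1(3)[OF \<phi>] A(1) K12 t c
          by (intro mult_mono add_mono mult_left_mono mult_nonneg_nonneg add_nonneg_nonneg nrm_nonneg) (auto simp: N_def)
        show "q_hi * nrm ?M w * (1 / c0 * nrm ?M \<phi>) \<le> q_hi * (K2 * t) * (1 / c0 * N)"
          using en(2) N(2) qhi K12 t c
          by (intro mult_mono mult_left_mono mult_nonneg_nonneg nrm_nonneg) auto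
      qed
      also have "\<dots> = (K * t) * N" by (simp add: K_def algebra_simps)
      finally show ?thesis by (simp add: N_def)
    qed
    have "\<epsilon> < 1" using \<epsilon>(2) by simp
    have dual: "\<bar>\<integral>x. p x * \<phi> x \<partial>?M\<bar> \<le> 2 * (K * t)"
      if "\<phi> \<in> sobolev0 \<Omega> (1 + \<epsilon>)" "sobolev_norm \<Omega> (1 + \<epsilon>) \<phi> \<le> 1" for \<phi>
      by (rule sobolev0_test_bound[OF \<Omega> \<epsilon>(1) \<open>\<epsilon> < 1\<close> that sw(3) mult_nonneg_nonneg[OF K t] main])
    have "neg_sobolev_norm \<Omega> (1 + \<epsilon>) p \<le> ennreal (2 * (K * t))"
      unfolding neg_sobolev_norm_def by (rule SUP_least) (use dual in \<open>auto intro: ennreal_leI\<close>)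
    also have "\<dots> \<le> ennreal ((2 * K + 1) * t)" using t by (intro ennreal_leI) (simp add: algebra_simps)
    also have "(2 * K + 1) * t = (2 * K + 1) * L2_norm \<Omega> (\<lambda>x. u x - u_true x) powr (1/2)"
      by (simp add: t_def w_def[abs_def] v_def L2_norm_eq_nrm powr_half_sqrt nrm_nonneg)
    finally show "neg_sobolev_norm \<Omega> (1 + \<epsilon>) (\<lambda>x. q x - q_true x)
             \<le> ennreal ((2 * K + 1) * L2_norm \<Omega> (\<lambda>x. u x - u_true x) powr (1/2))"
      by (simp add: p_def[abs_def])
  qed
qed

end
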